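(* Let $n$ be a positive integer and let $\mu$ be a partition of $n$. If $\mu \le (3,1^{n-3})$ or $\mu \ge (n-4,1^4)$ in reverse lexicographic order (whenever these are partitions of $n$), then the symmetric function $$\psi_\mu=\sum_{\lambda\vdash n,\ (1^n)\le \lambda\le \mu} p_\lambda$$ is Schur-positive.
   Context: $p_\lambda=\prod_i p_{\lambda_i}$ denotes the power sum symmetric function. Reverse lexicographic order on partitions of $n$ is the total order in which, for distinct partitions $\lambda,\mu$ of $n$, $\lambda>\mu$ if and only if $\lambda_j>\mu_j$ at the first index $j$ where $\lambda_j\neq\mu_j$; thus $(1^n)$ is the minimum and $(n)$ the maximum. A symmetric function is Schur-positive if it is a linear combination of Schur functions $s_\lambda$ with nonnegative (integer) coefficients. *)

theory Defs
  imports Main "HOL-Library.FuncSet"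
begin

definition is_partition :: "nat \<Rightarrow> nat list \<Rightarrow> bool" where
  "is_partition n lam \<longleftrightarrow> sorted_wrt (\<ge>) lam \<and> (\<forall>x\<in>set lam. 0 < x) \<and> sum_list lam = n"

definition partitions :: "nat \<Rightarrow> nat list set" where
  "partitions n = {lam. is_partition n lam}"

definition part :: "nat list \<Rightarrow> nat \<Rightarrow> nat" where
  "part lam i = (if i < length lam then lam ! i else 0)"

definition revlex_le :: "nat list \<Rightarrow> nat list \<Rightarrow> bool" where
  "revlex_le lam mu \<longleftrightarrow> lam = mu \<or>
     (\<exists>j. (\<forall>i<j. part lam i = part mu i) \<and> part lam j < part mu j)"

(* Symmetric functions of degree n are represented faithfully by their images in
   n variables x_0,...,x_{n-1}, i.e. by their monomial coefficient functions:
   an exponent vector is alpha :: nat \<Rightarrow> nat with alpha k = 0 for k \<ge> n. *)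
definition exponent :: "nat \<Rightarrow> (nat \<Rightarrow> nat) \<Rightarrow> bool" where
  "exponent n alpha \<longleftrightarrow> (\<forall>k\<ge>n. alpha k = 0)"

(* coefficient of x^alpha in p_lam(x_0,...,x_{n-1}) = prod_i (sum_j x_j^{lam_i}):
   number of maps f from parts to variables with sum_{i: f i = j} lam_i = alpha j *)
definition p_coeff :: "nat \<Rightarrow> nat list \<Rightarrow> (nat \<Rightarrow> nat) \<Rightarrow> int" where
  "p_coeff n lam alpha = int (card {f \<in> {..<length lam} \<rightarrow>\<^sub>E {..<n}.
       \<forall>j. (\<Sum>i\<in>{i. i < length lam \<and> f i = j}. lam ! i) = alpha j})"

definition cells :: "nat list \<Rightarrow> (nat \<times> nat) set" where
  "cells lam = {(i, j). i < length lam \<and> j < lam ! i}"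

definition ssyt :: "nat \<Rightarrow> nat list \<Rightarrow> ((nat \<times> nat) \<Rightarrow> nat) set" where
  "ssyt n lam = {T \<in> cells lam \<rightarrow>\<^sub>E {..<n}.
      (\<forall>i j. (i, j) \<in> cells lam \<and> (i, Suc j) \<in> cells lam \<longrightarrow> T (i, j) \<le> T (i, Suc j)) \<and>
      (\<forall>i j. (i, j) \<in> cells lam \<and> (Suc i, j) \<in> cells lam \<longrightarrow> T (i, j) < T (Suc i, j))}"

definition s_coeff :: "nat \<Rightarrow> nat list \<Rightarrow> (nat \<Rightarrow> nat) \<Rightarrow> int" where
  "s_coeff n lam alpha = int (card {T \<in> ssyt n lam.
       \<forall>k. card {c \<in> cells lam. T c = k} = alpha k})"

definition schur_positive :: "nat \<Rightarrow> ((nat \<Rightarrow> nat) \<Rightarrow> int) \<Rightarrow> bool" where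
  "schur_positive n F \<longleftrightarrow> (\<exists>c :: nat list \<Rightarrow> nat. \<forall>alpha. exponent n alpha \<longrightarrow>
       F alpha = (\<Sum>nu\<in>partitions n. int (c nu) * s_coeff n nu alpha))"

definition psi_coeff :: "nat \<Rightarrow> nat list \<Rightarrow> (nat \<Rightarrow> nat) \<Rightarrow> int" where
  "psi_coeff n mu alpha = (\<Sum>lam\<in>{lam \<in> partitions n. revlex_le (replicate n 1) lam \<and> revlex_le lam mu}.
       p_coeff n lam alpha)"

end

theory Submission
  imports Defs "HOL-Combinatorics.Cycles" "HOL-Computational_Algebra.Polynomial"
begin

text \<open>
  Let $Q_n$ be the sum of all $p_\lambda$ with $\lambda\vdash n$. Counting commuting pairs of permutations gives
  $Q_n = \sum_\lambda F_\lambda$, where $F_\lambda$ is the characteristic of the permutation action on the class of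
  cycle type $\lambda$; so $Q_n$ is Schur-positive, and $F_{(i,\nu)} = F_{(i)} F_\nu$ if all parts of $\nu$ are less
  than $i$.

  If $\mu$ is close to $(n)$, then $\psi_\mu$ is $Q_n$ minus the products $p_{n-j} Q_j$ for small $j$ and a piece of
  the last one. By the hook expansion $p_i = E_i - O_i$, with $E_i$ and $O_i$ the sums of the hooks of even and odd
  leg length. Comparing the cyclic with the dihedral group shows that $F_{(i)} - E_i$ is Schur-positive, and $O_{i+1}$
  is contained in $p_1 E_i$. So the terms $F_{(n-j)} Q_j$ of $Q_n$ pay for the removed products. This works unless $n$
  is small; the remaining $\psi_\mu$ are explicit nonnegative combinations of products of Schur functions.

  If $\mu$ is close to $(1^n)$, only parts 1 and 2 and at most one part 3 occur, and
  $p_1^2 = h_2 + e_2$, $p_2 = h_2 - e_2$ turns $\psi_\mu$ into a polynomial in $h_2$ and $e_2^2$ up to visibly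
  positive factors.

  Symmetric functions are polynomials in $N \ge n$ variables, and products of Schur functions are expanded by means
  of the orthogonality of the class functions that are dual to them.
\<close>

section \<open>Schur polynomials and the Pieri rule\<close>

text \<open>The obstacle is positivity without representations. The class functions
  \<open>chi\<close> arise by inverting the unitriangular Kostka matrix on the permutation
  characters \<open>pc\<close>; this gives orthonormality but no information on signs. The missing
  fact is \<open>chi_idempotent\<close>: the convolution square of \<open>chi\<close> is a positive
  multiple of \<open>chi\<close>. It rests on the vanishing of the convolution of two different
  \<open>chi\<close>. There the first factor is expanded in fixed words, the second one, twisted by
  the sign, in fixed words for the conjugate shape; a transposition cancels every pair of words that
  does not separate the positions, and the surviving pairs force dominance, in both directions by
  commutativity. Hence each \<open>chi\<close> is a Gram kernel, and every form sum_{i,j} y_i y_j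
  P(t_i^{-1} t_j) is Schur-positive (\<open>SP_gram\<close>). This one criterion covers the actions
  on conjugacy classes, the two dihedral characters and the products of Schur functions.
  Coefficients stay real until the last step, where the integer inverse of the Kostka matrix shows
  that they are integers.\<close>

definition shape :: "(nat \<Rightarrow> nat) \<Rightarrow> bool" where
  "shape l \<longleftrightarrow> antimono l \<and> finite {i. l i \<noteq> 0}"

definition sz :: "(nat \<Rightarrow> nat) \<Rightarrow> nat" where
  "sz l = (\<Sum>i | l i \<noteq> 0. l i)"

text \<open>A partition is an eventually zero decreasing function; the relation below says that $l/m$ is a horizontal strip.\<close>

definition hs :: "(nat \<Rightarrow> nat) \<Rightarrow> (nat \<Rightarrow> nat) \<Rightarrow> bool" where
  "hs m l \<longleftrightarrow> (\<forall>i. m i \<le> l i \<and> l (Suc i) \<le> m i)"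

definition Par :: "nat \<Rightarrow> (nat \<Rightarrow> nat) set" where
  "Par n = {l. shape l \<and> sz l = n}"

definition row :: "nat \<Rightarrow> nat \<Rightarrow> nat" where
  "row k = (\<lambda>i. if i = 0 then k else 0)"

lemma sz_eq_sum: "(\<And>i. L \<le> i \<Longrightarrow> l i = 0) \<Longrightarrow> sz l = (\<Sum>i<L. l i)"
  unfolding sz_def
  by (rule sum.mono_neutral_left) (auto, metis leI less_irrefl)

lemma shape_bound: assumes "shape l" obtains L where "\<And>i. L \<le> i \<Longrightarrow> l i = 0"
proof -
  have "finite {i. l i \<noteq> 0}" using assms by (simp add: shape_def)
  then obtain L where "\<forall>i\<in>{i. l i \<noteq> 0}. i < L" 
    using finite_nat_set_iff_bounded by blast
  then show ?thesis using that by (metis mem_Collect_eq not_le)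
qed

lemma shapeI: "(\<And>i. l (Suc i) \<le> l i) \<Longrightarrow> (\<And>i. L \<le> i \<Longrightarrow> l i = 0) \<Longrightarrow> shape l"
  unfolding shape_def
  by (auto simp: antimono_iff_le_Suc intro!: finite_subset[of _ "{..<L}"]) (metis leI less_irrefl)

lemma shape_Suc: "shape l \<Longrightarrow> l (Suc i) \<le> l i"
  by (simp add: shape_def antimono_iff_le_Suc)

lemma shape_mono: "shape l \<Longrightarrow> i \<le> j \<Longrightarrow> l j \<le> l i"
  by (simp add: shape_def antimonoD)

text \<open>If \<open>l i\<close> is nonzero, the first \<open>Suc i\<close> entries contribute at
  least \<open>Suc i\<close> to the size. So the size itself bounds the support and can serve as a
  summation range.\<close>

lemma shape_vanish: assumes "shape l" "sz l \<le> i" shows "l i = 0"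
proof (rule ccontr)
  assume "l i \<noteq> 0"
  obtain L where L: "\<And>i. L \<le> i \<Longrightarrow> l i = 0" using shape_bound[OF assms(1)] by blast
  have iL: "i < L" using L \<open>l i \<noteq> 0\<close> by (metis not_le)
  have "(\<Sum>j<Suc i. 1) \<le> (\<Sum>j<Suc i. l j)"
  proof (rule sum_mono)
    fix j assume "j \<in> {..<Suc i}"
    then have "l i \<le> l j" using shape_mono[OF assms(1)] by simp
    with \<open>l i \<noteq> 0\<close> show "1 \<le> l j" by linarith
  qed
  also have "\<dots> \<le> (\<Sum>j<L. l j)" using iL by (intro sum_mono2) auto
  also have "\<dots> = sz l" using sz_eq_sum[OF L] by simp
  finally show False using assms(2) by simp
qed

lemma shape_le_sz: assumes "shape l" shows "l i \<le> sz l"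
proof (cases "l i = 0")
  case False
  then show ?thesis unfolding sz_def using assms
    by (intro member_le_sum) (auto simp: shape_def)
qed simp

lemma sz_eq: "shape l \<Longrightarrow> sz l \<le> L \<Longrightarrow> sz l = (\<Sum>i<L. l i)"
  by (rule sz_eq_sum) (auto intro: shape_vanish)

lemma sz_0 [simp]: "sz (\<lambda>_. 0) = 0" by (simp add: sz_def)

lemma shape_0 [simp]: "shape (\<lambda>_. 0)" by (rule shapeI) auto

lemma sz_zero_iff: "shape l \<Longrightarrow> sz l = 0 \<longleftrightarrow> l = (\<lambda>_. 0)"
  by (auto simp: sz_def shape_def fun_eq_iff)

lemma shape_row [simp]: "shape (row k)"
  by (rule shapeI[of _ 1]) (auto simp: row_def)

lemma sz_row [simp]: "sz (row k) = k"
  by (subst sz_eq_sum[of 1]) (auto simp: row_def)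

lemma finite_shapes: "finite {l. shape l \<and> sz l \<le> n}"
proof (rule finite_subset)
  show "{l. shape l \<and> sz l \<le> n} \<subseteq> {l. l ` {..<n} \<subseteq> {..n} \<and> (\<forall>i. i \<notin> {..<n} \<longrightarrow> l i = 0)}"
  proof clarsimp
    fix l assume "shape l" "sz l \<le> n"
    then show "l ` {..<n} \<subseteq> {..n} \<and> (\<forall>i. \<not> i < n \<longrightarrow> l i = 0)"
      using shape_le_sz[of l] shape_vanish[of l] by (auto simp: image_subset_iff) (meson le_trans)
  qed
  show "finite {l. l ` {..<n} \<subseteq> {..n::nat} \<and> (\<forall>i. i \<notin> {..<n} \<longrightarrow> l i = (0::nat))}"
    using finite_set_of_finite_funs[of "{..<n}" "{..n}" 0] 
    by (rule rev_finite_subset) (auto simp: image_subset_iff)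
qed

lemma finite_Par [simp]: "finite (Par n)"
  by (rule finite_subset[OF _ finite_shapes[of n]]) (auto simp: Par_def)

lemma Par_0: "Par 0 = {\<lambda>_. 0}" by (auto simp: Par_def sz_zero_iff)

lemma hs_shape: "hs m l \<Longrightarrow> shape m \<longleftrightarrow> shape l"
proof
  assume h: "hs m l" and s: "shape l"
  obtain L where L: "\<And>i. L \<le> i \<Longrightarrow> l i = 0" using shape_bound[OF s] by blast
  show "shape m"
  proof (rule shapeI[of _ L])
    show "m (Suc i) \<le> m i" for i using h by (meson hs_def le_trans)
    show "m i = 0" if "L \<le> i" for i using that h L by (metis hs_def le_zero_eq)
  qed
next
  assume h: "hs m l" and s: "shape m"
  obtain L where L: "\<And>i. L \<le> i \<Longrightarrow> m i = 0" using shape_bound[OF s] by blast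
  show "shape l"
  proof (rule shapeI[of _ "Suc L"])
    show "l (Suc i) \<le> l i" for i using h by (auto simp: hs_def intro: le_trans)
    show "l i = 0" if "Suc L \<le> i" for i using that h L
      by (metis Suc_le_D Suc_le_mono hs_def le_zero_eq)
  qed
qed

lemma hs_sz_le: assumes "hs m l" "shape l" shows "sz m \<le> sz l"
proof -
  obtain L where L: "\<And>i. L \<le> i \<Longrightarrow> l i = 0" using shape_bound[OF assms(2)] by blast
  have "\<And>i. L \<le> i \<Longrightarrow> m i = 0" using L assms(1) by (metis hs_def le_zero_eq)
  then have "sz m = (\<Sum>i<L. m i)" by (rule sz_eq_sum)
  also have "\<dots> \<le> (\<Sum>i<L. l i)" using assms(1) by (intro sum_mono) (auto simp: hs_def)
  also have "\<dots> = sz l" using sz_eq_sum[OF L] by simp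
  finally show ?thesis .
qed

lemma finite_hs_below: "shape l \<Longrightarrow> finite {m. hs m l}"
  by (rule finite_subset[OF _ finite_shapes[of "sz l"]]) (auto simp: hs_shape hs_sz_le)

lemma finite_hs_above: "shape l \<Longrightarrow> finite {m. hs l m \<and> sz m \<le> s}"
  by (rule finite_subset[OF _ finite_shapes[of s]]) (auto simp: hs_shape)

lemma hs_zero_iff: "hs m (\<lambda>_. 0) \<longleftrightarrow> m = (\<lambda>_. 0)"
  by (auto simp: hs_def fun_eq_iff)

lemma hs_row_iff: "hs m (row k) \<longleftrightarrow> (\<exists>g\<le>k. m = row g)"
proof
  assume h: "hs m (row k)"
  then have "m 0 \<le> k" "\<And>i. i \<noteq> 0 \<Longrightarrow> m i = 0"
    unfolding hs_def row_def by (metis, metis le_zero_eq)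
  then have "m = row (m 0)" "m 0 \<le> k" by (auto simp: row_def)
  then show "\<exists>g\<le>k. m = row g" by blast
qed (auto simp: hs_def row_def)

lemma inj_row: "inj row" by (rule injI) (metis row_def)

text \<open>Summed over all \<open>i\<close>, the relation counts every entry of \<open>l\<close>
  and of \<open>r\<close> once, since maximum plus minimum is the sum. Only the maximum at index 0
  is left over, because the relation never involves \<open>k 0\<close>.\<close>

lemma local_rule_sz:
  assumes "shape l" "shape r" "hs t l" "hs t r"
    "\<And>i. k (Suc i) + t i = max (l (Suc i)) (r (Suc i)) + min (l i) (r i)"
  shows "sz k + sz t + max (l 0) (r 0) = k 0 + sz l + sz r"
proof -
  obtain L1 L2 where "\<And>i. L1 \<le> i \<Longrightarrow> l i = 0" "\<And>i. L2 \<le> i \<Longrightarrow> r i = 0"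
    using shape_bound[OF assms(1)] shape_bound[OF assms(2)] by metis
  then have L: "\<And>i. max L1 L2 \<le> i \<Longrightarrow> l i = 0 \<and> r i = 0" by simp
  define L where "L = max L1 L2"
  have z: "l i = 0" "r i = 0" "t i = 0" if "L \<le> i" for i
    using L[of i] that assms(3) by (auto simp: L_def hs_def) (metis le_zero_eq)
  have zk: "k i = 0" if c: "Suc L \<le> i" for i
  proof -
    obtain j where j: "i = Suc j" using Suc_le_D[OF c] by blast
    then have "l j = 0" "r j = 0" "l (Suc j) = 0" "r (Suc j) = 0" using z c by auto
    then show ?thesis using assms(5)[of j] j by simp
  qed
  have "sz k + sz t = k 0 + (\<Sum>i<L. k (Suc i)) + (\<Sum>i<L. t i)"
    using sz_eq_sum[of "Suc L" k] sz_eq_sum[of L t] zk z by (simp add: sum.lessThan_Suc_shift del: sum.lessThan_Suc)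
  also have "\<dots> = k 0 + (\<Sum>i<L. k (Suc i) + t i)" by (simp add: sum.distrib)
  also have "\<dots> = k 0 + (\<Sum>i<L. max (l (Suc i)) (r (Suc i)) + min (l i) (r i))" using assms(5) by simp
  also have "\<dots> + max (l 0) (r 0) = k 0 + ((\<Sum>i<Suc L. max (l i) (r i)) + (\<Sum>i<L. min (l i) (r i)))"
    by (simp add: sum.distrib sum.lessThan_Suc_shift del: sum.lessThan_Suc)
  also have "\<dots> = k 0 + (\<Sum>i<L. max (l i) (r i) + min (l i) (r i))" using z[of L] by (simp add: sum.distrib)
  also have "\<dots> = k 0 + (\<Sum>i<L. l i + r i)" 
  proof -
    have "max a b + min a b = a + b" for a b :: nat by linarith
    then show ?thesis by simp
  qed
  also have "\<dots> = k 0 + sz l + sz r" using sz_eq_sum[of L l] sz_eq_sum[of L r] z by (simp add: sum.distrib)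
  finally show ?thesis by simp
qed

text \<open>The local rule of Robinson-Schensted-Knuth growth diagrams in piecewise linear form.
  \<open>k (Suc i)\<close> and \<open>t i\<close> range over the same interval, from
  \<open>max (l (Suc i)) (r (Suc i))\<close> to \<open>min (l i) (r i)\<close>, and reflecting that
  interval exchanges them. The first row \<open>k 0\<close> has no partner in \<open>t\<close> and
  no upper bound; it absorbs what the size \<open>s\<close> demands, and this amount must be
  nonnegative, which is the inequality on the right.\<close>

lemma local_rule:
  assumes l: "shape l" and r: "shape r"
  shows "card {k. hs l k \<and> hs r k \<and> sz k = s} = card {t. hs t l \<and> hs t r \<and> sz l + sz r \<le> s + sz t}"
proof -
  define G where "G k = (\<lambda>i. max (l (Suc i)) (r (Suc i)) + min (l i) (r i) - k (Suc i))" for k :: "nat \<Rightarrow> nat"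
  define F where "F t = (\<lambda>i. case i of 0 \<Rightarrow> max (l 0) (r 0) + (s + sz t - (sz l + sz r))
      | Suc i \<Rightarrow> max (l (Suc i)) (r (Suc i)) + min (l i) (r i) - t i)" for t
  let ?A = "{k. hs l k \<and> hs r k \<and> sz k = s}"
  let ?B = "{t. hs t l \<and> hs t r \<and> sz l + sz r \<le> s + sz t}"
  have A: "G k \<in> ?B \<and> F (G k) = k" if "k \<in> ?A" for k
  proof -
    from that have h: "hs l k" "hs r k" "sz k = s" by auto
    have k0: "max (l 0) (r 0) \<le> k 0" using h by (auto simp: hs_def)
    have kS: "max (l (Suc i)) (r (Suc i)) \<le> k (Suc i)" "k (Suc i) \<le> min (l i) (r i)" for i
      using h by (auto simp: hs_def)
    have sum: "k (Suc i) + G k i = max (l (Suc i)) (r (Suc i)) + min (l i) (r i)" for i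
      using trans_le_add2[OF kS(2)[of i]] by (simp add: G_def)
    have "max (l (Suc i)) (r (Suc i)) \<le> G k i" "G k i \<le> min (l i) (r i)" for i
      using sum[of i] kS[of i] by linarith+
    then have g: "hs (G k) l" "hs (G k) r" by (auto simp: hs_def)
    have sz: "sz k + sz (G k) + max (l 0) (r 0) = k 0 + sz l + sz r"
      by (rule local_rule_sz[OF l r g]) (rule sum)
    have "F (G k) i = k i" for i
    proof (cases i)
      case 0
      have "s + sz (G k) - (sz l + sz r) = k 0 - max (l 0) (r 0)" using sz h(3) by linarith
      then show ?thesis using k0 0 by (simp add: F_def)
    next
      case (Suc j)
      then show ?thesis using sum[of j] by (simp add: F_def)
    qed
    then show ?thesis using g sz k0 h(3) by auto
  qed
  have B: "F t \<in> ?A \<and> G (F t) = t" if "t \<in> ?B" for t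
  proof -
    from that have h: "hs t l" "hs t r" "sz l + sz r \<le> s + sz t" by auto
    have tS: "max (l (Suc i)) (r (Suc i)) \<le> t i" "t i \<le> min (l i) (r i)" for i
      using h by (auto simp: hs_def)
    have sum: "F t (Suc i) + t i = max (l (Suc i)) (r (Suc i)) + min (l i) (r i)" for i
      using trans_le_add2[OF tS(2)[of i]] by (simp add: F_def)
    have f: "max (l (Suc i)) (r (Suc i)) \<le> F t (Suc i)" "F t (Suc i) \<le> min (l i) (r i)" for i
      using sum[of i] tS[of i] by linarith+
    have f0: "F t 0 = max (l 0) (r 0) + (s + sz t - (sz l + sz r))" by (simp add: F_def)
    have "l i \<le> F t i \<and> r i \<le> F t i" for i
      using f0 f(1) by (cases i) auto
    then have g: "hs l (F t)" "hs r (F t)" using f(2) by (auto simp: hs_def)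
    have sz: "sz (F t) + sz t + max (l 0) (r 0) = F t 0 + sz l + sz r"
      by (rule local_rule_sz[OF l r h(1,2)]) (rule sum)
    have "G (F t) i = t i" for i using sum[of i] by (simp add: G_def)
    then show ?thesis using g sz f0 h(3) by auto
  qed
  have "bij_betw G ?A ?B"
    by (rule bij_betw_byWitness[where f'=F]) (use A B in blast)+
  then show ?thesis by (rule bij_betw_same_card)
qed

text \<open>The branching rule, stripping off the last variable.\<close>

primrec S :: "nat \<Rightarrow> (nat \<Rightarrow> nat) \<Rightarrow> (nat \<Rightarrow> real) \<Rightarrow> real" where
  "S 0 l x = (if l = (\<lambda>_. 0) then 1 else 0)"
| "S (Suc a) l x = (\<Sum>m | hs m l. x a ^ (sz l - sz m) * S a m x)"

abbreviation H :: "nat \<Rightarrow> nat \<Rightarrow> (nat \<Rightarrow> real) \<Rightarrow> real" where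
  "H a k \<equiv> S a (row k)"

lemma S_0 [simp]: "S a (\<lambda>_. 0) x = 1"
  by (induction a) (simp_all add: hs_zero_iff)

lemma H_Suc: "H (Suc a) k x = (\<Sum>g\<le>k. x a ^ (k - g) * H a g x)"
proof -
  have "{m. hs m (row k)} = row ` {..k}" by (auto simp: hs_row_iff)
  then show ?thesis using inj_row by (simp add: sum.reindex inj_on_def)
qed

lemma row_0: "row 0 = (\<lambda>_. 0)" by (auto simp: row_def)

text \<open>Induction on the number of variables. Expanding the last variable on the left gives
  shapes \<open>k\<close> above both \<open>l\<close> and \<open>r\<close>;
  \<open>local_rule\<close> trades \<open>k\<close> for a \<open>t\<close> below both. Then
  \<open>l\<close> is stripped to \<open>t\<close>, \<open>r\<close> is a strip over
  \<open>t\<close>, and the induction hypothesis applies to \<open>t\<close>. The bound on the size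
  of \<open>r\<close> is what \<open>H_Suc\<close> needs to assemble the complete function in one
  more variable.\<close>

theorem pieri:
  assumes "shape l"
  shows "(\<Sum>k | hs l k \<and> sz k = sz l + n. S a k x) = H a n x * S a l x"
  using assms
proof (induction a arbitrary: l n)
  case 0
  have fin: "finite {k. hs l k \<and> sz k = sz l + n}"
    by (rule finite_subset[OF _ finite_hs_above[OF 0, of "sz l + n"]]) auto
  show ?case
  proof (cases "n = 0 \<and> l = (\<lambda>_. 0)")
    case True
    have "{k. hs l k \<and> sz k = sz l + n} = {\<lambda>_. 0}"
    proof -
      have "k = (\<lambda>_. 0)" if "hs l k" "sz k = 0" for k
        using that 0 hs_shape[of l k] sz_zero_iff[of k] by simp
      then show ?thesis using True by (auto simp: hs_zero_iff)
    qed
    then show ?thesis using True by (simp add: row_0)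
  next
    case False
    have "k \<noteq> (\<lambda>_. 0)" if "hs l k \<and> sz k = sz l + n" for k
      using that False sz_zero_iff[OF 0] by (cases "n = 0") auto
    then have "(\<Sum>k | hs l k \<and> sz k = sz l + n. S 0 k x) = 0"
      by (intro sum.neutral) auto
    moreover have "H 0 n x * S 0 l x = 0" using False by (auto simp: row_def fun_eq_iff)
    ultimately show ?thesis by simp
  qed
next
  case (Suc a)
  define s where "s = sz l + n"
  define R where "R = {r. shape r \<and> sz r \<le> s}"
  define U where "U = {k. hs l k \<and> sz k = s}"
  have finR: "finite R" unfolding R_def by (rule finite_shapes)
  have finU: "finite U" unfolding U_def
    by (rule finite_subset[OF _ finite_hs_above[OF Suc.prems, of s]]) auto
  have U: "shape k" if "k \<in> U" for k using that Suc.prems hs_shape by (auto simp: U_def)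
  have "(\<Sum>k\<in>U. S (Suc a) k x) = (\<Sum>k\<in>U. \<Sum>r | r \<in> R \<and> hs r k. x a ^ (s - sz r) * S a r x)"
  proof (rule sum.cong[OF refl])
    fix k assume k: "k \<in> U"
    have "{r. hs r k} = {r. r \<in> R \<and> hs r k}"
      using k U[OF k] hs_sz_le[of _ k] by (auto simp: R_def hs_shape U_def)
    then show "S (Suc a) k x = (\<Sum>r | r \<in> R \<and> hs r k. x a ^ (s - sz r) * S a r x)"
      using k by (simp add: U_def)
  qed
  also have "\<dots> = (\<Sum>r\<in>R. \<Sum>k | k \<in> U \<and> hs r k. x a ^ (s - sz r) * S a r x)"
    by (rule sum.swap_restrict[OF finU finR])
  \<comment> \<open>For fixed \<open>r\<close> the summand does not depend on the inner index, so
    equality of cardinalities suffices.\<close>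
  also have "\<dots> = (\<Sum>r\<in>R. \<Sum>t | t \<in> {t. hs t l} \<and> (hs t r \<and> sz r \<le> sz t + n). x a ^ (s - sz r) * S a r x)"
  proof (rule sum.cong[OF refl])
    fix r assume r: "r \<in> R"
    have "{k. k \<in> U \<and> hs r k} = {k. hs l k \<and> hs r k \<and> sz k = s}" by (auto simp: U_def)
    moreover have "{t. hs t l \<and> hs t r \<and> sz l + sz r \<le> s + sz t} = {t. t \<in> {t. hs t l} \<and> (hs t r \<and> sz r \<le> sz t + n)}"
      by (auto simp: s_def)
    ultimately show "(\<Sum>k | k \<in> U \<and> hs r k. x a ^ (s - sz r) * S a r x) = 
      (\<Sum>t | t \<in> {t. hs t l} \<and> (hs t r \<and> sz r \<le> sz t + n). x a ^ (s - sz r) * S a r x)"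
      using local_rule[OF Suc.prems, of r s] r by (simp add: R_def)
  qed
  also have "\<dots> = (\<Sum>t | hs t l. \<Sum>r | r \<in> R \<and> (hs t r \<and> sz r \<le> sz t + n). x a ^ (s - sz r) * S a r x)"
    by (rule sum.swap_restrict[OF finR finite_hs_below[OF Suc.prems]])
  also have "\<dots> = (\<Sum>t | hs t l. x a ^ (sz l - sz t) * S a t x * H (Suc a) n x)"
  proof (rule sum.cong[OF refl])
    fix t assume "t \<in> {t. hs t l}"
    then have t: "hs t l" "shape t" "sz t \<le> sz l" using Suc.prems hs_shape hs_sz_le by auto
    have eq: "{r. r \<in> R \<and> (hs t r \<and> sz r \<le> sz t + n)} = (\<Union>g\<in>{..n}. {r. hs t r \<and> sz r = sz t + g})" (is "?L = ?R")
    proof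
      show "?L \<subseteq> ?R"
      proof
        fix r assume "r \<in> ?L"
        then have "hs t r" "sz r \<le> sz t + n" "shape r" by (auto simp: R_def)
        moreover have "sz t \<le> sz r" using hs_sz_le[OF \<open>hs t r\<close> \<open>shape r\<close>] .
        ultimately have "sz r = sz t + (sz r - sz t)" "sz r - sz t \<le> n" by auto
        then show "r \<in> ?R" using \<open>hs t r\<close> by blast
      qed
      show "?R \<subseteq> ?L" using t hs_shape by (auto simp: R_def s_def)
    qed
    have fin: "finite {r. hs t r \<and> sz r = sz t + g}" for g
      by (rule finite_subset[OF _ finite_hs_above[OF t(2), of "sz t + g"]]) auto
    have "(\<Sum>r | r \<in> R \<and> (hs t r \<and> sz r \<le> sz t + n). x a ^ (s - sz r) * S a r x)
      = (\<Sum>g\<le>n. \<Sum>r | hs t r \<and> sz r = sz t + g. x a ^ (s - sz r) * S a r x)"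
      unfolding eq by (subst sum.UNION_disjoint) (auto simp: fin)
    also have "\<dots> = (\<Sum>g\<le>n. x a ^ (sz l - sz t) * (x a ^ (n - g) * (H a g x * S a t x)))"
    proof (rule sum.cong[OF refl])
      fix g assume g: "g \<in> {..n}"
      have "(\<Sum>r | hs t r \<and> sz r = sz t + g. x a ^ (s - sz r) * S a r x)
        = (\<Sum>r | hs t r \<and> sz r = sz t + g. x a ^ (sz l - sz t) * x a ^ (n - g) * S a r x)"
      proof (rule sum.cong[OF refl])
        fix r assume "r \<in> {r. hs t r \<and> sz r = sz t + g}"
        then have "s - sz r = (sz l - sz t) + (n - g)" using g t(3) by (simp add: s_def)
        then show "x a ^ (s - sz r) * S a r x = x a ^ (sz l - sz t) * x a ^ (n - g) * S a r x"
          by (simp add: power_add)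
      qed
      also have "\<dots> = x a ^ (sz l - sz t) * x a ^ (n - g) * (\<Sum>r | hs t r \<and> sz r = sz t + g. S a r x)"
        by (simp add: sum_distrib_left)
      also have "\<dots> = x a ^ (sz l - sz t) * (x a ^ (n - g) * (H a g x * S a t x))"
        using Suc.IH[OF t(2), of g] by simp
      finally show "(\<Sum>r | hs t r \<and> sz r = sz t + g. x a ^ (s - sz r) * S a r x) = \<dots>" .
    qed
    also have "\<dots> = x a ^ (sz l - sz t) * S a t x * H (Suc a) n x"
      unfolding H_Suc by (simp add: sum_distrib_left sum_distrib_right mult_ac)
    finally show "(\<Sum>r | r \<in> R \<and> (hs t r \<and> sz r \<le> sz t + n). x a ^ (s - sz r) * S a r x) = \<dots>" .
  qed
  also have "\<dots> = H (Suc a) n x * S (Suc a) l x"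
    by (simp add: sum_distrib_left mult_ac)
  finally show ?case by (simp add: U_def s_def)
qed

text \<open>The degree \<open>n\<close> part of the product of all 1 / (1 - x_i y_j) with
  \<open>i < a\<close> and \<open>j < b\<close>, built one \<open>y\<close> variable at a time to
  match the branching recursion of \<open>S\<close>.\<close>

primrec HH :: "nat \<Rightarrow> nat \<Rightarrow> nat \<Rightarrow> (nat \<Rightarrow> real) \<Rightarrow> (nat \<Rightarrow> real) \<Rightarrow> real" where
  "HH a 0 n x y = (if n = 0 then 1 else 0)"
| "HH a (Suc b) n x y = (\<Sum>k\<le>n. y b ^ k * H a k x * HH a b (n - k) x y)"

text \<open>Stripping the last \<open>y\<close> variable from the second factor leaves, for each
  smaller shape \<open>m\<close>, a sum over the horizontal strips on \<open>m\<close>. This is one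
  instance of \<open>pieri\<close> in the \<open>x\<close> variables.\<close>

theorem cauchy: "(\<Sum>l\<in>Par n. S a l x * S b l y) = HH a b n x y"
proof (induction b arbitrary: n)
  case 0
  show ?case
  proof (cases "n = 0")
    case True then show ?thesis by (simp add: Par_0)
  next
    case False
    then have "(\<lambda>_. 0) \<notin> Par n" by (auto simp: Par_def)
    then have "(\<Sum>l\<in>Par n. S a l x * S 0 l y) = 0" by (intro sum.neutral) auto
    then show ?thesis using False by simp
  qed
next
  case (Suc b)
  define R where "R = {m. shape m \<and> sz m \<le> n}"
  have finR: "finite R" unfolding R_def by (rule finite_shapes)
  have "(\<Sum>l\<in>Par n. S a l x * S (Suc b) l y)
      = (\<Sum>l\<in>Par n. \<Sum>m | m \<in> R \<and> hs m l. y b ^ (n - sz m) * S b m y * S a l x)"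
  proof (rule sum.cong[OF refl])
    fix l assume l: "l \<in> Par n"
    have "{m. hs m l} = {m. m \<in> R \<and> hs m l}"
      using l hs_sz_le[of _ l] by (auto simp: Par_def R_def hs_shape)
    then show "S a l x * S (Suc b) l y = (\<Sum>m | m \<in> R \<and> hs m l. y b ^ (n - sz m) * S b m y * S a l x)"
      using l by (simp add: Par_def sum_distrib_left mult_ac)
  qed
  also have "\<dots> = (\<Sum>m\<in>R. \<Sum>l | l \<in> Par n \<and> hs m l. y b ^ (n - sz m) * S b m y * S a l x)"
    by (rule sum.swap_restrict[OF finite_Par finR])
  also have "\<dots> = (\<Sum>m\<in>R. y b ^ (n - sz m) * S b m y * (H a (n - sz m) x * S a m x))"
  proof (rule sum.cong[OF refl])
    fix m assume m: "m \<in> R"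
    have "{l. l \<in> Par n \<and> hs m l} = {l. hs m l \<and> sz l = sz m + (n - sz m)}"
      using m hs_shape by (auto simp: Par_def R_def)
    then show "(\<Sum>l | l \<in> Par n \<and> hs m l. y b ^ (n - sz m) * S b m y * S a l x)
      = y b ^ (n - sz m) * S b m y * (H a (n - sz m) x * S a m x)"
      using pieri[where l=m and a=a and n="n - sz m" and x=x] m by (simp add: R_def sum_distrib_left[symmetric])
  qed
  also have "\<dots> = (\<Sum>m\<in>(\<Union>k\<in>{..n}. Par (n - k)). y b ^ (n - sz m) * S b m y * (H a (n - sz m) x * S a m x))"
  proof (rule sum.cong)
    show "R = (\<Union>k\<in>{..n}. Par (n - k))"
    proof
      show "R \<subseteq> (\<Union>k\<in>{..n}. Par (n - k))"
      proof
        fix m assume "m \<in> R"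
        then have "m \<in> Par (n - (n - sz m))" "n - sz m \<le> n" by (auto simp: R_def Par_def)
        then show "m \<in> (\<Union>k\<in>{..n}. Par (n - k))" by blast
      qed
    qed (auto simp: R_def Par_def)
  qed simp
  also have "\<dots> = (\<Sum>k\<le>n. \<Sum>m\<in>Par (n - k). y b ^ (n - sz m) * S b m y * (H a (n - sz m) x * S a m x))"
    by (rule sum.UNION_disjoint) (simp, simp, force simp: Par_def)
  also have "\<dots> = (\<Sum>k\<le>n. y b ^ k * H a k x * HH a b (n - k) x y)"
  proof (rule sum.cong[OF refl])
    fix k assume k: "k \<in> {..n}"
    have "(\<Sum>m\<in>Par (n - k). y b ^ (n - sz m) * S b m y * (H a (n - sz m) x * S a m x))
      = (\<Sum>m\<in>Par (n - k). y b ^ k * H a k x * (S a m x * S b m y))"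
      using k by (intro sum.cong) (auto simp: Par_def)
    also have "\<dots> = y b ^ k * H a k x * HH a b (n - k) x y"
      using Suc.IH[of "n - k"] by (simp add: sum_distrib_left[symmetric])
    finally show "(\<Sum>m\<in>Par (n - k). y b ^ (n - sz m) * S b m y * (H a (n - sz m) x * S a m x)) = \<dots>" .
  qed
  finally show ?case by simp
qed

section \<open>Words fixed by a permutation\<close>

definition Sym :: "nat \<Rightarrow> (nat \<Rightarrow> nat) set" where
  "Sym n = {g. g permutes {..<n}}"

text \<open>The power sum indexed by the cycle type of \<open>g\<close>, since a fixed word chooses
  one letter for each cycle. Fixed words avoid all mention of cycles, and the arbitrary alphabet
  allows pairs of letters as letters.\<close>

definition wts :: "nat \<Rightarrow> 'c set \<Rightarrow> (nat \<Rightarrow> nat) \<Rightarrow> ('c \<Rightarrow> real) \<Rightarrow> real" where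
  "wts n C g z = (\<Sum>v | v \<in> {..<n} \<rightarrow>\<^sub>E C \<and> v \<circ> g = v. \<Prod>i<n. z (v i))"

definition content :: "nat \<Rightarrow> (nat \<Rightarrow> 'c) \<Rightarrow> 'c \<Rightarrow> nat" where
  "content n v = (\<lambda>c. card {i. i < n \<and> v i = c})"

definition exps :: "'c set \<Rightarrow> nat \<Rightarrow> ('c \<Rightarrow> nat) set" where
  "exps C n = {m. (\<forall>c. c \<notin> C \<longrightarrow> m c = 0) \<and> (\<Sum>c\<in>C. m c) = n}"

definition mon :: "'c set \<Rightarrow> ('c \<Rightarrow> nat) \<Rightarrow> ('c \<Rightarrow> real) \<Rightarrow> real" where
  "mon C m z = (\<Prod>c\<in>C. z c ^ m c)"

text \<open>The complete homogeneous function in the letters of \<open>C\<close>. \<open>H\<close>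
  is the same object for an ordered list of variables; \<open>hsum_column\<close> links the
  two.\<close>

definition hsum :: "nat \<Rightarrow> 'c set \<Rightarrow> ('c \<Rightarrow> real) \<Rightarrow> real" where
  "hsum n C z = (\<Sum>m\<in>exps C n. mon C m z)"

lemma Sym_finite [simp]: "finite (Sym n)" by (simp add: Sym_def finite_permutations)
lemma card_Sym: "card (Sym n) = fact n" by (simp add: Sym_def card_permutations)
lemma Sym_id [simp]: "id \<in> Sym n" by (simp add: Sym_def permutes_id)
lemma Sym_comp [intro]: "g \<in> Sym n \<Longrightarrow> h \<in> Sym n \<Longrightarrow> g \<circ> h \<in> Sym n" by (simp add: Sym_def permutes_compose)
lemma Sym_inv [intro]: "g \<in> Sym n \<Longrightarrow> inv g \<in> Sym n" by (simp add: Sym_def permutes_inv)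
lemma Sym_inv_o: "g \<in> Sym n \<Longrightarrow> g \<circ> inv g = id" "g \<in> Sym n \<Longrightarrow> inv g \<circ> g = id"
  by (simp_all add: Sym_def permutes_inv_o)
lemma Sym_inv_inv: "g \<in> Sym n \<Longrightarrow> inv (inv g) = g" by (simp add: Sym_def permutes_inv_inv)
lemma Sym_inv_comp: "g \<in> Sym n \<Longrightarrow> h \<in> Sym n \<Longrightarrow> inv (g \<circ> h) = inv h \<circ> inv g"
  by (simp add: Sym_def o_inv_distrib permutes_bij)
lemma Sym_cancel: "g \<in> Sym n \<Longrightarrow> g \<circ> (inv g \<circ> h) = h" "g \<in> Sym n \<Longrightarrow> inv g \<circ> (g \<circ> h) = h"
  "g \<in> Sym n \<Longrightarrow> (h \<circ> g) \<circ> inv g = h" "g \<in> Sym n \<Longrightarrow> (h \<circ> inv g) \<circ> g = h"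
  by (simp_all add: comp_assoc[symmetric] Sym_inv_o) (simp_all add: comp_assoc Sym_inv_o)
lemma Sym_less: "g \<in> Sym n \<Longrightarrow> i < n \<Longrightarrow> g i < n" 
  by (metis Sym_def lessThan_iff mem_Collect_eq permutes_in_image)
lemma Sym_ge: "g \<in> Sym n \<Longrightarrow> n \<le> i \<Longrightarrow> g i = i" 
  by (metis Sym_def lessThan_iff mem_Collect_eq permutes_not_in not_le)

lemma bij_Sym_left: "g \<in> Sym n \<Longrightarrow> bij_betw (\<lambda>h. g \<circ> h) (Sym n) (Sym n)"
  by (rule bij_betw_byWitness[where f'="\<lambda>h. inv g \<circ> h"]) (auto simp: Sym_cancel)

lemma bij_Sym_right: "g \<in> Sym n \<Longrightarrow> bij_betw (\<lambda>h. h \<circ> g) (Sym n) (Sym n)"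
  by (rule bij_betw_byWitness[where f'="\<lambda>h. h \<circ> inv g"]) (auto simp: Sym_cancel)

lemma bij_Sym_inv: "bij_betw inv (Sym n) (Sym n)"
  by (rule bij_betw_byWitness[where f'=inv]) (auto simp: Sym_inv_inv)

lemma sum_Sym_left: "g \<in> Sym n \<Longrightarrow> (\<Sum>h\<in>Sym n. f (g \<circ> h)) = (\<Sum>h\<in>Sym n. f h)"
  by (rule sum.reindex_bij_betw[OF bij_Sym_left])
lemma sum_Sym_right: "g \<in> Sym n \<Longrightarrow> (\<Sum>h\<in>Sym n. f (h \<circ> g)) = (\<Sum>h\<in>Sym n. f h)"
  by (rule sum.reindex_bij_betw[OF bij_Sym_right])
lemma sum_Sym_inv: "(\<Sum>h\<in>Sym n. f (inv h)) = (\<Sum>h\<in>Sym n. f h)"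
  by (rule sum.reindex_bij_betw[OF bij_Sym_inv])

lemma finite_words [simp]: "finite C \<Longrightarrow> finite ({..<n::nat} \<rightarrow>\<^sub>E C)" by (simp add: finite_PiE)

lemma word_comp: "v \<in> {..<n} \<rightarrow>\<^sub>E C \<Longrightarrow> g \<in> Sym n \<Longrightarrow> v \<circ> g \<in> {..<n} \<rightarrow>\<^sub>E C"
  by (auto simp: PiE_iff extensional_def Sym_less) (metis Sym_ge not_le)

lemma content_comp: assumes "g \<in> Sym n" shows "content n (v \<circ> g) = content n v"
proof
  fix c
  have "bij_betw g {i. i < n \<and> v (g i) = c} {i. i < n \<and> v i = c}"
    by (rule bij_betw_byWitness[where f'="inv g"]) 
       (use assms Sym_inv[OF assms] in \<open>auto simp: Sym_less Sym_def permutes_inverses\<close>)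
  then show "content n (v \<circ> g) c = content n v c"
    by (simp add: content_def bij_betw_same_card)
qed

lemma finite_exps [simp]: assumes "finite C" shows "finite (exps C n)"
proof (rule finite_subset)
  show "exps C n \<subseteq> {f. \<forall>x. (x \<in> C \<longrightarrow> f x \<in> {..n}) \<and> (x \<notin> C \<longrightarrow> f x = 0)}"
    using assms by (auto simp: exps_def intro: member_le_sum)
  show "finite {f. \<forall>x. (x \<in> C \<longrightarrow> f x \<in> {..n}) \<and> (x \<notin> C \<longrightarrow> f x = (0::nat))}"
    by (rule finite_set_of_finite_funs) (use assms in auto)
qed

lemma content_exps: assumes "finite C" "v \<in> {..<n} \<rightarrow>\<^sub>E C" shows "content n v \<in> exps C n"
proof -
  have "content n v c = 0" if "c \<notin> C" for c
    using that assms(2) by (auto simp: content_def PiE_iff)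
  moreover have "(\<Sum>c\<in>C. content n v c) = n"
  proof -
    have "(\<Sum>c\<in>C. content n v c) = (\<Sum>c\<in>C. \<Sum>i | i \<in> {..<n} \<and> v i = c. 1)"
      by (simp add: content_def)
    also have "\<dots> = (\<Sum>i<n. 1)"
      by (rule sum.group) (use assms in \<open>auto simp: PiE_iff\<close>)
    finally show ?thesis by simp
  qed
  ultimately show ?thesis by (simp add: exps_def)
qed

lemma prod_word: assumes "finite C" "v \<in> {..<n} \<rightarrow>\<^sub>E C" shows "(\<Prod>i<n. z (v i)) = mon C (content n v) z"
proof -
  have "(\<Prod>i<n. z (v i)) = (\<Prod>c\<in>C. \<Prod>i | i \<in> {..<n} \<and> v i = c. z (v i))"
    by (rule prod.group[symmetric]) (use assms in \<open>auto simp: PiE_iff\<close>)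
  also have "\<dots> = (\<Prod>c\<in>C. \<Prod>i | i \<in> {..<n} \<and> v i = c. z c)"
    by (intro prod.cong) auto
  finally show ?thesis by (simp add: mon_def content_def)
qed

lemma word_exists: assumes "finite C" "m \<in> exps C n" shows "\<exists>v \<in> {..<n} \<rightarrow>\<^sub>E C. content n v = m"
proof -
  define M where "M = (\<Sum>c\<in>C. replicate_mset (m c) c)"
  have count: "count M d = m d" for d
  proof -
    have "count M d = (\<Sum>c\<in>C. if c = d then m c else 0)"
      unfolding M_def count_sum by (intro sum.cong) auto
    also have "\<dots> = m d" using assms by (auto simp: exps_def)
    finally show ?thesis .
  qed
  have "size (\<Sum>c\<in>C. replicate_mset (m c) c) = (\<Sum>c\<in>C. m c)"
    using assms(1) by (induction C rule: finite_induct) auto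
  then have size: "size M = n" using assms(2) by (simp add: M_def exps_def)
  obtain xs where xs: "mset xs = M" using ex_mset by blast
  have len: "length xs = n" using xs size by (metis size_mset)
  have cnt: "card {i. i < n \<and> xs ! i = c} = m c" for c
  proof -
    have "m c = length (filter (\<lambda>y. c = y) xs)" 
      using count[of c] unfolding xs[symmetric] count_mset
      by (simp add: count_list_eq_length_filter)
    also have "\<dots> = card {i. i < n \<and> xs ! i = c}"
      unfolding length_filter_conv_card len by (rule arg_cong[where f=card]) auto
    finally show ?thesis by simp
  qed
  define v where "v = restrict (\<lambda>i. xs ! i) {..<n}"
  have "xs ! i \<in> C" if "i < n" for i
  proof (rule ccontr)
    assume "xs ! i \<notin> C"
    then have "m (xs ! i) = 0" using assms by (simp add: exps_def)
    moreover have "i \<in> {j. j < n \<and> xs ! j = xs ! i}" using that by simp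
    ultimately show False using cnt[of "xs ! i"] by auto
  qed
  then have "v \<in> {..<n} \<rightarrow>\<^sub>E C" by (auto simp: v_def)
  moreover have "content n v = m"
  proof
    fix c
    have "{i. i < n \<and> v i = c} = {i. i < n \<and> xs ! i = c}" by (auto simp: v_def)
    then show "content n v c = m c" by (simp add: content_def cnt)
  qed
  ultimately show ?thesis by blast
qed

lemma content_eq_conj:
  assumes "v \<in> {..<n} \<rightarrow>\<^sub>E C" "w \<in> {..<n} \<rightarrow>\<^sub>E C" "content n v = content n w"
  obtains p where "p \<in> Sym n" "v = w \<circ> p"
proof -
  have "count (image_mset v (mset_set {..<n})) c = count (image_mset w (mset_set {..<n})) c" for c
    using fun_cong[OF assms(3), of c]
    by (simp add: count_image_mset_eq_card_vimage content_def lessThan_def Collect_conj_eq)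
  then have "image_mset v (mset_set {..<n}) = image_mset w (mset_set {..<n})" by (rule multiset_eqI)
  then obtain p where p: "p permutes {..<n}" "\<forall>x\<in>{..<n}. v x = w (p x)"
    using image_mset_eq_implies_permutes[of "{..<n}" v w] by auto
  have "v x = (w \<circ> p) x" for x
  proof (cases "x < n")
    case False
    then have "p x = x" using p(1) by (simp add: permutes_def)
    then show ?thesis using False assms(1,2) by (auto simp: PiE_iff extensional_def)
  qed (use p in auto)
  then have "v = w \<circ> p" by blast
  then show ?thesis using that p(1) by (simp add: Sym_def)
qed

text \<open>The words of content \<open>m\<close> form one orbit. The stabilizer of \<open>v\<close>
  is a translate of the set of permutations carrying a fixed word \<open>w\<close> to
  \<open>v\<close>, and these sets partition the group.\<close>

lemma stabilizer_count:
  assumes "finite C" "m \<in> exps C n"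
  shows "(\<Sum>v | v \<in> {..<n} \<rightarrow>\<^sub>E C \<and> content n v = m. card {g \<in> Sym n. v \<circ> g = v}) = fact n"
proof -
  obtain w where w: "w \<in> {..<n} \<rightarrow>\<^sub>E C" "content n w = m" using word_exists[OF assms] by blast
  let ?V = "{v. v \<in> {..<n} \<rightarrow>\<^sub>E C \<and> content n v = m}"
  have "card {g \<in> Sym n. v \<circ> g = v} = card {g \<in> Sym n. w \<circ> g = v}" if v: "v \<in> ?V" for v
  proof -
    obtain p where p: "p \<in> Sym n" "v = w \<circ> p" using content_eq_conj[of v n C w] v w by auto
    have "bij_betw (\<lambda>g. p \<circ> g) {g \<in> Sym n. v \<circ> g = v} {g \<in> Sym n. w \<circ> g = v}"
      by (rule bij_betw_byWitness[where f'="\<lambda>g. inv p \<circ> g"])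
         (use p in \<open>auto simp: Sym_cancel comp_assoc\<close>)
    then show ?thesis by (rule bij_betw_same_card)
  qed
  then have "(\<Sum>v\<in>?V. card {g \<in> Sym n. v \<circ> g = v}) = (\<Sum>v\<in>?V. \<Sum>g | g \<in> Sym n \<and> w \<circ> g = v. 1)"
    by (intro sum.cong) auto
  also have "\<dots> = (\<Sum>g\<in>Sym n. 1)"
  proof (rule sum.group)
    show "finite ?V" by (rule finite_subset[of _ "{..<n} \<rightarrow>\<^sub>E C"]) (use assms in auto)
    show "(\<lambda>g. w \<circ> g) ` Sym n \<subseteq> ?V" using w by (simp add: image_subset_iff word_comp content_comp)
  qed simp
  finally show ?thesis by (simp add: card_Sym)
qed

text \<open>Exchanging the sums turns words fixed by \<open>g\<close> into stabilizers of words,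
  whose total size for each content is \<open>fact n\<close>.\<close>

lemma burnside: 
  assumes "finite C"
  shows "(\<Sum>g\<in>Sym n. wts n C g z) = fact n * hsum n C z"
proof -
  let ?W = "{..<n} \<rightarrow>\<^sub>E C"
  have "(\<Sum>g\<in>Sym n. wts n C g z) = (\<Sum>v\<in>?W. \<Sum>g | g \<in> Sym n \<and> v \<circ> g = v. \<Prod>i<n. z (v i))"
    unfolding wts_def by (rule sum.swap_restrict) (use assms in auto)
  also have "\<dots> = (\<Sum>v\<in>?W. real (card {g \<in> Sym n. v \<circ> g = v}) * mon C (content n v) z)"
    using assms by (intro sum.cong) (auto simp: prod_word)
  also have "\<dots> = (\<Sum>m\<in>exps C n. \<Sum>v | v \<in> ?W \<and> content n v = m. 
      real (card {g \<in> Sym n. v \<circ> g = v}) * mon C (content n v) z)"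
    by (rule sum.group[symmetric]) (use assms content_exps in auto)
  also have "\<dots> = (\<Sum>m\<in>exps C n. real (\<Sum>v | v \<in> ?W \<and> content n v = m. card {g \<in> Sym n. v \<circ> g = v}) * mon C m z)"
    by (intro sum.cong) (auto simp: sum_distrib_right)
  also have "\<dots> = (\<Sum>m\<in>exps C n. fact n * mon C m z)"
    by (intro sum.cong refl) (simp only: stabilizer_count[OF assms] of_nat_fact)
  finally show ?thesis by (simp add: hsum_def sum_distrib_left)
qed

lemma hsum_empty: "hsum n {} z = (if n = 0 then 1 else 0)"
proof -
  have "exps ({} :: 'a set) n = (if n = 0 then {\<lambda>_. 0} else {})" 
  proof -
    have "(\<forall>c. m c = 0) \<longleftrightarrow> m = (\<lambda>_. 0)" for m :: "'a \<Rightarrow> nat" by auto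
    then show ?thesis unfolding exps_def by auto
  qed
  then show ?thesis by (simp add: hsum_def mon_def)
qed

lemma hsum_insert:
  assumes "finite C" "c \<notin> C"
  shows "hsum n (insert c C) z = (\<Sum>k\<le>n. z c ^ k * hsum (n - k) C z)"
proof -
  have eq: "exps (insert c C) n = (\<Union>k\<in>{..n}. (\<lambda>m. m(c := k)) ` exps C (n - k))" (is "?L = ?R")
  proof
    show "?L \<subseteq> ?R"
    proof
      fix m assume m: "m \<in> ?L"
      then have s: "m c + (\<Sum>d\<in>C. m d) = n" using assms by (simp add: exps_def)
      have "(\<Sum>d\<in>C. (m(c := 0)) d) = (\<Sum>d\<in>C. m d)" using assms by (intro sum.cong) auto
      then have "m(c := 0) \<in> exps C (n - m c)" using m s by (auto simp: exps_def)
      moreover have "m = (m(c := 0))(c := m c)" "m c \<le> n" using s by auto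
      ultimately show "m \<in> ?R" by blast
    qed
    show "?R \<subseteq> ?L"
    proof clarsimp
      fix k m assume k: "k \<le> n" "m \<in> exps C (n - k)"
      have "(\<Sum>d\<in>C. (m(c := k)) d) = (\<Sum>d\<in>C. m d)" using assms by (intro sum.cong) auto
      then show "m(c := k) \<in> ?L" using k assms by (auto simp: exps_def)
    qed
  qed
  have inj: "inj_on (\<lambda>m. m(c := k)) (exps C j)" for k j
  proof (rule inj_onI)
    fix m m' assume *: "m \<in> exps C j" "m' \<in> exps C j" "m(c := k) = m'(c := k)"
    show "m = m'"
    proof
      fix d show "m d = m' d"
      proof (cases "d = c")
        case True
        then show ?thesis using *(1,2) assms(2) by (simp add: exps_def)
      next
        case False
        then show ?thesis using fun_cong[OF *(3), of d] by simp
      qed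
    qed
  qed
  have "hsum n (insert c C) z = (\<Sum>k\<le>n. \<Sum>m\<in>(\<lambda>m. m(c := k)) ` exps C (n - k). mon (insert c C) m z)"
    unfolding hsum_def eq
  proof (rule sum.UNION_disjoint)
    show "\<forall>i\<in>{..n}. \<forall>j\<in>{..n}. i \<noteq> j \<longrightarrow> (\<lambda>m. m(c := i)) ` exps C (n - i) \<inter> (\<lambda>m. m(c := j)) ` exps C (n - j) = {}"
      by (auto dest: fun_cong[where x=c])
  qed (use assms in auto)
  also have "\<dots> = (\<Sum>k\<le>n. \<Sum>m\<in>exps C (n - k). z c ^ k * mon C m z)"
  proof (rule sum.cong[OF refl])
    fix k
    have "mon (insert c C) (m(c := k)) z = z c ^ k * mon C m z" for m
    proof -
      have "(\<Prod>d\<in>C. z d ^ (m(c := k)) d) = (\<Prod>d\<in>C. z d ^ m d)" using assms by (intro prod.cong) auto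
      then show ?thesis using assms by (simp add: mon_def)
    qed
    then show "(\<Sum>m\<in>(\<lambda>m. m(c := k)) ` exps C (n - k). mon (insert c C) m z) = (\<Sum>m\<in>exps C (n - k). z c ^ k * mon C m z)"
      using inj by (simp add: sum.reindex)
  qed
  finally show ?thesis by (simp add: hsum_def sum_distrib_left)
qed

lemma hsum_Un:
  assumes "finite C" "finite D" "C \<inter> D = {}"
  shows "hsum n (C \<union> D) z = (\<Sum>k\<le>n. hsum k D z * hsum (n - k) C z)"
  using assms(2,3)
proof (induction D arbitrary: n rule: finite_induct)
  case empty
  have "(\<Sum>k\<le>n. hsum k {} z * hsum (n - k) C z) = (\<Sum>k\<le>n. if k = 0 then hsum n C z else 0)"
    by (intro sum.cong) (auto simp: hsum_empty)
  then show ?case by simp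
next
  case (insert d D)
  have "hsum n (C \<union> insert d D) z = (\<Sum>k\<le>n. z d ^ k * (\<Sum>j\<le>n-k. hsum j D z * hsum (n - k - j) C z))"
    using insert assms(1) by (simp add: hsum_insert)
  also have "\<dots> = (\<Sum>k\<le>n. \<Sum>j\<le>n-k. z d ^ k * hsum j D z * hsum (n - (k + j)) C z)"
    by (simp add: sum_distrib_left mult_ac)
  also have "\<dots> = (\<Sum>(k, j)\<in>{(k, j). k + j \<le> n}. z d ^ k * hsum j D z * hsum (n - (k + j)) C z)"
    by (subst sum.Sigma) (auto intro!: sum.cong)
  also have "\<dots> = (\<Sum>s\<le>n. \<Sum>k\<le>s. z d ^ k * hsum (s - k) D z * hsum (n - s) C z)"
    by (simp add: sum.triangle_reindex_eq)
  also have "\<dots> = (\<Sum>s\<le>n. hsum s (insert d D) z * hsum (n - s) C z)"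
    using insert by (simp add: hsum_insert sum_distrib_right)
  finally show ?case .
qed

lemma hsum_column: "hsum k ({..<a} \<times> {b}) (\<lambda>(i, j). x i * y j) = y b ^ k * H a k (x :: nat \<Rightarrow> real)"
proof (induction a arbitrary: k)
  case 0
  then show ?case by (auto simp: hsum_empty row_def fun_eq_iff)
next
  case (Suc a)
  have eq: "{..<Suc a} \<times> {b} = insert (a, b) ({..<a} \<times> {b})" by auto
  have "hsum k ({..<Suc a} \<times> {b}) (\<lambda>(i, j). x i * y j) = (\<Sum>g\<le>k. (x a * y b) ^ g * (y b ^ (k - g) * H a (k - g) x))"
    unfolding eq by (subst hsum_insert) (auto simp: Suc)
  also have "\<dots> = (\<Sum>g\<le>k. y b ^ k * (x a ^ g * H a (k - g) x))"
  proof (rule sum.cong[OF refl])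
    fix g assume "g \<in> {..k}"
    then have "y b ^ k = y b ^ g * y b ^ (k - g)" by (simp flip: power_add)
    then show "(x a * y b) ^ g * (y b ^ (k - g) * H a (k - g) x) = y b ^ k * (x a ^ g * H a (k - g) x)"
      by (simp add: power_mult_distrib mult_ac)
  qed
  also have "\<dots> = y b ^ k * (\<Sum>g\<le>k. x a ^ g * H a (k - g) x)" by (simp add: sum_distrib_left)
  also have "(\<Sum>g\<le>k. x a ^ g * H a (k - g) x) = H (Suc a) k x"
    unfolding H_Suc by (rule sum.reindex_bij_witness[of _ "\<lambda>g. k - g" "\<lambda>g. k - g"]) auto
  finally show ?case .
qed

lemma HH_eq_hsum: "HH a b n x y = hsum n ({..<a} \<times> {..<b}) (\<lambda>(i, j). x i * y j)"
proof (induction b arbitrary: n)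
  case 0
  then show ?case by (simp add: hsum_empty)
next
  case (Suc b)
  have "{..<a} \<times> {..<Suc b} = ({..<a} \<times> {..<b}) \<union> ({..<a} \<times> {b})" by auto
  then have "hsum n ({..<a} \<times> {..<Suc b}) (\<lambda>(i, j). x i * y j) 
    = (\<Sum>k\<le>n. hsum k ({..<a} \<times> {b}) (\<lambda>(i, j). x i * y j) * HH a b (n - k) x y)"
    using hsum_Un[of "{..<a} \<times> {..<b}" "{..<a} \<times> {b}" n "\<lambda>(i, j). x i * y j"] by (auto simp: Suc)
  also have "\<dots> = HH a (Suc b) n x y" by (simp add: hsum_column)
  finally show ?case by simp
qed

text \<open>A pair of fixed words over \<open>C\<close> and \<open>D\<close> is one fixed word over
  \<open>C \<times> D\<close>. So \<open>burnside\<close> applies to products in two sets of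
  variables.\<close>

lemma wts_mult: 
  assumes g: "g \<in> Sym n" and fin: "finite C" "finite D"
  shows "wts n C g x * wts n D g y = wts n (C \<times> D) g (\<lambda>(i, j). x i * y j)"
proof -
  let ?A = "{v. v \<in> {..<n} \<rightarrow>\<^sub>E C \<and> v \<circ> g = v}" and ?B = "{v. v \<in> {..<n} \<rightarrow>\<^sub>E D \<and> v \<circ> g = v}"
  let ?C = "{v. v \<in> {..<n} \<rightarrow>\<^sub>E C \<times> D \<and> v \<circ> g = v}"
  have "wts n C g x * wts n D g y = (\<Sum>(u, w)\<in>?A \<times> ?B. (\<Prod>i<n. x (u i)) * (\<Prod>i<n. y (w i)))"
    by (simp add: wts_def sum_product sum.cartesian_product)
  also have "\<dots> = (\<Sum>v\<in>?C. \<Prod>i<n. (\<lambda>(i, j). x i * y j) (v i))"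
  proof (rule sum.reindex_bij_witness[where
      i="\<lambda>v. (restrict (fst \<circ> v) {..<n}, restrict (snd \<circ> v) {..<n})" and 
      j="\<lambda>(u, w). restrict (\<lambda>i. (u i, w i)) {..<n}"])
    have ext: "(f \<circ> g = f) \<longleftrightarrow> (\<forall>i<n. f (g i) = f i)" for f :: "nat \<Rightarrow> 'z"
      using Sym_ge[OF g] by (metis comp_apply not_le ext)
    show "(\<lambda>v. (restrict (fst \<circ> v) {..<n}, restrict (snd \<circ> v) {..<n})) ((\<lambda>(u, w). restrict (\<lambda>i. (u i, w i)) {..<n}) p) = p" 
      if "p \<in> ?A \<times> ?B" for p
      using that by (auto simp: PiE_iff extensional_def fun_eq_iff)
    show "(\<lambda>(u, w). restrict (\<lambda>i. (u i, w i)) {..<n}) p \<in> ?C" if "p \<in> ?A \<times> ?B" for p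
      using that Sym_less[OF g] by (auto simp: ext PiE_iff)
    show "(\<lambda>(u, w). restrict (\<lambda>i. (u i, w i)) {..<n}) ((\<lambda>v. (restrict (fst \<circ> v) {..<n}, restrict (snd \<circ> v) {..<n})) v) = v"
      if "v \<in> ?C" for v using that by (auto simp: PiE_iff extensional_def fun_eq_iff)
    show "(\<lambda>v. (restrict (fst \<circ> v) {..<n}, restrict (snd \<circ> v) {..<n})) v \<in> ?A \<times> ?B" if "v \<in> ?C" for v
      using that Sym_less[OF g] by (auto simp: ext PiE_iff mem_Times_iff)
    show "(\<Prod>i<n. (\<lambda>(i, j). x i * y j) ((\<lambda>(u, w). restrict (\<lambda>i. (u i, w i)) {..<n}) p i)) 
      = (case p of (u, w) \<Rightarrow> (\<Prod>i<n. x (u i)) * (\<Prod>i<n. y (w i)))" if "p \<in> ?A \<times> ?B" for p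
      by (cases p) (simp add: prod.distrib)
  qed
  finally show ?thesis by (simp add: wts_def)
qed

abbreviation P :: "nat \<Rightarrow> nat \<Rightarrow> (nat \<Rightarrow> nat) \<Rightarrow> (nat \<Rightarrow> real) \<Rightarrow> real" where
  "P N n g x \<equiv> wts n {..<N} g x"

text \<open>Both sides are \<open>fact n\<close> times the complete function in the products of the
  variables, by \<open>burnside\<close> on the group side and by \<open>cauchy\<close> on the Schur
  side. All orthogonality relations below come from this identity.\<close>

theorem P_cauchy: 
  "(\<Sum>g\<in>Sym n. P N n g x * P N n g y) = fact n * (\<Sum>l\<in>Par n. S N l x * S N l y)"
proof -
  have "(\<Sum>g\<in>Sym n. P N n g x * P N n g y) = (\<Sum>g\<in>Sym n. wts n ({..<N} \<times> {..<N}) g (\<lambda>(i, j). x i * y j))"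
    by (intro sum.cong) (auto simp: wts_mult)
  then show ?thesis by (simp add: burnside cauchy HH_eq_hsum)
qed

section \<open>Characters of the symmetric group\<close>

lemma sum_nonzeroE: 
  assumes "sum f A \<noteq> 0" obtains x where "x \<in> A" "f x \<noteq> 0"
  using assms by (metis sum.neutral)

lemma base_expansion_unique:
  fixes a b :: "nat \<Rightarrow> nat"
  assumes "\<And>k. k < N \<Longrightarrow> a k < B" "\<And>k. k < N \<Longrightarrow> b k < B"
    "(\<Sum>k<N. a k * B ^ k) = (\<Sum>k<N. b k * B ^ k)" "k < N"
  shows "a k = b k"
  using assms
proof (induction N arbitrary: a b k)
  case (Suc N)
  have s: "(\<Sum>k<Suc N. c k * B ^ k) = c 0 + B * (\<Sum>k<N. c (Suc k) * B ^ k)" for c :: "nat \<Rightarrow> nat"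
    by (simp add: sum.lessThan_Suc_shift sum_distrib_left mult_ac del: sum.lessThan_Suc)
  have eq: "a 0 + B * (\<Sum>k<N. a (Suc k) * B ^ k) = b 0 + B * (\<Sum>k<N. b (Suc k) * B ^ k)"
    using Suc.prems(3) unfolding s .
  have lt: "a 0 < B" "b 0 < B" using Suc.prems by auto
  have 0: "a 0 = b 0" using arg_cong[OF eq, of "\<lambda>t. t mod B"] lt by simp
  then have eqs: "(\<Sum>k<N. a (Suc k) * B ^ k) = (\<Sum>k<N. b (Suc k) * B ^ k)" using eq lt by simp
  have "a (Suc j) = b (Suc j)" if "j < N" for j
    by (rule Suc.IH[of "\<lambda>k. a (Suc k)" "\<lambda>k. b (Suc k)"]) (simp_all add: Suc.prems(1,2) eqs that)
  then show ?case using 0 Suc.prems(4) by (cases k) auto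
qed simp

text \<open>Kronecker substitution $x_k = t^{B^k}$ reduces the independence of monomials to polynomials in one variable.\<close>

lemma monomials_independent:
  assumes fin: "finite A" and supp: "\<And>m k. m \<in> A \<Longrightarrow> k \<notin> {..<N} \<Longrightarrow> m k = 0"
    and zero: "\<And>x. (\<Sum>m\<in>A. c m * mon {..<N::nat} m x) = 0" and m: "m \<in> A"
  shows "c m = 0"
proof -
  define B where "B = Suc (\<Sum>m\<in>A. \<Sum>k<N. m k)"
  have B: "m k < B" if "m \<in> A" "k < N" for m k
  proof -
    have "m k \<le> (\<Sum>k<N. m k)" using that by (intro member_le_sum) auto
    also have "\<dots> \<le> (\<Sum>m\<in>A. \<Sum>k<N. m k)" using that fin by (intro member_le_sum) auto
    finally show ?thesis by (simp add: B_def)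
  qed
  define e where "e m = (\<Sum>k<N. m k * B ^ k)" for m :: "nat \<Rightarrow> nat"
  have inj: "m = m'" if "m \<in> A" "m' \<in> A" "e m = e m'" for m m'
  proof
    fix k show "m k = m' k"
    proof (cases "k < N")
      case True
      show ?thesis
        by (rule base_expansion_unique[of N m B m' k]) (use B that True in \<open>simp_all add: e_def\<close>)
    next
      case False
      then show ?thesis using supp[of m k] supp[of m' k] that by simp
    qed
  qed
  define p where "p = (\<Sum>m\<in>A. monom (c m) (e m))"
  have "poly p t = 0" for t
  proof -
    have "mon {..<N} m (\<lambda>k. t ^ (B ^ k)) = t ^ e m" for m
      by (simp add: mon_def e_def power_sum power_mult[symmetric] mult.commute)
    then show ?thesis using zero[of "\<lambda>k. t ^ (B ^ k)"] by (simp add: p_def poly_sum poly_monom)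
  qed
  then have "p = 0" using poly_all_0_iff_0 by blast
  then have "0 = coeff p (e m)" by simp
  also have "\<dots> = (\<Sum>m'\<in>A. if m' = m then c m' else 0)"
    unfolding p_def coeff_sum using inj m by (intro sum.cong) auto
  also have "\<dots> = c m" using fin m by simp
  finally show ?thesis by simp
qed

text \<open>The Kostka numbers, by the recursion of \<open>S\<close> with the exponent of each
  variable prescribed. That they count tableaux is shown in \<open>card_tab\<close>; until then they
  serve as coefficients of Schur polynomials.\<close>

primrec K :: "nat \<Rightarrow> (nat \<Rightarrow> nat) \<Rightarrow> (nat \<Rightarrow> nat) \<Rightarrow> nat" where
  "K 0 l m = (if l = (\<lambda>_. 0) then 1 else 0)"
| "K (Suc a) l m = (\<Sum>r | hs r l \<and> sz r + m a = sz l. K a r m)"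

lemma K_cong: "(\<And>i. i < a \<Longrightarrow> m i = m' i) \<Longrightarrow> K a l m = K a l m'"
  by (induction a arbitrary: l) simp_all

lemma S_eq_K:
  assumes "shape l"
  shows "S a l x = (\<Sum>m\<in>exps {..<a} (sz l). real (K a l m) * mon {..<a} m x)"
  using assms
proof (induction a arbitrary: l)
  case 0
  have "exps ({..<0} :: nat set) k = (if k = 0 then {\<lambda>_. 0} else {})" for k
  proof -
    have "(\<forall>c. m c = 0) \<longleftrightarrow> m = (\<lambda>_. 0)" for m :: "nat \<Rightarrow> nat" by auto
    then show ?thesis unfolding exps_def by auto
  qed
  then show ?case using sz_zero_iff[OF 0] by (auto simp: mon_def)
next
  case (Suc a)
  let ?E = "exps {..<Suc a} (sz l)" and ?R = "{r. hs r l}"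
  have finR: "finite ?R" using Suc.prems by (rule finite_hs_below)
  have "(\<Sum>m\<in>?E. real (K (Suc a) l m) * mon {..<Suc a} m x)
    = (\<Sum>m\<in>?E. \<Sum>r | r \<in> ?R \<and> sz r + m a = sz l. real (K a r m) * mon {..<Suc a} m x)"
    by (simp add: sum_distrib_right)
  also have "\<dots> = (\<Sum>r\<in>?R. \<Sum>m | m \<in> ?E \<and> sz r + m a = sz l. real (K a r m) * mon {..<Suc a} m x)"
    by (rule sum.swap_restrict) (use finR in auto)
  also have "\<dots> = (\<Sum>r\<in>?R. x a ^ (sz l - sz r) * S a r x)"
  proof (rule sum.cong[OF refl])
    fix r assume r: "r \<in> ?R"
    then have sr: "shape r" "sz r \<le> sz l" using Suc.prems hs_shape hs_sz_le by auto
    let ?d = "sz l - sz r"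
    have upd: "(\<Sum>c<a. (m(a := d)) c) = (\<Sum>c<a. m c)" for m :: "nat \<Rightarrow> nat" and d
      by (intro sum.cong) auto
    have "(\<Sum>m | m \<in> ?E \<and> sz r + m a = sz l. real (K a r m) * mon {..<Suc a} m x)
      = (\<Sum>m\<in>exps {..<a} (sz r). x a ^ ?d * (real (K a r m) * mon {..<a} m x))"
    proof (rule sum.reindex_bij_witness[of _ "\<lambda>m. m(a := ?d)" "\<lambda>m. m(a := 0)"])
      fix m assume m: "m \<in> {m \<in> ?E. sz r + m a = sz l}"
      then have "m a = ?d" by auto
      then show "(m(a := 0))(a := ?d) = m" by (metis fun_upd_triv fun_upd_upd)
      show "m(a := 0) \<in> exps {..<a} (sz r)" using m upd[of m 0] by (auto simp: exps_def)
      have "mon {..<Suc a} m x = x a ^ ?d * mon {..<a} (m(a := 0)) x"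
      proof -
        have "(\<Prod>c<a. x c ^ (m(a := 0)) c) = (\<Prod>c<a. x c ^ m c)" by (intro prod.cong) auto
        moreover have "m a = ?d" using m by auto
        ultimately show ?thesis by (simp add: mon_def)
      qed
      moreover have "K a r (m(a := 0)) = K a r m" by (rule K_cong) simp
      ultimately show "x a ^ ?d * (real (K a r (m(a := 0))) * mon {..<a} (m(a := 0)) x) = real (K a r m) * mon {..<Suc a} m x"
        by simp
    next
      fix m assume m: "m \<in> exps {..<a} (sz r)"
      then show "(m(a := ?d))(a := 0) = m" by (auto simp: exps_def)
      show "m(a := ?d) \<in> {m \<in> ?E. sz r + m a = sz l}" using m sr upd[of m ?d] by (auto simp: exps_def)
    qed
    also have "\<dots> = x a ^ ?d * S a r x" using Suc.IH[OF sr(1)] by (simp add: sum_distrib_left)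
    finally show "(\<Sum>m | m \<in> ?E \<and> sz r + m a = sz l. real (K a r m) * mon {..<Suc a} m x) = x a ^ ?d * S a r x" .
  qed
  finally show ?case by simp
qed

definition dom :: "(nat \<Rightarrow> nat) \<Rightarrow> (nat \<Rightarrow> nat) \<Rightarrow> bool" where
  "dom l m \<longleftrightarrow> (\<forall>k. (\<Sum>i<k. m i) \<le> (\<Sum>i<k. l i))"

lemma dom_refl [simp]: "dom l l" by (simp add: dom_def)
lemma dom_trans: "dom l m \<Longrightarrow> dom m r \<Longrightarrow> dom l r" unfolding dom_def by (meson le_trans)

lemma partial_sums_eq: 
  fixes l m :: "nat \<Rightarrow> nat"
  assumes "\<And>k. (\<Sum>i<k. l i) = (\<Sum>i<k. m i)" shows "l = m"
proof
  fix k show "l k = m k" using assms[of "Suc k"] assms[of k] by simp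
qed

lemma dom_antisym: "dom l m \<Longrightarrow> dom m l \<Longrightarrow> l = m"
  by (rule partial_sums_eq) (auto simp: dom_def intro: antisym)

text \<open>Each letter adds a horizontal strip, so after \<open>k\<close> letters at most
  \<open>k\<close> rows are occupied, which gives the inequality for \<open>k\<close>. Later strips
  only enlarge rows.\<close>

lemma K_nonzero:
  assumes "K a l m \<noteq> 0" "shape l"
  shows "(\<forall>i\<ge>a. l i = 0) \<and> sz l = (\<Sum>i<a. m i) \<and> (\<forall>k\<le>a. (\<Sum>i<k. m i) \<le> (\<Sum>i<k. l i))"
  using assms
proof (induction a arbitrary: l)
  case 0
  then show ?case by (auto split: if_splits)
next
  case (Suc a)
  obtain r where r: "hs r l" "sz r + m a = sz l" "K a r m \<noteq> 0"
  proof -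
    have "(\<Sum>r | hs r l \<and> sz r + m a = sz l. K a r m) \<noteq> 0" using Suc.prems(1) by simp
    then show ?thesis using that by (elim sum_nonzeroE) blast
  qed
  have sr: "shape r" using r(1) Suc.prems(2) hs_shape by blast
  note IH = Suc.IH[OF r(3) sr]
  have l0: "l i = 0" if i: "Suc a \<le> i" for i
  proof -
    obtain j where j: "i = Suc j" using Suc_le_D[OF i] by blast
    then have "r j = 0" using IH i by simp
    then show ?thesis using r(1) j by (metis hs_def le_zero_eq)
  qed
  have szl: "sz l = (\<Sum>i<Suc a. m i)" using r(2) IH by simp
  moreover have "(\<Sum>i<k. m i) \<le> (\<Sum>i<k. l i)" if "k \<le> Suc a" for k
  proof (cases "k = Suc a")
    case True
    then show ?thesis using szl sz_eq_sum[of "Suc a" l] l0 by simp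
  next
    case False
    then have "(\<Sum>i<k. m i) \<le> (\<Sum>i<k. r i)" using IH that by simp
    also have "\<dots> \<le> (\<Sum>i<k. l i)" using r(1) by (intro sum_mono) (auto simp: hs_def)
    finally show ?thesis .
  qed
  ultimately show ?case using l0 by simp
qed

lemma K_dom:
  assumes "K N l m \<noteq> 0" "shape l" "\<And>i. N \<le> i \<Longrightarrow> m i = 0" shows "dom l m"
  unfolding dom_def
proof
  fix k
  note * = K_nonzero[OF assms(1,2)]
  show "(\<Sum>i<k. m i) \<le> (\<Sum>i<k. l i)"
  proof (cases "k \<le> N")
    case False
    then have "(\<Sum>i<k. m i) = (\<Sum>i<N. m i)" by (intro sum.mono_neutral_right) (auto simp: assms(3))
    also have "\<dots> \<le> (\<Sum>i<N. l i)" using * by simp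
    also have "\<dots> \<le> (\<Sum>i<k. l i)" using False by (intro sum_mono2) auto
    finally show ?thesis .
  qed (use * in simp)
qed

text \<open>With content \<open>l\<close> the last strip must be the last row: what remains lies in
  the first \<open>a\<close> rows, is contained in \<open>l\<close>, and has the size of those rows
  of \<open>l\<close>.\<close>

lemma K_self:
  assumes "shape l" "\<And>i. a \<le> i \<Longrightarrow> l i = 0" shows "K a l l = 1"
  using assms
proof (induction a arbitrary: l)
  case (Suc a)
  let ?m = "l(a := 0)"
  have sm: "shape ?m"
    by (rule shapeI[of _ a]) (use Suc.prems in \<open>auto simp: shape_Suc\<close>)
  have "(\<Sum>i<a. ?m i) = (\<Sum>i<a. l i)" by (intro sum.cong) auto
  then have szm: "sz ?m = (\<Sum>i<a. l i)" using sz_eq_sum[of a ?m] Suc.prems(2) by (simp add: Suc_le_eq)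
  have szl: "sz l = (\<Sum>i<a. l i) + l a" using sz_eq_sum[of "Suc a" l] Suc.prems(2) by simp
  have hm: "hs ?m l" using Suc.prems by (auto simp: hs_def shape_Suc)
  let ?R = "{r. hs r l \<and> sz r + l a = sz l}"
  have fin: "finite ?R" by (rule finite_subset[OF _ finite_hs_below[OF Suc.prems(1)]]) auto
  have zero: "K a r l = 0" if r: "r \<in> ?R - {?m}" for r
  proof (rule ccontr)
    assume "K a r l \<noteq> 0"
    moreover have "shape r" using r Suc.prems(1) hs_shape by auto
    ultimately have *: "\<forall>i\<ge>a. r i = 0" "sz r = (\<Sum>i<a. l i)" using K_nonzero by auto
    then have "(\<Sum>i<a. r i) = (\<Sum>i<a. l i)" using sz_eq_sum[of a r] by simp
    then have "r i = l i" if "i < a" for i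
      using sum_mono_inv[of r "{..<a}" l i] r that by (auto simp: hs_def)
    then have "r = ?m" using *(1) Suc.prems(2) by (auto simp: fun_eq_iff) (metis Suc_leI le_neq_implies_less not_le)
    then show False using r by simp
  qed
  have "K (Suc a) l l = K a ?m l + (\<Sum>r\<in>?R - {?m}. K a r l)"
    using sum.remove[OF fin, of ?m "\<lambda>r. K a r l"] hm szm szl by simp
  also have "(\<Sum>r\<in>?R - {?m}. K a r l) = 0" using zero by (intro sum.neutral) blast
  also have "K a ?m l = K a ?m ?m" by (rule K_cong) simp
  also have "\<dots> = 1" by (rule Suc.IH[OF sm]) (use Suc.prems(2) in \<open>auto simp: Suc_le_eq\<close>)
  finally show ?case by simp
qed auto

lemma Par_exps: "l \<in> Par n \<Longrightarrow> n \<le> N \<Longrightarrow> l \<in> exps {..<N} n"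
  by (auto simp: Par_def exps_def sz_eq[symmetric] intro: shape_vanish)

text \<open>By \<open>K_self\<close> and \<open>K_dom\<close> the Kostka matrix is unitriangular for
  dominance. A row of the inverse is found by back substitution from the rows of the shapes strictly
  above \<open>v\<close>, with induction on their number. That the entries are integers matters in
  \<open>schur_positiveI\<close>.\<close>

lemma inverse_kostka:
  assumes "n \<le> N" "v \<in> Par n"
  shows "\<exists>c :: (nat \<Rightarrow> nat) \<Rightarrow> int. c v = 1 \<and> (\<forall>b. c b \<noteq> 0 \<longrightarrow> b \<in> Par n \<and> dom b v) \<and>
     (\<forall>l\<in>Par n. (\<Sum>b\<in>Par n. c b * int (K N l b)) = (if l = v then 1 else 0))"
  using assms(2)
proof (induction "card {l \<in> Par n. dom l v \<and> l \<noteq> v}" arbitrary: v rule: less_induct)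
  case less
  let ?R = "{l \<in> Par n. dom l v \<and> l \<noteq> v}"
  have "\<exists>c :: (nat \<Rightarrow> nat) \<Rightarrow> int. c r = 1 \<and> (\<forall>b. c b \<noteq> 0 \<longrightarrow> b \<in> Par n \<and> dom b r) \<and>
     (\<forall>l\<in>Par n. (\<Sum>b\<in>Par n. c b * int (K N l b)) = (if l = r then 1 else 0))" if r: "r \<in> ?R" for r
  proof (rule less.hyps)
    show "card {l \<in> Par n. dom l r \<and> l \<noteq> r} < card ?R"
      by (rule psubset_card_mono) (use r dom_trans dom_antisym in auto)
  qed (use r in auto)
  then have "\<forall>r\<in>?R. \<exists>c :: (nat \<Rightarrow> nat) \<Rightarrow> int. c r = 1 \<and> (\<forall>b. c b \<noteq> 0 \<longrightarrow> b \<in> Par n \<and> dom b r) \<and>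
     (\<forall>l\<in>Par n. (\<Sum>b\<in>Par n. c b * int (K N l b)) = (if l = r then 1 else 0))" by blast
  from bchoice[OF this] obtain C where
    C0: "\<forall>r\<in>?R. C r r = 1 \<and> (\<forall>b. C r b \<noteq> 0 \<longrightarrow> b \<in> Par n \<and> dom b r) \<and>
     (\<forall>l\<in>Par n. (\<Sum>b\<in>Par n. C r b * int (K N l b)) = (if l = r then 1 else 0))" ..
  then have
    C: "\<And>r. r \<in> ?R \<Longrightarrow> \<forall>b. C r b \<noteq> 0 \<longrightarrow> b \<in> Par n \<and> dom b r"
       "\<And>r l. r \<in> ?R \<Longrightarrow> l \<in> Par n \<Longrightarrow> (\<Sum>b\<in>Par n. C r b * int (K N l b)) = (if l = r then 1 else 0)"
    by blast+
  define c where "c b = (if b = v then 1 else 0) - (\<Sum>r\<in>?R. int (K N r v) * C r b)" for b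
  have Kvv: "K N v v = 1" using less.prems assms(1) by (intro K_self) (auto simp: Par_def intro: shape_vanish)
  have "(\<Sum>r\<in>?R. int (K N r v) * C r v) = 0"
  proof (rule sum.neutral, rule ballI)
    fix r assume r: "r \<in> ?R"
    have "C r v = 0" using C(1)[OF r] r dom_antisym by blast
    then show "int (K N r v) * C r v = 0" by simp
  qed
  then have 1: "c v = 1" by (simp add: c_def)
  have 2: "b \<in> Par n \<and> dom b v" if "c b \<noteq> 0" for b
  proof (cases "b = v")
    case False
    then have "(\<Sum>r\<in>?R. int (K N r v) * C r b) \<noteq> 0" using that by (simp add: c_def)
    then obtain r where "r \<in> ?R" "C r b \<noteq> 0" by (auto elim: sum_nonzeroE)
    then show ?thesis using C(1)[of r] dom_trans by blast
  qed (use less.prems in simp)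
  have 3: "(\<Sum>b\<in>Par n. c b * int (K N l b)) = (if l = v then 1 else 0)" if l: "l \<in> Par n" for l
  proof -
    have "(\<Sum>b\<in>Par n. c b * int (K N l b)) = (\<Sum>b\<in>Par n. (if b = v then int (K N l b) else 0)) - 
       (\<Sum>b\<in>Par n. \<Sum>r\<in>?R. int (K N r v) * C r b * int (K N l b))"
      unfolding sum_subtractf[symmetric]
      by (intro sum.cong) (auto simp: c_def left_diff_distrib sum_distrib_right)
    also have "(\<Sum>b\<in>Par n. \<Sum>r\<in>?R. int (K N r v) * C r b * int (K N l b)) = 
       (\<Sum>r\<in>?R. int (K N r v) * (\<Sum>b\<in>Par n. C r b * int (K N l b)))"
      by (subst sum.swap) (simp add: sum_distrib_left mult_ac)
    also have "\<dots> = (\<Sum>r\<in>?R. if l = r then int (K N r v) else 0)"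
      using C(2) l by (intro sum.cong) auto
    also have "\<dots> = (if l \<in> ?R then int (K N l v) else 0)" by simp
    also have "(\<Sum>b\<in>Par n. (if b = v then int (K N l b) else 0)) = int (K N l v)"
      using less.prems by simp
    finally have eq: "(\<Sum>b\<in>Par n. c b * int (K N l b)) = int (K N l v) - (if l \<in> ?R then int (K N l v) else 0)" .
    show ?thesis
    proof (cases "l = v")
      case False
      have "K N l v = 0" if "l \<notin> ?R"
      proof (rule ccontr)
        assume "K N l v \<noteq> 0"
        then have "dom l v"
          by (rule K_dom) (use l less.prems assms(1) in \<open>auto simp: Par_def intro: shape_vanish\<close>)
        then show False using that l False by simp
      qed
      then show ?thesis using eq False by auto
    qed (use eq Kvv in simp)
  qed
  show ?case using 1 2 3 by blast
qed

definition invK :: "nat \<Rightarrow> nat \<Rightarrow> (nat \<Rightarrow> nat) \<Rightarrow> (nat \<Rightarrow> nat) \<Rightarrow> int" where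
  "invK N n v = (SOME c. c v = 1 \<and> (\<forall>b. c b \<noteq> 0 \<longrightarrow> b \<in> Par n \<and> dom b v) \<and>
     (\<forall>l\<in>Par n. (\<Sum>b\<in>Par n. c b * int (K N l b)) = (if l = v then 1 else 0)))"

lemma invK:
  assumes "n \<le> N" "v \<in> Par n"
  shows "invK N n v v = 1" "\<And>b. invK N n v b \<noteq> 0 \<Longrightarrow> b \<in> Par n \<and> dom b v"
    "\<And>l. l \<in> Par n \<Longrightarrow> (\<Sum>b\<in>Par n. real_of_int (invK N n v b) * real (K N l b)) = (if l = v then 1 else 0)"
proof -
  note * = someI_ex[OF inverse_kostka[OF assms], folded invK_def]
  show "invK N n v v = 1" "\<And>b. invK N n v b \<noteq> 0 \<Longrightarrow> b \<in> Par n \<and> dom b v" using * by auto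
  fix l assume "l \<in> Par n"
  then have "(\<Sum>b\<in>Par n. invK N n v b * int (K N l b)) = (if l = v then 1 else 0)" using * by blast
  from arg_cong[OF this, of real_of_int]
  show "(\<Sum>b\<in>Par n. real_of_int (invK N n v b) * real (K N l b)) = (if l = v then 1 else 0)" by simp
qed

text \<open>Used in two readings: as the coefficient of the monomial \<open>m\<close> in
  \<open>P N n g\<close>, and as the permutation character on the words of content
  \<open>m\<close>.\<close>

definition pc :: "nat \<Rightarrow> nat \<Rightarrow> (nat \<Rightarrow> nat) \<Rightarrow> (nat \<Rightarrow> nat) \<Rightarrow> real" where
  "pc N n m g = real (card {v. v \<in> {..<n} \<rightarrow>\<^sub>E {..<N} \<and> v \<circ> g = v \<and> content n v = m})"

definition ip :: "nat \<Rightarrow> ((nat \<Rightarrow> nat) \<Rightarrow> real) \<Rightarrow> ((nat \<Rightarrow> nat) \<Rightarrow> real) \<Rightarrow> real" where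
  "ip n f h = (\<Sum>g\<in>Sym n. f g * h g) / fact n"

text \<open>The class functions that expand power sums in Schur functions; no representations are constructed.\<close>

definition chi :: "nat \<Rightarrow> nat \<Rightarrow> (nat \<Rightarrow> nat) \<Rightarrow> (nat \<Rightarrow> nat) \<Rightarrow> real" where
  "chi N n v g = (\<Sum>b\<in>Par n. real_of_int (invK N n v b) * pc N n b g)"

lemma P_eq_pc: "P N n g x = (\<Sum>m\<in>exps {..<N} n. pc N n m g * mon {..<N} m x)"
proof -
  let ?A = "{v. v \<in> {..<n} \<rightarrow>\<^sub>E {..<N} \<and> v \<circ> g = v}"
  have finA: "finite ?A" by (rule finite_subset[of _ "{..<n} \<rightarrow>\<^sub>E {..<N}"]) auto
  have "P N n g x = (\<Sum>v\<in>?A. mon {..<N} (content n v) x)"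
    unfolding wts_def by (intro sum.cong) (auto simp: prod_word)
  also have "\<dots> = (\<Sum>m\<in>exps {..<N} n. \<Sum>v | v \<in> ?A \<and> content n v = m. mon {..<N} (content n v) x)"
    by (rule sum.group[symmetric]) (use finA content_exps[of "{..<N}"] in auto)
  also have "\<dots> = (\<Sum>m\<in>exps {..<N} n. pc N n m g * mon {..<N} m x)"
    by (intro sum.cong) (auto simp: pc_def conj_assoc)
  finally show ?thesis .
qed

lemma ip_commute: "ip n f h = ip n h f" by (simp add: ip_def mult.commute)
lemma ip_sum: "ip n (\<lambda>g. \<Sum>i\<in>I. c i * f i g) h = (\<Sum>i\<in>I. c i * ip n (f i) h)"
  unfolding ip_def sum_divide_distrib sum_distrib_right
  by (subst sum.swap) (simp add: sum_distrib_left sum_divide_distrib mult_ac)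
lemma ip_diff: "ip n (\<lambda>g. f g - f' g) h = ip n f h - ip n f' h"
  by (simp add: ip_def left_diff_distrib sum_subtractf diff_divide_distrib)
lemma ip_scale: "ip n (\<lambda>g. c * f g) h = c * ip n f h"
  by (simp add: ip_def sum_distrib_left mult_ac)

lemma ip_definite: assumes "ip n f f = 0" "g \<in> Sym n" shows "f g = 0"
proof -
  have "(\<Sum>g\<in>Sym n. f g * f g) = 0" using assms(1) by (simp add: ip_def)
  then show ?thesis using assms(2) by (subst (asm) sum_nonneg_eq_0_iff) auto
qed

text \<open>Comparison of coefficients in \<open>P_cauchy\<close>. Independence of monomials is
  applied twice, first in \<open>x\<close> with coefficients depending on \<open>y\<close>, then in
  \<open>y\<close>.\<close>

lemma ip_pc:
  assumes "l \<in> exps {..<N} n" "m \<in> exps {..<N} n"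
  shows "ip n (pc N n l) (pc N n m) = (\<Sum>r\<in>Par n. real (K N r l) * real (K N r m))"
proof -
  let ?E = "exps {..<N} n"
  define D where "D l m = (\<Sum>g\<in>Sym n. pc N n l g * pc N n m g) - fact n * (\<Sum>r\<in>Par n. real (K N r l) * real (K N r m))" for l m
  have supp: "\<And>m k. m \<in> ?E \<Longrightarrow> k \<notin> {..<N} \<Longrightarrow> m k = 0" by (simp add: exps_def)
  have fin: "finite ?E" by simp
  have S: "S N r x = (\<Sum>m\<in>?E. real (K N r m) * mon {..<N} m x)" if "r \<in> Par n" for r x
    using S_eq_K[of r N x] that by (simp add: Par_def)
  have zero: "(\<Sum>l\<in>?E. (\<Sum>m\<in>?E. D l m * mon {..<N} m y) * mon {..<N} l x) = 0" for x y
  proof -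
    have "(\<Sum>g\<in>Sym n. P N n g x * P N n g y) = 
        (\<Sum>g\<in>Sym n. \<Sum>l\<in>?E. \<Sum>m\<in>?E. pc N n l g * pc N n m g * mon {..<N} m y * mon {..<N} l x)"
      by (intro sum.cong refl) (simp add: P_eq_pc sum_product mult_ac)
    also have "\<dots> = (\<Sum>l\<in>?E. \<Sum>g\<in>Sym n. \<Sum>m\<in>?E. pc N n l g * pc N n m g * mon {..<N} m y * mon {..<N} l x)"
      by (rule sum.swap)
    also have "\<dots> = (\<Sum>l\<in>?E. \<Sum>m\<in>?E. \<Sum>g\<in>Sym n. pc N n l g * pc N n m g * mon {..<N} m y * mon {..<N} l x)"
      by (rule sum.cong[OF refl], rule sum.swap)
    finally have 1: "(\<Sum>g\<in>Sym n. P N n g x * P N n g y) = 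
        (\<Sum>l\<in>?E. \<Sum>m\<in>?E. (\<Sum>g\<in>Sym n. pc N n l g * pc N n m g) * mon {..<N} m y * mon {..<N} l x)"
      by (simp add: sum_distrib_right)
    have "(\<Sum>r\<in>Par n. S N r x * S N r y) = 
        (\<Sum>r\<in>Par n. \<Sum>l\<in>?E. \<Sum>m\<in>?E. real (K N r l) * real (K N r m) * mon {..<N} m y * mon {..<N} l x)"
      by (intro sum.cong refl) (simp add: S sum_product mult_ac)
    also have "\<dots> = (\<Sum>l\<in>?E. \<Sum>r\<in>Par n. \<Sum>m\<in>?E. real (K N r l) * real (K N r m) * mon {..<N} m y * mon {..<N} l x)"
      by (rule sum.swap)
    also have "\<dots> = (\<Sum>l\<in>?E. \<Sum>m\<in>?E. \<Sum>r\<in>Par n. real (K N r l) * real (K N r m) * mon {..<N} m y * mon {..<N} l x)"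
      by (rule sum.cong[OF refl], rule sum.swap)
    finally have 2: "(\<Sum>r\<in>Par n. S N r x * S N r y) =
        (\<Sum>l\<in>?E. \<Sum>m\<in>?E. (\<Sum>r\<in>Par n. real (K N r l) * real (K N r m)) * mon {..<N} m y * mon {..<N} l x)"
      by (simp add: sum_distrib_right)
    have "(\<Sum>l\<in>?E. (\<Sum>m\<in>?E. D l m * mon {..<N} m y) * mon {..<N} l x) = 
      (\<Sum>l\<in>?E. \<Sum>m\<in>?E. D l m * mon {..<N} m y * mon {..<N} l x)"
      by (simp only: sum_distrib_right)
    also have "\<dots> = (\<Sum>l\<in>?E. \<Sum>m\<in>?E. (\<Sum>g\<in>Sym n. pc N n l g * pc N n m g) * mon {..<N} m y * mon {..<N} l x
        - fact n * ((\<Sum>r\<in>Par n. real (K N r l) * real (K N r m)) * mon {..<N} m y * mon {..<N} l x))"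
      by (simp only: D_def left_diff_distrib mult.assoc)
    also have "\<dots> = (\<Sum>g\<in>Sym n. P N n g x * P N n g y) - fact n * (\<Sum>r\<in>Par n. S N r x * S N r y)"
      unfolding 1 2 by (simp only: sum_subtractf sum_distrib_left)
    finally have "(\<Sum>l\<in>?E. (\<Sum>m\<in>?E. D l m * mon {..<N} m y) * mon {..<N} l x) = 
      (\<Sum>g\<in>Sym n. P N n g x * P N n g y) - fact n * (\<Sum>r\<in>Par n. S N r x * S N r y)" .
    then show ?thesis by (simp add: P_cauchy)
  qed
  have "(\<Sum>m\<in>?E. D l m * mon {..<N} m y) = 0" for y
    by (rule monomials_independent[where c="\<lambda>l. \<Sum>m\<in>?E. D l m * mon {..<N} m y" and A="?E" and N=N])
      (use fin supp zero assms(1) in auto)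
  then have "D l m = 0"
    by (intro monomials_independent[where c="\<lambda>m. D l m" and A="?E" and N=N]) (use fin supp assms(2) in auto)
  then show ?thesis by (simp add: D_def ip_def)
qed

lemma ip_chi_pc:
  assumes "n \<le> N" "v \<in> Par n" "m \<in> exps {..<N} n"
  shows "ip n (chi N n v) (pc N n m) = real (K N v m)"
proof -
  have "ip n (chi N n v) (pc N n m) = (\<Sum>b\<in>Par n. real_of_int (invK N n v b) * ip n (pc N n b) (pc N n m))"
    unfolding chi_def by (rule ip_sum)
  also have "\<dots> = (\<Sum>b\<in>Par n. \<Sum>r\<in>Par n. real (K N r m) * (real_of_int (invK N n v b) * real (K N r b)))"
    using assms by (intro sum.cong) (auto simp: ip_pc Par_exps sum_distrib_left mult_ac)
  also have "\<dots> = (\<Sum>r\<in>Par n. real (K N r m) * (\<Sum>b\<in>Par n. real_of_int (invK N n v b) * real (K N r b)))"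
    by (subst sum.swap) (simp add: sum_distrib_left)
  also have "\<dots> = (\<Sum>r\<in>Par n. if r = v then real (K N r m) else 0)"
    using invK(3)[OF assms(1,2)] by (intro sum.cong) auto
  also have "\<dots> = real (K N v m)" using assms(2) by simp
  finally show ?thesis .
qed

lemma ip_chi:
  assumes "n \<le> N" "v \<in> Par n" "l \<in> Par n"
  shows "ip n (chi N n v) (chi N n l) = (if v = l then 1 else 0)"
proof -
  have "ip n (chi N n v) (chi N n l) = (\<Sum>b\<in>Par n. real_of_int (invK N n l b) * ip n (pc N n b) (chi N n v))"
    unfolding ip_commute[of n "chi N n v"] chi_def[of N n l] by (rule ip_sum)
  also have "\<dots> = (\<Sum>b\<in>Par n. real_of_int (invK N n l b) * real (K N v b))"
    using assms by (intro sum.cong) (auto simp: ip_commute[of n "pc N n _"] ip_chi_pc Par_exps)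
  finally show ?thesis using invK(3)[OF assms(1,3,2)] by simp
qed

text \<open>Young's rule. The difference of the two sides is orthogonal to every \<open>chi\<close>,
  and also to \<open>pc N n m\<close>, since both terms give the sum of the squares of the Kostka
  numbers. So it is orthogonal to itself.\<close>

theorem pc_eq_chi:
  assumes "n \<le> N" "m \<in> exps {..<N} n" "g \<in> Sym n"
  shows "pc N n m g = (\<Sum>l\<in>Par n. real (K N l m) * chi N n l g)"
proof -
  define D where "D g = pc N n m g - (\<Sum>l\<in>Par n. real (K N l m) * chi N n l g)" for g
  have 1: "ip n D (chi N n v) = 0" if "v \<in> Par n" for v
  proof -
    have "ip n D (chi N n v) = ip n (chi N n v) (pc N n m) - (\<Sum>l\<in>Par n. real (K N l m) * ip n (chi N n l) (chi N n v))"
      unfolding D_def by (simp add: ip_diff ip_sum ip_commute[of n "pc N n m"])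
    also have "(\<Sum>l\<in>Par n. real (K N l m) * ip n (chi N n l) (chi N n v)) = (\<Sum>l\<in>Par n. if l = v then real (K N l m) else 0)"
      using assms that by (intro sum.cong) (auto simp: ip_chi)
    finally show ?thesis using assms that by (simp add: ip_chi_pc)
  qed
  have 2: "ip n D (pc N n m) = 0"
    unfolding D_def using assms by (simp add: ip_diff ip_sum ip_pc ip_chi_pc)
  have "ip n D h = ip n (pc N n m) h - (\<Sum>l\<in>Par n. real (K N l m) * ip n (chi N n l) h)" for h
    unfolding D_def by (simp add: ip_diff ip_sum)
  then have "ip n D D = ip n (pc N n m) D - (\<Sum>l\<in>Par n. real (K N l m) * ip n (chi N n l) D)" .
  also have "\<dots> = 0" using 1 2 by (simp add: ip_commute[of n _ D])
  finally have "D g = 0" using assms(3) by (rule ip_definite)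
  then show ?thesis by (simp add: D_def)
qed

text \<open>Frobenius's formula: \<open>pc_eq_chi\<close> holds for each monomial, and collecting
  the monomials gives the Schur polynomials.\<close>

theorem P_eq_chi:
  assumes "n \<le> N" "g \<in> Sym n"
  shows "P N n g x = (\<Sum>l\<in>Par n. chi N n l g * S N l x)"
proof -
  have "P N n g x = (\<Sum>m\<in>exps {..<N} n. \<Sum>l\<in>Par n. chi N n l g * (real (K N l m) * mon {..<N} m x))"
    unfolding P_eq_pc
  proof (rule sum.cong[OF refl])
    fix m assume m: "m \<in> exps {..<N} n"
    show "pc N n m g * mon {..<N} m x = (\<Sum>l\<in>Par n. chi N n l g * (real (K N l m) * mon {..<N} m x))"
      unfolding pc_eq_chi[OF assms(1) m assms(2)] sum_distrib_right by (simp add: mult_ac)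
  qed
  also have "\<dots> = (\<Sum>l\<in>Par n. chi N n l g * (\<Sum>m\<in>exps {..<N} n. real (K N l m) * mon {..<N} m x))"
    by (subst sum.swap) (simp add: sum_distrib_left)
  also have "\<dots> = (\<Sum>l\<in>Par n. chi N n l g * S N l x)"
    by (intro sum.cong) (auto simp: S_eq_K Par_def)
  finally show ?thesis .
qed

lemma schur_eq_chi:
  assumes "n \<le> N" "v \<in> Par n"
  shows "fact n * S N v x = (\<Sum>g\<in>Sym n. chi N n v g * P N n g x)"
proof -
  have "(\<Sum>g\<in>Sym n. chi N n v g * P N n g x) = (\<Sum>g\<in>Sym n. \<Sum>l\<in>Par n. S N l x * (chi N n v g * chi N n l g))"
    using assms by (intro sum.cong) (auto simp: P_eq_chi sum_distrib_left mult_ac)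
  also have "\<dots> = (\<Sum>l\<in>Par n. S N l x * (fact n * ip n (chi N n v) (chi N n l)))"
  proof -
    have "fact n * ip n (chi N n v) (chi N n l) = (\<Sum>g\<in>Sym n. chi N n v g * chi N n l g)" for l
      by (simp add: ip_def)
    then show ?thesis by (subst sum.swap) (simp only: sum_distrib_left)
  qed
  also have "\<dots> = (\<Sum>l\<in>Par n. if l = v then fact n * S N l x else 0)"
    using assms by (intro sum.cong) (auto simp: ip_chi)
  finally show ?thesis using assms by simp
qed

lemma pc_inv: assumes "g \<in> Sym n" shows "pc N n m (inv g) = pc N n m g"
proof -
  have "v \<circ> inv g = v \<longleftrightarrow> v \<circ> g = v" for v :: "nat \<Rightarrow> nat"
    using assms by (metis Sym_cancel(3,4))
  then show ?thesis by (simp add: pc_def)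
qed

lemma pc_conj: assumes "g \<in> Sym n" "h \<in> Sym n" shows "pc N n m (h \<circ> g \<circ> inv h) = pc N n m g"
proof -
  have "bij_betw (\<lambda>v. v \<circ> h) {v. v \<in> {..<n} \<rightarrow>\<^sub>E {..<N} \<and> v \<circ> (h \<circ> g \<circ> inv h) = v \<and> content n v = m}
     {v. v \<in> {..<n} \<rightarrow>\<^sub>E {..<N} \<and> v \<circ> g = v \<and> content n v = m}"
  proof (rule bij_betw_byWitness[where f'="\<lambda>v. v \<circ> inv h"])
    have "v \<circ> h \<circ> g = v \<circ> h" if "v \<circ> (h \<circ> g \<circ> inv h) = v" for v :: "nat \<Rightarrow> nat"
    proof -
      have "v \<circ> h \<circ> g = (v \<circ> (h \<circ> g \<circ> inv h)) \<circ> h" by (simp add: comp_assoc Sym_inv_o(2)[OF assms(2)])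
      then show ?thesis by (simp only: that)
    qed
    then show "(\<lambda>v. v \<circ> h) ` {v. v \<in> {..<n} \<rightarrow>\<^sub>E {..<N} \<and> v \<circ> (h \<circ> g \<circ> inv h) = v \<and> content n v = m}
      \<subseteq> {v. v \<in> {..<n} \<rightarrow>\<^sub>E {..<N} \<and> v \<circ> g = v \<and> content n v = m}"
      by (simp add: image_subset_iff word_comp[OF _ assms(2)] content_comp[OF assms(2)])
    have "v \<circ> inv h \<circ> (h \<circ> g \<circ> inv h) = v \<circ> inv h" if "v \<circ> g = v" for v :: "nat \<Rightarrow> nat"
    proof -
      have "v \<circ> inv h \<circ> (h \<circ> g \<circ> inv h) = (v \<circ> g) \<circ> inv h" by (simp add: comp_assoc Sym_cancel(2)[OF assms(2)])
      then show ?thesis by (simp only: that)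
    qed
    then show "(\<lambda>v. v \<circ> inv h) ` {v. v \<in> {..<n} \<rightarrow>\<^sub>E {..<N} \<and> v \<circ> g = v \<and> content n v = m}
      \<subseteq> {v. v \<in> {..<n} \<rightarrow>\<^sub>E {..<N} \<and> v \<circ> (h \<circ> g \<circ> inv h) = v \<and> content n v = m}"
      by (simp add: image_subset_iff word_comp[OF _ Sym_inv[OF assms(2)]] content_comp[OF Sym_inv[OF assms(2)]])
  qed (use assms in \<open>auto simp: Sym_cancel\<close>)
  then show ?thesis by (simp add: pc_def bij_betw_same_card)
qed

lemma chi_inv: "g \<in> Sym n \<Longrightarrow> chi N n v (inv g) = chi N n v g"
  by (simp add: chi_def pc_inv)

lemma chi_conj: "g \<in> Sym n \<Longrightarrow> h \<in> Sym n \<Longrightarrow> chi N n v (h \<circ> g \<circ> inv h) = chi N n v g"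
  by (simp add: chi_def pc_conj)

text \<open>All monomial coefficients vanish, and the row of \<open>v\<close> of the inverse Kostka
  matrix extracts \<open>b v\<close> from them.\<close>

lemma schur_independent:
  assumes "n \<le> N" "\<And>x. (\<Sum>l\<in>Par n. b l * S N l x) = 0" "v \<in> Par n"
  shows "b v = 0"
proof -
  have *: "(\<Sum>l\<in>Par n. b l * real (K N l m)) = 0" if m: "m \<in> exps {..<N} n" for m
  proof (rule monomials_independent[of "exps {..<N} n" N "\<lambda>m. \<Sum>l\<in>Par n. b l * real (K N l m)"])
    fix x
    have "(\<Sum>l\<in>Par n. b l * S N l x) = (\<Sum>l\<in>Par n. \<Sum>m\<in>exps {..<N} n. b l * real (K N l m) * mon {..<N} m x)"
      by (intro sum.cong) (auto simp: S_eq_K Par_def sum_distrib_left mult_ac)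
    also have "\<dots> = (\<Sum>m\<in>exps {..<N} n. (\<Sum>l\<in>Par n. b l * real (K N l m)) * mon {..<N} m x)"
      by (subst sum.swap) (simp add: sum_distrib_right)
    finally show "(\<Sum>m\<in>exps {..<N} n. (\<Sum>l\<in>Par n. b l * real (K N l m)) * mon {..<N} m x) = 0"
      using assms(2) by simp
  qed (simp, simp add: exps_def, rule m)
  have "0 = (\<Sum>m\<in>Par n. real_of_int (invK N n v m) * (\<Sum>l\<in>Par n. b l * real (K N l m)))"
    using * assms by (simp add: Par_exps)
  also have "\<dots> = (\<Sum>l\<in>Par n. b l * (\<Sum>m\<in>Par n. real_of_int (invK N n v m) * real (K N l m)))"
    unfolding sum_distrib_left by (subst sum.swap) (simp add: mult_ac)
  also have "\<dots> = (\<Sum>l\<in>Par n. if l = v then b l else 0)"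
    using invK(3)[OF assms(1,3)] by (intro sum.cong) auto
  also have "\<dots> = b v" using assms by simp
  finally show ?thesis by simp
qed

section \<open>Cycle types\<close>

definition glue :: "nat \<Rightarrow> (nat \<Rightarrow> nat) \<Rightarrow> (nat \<Rightarrow> nat) \<Rightarrow> nat \<Rightarrow> nat" where
  "glue k g h = (\<lambda>j. if j < k then g j else k + h (j - k))"

definition rot :: "nat \<Rightarrow> nat \<Rightarrow> nat" where
  "rot i = (\<lambda>j. if j < i then (if Suc j = i then 0 else Suc j) else j)"

text \<open>One representative for each cycle type, with cycles on consecutive blocks. The recursion
  through \<open>glue\<close> makes power sums, periods and centralizers accessible to induction on
  the list.\<close>

primrec sig :: "nat list \<Rightarrow> nat \<Rightarrow> nat" where
  "sig [] = id"
| "sig (i # is) = glue i (rot i) (sig is)"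

definition pw :: "nat \<Rightarrow> nat \<Rightarrow> (nat \<Rightarrow> real) \<Rightarrow> real" where
  "pw N k x = (\<Sum>j<N. x j ^ k)"

definition pm :: "nat \<Rightarrow> nat list \<Rightarrow> (nat \<Rightarrow> real) \<Rightarrow> real" where
  "pm N m x = (\<Prod>k\<leftarrow>m. pw N k x)"

lemma SymI: "(\<And>i. i < n \<Longrightarrow> g i < n) \<Longrightarrow> (\<And>i. i < n \<Longrightarrow> h i < n) \<Longrightarrow> (\<And>i. i < n \<Longrightarrow> h (g i) = i) \<Longrightarrow>
   (\<And>i. i < n \<Longrightarrow> g (h i) = i) \<Longrightarrow> (\<And>i. n \<le> i \<Longrightarrow> g i = i) \<Longrightarrow> g \<in> Sym n"
  unfolding Sym_def mem_Collect_eq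
  by (rule bij_imp_permutes, rule bij_betw_byWitness[where f'=h]) auto

lemma glue_comp: "g' \<in> Sym k \<Longrightarrow> glue k g h \<circ> glue k g' h' = glue k (g \<circ> g') (h \<circ> h')"
  by (auto simp: glue_def fun_eq_iff Sym_less)

lemma glue_id: "glue k id id = id" by (auto simp: glue_def fun_eq_iff)

lemma glue_Sym: assumes "g \<in> Sym k" "h \<in> Sym l" shows "glue k g h \<in> Sym (k + l)"
proof (rule SymI[where h="glue k (inv g) (inv h)"])
  have l: "glue k g h i < k + l" if "g \<in> Sym k" "h \<in> Sym l" "i < k + l" for g h i
    using that Sym_less[of g k i] Sym_less[of h l "i - k"] by (auto simp: glue_def)
  show "\<And>i. i < k + l \<Longrightarrow> glue k g h i < k + l" "\<And>i. i < k + l \<Longrightarrow> glue k (inv g) (inv h) i < k + l"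
    using l assms Sym_inv by auto
  have "glue k (inv g) (inv h) \<circ> glue k g h = id" "glue k g h \<circ> glue k (inv g) (inv h) = id"
    using assms by (simp_all add: glue_comp Sym_inv Sym_inv_o glue_id)
  then show "\<And>i. glue k (inv g) (inv h) (glue k g h i) = i" "\<And>i. glue k g h (glue k (inv g) (inv h) i) = i"
    by (simp_all add: pointfree_idE)
  show "\<And>i. k + l \<le> i \<Longrightarrow> glue k g h i = i" using Sym_ge[OF assms(2)] by (auto simp: glue_def)
qed

lemma glue_inv: assumes "g \<in> Sym k" "h \<in> Sym l" shows "inv (glue k g h) = glue k (inv g) (inv h)"
proof (rule inv_unique_comp)
  show "glue k g h \<circ> glue k (inv g) (inv h) = id" "glue k (inv g) (inv h) \<circ> glue k g h = id"
    using assms by (simp_all add: glue_comp Sym_inv Sym_inv_o glue_id)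
qed

lemma glue_inject: assumes "g \<in> Sym k" "g' \<in> Sym k"  
  shows "glue k g h = glue k g' h' \<longleftrightarrow> g = g' \<and> h = h'"
proof
  assume eq: "glue k g h = glue k g' h'"
  have "g j = g' j" for j
    using fun_cong[OF eq, of j] Sym_ge[OF assms(1), of j] Sym_ge[OF assms(2), of j] by (cases "j < k") (auto simp: glue_def)
  moreover have "h j = h' j" for j using fun_cong[OF eq, of "k + j"] by (simp add: glue_def)
  ultimately show "g = g' \<and> h = h'" by blast
qed simp

lemma Sym_fixes_word: "g \<in> Sym n \<Longrightarrow> v \<circ> g = v \<longleftrightarrow> (\<forall>i<n. v (g i) = v i)"
  using Sym_ge[of g n] by (metis comp_apply not_le ext)

text \<open>A word fixed by \<open>glue k g h\<close> is cut into its first \<open>k\<close> and its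
  last \<open>l\<close> letters, each fixed by its own permutation.\<close>

lemma wts_glue: 
  assumes g: "g \<in> Sym k" and h: "h \<in> Sym l"
  shows "wts (k + l) C (glue k g h) x = wts k C g x * wts l C h x"
proof -
  let ?A = "{v. v \<in> {..<k} \<rightarrow>\<^sub>E C \<and> v \<circ> g = v}" and ?B = "{v. v \<in> {..<l} \<rightarrow>\<^sub>E C \<and> v \<circ> h = v}"
  let ?C = "{v. v \<in> {..<k + l} \<rightarrow>\<^sub>E C \<and> v \<circ> glue k g h = v}"
  have gl: "glue k g h \<in> Sym (k + l)" using assms by (rule glue_Sym)
  have "wts k C g x * wts l C h x = (\<Sum>(u, w)\<in>?A \<times> ?B. (\<Prod>i<k. x (u i)) * (\<Prod>i<l. x (w i)))"
    by (simp add: wts_def sum_product sum.cartesian_product)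
  also have "\<dots> = (\<Sum>v\<in>?C. \<Prod>i<k+l. x (v i))"
  proof (rule sum.reindex_bij_witness[where
      i="\<lambda>v. (restrict v {..<k}, restrict (\<lambda>i. v (k + i)) {..<l})" and 
      j="\<lambda>(u, w). restrict (\<lambda>i. if i < k then u i else w (i - k)) {..<k + l}"])
    fix p assume p: "p \<in> ?A \<times> ?B"
    obtain u w where uw: "p = (u, w)" by fastforce
    have u: "u \<in> {..<k} \<rightarrow>\<^sub>E C" "\<forall>i<k. u (g i) = u i" and w: "w \<in> {..<l} \<rightarrow>\<^sub>E C" "\<forall>i<l. w (h i) = w i"
      using p uw g h by (auto simp: Sym_fixes_word)
    let ?v = "restrict (\<lambda>i. if i < k then u i else w (i - k)) {..<k + l}"
    show "(\<lambda>v. (restrict v {..<k}, restrict (\<lambda>i. v (k + i)) {..<l})) ((\<lambda>(u, w). restrict (\<lambda>i. if i < k then u i else w (i - k)) {..<k + l}) p) = p"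
      using u w by (auto simp: uw PiE_iff extensional_def fun_eq_iff)
    have "?v (glue k g h i) = ?v i" if "i < k + l" for i
      using that u w Sym_less[OF g, of i] Sym_less[OF h, of "i - k"] by (auto simp: glue_def)
    moreover have "?v \<in> {..<k + l} \<rightarrow>\<^sub>E C" using u w by (auto simp: PiE_iff)
    ultimately show "(\<lambda>(u, w). restrict (\<lambda>i. if i < k then u i else w (i - k)) {..<k + l}) p \<in> ?C"
      using Sym_fixes_word[OF gl, of ?v] by (simp add: uw)
    have "(\<Prod>i<k+l. x (?v i)) = (\<Prod>i\<in>{..<k} \<union> {k..<k+l}. x (?v i))"
      by (intro prod.cong) auto
    also have "\<dots> = (\<Prod>i<k. x (?v i)) * (\<Prod>i\<in>{k..<k+l}. x (?v i))"
      by (rule prod.union_disjoint) auto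
    also have "(\<Prod>i\<in>{k..<k+l}. x (?v i)) = (\<Prod>i<l. x (w i))"
      by (rule prod.reindex_bij_witness[of _ "\<lambda>i. k + i" "\<lambda>i. i - k"]) auto
    finally show "(\<Prod>i<k+l. x ((\<lambda>(u, w). restrict (\<lambda>i. if i < k then u i else w (i - k)) {..<k + l}) p i)) =
       (case p of (u, w) \<Rightarrow> (\<Prod>i<k. x (u i)) * (\<Prod>i<l. x (w i)))" by (simp add: uw)
  next
    fix v assume v: "v \<in> ?C"
    then have vg: "v (glue k g h i) = v i" for i by (metis (mono_tags, lifting) comp_apply mem_Collect_eq)
    show "(\<lambda>(u, w). restrict (\<lambda>i. if i < k then u i else w (i - k)) {..<k + l}) ((\<lambda>v. (restrict v {..<k}, restrict (\<lambda>i. v (k + i)) {..<l})) v) = v"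
      using v by (auto simp: PiE_iff extensional_def fun_eq_iff)
    have "v (g i) = v i" if "i < k" for i using vg[of i] that by (simp add: glue_def)
    moreover have "v (k + h i) = v (k + i)" for i using vg[of "k + i"] by (simp add: glue_def)
    ultimately show "(\<lambda>v. (restrict v {..<k}, restrict (\<lambda>i. v (k + i)) {..<l})) v \<in> ?A \<times> ?B"
      using v g h Sym_less[OF g] Sym_less[OF h] by (auto simp: Sym_fixes_word PiE_iff)
  qed
  finally show ?thesis by (simp add: wts_def)
qed

lemma rot_Sym: "rot i \<in> Sym i"
  by (rule SymI[where h="\<lambda>j. if j = 0 then i - 1 else j - 1"]) (auto simp: rot_def)

lemma sig_Sym: "sig m \<in> Sym (sum_list m)"
proof (induction m)
  case (Cons i m)
  then show ?case using glue_Sym[OF rot_Sym, of "sig m" "sum_list m" i] by simp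
qed (simp only: sig.simps Sym_id)

lemma wts_rot: assumes "0 < i" "finite C" shows "wts i C (rot i) x = (\<Sum>c\<in>C. x c ^ i)"
proof -
  have "wts i C (rot i) x = (\<Sum>c\<in>C. \<Prod>j<i. x c)"
    unfolding wts_def
  proof (rule sum.reindex_bij_witness[where j="\<lambda>v. v 0" and i="\<lambda>c. restrict (\<lambda>_. c) {..<i}"])
    fix v assume "v \<in> {v. v \<in> {..<i} \<rightarrow>\<^sub>E C \<and> v \<circ> rot i = v}"
    then have v: "v \<in> {..<i} \<rightarrow>\<^sub>E C" "\<And>j. j < i \<Longrightarrow> v (rot i j) = v j" by (auto simp: Sym_fixes_word[OF rot_Sym])
    have "v j = v 0" if "j < i" for j using that
    proof (induction j)
      case (Suc j)
      then show ?case using v(2)[of j] by (simp add: rot_def)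
    qed simp
    note v0 = this
    show "restrict (\<lambda>_. v 0) {..<i} = v"
    proof
      fix j show "restrict (\<lambda>_. v 0) {..<i} j = v j"
        using v0[of j] v(1) by (cases "j < i") (auto simp: PiE_iff extensional_def)
    qed
    show "(\<Prod>j<i. x (v 0)) = (\<Prod>i<i. x (v i))" 
    proof (rule prod.cong[OF refl])
      fix j assume "j \<in> {..<i}"
      then show "x (v 0) = x (v j)" using v0[of j] by simp
    qed
    show "v 0 \<in> C" using v assms by auto
  next
    fix c assume "c \<in> C"
    then show "restrict (\<lambda>_. c) {..<i} 0 = c" "restrict (\<lambda>_. c) {..<i} \<in> {v. v \<in> {..<i} \<rightarrow>\<^sub>E C \<and> v \<circ> rot i = v}"
      using assms Sym_less[OF rot_Sym] by (auto simp: Sym_fixes_word[OF rot_Sym])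
  qed
  then show ?thesis by simp
qed

lemma P_id0: "P N 0 g x = 1"
proof -
  have "{v. v \<in> {..<0::nat} \<rightarrow>\<^sub>E {..<N} \<and> v \<circ> g = v} = {\<lambda>_. undefined}" by auto
  then show ?thesis by (simp add: wts_def)
qed

lemma P_sig: "\<forall>i\<in>set m. 0 < i \<Longrightarrow> P N (sum_list m) (sig m) x = pm N m x"
  by (induction m) (simp_all add: P_id0 pm_def wts_glue rot_Sym sig_Sym wts_rot pw_def)

section \<open>Periods, orbits and conjugacy classes\<close>

abbreviation per :: "(nat \<Rightarrow> nat) \<Rightarrow> nat \<Rightarrow> nat" where
  "per \<equiv> least_power"

lemmas per_def = least_power_def

lemma per: assumes "finite A" "g permutes A" shows "0 < per g a" "(g ^^ per g a) a = a"
  using least_power_of_permutation[OF permutes_imp_permutation[OF assms]] by auto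

lemma orbit_inj: assumes "finite A" "g permutes A" shows "inj_on (\<lambda>k. (g ^^ k) a) {..<per g a}"
proof (rule linorder_inj_onI)
  fix i j assume ij: "i < j" "i \<in> {..<per g a}" "j \<in> {..<per g a}"
  show "(g ^^ i) a \<noteq> (g ^^ j) a"
  proof
    assume eq: "(g ^^ i) a = (g ^^ j) a"
    have "(g ^^ (j - i)) a = a" by (rule funpow_diff[OF permutes_inj[OF assms(2)] _ eq]) (use ij in simp)
    then have "per g a \<le> j - i" using ij(1) by (intro least_power_le) auto
    then show False using ij by simp
  qed
qed auto

text \<open>Induction removing an orbit of maximal length. The map \<open>b\<close> numbers the
  elements of \<open>A\<close> so that \<open>g\<close> acts on the numbers as \<open>sig m\<close>.
  The last clause makes every later part a period, hence at most the maximal one, so that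
  \<open>m\<close> comes out weakly decreasing.\<close>

lemma cycle_decomposition:
  assumes "finite A" "g permutes A"
  shows "\<exists>m b. sorted_wrt (\<ge>) m \<and> sum_list m = card A \<and> bij_betw b {..<card A} A \<and>
     (\<forall>j<card A. g (b j) = b (sig m j)) \<and> (\<forall>q\<in>set m. \<exists>a\<in>A. per g a = q)"
  using assms
proof (induction "card A" arbitrary: A g rule: less_induct)
  case less
  show ?case
  proof (cases "A = {}")
    case True
    then show ?thesis by (intro exI[of _ "[]"]) (auto simp: bij_betw_def)
  next
    case False
    have "finite (per g ` A)" "per g ` A \<noteq> {}" using less.prems False by auto
    then obtain a where a: "a \<in> A" "per g a = Max (per g ` A)" using Max_in by (metis (no_types, lifting) imageE)
    then have max: "per g c \<le> per g a" if "c \<in> A" for c using less.prems that by simp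
    define p where "p = per g a"
    note pp = per[OF less.prems, of a, folded p_def]
    define O' where "O' = (\<lambda>k. (g ^^ k) a) ` {..<p}"
    have cardO: "card O' = p" unfolding O'_def p_def using orbit_inj[OF less.prems] by (simp add: card_image)
    have OA: "O' \<subseteq> A" using permutes_funpow[OF less.prems(2)] a(1) by (auto simp: O'_def permutes_in_image)
    have gO: "g c \<in> O'" if "c \<in> O'" for c
    proof -
      from that obtain k where k: "k < p" "c = (g ^^ k) a" by (auto simp: O'_def)
      show ?thesis
      proof (cases "Suc k = p")
        case True
        have "g c = (g ^^ Suc k) a" using k by simp
        also have "\<dots> = (g ^^ 0) a" using pp(2) True by simp
        finally show ?thesis using pp(1) unfolding O'_def by blast
      next
        case False
        then have "g c = (g ^^ Suc k) a" "Suc k < p" using k by auto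
        then show ?thesis unfolding O'_def by blast
      qed
    qed
    have gO_eq: "g ` O' = O'"
      by (rule card_subset_eq) (use gO cardO permutes_inj_on[OF less.prems(2)] finite_subset[OF OA less.prems(1)] in \<open>auto simp: card_image\<close>)
    define A' where "A' = A - O'"
    define g' where "g' = (\<lambda>c. if c \<in> A' then g c else c)"
    have gA': "g ` A' = A'"
      unfolding A'_def using gO_eq permutes_image[OF less.prems(2)] permutes_inj[OF less.prems(2)] by (simp add: image_set_diff)
    have perm': "g' permutes A'"
    proof (rule bij_imp_permutes)
      show "bij_betw g' A' A'" unfolding bij_betw_def
        using gA' permutes_inj_on[OF less.prems(2), of A'] by (auto simp: g'_def inj_on_def image_iff)
    qed (simp add: g'_def)
    have pow': "(g' ^^ k) c = (g ^^ k) c \<and> (g ^^ k) c \<in> A'" if "c \<in> A'" for k c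
      by (induction k) (use that gA' in \<open>auto simp: g'_def\<close>)
    have per': "per g' c = per g c" if "c \<in> A'" for c
      using pow'[OF that] by (simp add: per_def)
    have cA': "card A = p + card A'" using OA less.prems(1) cardO finite_subset
      by (metis A'_def card_Diff_subset card_mono le_add_diff_inverse)
    then have "card A' < card A" using pp(1) by simp
    from less.hyps[OF this _ perm'] obtain m b where IH: "sorted_wrt (\<ge>) m" "sum_list m = card A'"
      "bij_betw b {..<card A'} A'" "\<forall>j<card A'. g' (b j) = b (sig m j)" "\<forall>q\<in>set m. \<exists>a\<in>A'. per g' a = q"
      using less.prems(1) by (auto simp: A'_def)
    define b' where "b' j = (if j < p then (g ^^ j) a else b (j - p))" for j
    have bA': "b j \<in> A'" if "j < card A'" for j using IH(3) that by (auto simp: bij_betw_def)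
    have "bij_betw b' ({..<p} \<union> {p..<p + card A'}) (O' \<union> A')"
    proof (rule bij_betw_combine)
      show "bij_betw b' {..<p} O'" unfolding O'_def p_def bij_betw_def 
        using orbit_inj[OF less.prems, of a] by (auto simp: b'_def p_def inj_on_def)
      have "bij_betw (b \<circ> (\<lambda>j. j - p)) {p..<p + card A'} A'"
        by (rule bij_betw_trans[OF _ IH(3)], rule bij_betw_byWitness[where f'="\<lambda>j. j + p"]) auto
      then show "bij_betw b' {p..<p + card A'} A'"
        by (subst bij_betw_cong[where g="b \<circ> (\<lambda>j. j - p)"]) (auto simp: b'_def)
      show "O' \<inter> A' = {}" by (auto simp: A'_def)
    qed
    moreover have "{..<p} \<union> {p..<p + card A'} = {..<card A}" using cA' by auto
    moreover have "O' \<union> A' = A" using OA by (auto simp: A'_def)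
    ultimately have 1: "bij_betw b' {..<card A} A" by simp
    have 2: "g (b' j) = b' (sig (p # m) j)" if j: "j < card A" for j
    proof (cases "j < p")
      case True
      have "g ((g ^^ j) a) = (g ^^ Suc j) a" by simp
      then show ?thesis using True pp by (auto simp: b'_def glue_def rot_def)
    next
      case False
      then have "j - p < card A'" using j cA' by auto
      then have "g (b (j - p)) = b (sig m (j - p))" using IH(4) bA' by (auto simp: g'_def)
      then show ?thesis using False by (simp add: b'_def glue_def)
    qed
    have 3: "\<forall>q\<in>set (p # m). \<exists>a\<in>A. per g a = q" using IH(5) per' a(1) by (auto simp: p_def A'_def)
    have "\<forall>q\<in>set m. q \<le> p"
    proof
      fix q assume "q \<in> set m"
      then obtain c where "c \<in> A'" "per g' c = q" using IH(5) by blast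
      then show "q \<le> p" using per' max[of c] by (auto simp: p_def A'_def)
    qed
    then have 4: "sorted_wrt (\<ge>) (p # m)" using IH(1) by simp
    show ?thesis
      by (intro exI[of _ "p # m"] exI[of _ b'] conjI) (use 1 2 3 4 cA' IH(2) in auto)
  qed
qed

theorem conj_sig:
  assumes g: "g \<in> Sym n"
  shows "\<exists>m\<in>partitions n. \<exists>h\<in>Sym n. g = h \<circ> sig m \<circ> inv h"
proof -
  have gp: "g permutes {..<n}" using g by (simp add: Sym_def)
  obtain m b where m: "sorted_wrt (\<ge>) m" "sum_list m = n" "bij_betw b {..<n} {..<n}"
     "\<forall>j<n. g (b j) = b (sig m j)" "\<forall>q\<in>set m. \<exists>a\<in>{..<n}. per g a = q"
    using cycle_decomposition[OF _ gp] by auto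
  define h where "h = (\<lambda>j. if j < n then b j else j)"
  have h: "h \<in> Sym n" unfolding Sym_def mem_Collect_eq
  proof (rule bij_imp_permutes)
    show "bij_betw h {..<n} {..<n}" using m(3) by (subst bij_betw_cong[where g=b]) (auto simp: h_def)
  qed (simp add: h_def)
  have s: "sig m \<in> Sym n" using sig_Sym[of m] m(2) by simp
  have "g \<circ> h = h \<circ> sig m"
  proof
    fix j show "(g \<circ> h) j = (h \<circ> sig m) j"
      using m(4) Sym_less[OF s, of j] Sym_ge[OF s, of j] Sym_ge[OF g, of j] by (cases "j < n") (auto simp: h_def)
  qed
  then have "g = h \<circ> sig m \<circ> inv h" using h by (metis Sym_cancel(3))
  moreover have "m \<in> partitions n"
    using m per(1)[OF _ gp] by (auto simp: partitions_def is_partition_def)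
  ultimately show ?thesis using h by blast
qed

lemma conj_funpow: "h \<in> Sym n \<Longrightarrow> (h \<circ> g \<circ> inv h) ^^ k = h \<circ> (g ^^ k) \<circ> inv h"
proof (induction k)
  case (Suc k)
  have "(h \<circ> g \<circ> inv h) ^^ Suc k = (h \<circ> g \<circ> inv h) \<circ> (h \<circ> (g ^^ k) \<circ> inv h)"
    by (simp only: funpow.simps(2) Suc.IH[OF Suc.prems])
  also have "\<dots> = h \<circ> (g \<circ> (inv h \<circ> (h \<circ> ((g ^^ k) \<circ> inv h))))" by (simp add: comp_assoc)
  also have "\<dots> = h \<circ> (g \<circ> ((g ^^ k) \<circ> inv h))" by (simp only: Sym_cancel(2)[OF Suc.prems])
  finally show ?case by (simp only: funpow.simps(2) comp_assoc)
qed (simp add: Sym_inv_o(1))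

lemma per_conj: assumes "h \<in> Sym n" shows "per (h \<circ> g \<circ> inv h) (h a) = per g a"
proof -
  have "((h \<circ> g \<circ> inv h) ^^ k) (h a) = h a \<longleftrightarrow> (g ^^ k) a = a" for k
    using assms by (simp add: conj_funpow Sym_def permutes_inverses inj_eq[OF permutes_inj])
  then show ?thesis by (simp add: per_def)
qed

lemma glue_funpow: "g \<in> Sym k \<Longrightarrow> glue k g h ^^ r = glue k (g ^^ r) (h ^^ r)"
proof (induction r)
  case (Suc r)
  have "g ^^ r \<in> Sym k" using Suc.prems by (simp add: Sym_def permutes_funpow)
  then show ?case by (simp only: funpow.simps(2) Suc.IH[OF Suc.prems] glue_comp)
qed (simp add: glue_id)

lemma rot_funpow: "j < i \<Longrightarrow> (rot i ^^ r) j = (j + r) mod i"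
proof (induction r)
  case (Suc r)
  have "(j + r) mod i < i" using Suc.prems by simp
  then show ?case using Suc by (simp add: rot_def mod_Suc)
qed simp

lemma per_rot: assumes "j < i" shows "per (rot i) j = i"
  unfolding per_def
proof (rule Least_equality)
  show "(rot i ^^ i) j = j \<and> 0 < i" using assms by (simp add: rot_funpow)
  fix k assume k: "(rot i ^^ k) j = j \<and> 0 < k"
  then have "(j + k) mod i = j mod i" using assms by (simp add: rot_funpow)
  then have "i dvd k" by (metis add_diff_cancel_left' le_add1 mod_eq_dvd_iff_nat)
  then show "i \<le> k" using k by (simp add: dvd_imp_le)
qed

lemma per_glue: "g \<in> Sym k \<Longrightarrow> per (glue k g h) j = (if j < k then per g j else per h (j - k))"
  unfolding per_def by (simp only: glue_funpow) (auto simp: glue_def intro!: arg_cong[where f=Least])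

lemma card_per_sig: "card {j. j < sum_list m \<and> per (sig m) j = i} = i * count (mset m) i"
proof (induction m)
  case (Cons k m)
  have "{j. j < sum_list (k # m) \<and> per (sig (k # m)) j = i} = 
    {j. j < k \<and> k = i} \<union> (\<lambda>j. k + j) ` {j. j < sum_list m \<and> per (sig m) j = i}" (is "?L = ?A \<union> ?B")
  proof (intro set_eqI iffI)
    fix j assume j: "j \<in> ?L"
    show "j \<in> ?A \<union> ?B"
    proof (cases "j < k")
      case False
      then have "j - k \<in> {j. j < sum_list m \<and> per (sig m) j = i}" "j = k + (j - k)"
        using j by (auto simp: per_glue rot_Sym)
      then show ?thesis by blast
    qed (use j in \<open>simp add: per_glue rot_Sym per_rot\<close>)
  qed (auto simp: per_glue rot_Sym per_rot)
  moreover have "?A \<inter> ?B = {}" by auto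
  moreover have "card ?B = i * count (mset m) i" using Cons by (simp add: card_image)
  moreover have "card ?A = (if k = i then i else 0)" by simp
  ultimately show ?case by (simp add: card_Un_disjoint)
qed simp

text \<open>Conjugation preserves periods, and the points of period \<open>i\<close> number
  \<open>i\<close> times the multiplicity of the part \<open>i\<close>. So all multiplicities
  agree.\<close>

theorem sig_conj_unique:
  assumes "m \<in> partitions n" "r \<in> partitions n" "h \<in> Sym n" "sig r = h \<circ> sig m \<circ> inv h"
  shows "m = r"
proof -
  have s: "sum_list m = n" "sum_list r = n" "\<forall>i\<in>set m. 0 < i" "\<forall>i\<in>set r. 0 < i"
    using assms by (auto simp: partitions_def is_partition_def)
  have "count (mset m) i = count (mset r) i" for i
  proof (cases "i = 0")
    case True
    then show ?thesis using s by (metis count_mset_0_iff less_irrefl)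
  next
    case False
    have "bij_betw h {j. j < n \<and> per (sig m) j = i} {j. j < n \<and> per (sig r) j = i}"
    proof (rule bij_betw_byWitness[where f'="inv h"])
      have hi: "h (inv h j) = j" "inv h (h j) = j" for j using assms(3) by (auto simp: Sym_def permutes_inverses)
      show "\<forall>a\<in>{j. j < n \<and> per (sig m) j = i}. inv h (h a) = a" "\<forall>a\<in>{j. j < n \<and> per (sig r) j = i}. h (inv h a) = a"
        using hi by auto
      have *: "per (sig r) (h a) = per (sig m) a" for a unfolding assms(4) by (rule per_conj[OF assms(3)])
      show "h ` {j. j < n \<and> per (sig m) j = i} \<subseteq> {j. j < n \<and> per (sig r) j = i}"
        using * Sym_less[OF assms(3)] by auto
      show "inv h ` {j. j < n \<and> per (sig r) j = i} \<subseteq> {j. j < n \<and> per (sig m) j = i}"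
        using *[of "inv h _"] hi Sym_less[OF Sym_inv[OF assms(3)]] by auto
    qed
    from bij_betw_same_card[OF this] have "i * count (mset m) i = i * count (mset r) i"
      using card_per_sig[of m i] card_per_sig[of r i] s(1,2) by simp
    then show ?thesis using False by simp
  qed
  then have ms: "mset m = mset r" by (rule multiset_eqI)
  have "sorted (rev m)" "sorted (rev r)"
    using assms by (auto simp: partitions_def is_partition_def sorted_wrt_rev)
  then have "rev m = rev r" using ms by (metis mset_rev properties_for_sort)
  then show ?thesis by simp
qed

section \<open>Irreducibility and Schur positivity\<close>

definition cj :: "(nat \<Rightarrow> nat) \<Rightarrow> nat \<Rightarrow> nat" where
  "cj l j = card {i. j < l i}"

definition sg :: "(nat \<Rightarrow> nat) \<Rightarrow> real" where
  "sg g = real_of_int (sign g)"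

definition conv :: "nat \<Rightarrow> ((nat \<Rightarrow> nat) \<Rightarrow> real) \<Rightarrow> ((nat \<Rightarrow> nat) \<Rightarrow> real) \<Rightarrow> (nat \<Rightarrow> nat) \<Rightarrow> real" where
  "conv n f h s = (\<Sum>g\<in>Sym n. f g * h (inv g \<circ> s))"

lemma Sym_permutation: "g \<in> Sym n \<Longrightarrow> permutation g"
  by (auto simp: Sym_def intro: permutes_imp_permutation[of "{..<n}"])

lemma sg_comp: "g \<in> Sym n \<Longrightarrow> h \<in> Sym n \<Longrightarrow> sg (g \<circ> h) = sg g * sg h"
  by (simp add: sg_def sign_compose Sym_permutation)
lemma sg_sq [simp]: "sg g * sg g = 1" "sg g * (sg g * c) = c"
  by (simp_all add: sg_def flip: of_int_mult mult.assoc)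
lemma sg_id [simp]: "sg id = 1" by (simp add: sg_def)

section \<open>Conjugate partitions and dominance\<close>

lemma column_eq: assumes "shape l" shows "{i. j < l i} = {..<cj l j}"
proof -
  obtain L where L: "\<And>i. L \<le> i \<Longrightarrow> l i = 0" using shape_bound[OF assms] by blast
  have fin: "finite {i. j < l i}" by (rule finite_subset[of _ "{..<L}"]) (auto, metis L less_nat_zero_code not_le)
  have down: "i' \<in> {i. j < l i}" if "i \<in> {i. j < l i}" "i' \<le> i" for i i'
    using that shape_mono[OF assms, of i' i] by auto
  have "{i. j < l i} = {..<card {i. j < l i}}"
  proof (rule card_subset_eq[symmetric])
    show "{..<card {i. j < l i}} \<subseteq> {i. j < l i}"
    proof (rule ccontr)
      assume "\<not> {..<card {i. j < l i}} \<subseteq> {i. j < l i}"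
      then obtain a where a: "a < card {i. j < l i}" "a \<notin> {i. j < l i}" by blast
      then have "{i. j < l i} \<subseteq> {..<a}" using down by (metis leI lessThan_iff subsetI)
      from card_mono[OF _ this] show False using a by simp
    qed
  qed (use fin in simp_all)
  then show ?thesis by (simp add: cj_def)
qed

lemma less_cj_iff: "shape l \<Longrightarrow> i < cj l j \<longleftrightarrow> j < l i" using column_eq by blast

lemma Par_le: "l \<in> Par n \<Longrightarrow> l i \<le> n" using shape_le_sz by (auto simp: Par_def)
lemma Par_zero: "l \<in> Par n \<Longrightarrow> n \<le> i \<Longrightarrow> l i = 0" using shape_vanish by (auto simp: Par_def)
lemma Par_sum: "l \<in> Par n \<Longrightarrow> n \<le> L \<Longrightarrow> (\<Sum>i<L. l i) = n" using sz_eq by (auto simp: Par_def)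
lemma Par_shape: "l \<in> Par n \<Longrightarrow> shape l" by (simp add: Par_def)

lemma count_rows: "(\<Sum>i<a. card {j. j < b \<and> R i j}) = (\<Sum>j<b. card {i. i < a \<and> R i (j::nat)})" for a :: nat
proof -
  have "(\<Sum>i<a. card {j. j < b \<and> R i j}) = (\<Sum>i<a. \<Sum>j | j \<in> {..<b} \<and> R i j. 1)" by simp
  also have "\<dots> = (\<Sum>j<b. \<Sum>i | i \<in> {..<a} \<and> R i j. 1)" by (rule sum.swap_restrict) auto
  finally show ?thesis by simp
qed

text \<open>The cells in the first \<open>k\<close> columns, counted by columns and by rows.\<close>

lemma sum_cj: assumes "l \<in> Par n" "n \<le> L" shows "(\<Sum>j<k. cj l j) = (\<Sum>i<L. min (l i) k)"
proof -
  have "{j. j < k \<and> j < l i} = {..<min (l i) k}" for i by auto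
  then have "(\<Sum>i<L. min (l i) k) = (\<Sum>i<L. card {j. j < k \<and> j < l i})" by simp
  also have "\<dots> = (\<Sum>j<k. card {i. i < L \<and> j < l i})" by (rule count_rows)
  also have "\<dots> = (\<Sum>j<k. cj l j)"
  proof (rule sum.cong[OF refl])
    fix j
    have "{i. i < L \<and> j < l i} = {i. j < l i}" using Par_zero[OF assms(1)] assms(2)
      by (auto, metis le_trans less_nat_zero_code not_le)
    then show "card {i. i < L \<and> j < l i} = cj l j" by (simp add: cj_def)
  qed
  finally show ?thesis by simp
qed

lemma sum_min_cj: assumes "l \<in> Par n" "n \<le> L" shows "(\<Sum>j<L. min (cj l j) k) = (\<Sum>i<k. l i)"
proof -
  have "{i. i < k \<and> j < l i} = {..<min (cj l j) k}" for j
    using less_cj_iff[OF Par_shape[OF assms(1)]] by auto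
  then have "(\<Sum>j<L. min (cj l j) k) = (\<Sum>j<L. card {i. i < k \<and> j < l i})" by simp
  also have "\<dots> = (\<Sum>i<k. card {j. j < L \<and> j < l i})" by (rule count_rows)
  also have "\<dots> = (\<Sum>i<k. l i)"
  proof (rule sum.cong[OF refl])
    fix i
    have "{j. j < L \<and> j < l i} = {..<l i}" using Par_le[OF assms(1), of i] assms(2) by auto
    then show "card {j. j < L \<and> j < l i} = l i" by simp
  qed
  finally show ?thesis .
qed

lemma cj_Par: assumes "l \<in> Par n" shows "cj l \<in> Par n"
proof -
  have sh: "shape l" using assms by (rule Par_shape)
  have z: "cj l j = 0" if "n \<le> j" for j
  proof -
    have "{i. j < l i} = {}" using Par_le[OF assms] that by (auto simp: not_less intro: le_trans)
    then show ?thesis by (simp only: cj_def card.empty)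
  qed
  have "shape (cj l)"
  proof (rule shapeI[OF _ z])
    show "cj l (Suc j) \<le> cj l j" for j
      using less_cj_iff[OF sh, of "cj l j"] by (metis Suc_lessD less_irrefl not_le)
  qed
  moreover have "sz (cj l) = n"
  proof -
    have "sz (cj l) = (\<Sum>i<n. min (l i) n)" using sz_eq_sum[OF z] sum_cj[OF assms order_refl] by simp
    also have "\<dots> = (\<Sum>i<n. l i)" using Par_le[OF assms] by (intro sum.cong) auto
    finally show ?thesis using Par_sum[OF assms order_refl] by simp
  qed
  ultimately show ?thesis by (simp add: Par_def)
qed

text \<open>Conjugation reverses dominance; in view of \<open>sum_cj\<close> these are sums of
  initial columns. Let \<open>m\<close> be the number of the first \<open>L\<close> entries of
  \<open>c\<close> that are at least \<open>k\<close>. The truncated sum of \<open>c\<close> is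
  exactly \<open>m\<close> times \<open>k\<close> plus the tail of \<open>c\<close>; for
  \<open>b\<close> the same expression is an upper bound, and by dominance the tail of
  \<open>b\<close> is no larger.\<close>

lemma sum_min_antimono:
  assumes "b \<in> Par n" "c \<in> Par n" "dom b c" "n \<le> L"
  shows "(\<Sum>i<L. min (b i) k) \<le> (\<Sum>i<L. min (c i) k)"
proof -
  have "\<exists>m\<le>L. (\<forall>i<m. k \<le> c i) \<and> (\<forall>i. m \<le> i \<and> i < L \<longrightarrow> c i < k)"
  proof (cases "\<exists>i<L. c i < k")
    case True
    define m where "m = (LEAST i. c i < k)"
    have "c m < k" unfolding m_def using True by (metis LeastI)
    moreover have "m \<le> L" using True unfolding m_def by (metis Least_le le_trans less_imp_le)
    moreover have "k \<le> c i" if "i < m" for i using that not_less_Least not_le unfolding m_def by blast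
    ultimately show ?thesis using shape_mono[OF Par_shape[OF assms(2)]] by (meson le_less_trans)
  next
    case False
    then show ?thesis by (intro exI[of _ L]) auto
  qed
  then obtain m where m: "m \<le> L" "\<And>i. i < m \<Longrightarrow> k \<le> c i" "\<And>i. m \<le> i \<Longrightarrow> i < L \<Longrightarrow> c i < k" by blast
  have split: "(\<Sum>i<L. f i) = (\<Sum>i<m. f i) + (\<Sum>i=m..<L. f i)" for f :: "nat \<Rightarrow> nat"
    using m(1) by (simp add: lessThan_atLeast0 sum.atLeastLessThan_concat)
  have "(\<Sum>i<L. min (b i) k) \<le> (\<Sum>i<m. k) + (\<Sum>i=m..<L. b i)"
    unfolding split by (intro add_mono sum_mono) auto
  moreover have "(\<Sum>i<m. k) + (\<Sum>i=m..<L. c i) = (\<Sum>i<L. min (c i) k)"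
  proof -
    have "(\<Sum>i<m. min (c i) k) = (\<Sum>i<m. k)" using m(2) by (intro sum.cong) (auto simp: min_absorb2)
    moreover have "(\<Sum>i=m..<L. min (c i) k) = (\<Sum>i=m..<L. c i)" 
      using m(3) by (intro sum.cong) (auto simp: min_absorb1 less_imp_le)
    ultimately show ?thesis unfolding split by simp
  qed
  moreover have "(\<Sum>i=m..<L. b i) \<le> (\<Sum>i=m..<L. c i)"
    using split[of b] split[of c] Par_sum[OF assms(1,4)] Par_sum[OF assms(2,4)] assms(3)
    unfolding dom_def by (metis add_le_cancel_left add_le_mono1 nat_add_left_cancel_le add.commute)
  ultimately show ?thesis by linarith
qed

lemma bij_betw_Collect: 
  "bij_betw e A D \<Longrightarrow> (\<And>p. p \<in> A \<Longrightarrow> Q p \<longleftrightarrow> R (e p)) \<Longrightarrow> bij_betw e {p \<in> A. Q p} {d \<in> D. R d}"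
  by (auto simp: bij_betw_def inj_on_def)

definition jwords :: "nat \<Rightarrow> nat \<Rightarrow> (nat \<Rightarrow> nat) \<Rightarrow> (nat \<Rightarrow> nat) set" where
  "jwords N n a = {v. v \<in> {..<n} \<rightarrow>\<^sub>E {..<N} \<and> content n v = a}"

text \<open>With \<open>u\<close> read as the row and \<open>w\<close> as the column of a position,
  these are the placements of \<open>n\<close> labelled positions into distinct cells with row sums
  \<open>a\<close> and column sums \<open>b\<close>, that is, labelled 0/1 matrices.\<close>

definition ipairs :: "nat \<Rightarrow> nat \<Rightarrow> (nat \<Rightarrow> nat) \<Rightarrow> (nat \<Rightarrow> nat) \<Rightarrow> ((nat \<Rightarrow> nat) \<times> (nat \<Rightarrow> nat)) set" where
  "ipairs N n a b = {(u, w) \<in> jwords N n a \<times> jwords N n b. inj_on (\<lambda>p. (u p, w p)) {..<n}}"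

lemma finite_jwords [simp]: "finite (jwords N n a)"
  by (rule finite_subset[of _ "{..<n} \<rightarrow>\<^sub>E {..<N}"]) (auto simp: jwords_def)

lemma pc_eq_sum: "pc N n a g = (\<Sum>u\<in>jwords N n a. of_bool (u \<circ> g = u))"
  by (simp add: pc_def jwords_def Int_def conj_ac sum.If_cases of_bool_def)

lemma content_partial: fixes k :: nat assumes "content n u = a" shows "(\<Sum>i<k. a i) = card {p. p < n \<and> u p < k}"
proof -
  have "(\<Sum>i<k. a i) = (\<Sum>i<k. \<Sum>p | p \<in> {p. p < n \<and> u p < k} \<and> u p = i. 1)"
  proof (rule sum.cong[OF refl])
    fix i assume "i \<in> {..<k}"
    then have "{p. p \<in> {p. p < n \<and> u p < k} \<and> u p = i} = {p. p < n \<and> u p = i}" by auto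
    then show "a i = (\<Sum>p | p \<in> {p. p < n \<and> u p < k} \<and> u p = i. 1)"
      using fun_cong[OF assms, of i] by (simp add: content_def)
  qed
  also have "\<dots> = (\<Sum>p\<in>{p. p < n \<and> u p < k}. 1)" 
    by (rule sum.group) auto
  finally show ?thesis by simp
qed

lemma ipairs_swap: "(u, w) \<in> ipairs N n a b \<longleftrightarrow> (w, u) \<in> ipairs N n b a"
  by (auto simp: ipairs_def inj_on_def)

text \<open>A column meets the first \<open>k\<close> rows in at most \<open>k\<close> cells and in
  at most as many cells as it has. This is the easy half of the Gale-Ryser theorem.\<close>

lemma ipairs_bound:
  assumes "(u, w) \<in> ipairs N n a b"
  shows "card {p. p < n \<and> u p < k \<and> w p = j} \<le> min (b j) k"
    and "(\<Sum>j<N. card {p. p < n \<and> u p < k \<and> w p = j}) = (\<Sum>i<k. a i)"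
proof -
  have inj: "inj_on (\<lambda>p. (u p, w p)) {..<n}" and u: "content n u = a" and w: "content n w = b" "w \<in> {..<n} \<rightarrow>\<^sub>E {..<N}"
    using assms by (auto simp: ipairs_def jwords_def)
  have "card {p. p < n \<and> u p < k \<and> w p = j} \<le> card {p. p < n \<and> w p = j}" by (rule card_mono) auto
  moreover have "card {p. p < n \<and> u p < k \<and> w p = j} \<le> card {..<k}"
    by (rule card_inj_on_le[of u]) (use inj in \<open>auto simp: inj_on_def\<close>)
  ultimately show "card {p. p < n \<and> u p < k \<and> w p = j} \<le> min (b j) k"
    using w by (auto simp: content_def)
  have "(\<Sum>j<N. card {p. p < n \<and> u p < k \<and> w p = j}) = (\<Sum>j<N. \<Sum>p | p \<in> {p. p < n \<and> u p < k} \<and> w p = j. 1)"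
    by (simp add: conj_assoc)
  also have "\<dots> = (\<Sum>p\<in>{p. p < n \<and> u p < k}. 1)" by (rule sum.group) (use w in auto)
  finally show "(\<Sum>j<N. card {p. p < n \<and> u p < k \<and> w p = j}) = (\<Sum>i<k. a i)"
    using content_partial[OF u] by simp
qed

text \<open>The first \<open>k\<close> rows are bounded by the truncated column sums;
  \<open>sum_min_antimono\<close> replaces these by those of \<open>cj v\<close>, which add up to
  the first \<open>k\<close> rows of \<open>v\<close>.\<close>

lemma ipairs_dom:
  assumes "(u, w) \<in> ipairs N n a b" "dom a l" "dom b (cj v)" "b \<in> Par n" "l \<in> Par n" "v \<in> Par n" "n \<le> N"
  shows "dom v l"
  unfolding dom_def
proof
  fix k
  have "(\<Sum>i<k. l i) \<le> (\<Sum>i<k. a i)" using assms(2) by (simp add: dom_def)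
  also have "\<dots> \<le> (\<Sum>j<N. min (b j) k)" 
    unfolding ipairs_bound(2)[OF assms(1), symmetric] by (intro sum_mono ipairs_bound(1)[OF assms(1)])
  also have "\<dots> \<le> (\<Sum>j<N. min (cj v j) k)"
    by (rule sum_min_antimono) (use assms cj_Par in auto)
  also have "\<dots> = (\<Sum>i<k. v i)" using assms(6,7) by (rule sum_min_cj)
  finally show "(\<Sum>i<k. l i) \<le> (\<Sum>i<k. v i)" .
qed

text \<open>Taking \<open>a\<close> itself for \<open>l\<close> in \<open>ipairs_dom\<close> gives
  the reverse dominance for \<open>a\<close>; the count with rows and columns exchanged does the
  same for \<open>b\<close>.\<close>

lemma ipairs_eq:
  assumes "(u, w) \<in> ipairs N n a b" "dom a v" "dom b (cj v)" "a \<in> Par n" "b \<in> Par n" "v \<in> Par n" "n \<le> N"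
  shows "a = v" "b = cj v"
proof -
  show av: "a = v"
    by (rule dom_antisym[OF assms(2)]) (rule ipairs_dom[OF assms(1) dom_refl assms(3,5,4,6,7)])
  have "dom (cj v) b" unfolding dom_def
  proof
    fix k
    have *: "(w, u) \<in> ipairs N n b a" using assms(1) ipairs_swap by blast
    have "(\<Sum>i<k. b i) \<le> (\<Sum>j<N. min (a j) k)"
      unfolding ipairs_bound(2)[OF *, symmetric] by (intro sum_mono ipairs_bound(1)[OF *])
    also have "\<dots> = (\<Sum>j<k. cj v j)" using sum_cj[OF assms(6,7)] by (simp add: av)
    finally show "(\<Sum>i<k. b i) \<le> (\<Sum>j<k. cj v j)" .
  qed
  then show "b = cj v" using assms(3) dom_antisym by blast
qed

text \<open>Two positions in the same cell can be exchanged without changing either word. This odd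
  permutation will cancel the signed sums over such pairs.\<close>

lemma not_ipair_transposition:
  assumes "u \<in> jwords N n a" "w \<in> jwords N n b" "(u, w) \<notin> ipairs N n a b"
  obtains t where "t \<in> Sym n" "sg t = -1" "u \<circ> t = u" "w \<circ> t = w" "inv t = t"
proof -
  obtain p q where pq: "p < n" "q < n" "p \<noteq> q" "u p = u q" "w p = w q"
    using assms by (auto simp: ipairs_def inj_on_def)
  let ?t = "Transposition.transpose p q"
  show ?thesis
  proof (rule that[of ?t])
    show "?t \<in> Sym n" using pq by (simp add: Sym_def permutes_swap_id)
    show "sg ?t = -1" using pq by (simp add: sg_def sign_swap_id)
    show "u \<circ> ?t = u" "w \<circ> ?t = w" using pq by (auto simp: fun_eq_iff transpose_def)
  qed simp
qed

lemma fix_comp_right: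
  fixes u :: "nat \<Rightarrow> nat"
  assumes "t \<in> Sym n" "u \<circ> t = u" shows "u \<circ> (g \<circ> t) = u \<longleftrightarrow> u \<circ> g = u"
proof
  assume "u \<circ> (g \<circ> t) = u"
  then have "(u \<circ> g) \<circ> t = u \<circ> t" using assms(2) by (simp add: comp_assoc)
  then have "((u \<circ> g) \<circ> t) \<circ> inv t = (u \<circ> t) \<circ> inv t" by simp
  then show "u \<circ> g = u" by (simp only: Sym_cancel(3)[OF assms(1)])
next
  assume "u \<circ> g = u"
  then show "u \<circ> (g \<circ> t) = u" using assms(2) by (simp only: comp_assoc[symmetric])
qed

text \<open>After expansion in pairs of words, replacing \<open>g\<close> by
  \<open>g \<circ> t\<close> with the transposition \<open>t\<close> of
  \<open>not_ipair_transposition\<close> reverses the sign of the term, so every pair outside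
  \<open>ipairs\<close> sums to zero.\<close>

lemma conv_pc_sg_pc_zero:
  assumes "ipairs N n a b = {}" "s \<in> Sym n"
  shows "conv n (pc N n a) (\<lambda>g. sg g * pc N n b g) s = 0"
proof -
  define A where "A u w g = of_bool (u \<circ> g = u) * (sg (inv g \<circ> s) * of_bool (w \<circ> (inv g \<circ> s) = w))" 
    for u w :: "nat \<Rightarrow> nat" and g
  have zero: "(\<Sum>g\<in>Sym n. A u w g) = 0" if uw: "u \<in> jwords N n a" "w \<in> jwords N n b" for u w
  proof -
    obtain t where t: "t \<in> Sym n" "sg t = -1" "u \<circ> t = u" "w \<circ> t = w" "inv t = t"
      using not_ipair_transposition[OF uw] assms by blast
    have "A u w (g \<circ> t) = - A u w g" if g: "g \<in> Sym n" for g
    proof -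
      have e: "inv (g \<circ> t) \<circ> s = t \<circ> (inv g \<circ> s)" using g t by (simp add: Sym_inv_comp comp_assoc)
      have "sg (t \<circ> (inv g \<circ> s)) = - sg (inv g \<circ> s)"
        using sg_comp[OF t(1) Sym_comp[OF Sym_inv[OF g] assms(2)]] t(2) by simp
      moreover have "w \<circ> (t \<circ> (inv g \<circ> s)) = w \<circ> (inv g \<circ> s)" using t(4) by (simp only: comp_assoc[symmetric])
      ultimately show ?thesis unfolding A_def e fix_comp_right[OF t(1,3)] by simp
    qed
    then have "(\<Sum>g\<in>Sym n. A u w (g \<circ> t)) = - (\<Sum>g\<in>Sym n. A u w g)" by (simp add: sum_negf)
    then show ?thesis using sum_Sym_right[OF t(1), of "A u w"] by simp
  qed
  have "conv n (pc N n a) (\<lambda>g. sg g * pc N n b g) s = 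
    (\<Sum>g\<in>Sym n. \<Sum>u\<in>jwords N n a. \<Sum>w\<in>jwords N n b. A u w g)"
    unfolding conv_def pc_eq_sum A_def by (simp only: sum_product sum_distrib_left[where r="sg g" for g])
  also have "\<dots> = (\<Sum>u\<in>jwords N n a. \<Sum>g\<in>Sym n. \<Sum>w\<in>jwords N n b. A u w g)" by (rule sum.swap)
  also have "\<dots> = (\<Sum>u\<in>jwords N n a. \<Sum>w\<in>jwords N n b. \<Sum>g\<in>Sym n. A u w g)" 
    by (intro sum.cong[OF refl]) (rule sum.swap)
  also have "\<dots> = 0" using zero by simp
  finally show ?thesis .
qed

text \<open>For a pair in \<open>ipairs\<close> only the identity fixes both words, so it
  contributes 1; every other pair cancels through a transposition.\<close>

lemma ip_pc_sg_pc: "ip n (pc N n a) (\<lambda>g. sg g * pc N n b g) = real (card (ipairs N n a b)) / fact n"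
proof -
  define A where "A u w g = of_bool (u \<circ> g = u) * (sg g * of_bool (w \<circ> g = w))" for u w :: "nat \<Rightarrow> nat" and g
  have A: "(\<Sum>g\<in>Sym n. A u w g) = of_bool ((u, w) \<in> ipairs N n a b)" 
    if uw: "u \<in> jwords N n a" "w \<in> jwords N n b" for u w
  proof (cases "(u, w) \<in> ipairs N n a b")
    case False
    then obtain t where t: "t \<in> Sym n" "sg t = -1" "u \<circ> t = u" "w \<circ> t = w" "inv t = t"
      using not_ipair_transposition[OF uw] by blast
    have "A u w (g \<circ> t) = - A u w g" if g: "g \<in> Sym n" for g
      unfolding A_def fix_comp_right[OF t(1,3)] fix_comp_right[OF t(1,4)] using sg_comp[OF g t(1)] t(2) by simp
    then have "(\<Sum>g\<in>Sym n. A u w (g \<circ> t)) = - (\<Sum>g\<in>Sym n. A u w g)" by (simp add: sum_negf)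
    then show ?thesis using sum_Sym_right[OF t(1), of "A u w"] False by simp
  next
    case True
    then have inj: "inj_on (\<lambda>p. (u p, w p)) {..<n}" by (simp add: ipairs_def)
    have "A u w g = of_bool (g = id)" if g: "g \<in> Sym n" for g
    proof -
      have "g = id" if "u \<circ> g = u" "w \<circ> g = w"
      proof
        fix p
        have "u (g p) = u p" "w (g p) = w p" using that by (metis comp_apply)+
        then show "g p = id p" using inj Sym_less[OF g, of p] Sym_ge[OF g, of p]
          by (cases "p < n") (auto dest: inj_onD)
      qed
      then show ?thesis by (auto simp: A_def)
    qed
    then have "(\<Sum>g\<in>Sym n. A u w g) = (\<Sum>g\<in>Sym n. if g = id then 1 else 0)" by (intro sum.cong) auto
    also have "\<dots> = 1" by (simp only: sum.delta[OF Sym_finite] Sym_id if_True)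
    finally show ?thesis using True by simp
  qed
  have "(\<Sum>g\<in>Sym n. pc N n a g * (sg g * pc N n b g)) = 
    (\<Sum>g\<in>Sym n. \<Sum>u\<in>jwords N n a. \<Sum>w\<in>jwords N n b. A u w g)"
    unfolding pc_eq_sum A_def by (simp only: sum_product sum_distrib_left[where r="sg g" for g])
  also have "\<dots> = (\<Sum>u\<in>jwords N n a. \<Sum>g\<in>Sym n. \<Sum>w\<in>jwords N n b. A u w g)" by (rule sum.swap)
  also have "\<dots> = (\<Sum>u\<in>jwords N n a. \<Sum>w\<in>jwords N n b. \<Sum>g\<in>Sym n. A u w g)" 
    by (intro sum.cong[OF refl]) (rule sum.swap)
  also have "\<dots> = (\<Sum>u\<in>jwords N n a. \<Sum>w\<in>jwords N n b. of_bool ((u, w) \<in> ipairs N n a b))"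
    by (intro sum.cong refl) (rule A)
  also have "\<dots> = (\<Sum>(u, w)\<in>jwords N n a \<times> jwords N n b. of_bool ((u, w) \<in> ipairs N n a b))"
    by (rule sum.cartesian_product)
  also have "\<dots> = (\<Sum>z\<in>ipairs N n a b. 1)"
    by (rule sum.mono_neutral_cong_right) (auto simp: ipairs_def)
  finally show ?thesis by (simp add: ip_def)
qed

text \<open>For these contents the bounds of \<open>ipairs_bound\<close> add up to equality, so each
  of them is attained. Hence all positions in row \<open>i\<close> lie in the first
  \<open>v i\<close> columns, and injectivity together with the number of cells gives
  equality.\<close>

lemma ipairs_image:
  assumes "(u, w) \<in> ipairs N n v (cj v)" "v \<in> Par n" "n \<le> N"
  shows "(\<lambda>p. (u p, w p)) ` {..<n} = {(i, j). j < v i}"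
proof (rule card_subset_eq)
  have *: "(w, u) \<in> ipairs N n (cj v) v" using assms(1) ipairs_swap by blast
  have inj: "inj_on (\<lambda>p. (u p, w p)) {..<n}" and u: "content n u = v" and uN: "u \<in> {..<n} \<rightarrow>\<^sub>E {..<N}"
    using assms(1) by (auto simp: ipairs_def jwords_def)
  have cells: "{(i, j). j < v i} = Sigma {..<n} (\<lambda>i. {..<v i})"
    using Par_zero[OF assms(2)] by (auto simp: not_less[symmetric]) (metis less_nat_zero_code not_le)
  then show "finite {(i, j). j < v i}" by simp
  have "card {(i, j). j < v i} = (\<Sum>i<n. v i)" unfolding cells by simp
  then show "card ((\<lambda>p. (u p, w p)) ` {..<n}) = card {(i, j). j < v i}"
    using inj Par_sum[OF assms(2) order_refl] by (simp add: card_image)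
  show "(\<lambda>p. (u p, w p)) ` {..<n} \<subseteq> {(i, j). j < v i}"
  proof clarsimp
    fix p assume p: "p < n"
    define i where "i = u p"
    have iN: "i < N" using uN p by (auto simp: i_def)
    define k where "k = v i"
    have "(\<Sum>j<N. card {p. p < n \<and> w p < k \<and> u p = j}) = (\<Sum>j<N. min (v j) k)"
      unfolding ipairs_bound(2)[OF *] using sum_cj[OF assms(2,3)] by simp
    then have "card {p. p < n \<and> w p < k \<and> u p = i} = min (v i) k"
      by (rule sum_mono_inv) (use ipairs_bound(1)[OF *] iN in auto)
    then have "card {p. p < n \<and> w p < k \<and> u p = i} = card {p. p < n \<and> u p = i}"
      using fun_cong[OF u, of i] by (simp add: k_def content_def)
    then have "{p. p < n \<and> w p < k \<and> u p = i} = {p. p < n \<and> u p = i}"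
      by (intro card_subset_eq) auto
    then have "p \<in> {p. p < n \<and> w p < k \<and> u p = i}" using p by (simp add: i_def)
    then show "w p < v (u p)" by (simp add: k_def i_def)
  qed
qed

lemma ipairs_exists:
  assumes "v \<in> Par n" "n \<le> N" shows "\<exists>z. z \<in> ipairs N n v (cj v)"
proof -
  let ?D = "{(i, j). j < v i}"
  have cells: "?D = Sigma {..<n} (\<lambda>i. {..<v i})"
    using Par_zero[OF assms(1)] by (auto simp: not_less[symmetric]) (metis less_nat_zero_code not_le)
  then have fin: "finite ?D" by simp
  have "card ?D = n" unfolding cells using Par_sum[OF assms(1) order_refl] by simp
  then obtain e where e: "bij_betw e {..<n} ?D" using fin finite_same_card_bij[of "{..<n}" ?D] by auto
  define u where "u = restrict (fst \<circ> e) {..<n}"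
  define w where "w = restrict (snd \<circ> e) {..<n}"
  have ed: "snd (e p) < v (fst (e p))" if "p < n" for p using bij_betwE[OF e] that by (force split: prod.splits)
  have "u \<in> {..<n} \<rightarrow>\<^sub>E {..<N}"
  proof -
    have "fst (e p) < n" if "p < n" for p using ed[OF that] Par_zero[OF assms(1)] by (metis less_nat_zero_code not_le)
    then show ?thesis using assms(2) by (force simp: u_def)
  qed
  moreover have "w \<in> {..<n} \<rightarrow>\<^sub>E {..<N}"
  proof -
    have "snd (e p) < N" if "p < n" for p
      using ed[OF that] Par_le[OF assms(1), of "fst (e p)"] assms(2) by linarith
    then show ?thesis by (force simp: w_def)
  qed
  moreover have "content n u = v"
  proof
    fix i
    have "bij_betw e {p \<in> {..<n}. fst (e p) = i} {z \<in> ?D. fst z = i}"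
      using e by (rule bij_betw_Collect) simp
    moreover have "{z \<in> ?D. fst z = i} = Pair i ` {..<v i}" by auto
    ultimately have "card {p. p < n \<and> fst (e p) = i} = card (Pair i ` {..<v i})"
      using bij_betw_same_card by fastforce
    moreover have "{p. p < n \<and> u p = i} = {p. p < n \<and> fst (e p) = i}" by (auto simp: u_def)
    ultimately show "content n u i = v i" by (simp add: content_def card_image inj_on_def)
  qed
  moreover have "content n w = cj v"
  proof
    fix j
    have "bij_betw e {p \<in> {..<n}. snd (e p) = j} {z \<in> ?D. snd z = j}"
      using e by (rule bij_betw_Collect) simp
    moreover have "{z \<in> ?D. snd z = j} = (\<lambda>i. (i, j)) ` {i. j < v i}" by auto
    ultimately have "card {p. p < n \<and> snd (e p) = j} = card ((\<lambda>i. (i, j)) ` {i. j < v i})"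
      using bij_betw_same_card by fastforce
    moreover have "{p. p < n \<and> w p = j} = {p. p < n \<and> snd (e p) = j}" by (auto simp: w_def)
    ultimately show "content n w j = cj v j" by (simp add: content_def cj_def card_image inj_on_def)
  qed
  moreover have "inj_on (\<lambda>p. (u p, w p)) {..<n}"
    using e by (auto simp: bij_betw_def inj_on_def u_def w_def prod_eq_iff)
  ultimately show ?thesis by (auto simp: ipairs_def jwords_def)
qed

text \<open>All pairs fill the same diagram by \<open>ipairs_image\<close>, so any two differ by a
  unique permutation of the positions. It is found by applying \<open>content_eq_conj\<close> to
  words whose letters are cells.\<close>

lemma card_ipairs: assumes "v \<in> Par n" "n \<le> N" shows "card (ipairs N n v (cj v)) = fact n"
proof -
  obtain u w where uw: "(u, w) \<in> ipairs N n v (cj v)" using ipairs_exists[OF assms] by (metis surj_pair)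
  have inj: "inj_on (\<lambda>p. (u p, w p)) {..<n}" and uwj: "u \<in> jwords N n v" "w \<in> jwords N n (cj v)"
    using uw by (auto simp: ipairs_def)
  have "bij_betw (\<lambda>g. (u \<circ> g, w \<circ> g)) (Sym n) (ipairs N n v (cj v))"
    unfolding bij_betw_def
  proof
    show "inj_on (\<lambda>g. (u \<circ> g, w \<circ> g)) (Sym n)"
    proof (rule inj_onI)
      fix g h assume gh: "g \<in> Sym n" "h \<in> Sym n" "(u \<circ> g, w \<circ> g) = (u \<circ> h, w \<circ> h)"
      show "g = h"
      proof
        fix p
        have "u (g p) = u (h p)" "w (g p) = w (h p)" using gh(3) by (metis comp_apply prod.inject)+
        then show "g p = h p" using inj Sym_less[OF gh(1), of p] Sym_less[OF gh(2), of p] Sym_ge[OF gh(1), of p] Sym_ge[OF gh(2), of p]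
          by (cases "p < n") (auto dest: inj_onD)
      qed
    qed
    show "(\<lambda>g. (u \<circ> g, w \<circ> g)) ` Sym n = ipairs N n v (cj v)"
    proof (intro subset_antisym subsetI)
      fix z assume "z \<in> (\<lambda>g. (u \<circ> g, w \<circ> g)) ` Sym n"
      then obtain g where g: "g \<in> Sym n" "z = (u \<circ> g, w \<circ> g)" by blast
      have "inj_on (\<lambda>p. (u (g p), w (g p))) {..<n}"
      proof -
        have "inj_on ((\<lambda>p. (u p, w p)) \<circ> g) {..<n}"
          by (rule comp_inj_on) (use inj g(1) in \<open>auto simp: Sym_def permutes_inj_on permutes_image\<close>)
        then show ?thesis by (simp add: comp_def)
      qed
      then show "z \<in> ipairs N n v (cj v)"
        using g uwj by (auto simp: ipairs_def jwords_def word_comp content_comp)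
    next
      fix z assume z: "z \<in> ipairs N n v (cj v)"
      obtain u' w' where z': "z = (u', w')" by fastforce
      let ?e = "restrict (\<lambda>p. (u p, w p)) {..<n}" and ?e' = "restrict (\<lambda>p. (u' p, w' p)) {..<n}"
      have inj': "inj_on (\<lambda>p. (u' p, w' p)) {..<n}" and uwj': "u' \<in> jwords N n v" "w' \<in> jwords N n (cj v)"
        using z z' by (auto simp: ipairs_def)
      have cont: "content n (restrict f {..<n}) c = of_bool (c \<in> f ` {..<n})" if f: "inj_on f {..<n}" for f :: "nat \<Rightarrow> nat \<times> nat" and c
      proof (cases "c \<in> f ` {..<n}")
        case True
        then obtain p where p: "p < n" "c = f p" by auto
        then have "{i. i < n \<and> restrict f {..<n} i = c} = {p}" using f by (auto dest: inj_onD)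
        then show ?thesis using True by (simp add: content_def)
      next
        case False
        then have "{i. i < n \<and> restrict f {..<n} i = c} = {}" by auto
        then show ?thesis using False by (simp only: content_def card.empty) simp
      qed
      have im: "(\<lambda>p. (u p, w p)) ` {..<n} = (\<lambda>p. (u' p, w' p)) ` {..<n}"
        using ipairs_image[OF uw assms] ipairs_image[OF z[unfolded z'] assms] by simp
      have "content n ?e' = content n ?e" by (rule ext) (simp add: cont inj inj' im)
      moreover have "?e \<in> {..<n} \<rightarrow>\<^sub>E UNIV" "?e' \<in> {..<n} \<rightarrow>\<^sub>E UNIV" by auto
      ultimately obtain g where g: "g \<in> Sym n" "?e' = ?e \<circ> g" using content_eq_conj by blast
      have "u' p = u (g p) \<and> w' p = w (g p)" for p
      proof (cases "p < n")
        case True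
        then show ?thesis using fun_cong[OF g(2), of p] Sym_less[OF g(1) True] by simp
      next
        case False
        then show ?thesis using Sym_ge[OF g(1), of p] uwj uwj' by (auto simp: jwords_def PiE_iff extensional_def)
      qed
      then have "z = (u \<circ> g, w \<circ> g)" by (auto simp: z' fun_eq_iff)
      then show "z \<in> (\<lambda>g. (u \<circ> g, w \<circ> g)) ` Sym n" using g(1) by blast
    qed
  qed
  from bij_betw_same_card[OF this] show ?thesis by (simp add: card_Sym)
qed

lemma sg_chi: "sg g * chi N n v g = (\<Sum>b\<in>Par n. real_of_int (invK N n v b) * (sg g * pc N n b g))"
  by (simp add: chi_def sum_distrib_left mult_ac)

text \<open>By triangularity and \<open>ipairs_eq\<close> the inner product of the two sides has a
  single nonzero term, which is 1. Both sides have norm 1, so the difference has squared norm 1 - 2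
  + 1 = 0.\<close>

theorem chi_conjugate:
  assumes "v \<in> Par n" "n \<le> N" "g \<in> Sym n"
  shows "chi N n v g = sg g * chi N n (cj v) g"
proof -
  let ?s = "\<lambda>g. sg g * chi N n (cj v) g"
  have cv: "cj v \<in> Par n" using assms(1) by (rule cj_Par)
  have tm: "real_of_int (invK N n v a) * (real_of_int (invK N n (cj v) b) * (real (card (ipairs N n a b)) / fact n))
     = (if a = v then if b = cj v then 1 else 0 else 0)" if ab: "a \<in> Par n" "b \<in> Par n" for a b
  proof (cases "a = v \<and> b = cj v")
    case True
    then show ?thesis using invK(1)[OF assms(2,1)] invK(1)[OF assms(2) cv] card_ipairs[OF assms(1,2)] by simp
  next
    case False
    have "invK N n v a = 0 \<or> invK N n (cj v) b = 0 \<or> ipairs N n a b = {}"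
    proof (rule ccontr)
      assume *: "\<not> ?thesis"
      then obtain u w where "(u, w) \<in> ipairs N n a b" by (metis ex_in_conv surj_pair)
      moreover have "dom a v" "dom b (cj v)" using * invK(2)[OF assms(2,1)] invK(2)[OF assms(2) cv] by auto
      ultimately show False using ipairs_eq[of u w N n a b v] ab assms(1,2) False by blast
    qed
    then show ?thesis using False by auto
  qed
  have "ip n (chi N n v) ?s = (\<Sum>a\<in>Par n. real_of_int (invK N n v a) * ip n (pc N n a) ?s)"
    unfolding chi_def[of N n v] by (rule ip_sum)
  also have "\<dots> = (\<Sum>a\<in>Par n. \<Sum>b\<in>Par n. real_of_int (invK N n v a) * (real_of_int (invK N n (cj v) b) * (real (card (ipairs N n a b)) / fact n)))"
  proof (rule sum.cong[OF refl])
    fix a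
    have "ip n (pc N n a) ?s = (\<Sum>b\<in>Par n. real_of_int (invK N n (cj v) b) * ip n (\<lambda>g. sg g * pc N n b g) (pc N n a))"
      unfolding sg_chi ip_commute[of n "pc N n a"] by (rule ip_sum)
    then show "real_of_int (invK N n v a) * ip n (pc N n a) ?s = (\<Sum>b\<in>Par n. real_of_int (invK N n v a) * (real_of_int (invK N n (cj v) b) * (real (card (ipairs N n a b)) / fact n)))"
      by (simp add: ip_commute[of n _ "pc N n a"] ip_pc_sg_pc sum_distrib_left)
  qed
  also have "\<dots> = (\<Sum>a\<in>Par n. \<Sum>b\<in>Par n. if a = v then if b = cj v then 1 else 0 else 0)"
    using tm by (intro sum.cong refl) auto
  also have "\<dots> = (\<Sum>a\<in>Par n. if a = v then 1 else 0)" using cv by (intro sum.cong refl) auto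
  also have "\<dots> = 1" using assms(1) by simp
  finally have cross: "ip n (chi N n v) ?s = 1" .
  have norm: "ip n (chi N n v) (chi N n v) = 1" "ip n ?s ?s = 1"
    using ip_chi[OF assms(2,1,1)] ip_chi[OF assms(2) cv cv] by (simp_all add: ip_def mult_ac)
  define D where "D g = chi N n v g - ?s g" for g
  have lin: "ip n D h = ip n (chi N n v) h - ip n ?s h" for h
    unfolding D_def by (rule ip_diff)
  have "ip n D D = ip n D (chi N n v) - ip n D ?s"
    using lin[of D] ip_commute[of n D "chi N n v"] ip_commute[of n D ?s] by linarith
  also have "\<dots> = 0" 
    using lin[of "chi N n v"] lin[of ?s] cross norm ip_commute[of n ?s "chi N n v"] by linarith
  finally have "D g = 0" using assms(3) by (rule ip_definite)
  then show ?thesis by (simp add: D_def)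
qed

section \<open>Convolution of the dual class functions\<close>

lemma conv_sum_left: "conv n (\<lambda>g. \<Sum>i\<in>I. c i * f i g) h s = (\<Sum>i\<in>I. c i * conv n (f i) h s)"
  unfolding conv_def sum_distrib_right sum_distrib_left
  by (subst sum.swap) (simp add: mult_ac)
lemma conv_sum_right: "conv n h (\<lambda>g. \<Sum>i\<in>I. c i * f i g) s = (\<Sum>i\<in>I. c i * conv n h (f i) s)"
  unfolding conv_def sum_distrib_left
  by (subst sum.swap) (simp add: mult_ac)
lemma conv_cong: "s \<in> Sym n \<Longrightarrow> (\<And>g. g \<in> Sym n \<Longrightarrow> f g = f' g) \<Longrightarrow> (\<And>g. g \<in> Sym n \<Longrightarrow> h g = h' g) \<Longrightarrow>
   conv n f h s = conv n f' h' s"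
  unfolding conv_def by (intro sum.cong) auto

lemma conv_commute:
  assumes "\<And>g h. g \<in> Sym n \<Longrightarrow> h \<in> Sym n \<Longrightarrow> f (h \<circ> g \<circ> inv h) = f g" "s \<in> Sym n"
  shows "conv n f h s = conv n h f s"
proof -
  have e1: "inv (s \<circ> inv k) \<circ> s = k" if k: "k \<in> Sym n" for k
    by (simp add: Sym_inv_comp[OF assms(2) Sym_inv[OF k]] Sym_inv_inv[OF k] Sym_cancel(4)[OF assms(2)])
  have e2: "s \<circ> inv (inv k \<circ> s) = k" if k: "k \<in> Sym n" for k
    by (simp add: Sym_inv_comp[OF Sym_inv[OF k] assms(2)] Sym_inv_inv[OF k] Sym_cancel(1)[OF assms(2)])
  have "bij_betw (\<lambda>k. s \<circ> inv k) (Sym n) (Sym n)"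
    by (rule bij_betw_byWitness[where f'="\<lambda>k. inv k \<circ> s"]) 
       (use assms(2) e1 e2 Sym_inv Sym_comp in \<open>simp_all add: image_subset_iff\<close>)
  then have "conv n f h s = (\<Sum>k\<in>Sym n. f (s \<circ> inv k) * h (inv (s \<circ> inv k) \<circ> s))"
    unfolding conv_def by (rule sum.reindex_bij_betw[symmetric])
  also have "\<dots> = (\<Sum>k\<in>Sym n. h k * f (inv k \<circ> s))"
  proof (rule sum.cong[OF refl])
    fix k assume k: "k \<in> Sym n"
    have "k \<circ> (inv k \<circ> s) = s" by (rule Sym_cancel(1)[OF k])
    then have "f (s \<circ> inv k) = f (inv k \<circ> s)"
      using assms(1)[OF Sym_comp[OF Sym_inv[OF k] assms(2)] k] by simp
    then show "f (s \<circ> inv k) * h (inv (s \<circ> inv k) \<circ> s) = h k * f (inv k \<circ> s)" by (simp add: e1[OF k])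
  qed
  finally show ?thesis by (simp add: conv_def)
qed

text \<open>Rewriting the second factor by \<open>chi_conjugate\<close> brings in the sign. A
  surviving pair of contents must then admit an element of \<open>ipairs\<close>, and
  \<open>ipairs_dom\<close> compares the shapes.\<close>

lemma conv_chi_dom:
  assumes "l \<in> Par n" "v \<in> Par n" "n \<le> N" "s \<in> Sym n" "conv n (chi N n l) (chi N n v) s \<noteq> 0"
  shows "dom v l"
proof -
  have cv: "cj v \<in> Par n" using assms(2) by (rule cj_Par)
  have "conv n (chi N n l) (chi N n v) s = conv n (chi N n l) (\<lambda>g. sg g * chi N n (cj v) g) s"
    using assms by (intro conv_cong) (auto simp: chi_conjugate)
  also have "\<dots> = (\<Sum>a\<in>Par n. real_of_int (invK N n l a) * (\<Sum>b\<in>Par n. real_of_int (invK N n (cj v) b) * 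
     conv n (pc N n a) (\<lambda>g. sg g * pc N n b g) s))"
    unfolding chi_def[of N n l] sg_chi
    by (subst conv_sum_left, intro sum.cong refl arg_cong2[where f="(*)"], rule conv_sum_right)
  finally have "(\<Sum>a\<in>Par n. real_of_int (invK N n l a) * (\<Sum>b\<in>Par n. real_of_int (invK N n (cj v) b) * 
     conv n (pc N n a) (\<lambda>g. sg g * pc N n b g) s)) \<noteq> 0" using assms(5) by simp
  then obtain a b where ab: "a \<in> Par n" "b \<in> Par n" "invK N n l a \<noteq> 0" "invK N n (cj v) b \<noteq> 0" 
     "conv n (pc N n a) (\<lambda>g. sg g * pc N n b g) s \<noteq> 0"
    by (elim sum_nonzeroE) (auto elim!: sum_nonzeroE)
  then have "ipairs N n a b \<noteq> {}" using conv_pc_sg_pc_zero[OF _ assms(4)] by blast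
  then obtain u w where "(u, w) \<in> ipairs N n a b" by (metis ex_in_conv surj_pair)
  moreover have "dom a l" "dom b (cj v)" using invK(2)[OF assms(3,1) ab(3)] invK(2)[OF assms(3) cv ab(4)] by auto
  ultimately show ?thesis using ipairs_dom ab assms by blast
qed

text \<open>This takes the place of Schur's lemma. Class functions are central, so a nonzero product
  would be nonzero in both orders, and dominance would hold in both directions.\<close>

lemma conv_chi_zero:
  assumes "l \<in> Par n" "v \<in> Par n" "n \<le> N" "s \<in> Sym n" "l \<noteq> v"
  shows "conv n (chi N n l) (chi N n v) s = 0"
proof (rule ccontr)
  assume *: "conv n (chi N n l) (chi N n v) s \<noteq> 0"
  then have "dom v l" using conv_chi_dom assms by blast
  moreover have "conv n (chi N n v) (chi N n l) s \<noteq> 0"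
    using * conv_commute[of n "chi N n l" s "chi N n v"] chi_conj assms(4) by simp
  then have "dom l v" using conv_chi_dom assms by blast
  ultimately show False using dom_antisym assms(5) by blast
qed

section \<open>Class functions are determined by their pairing with permutation characters\<close>

lemma partitions_mset_eq:
  assumes "m \<in> partitions n" "r \<in> partitions n" "mset m = mset r" shows "m = r"
proof -
  have "sorted (rev m)" "sorted (rev r)"
    using assms by (auto simp: partitions_def is_partition_def sorted_wrt_rev)
  then have "rev m = rev r" using assms(3) by (metis mset_rev properties_for_sort)
  then show ?thesis by simp
qed

lemma partitions_length: assumes "m \<in> partitions n" shows "length m \<le> n"
proof -
  have "length m = (\<Sum>i\<leftarrow>m. 1)" by (simp add: sum_list_triv)
  also have "\<dots> \<le> (\<Sum>i\<leftarrow>m. i)" using assms by (intro sum_list_mono) (auto simp: partitions_def is_partition_def Suc_le_eq)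
  finally show ?thesis using assms by (simp add: partitions_def is_partition_def)
qed

lemma finite_partitions [simp]: "finite (partitions n)"
proof (rule finite_subset)
  show "partitions n \<subseteq> {m. set m \<subseteq> {..n} \<and> length m \<le> n}"
    using partitions_length member_le_sum_list by (fastforce simp: partitions_def is_partition_def)
qed (simp add: finite_lists_length_le)

lemma part_sum: "length m \<le> L \<Longrightarrow> (\<Sum>i<L. part m i) = sum_list m"
proof -
  assume "length m \<le> L"
  then have "(\<Sum>i<L. part m i) = (\<Sum>i<length m. part m i)"
    by (intro sum.mono_neutral_right) (auto simp: Defs.part_def)
  also have "\<dots> = (\<Sum>i<length m. m ! i)" by (simp add: Defs.part_def)
  finally show ?thesis by (simp add: sum_list_sum_nth lessThan_atLeast0)
qed

lemma part_exps: "m \<in> partitions n \<Longrightarrow> n \<le> N \<Longrightarrow> part m \<in> exps {..<N} n"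
  using partitions_length[of m n] part_sum[of m N]
  by (auto simp: exps_def partitions_def is_partition_def Defs.part_def)

text \<open>A fixed word is constant on each cycle; \<open>cs\<close> lists the colours of the
  cycles in order.\<close>

lemma fixed_word_colors:
  assumes "v \<circ> sig m = v"
  shows "\<exists>cs. length cs = length m \<and> (\<forall>c. content (sum_list m) v c = (\<Sum>i<length m. if cs ! i = c then m ! i else 0))"
  using assms
proof (induction m arbitrary: v)
  case Nil
  then show ?case by (simp add: content_def)
next
  case (Cons i m)
  have vg: "v (glue i (rot i) (sig m) j) = v j" for j using Cons.prems by (metis comp_apply sig.simps(2))
  have "(\<lambda>j. v (i + j)) \<circ> sig m = (\<lambda>j. v (i + j))"
  proof
    fix j show "((\<lambda>j. v (i + j)) \<circ> sig m) j = v (i + j)" using vg[of "i + j"] by (simp add: glue_def)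
  qed
  from Cons.IH[OF this] obtain cs where cs: "length cs = length m"
    "\<And>c. content (sum_list m) (\<lambda>j. v (i + j)) c = (\<Sum>k<length m. if cs ! k = c then m ! k else 0)" by blast
  have v0: "v j = v 0" if "j < i" for j using that
  proof (induction j)
    case (Suc j)
    then show ?case using vg[of j] by (simp add: glue_def rot_def)
  qed simp
  have "content (sum_list (i # m)) v c = (if v 0 = c then i else 0) + content (sum_list m) (\<lambda>j. v (i + j)) c" for c
  proof -
    have "{j. j < i + sum_list m \<and> v j = c} = {j. j < i \<and> v j = c} \<union> (\<lambda>j. i + j) ` {j. j < sum_list m \<and> v (i + j) = c}"
    proof (intro set_eqI iffI)
      fix j assume j: "j \<in> {j. j < i + sum_list m \<and> v j = c}"
      show "j \<in> {j. j < i \<and> v j = c} \<union> (\<lambda>j. i + j) ` {j. j < sum_list m \<and> v (i + j) = c}"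
      proof (cases "j < i")
        case False
        then have "j = i + (j - i)" "j - i < sum_list m" using j by auto
        then show ?thesis using j by (metis (mono_tags, lifting) UnI2 image_eqI mem_Collect_eq)
      qed (use j in simp)
    qed auto
    moreover have "{j. j < i \<and> v j = c} = (if v 0 = c then {..<i} else {})"
    proof -
      have "j < i \<and> v j = c \<longleftrightarrow> j < i \<and> v 0 = c" for j using v0[of j] by auto
      then show ?thesis by (auto simp: lessThan_def)
    qed
    moreover have "{j. j < i \<and> v j = c} \<inter> (\<lambda>j. i + j) ` {j. j < sum_list m \<and> v (i + j) = c} = {}" by auto
    ultimately show ?thesis by (simp add: content_def card_Un_disjoint card_image)
  qed
  then have "content (sum_list (i # m)) v c = (\<Sum>k<length (i # m). if (v 0 # cs) ! k = c then (i # m) ! k else 0)" for c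
    unfolding length_Cons sum.lessThan_Suc_shift
    by (simp add: cs(2) cong: if_cong)
  moreover have "length (v 0 # cs) = length (i # m)" using cs(1) by simp
  ultimately show ?case by blast
qed

text \<open>All of the \<open>length m\<close> colours must occur on the at most
  \<open>length m\<close> cycles of \<open>sig r\<close>. So each colour belongs to exactly one
  cycle, and the colouring matches the parts of the two partitions.\<close>

lemma fixed_word_type:
  assumes "m \<in> partitions n" "r \<in> partitions n" "v \<circ> sig r = v" "content n v = part m" "length r \<le> length m"
  shows "r = m"
proof -
  have s: "sum_list m = n" "sum_list r = n" "\<And>i. i \<in> set m \<Longrightarrow> 0 < i" "\<And>i. i \<in> set r \<Longrightarrow> 0 < i"
    using assms(1,2) by (auto simp: partitions_def is_partition_def)
  obtain cs where cs: "length cs = length r" "\<And>c. content n v c = (\<Sum>i<length r. if cs ! i = c then r ! i else 0)"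
    using fixed_word_colors[OF assms(3)] s(2) by blast
  have mem: "c \<in> set cs" if "c < length m" for c
  proof -
    have "content n v c \<noteq> 0" using that s(3)[of "m ! c"] by (simp add: assms(4) Defs.part_def)
    then obtain i where "i < length r" "cs ! i = c" unfolding cs(2) by (elim sum_nonzeroE) (auto split: if_splits)
    then show ?thesis using cs(1) by (metis nth_mem)
  qed
  have sub: "{..<length m} \<subseteq> set cs" using mem by auto
  then have "length m \<le> card (set cs)" using card_mono[OF _ sub] by simp
  then have cd: "card (set cs) = length cs" "length r = length m" using card_length[of cs] cs(1) assms(5) by auto
  then have dist: "distinct cs" by (simp add: card_distinct)
  have set: "set cs = {..<length m}" using sub cd cs(1) by (metis List.finite_set card_lessThan card_subset_eq)
  have nth: "m ! (cs ! i) = r ! i" if i: "i < length r" for i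
  proof -
    have ci: "cs ! i < length m" using i set cs(1) nth_mem by fastforce
    have "m ! (cs ! i) = content n v (cs ! i)" using ci by (simp add: assms(4) Defs.part_def)
    also have "\<dots> = (\<Sum>j<length r. if j = i then r ! j else 0)"
      unfolding cs(2) using dist i cs(1) by (intro sum.cong) (auto simp: nth_eq_iff_index_eq)
    finally show ?thesis using i by simp
  qed
  have "map (\<lambda>c. m ! c) cs = r" by (rule nth_equalityI) (use cs(1) nth in auto)
  then have "mset r = image_mset (\<lambda>c. m ! c) (mset cs)" by (metis mset_map)
  also have "mset cs = mset_set {..<length m}" using dist set by (metis mset_set_set)
  also have "image_mset (\<lambda>c. m ! c) (mset_set {..<length m}) = mset m" 
    by (metis map_nth mset_map mset_set_upto_eq_mset_upto)
  finally show ?thesis using partitions_mset_eq[OF assms(2,1)] by simp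
qed

text \<open>The number of the cycle of \<open>sig m\<close> that contains \<open>j\<close>. Read as
  a word it is fixed by \<open>sig m\<close> and has content \<open>part m\<close>.\<close>

primrec blk :: "nat list \<Rightarrow> nat \<Rightarrow> nat" where
  "blk [] j = 0"
| "blk (i # is) j = (if j < i then 0 else Suc (blk is (j - i)))"

lemma blk_sig: "j < sum_list m \<Longrightarrow> blk m (sig m j) = blk m j"
proof (induction m arbitrary: j)
  case (Cons i m)
  then show ?case by (auto simp: glue_def Sym_less[OF rot_Sym])
qed simp

lemma card_blk: "card {j. j < sum_list m \<and> blk m j = c} = part m c"
proof (induction m arbitrary: c)
  case (Cons i m)
  show ?case
  proof (cases c)
    case 0
    then have "{j. j < sum_list (i # m) \<and> blk (i # m) j = c} = {..<i}" by (auto split: if_splits)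
    then show ?thesis using 0 by (simp add: Defs.part_def)
  next
    case (Suc d)
    have "{j. j < sum_list (i # m) \<and> blk (i # m) j = c} = (\<lambda>j. i + j) ` {j. j < sum_list m \<and> blk m j = d}"
    proof (intro set_eqI iffI)
      fix j assume j: "j \<in> {j. j < sum_list (i # m) \<and> blk (i # m) j = c}"
      then have "j = i + (j - i)" "j - i \<in> {j. j < sum_list m \<and> blk m j = d}" using Suc by (auto split: if_splits)
      then show "j \<in> (\<lambda>j. i + j) ` {j. j < sum_list m \<and> blk m j = d}" by blast
    qed (use Suc in auto)
    then show ?thesis using Cons[of d] Suc by (simp add: card_image Defs.part_def)
  qed
qed (simp add: Defs.part_def)

lemma pc_sig_pos:
  assumes "m \<in> partitions n" "n \<le> N" shows "0 < pc N n (part m) (sig m)"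
proof -
  have s: "sum_list m = n" using assms(1) by (simp add: partitions_def is_partition_def)
  let ?v = "restrict (blk m) {..<n}"
  have sS: "sig m \<in> Sym n" using sig_Sym[of m] s by simp
  have fin: "finite {v. v \<in> {..<n} \<rightarrow>\<^sub>E {..<N} \<and> v \<circ> sig m = v \<and> content n v = part m}"
    by (rule finite_subset[of _ "{..<n} \<rightarrow>\<^sub>E {..<N}"]) auto
  have cont: "content n ?v = part m"
  proof
    fix c
    have "{j. j < n \<and> ?v j = c} = {j. j < sum_list m \<and> blk m j = c}" using s by auto
    then show "content n ?v c = part m c" by (simp add: content_def card_blk)
  qed
  have "blk m j < N" if "j < n" for j
  proof -
    have "j \<in> {i. i < sum_list m \<and> blk m i = blk m j}" using that s by simp
    then have "card {i. i < sum_list m \<and> blk m i = blk m j} \<noteq> 0" by (subst card_0_eq) auto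
    then have "part m (blk m j) \<noteq> 0" unfolding card_blk .
    then have "blk m j < length m" by (auto simp: Defs.part_def split: if_splits)
    then show ?thesis using partitions_length[OF assms(1)] assms(2) by simp
  qed
  then have "?v \<in> {..<n} \<rightarrow>\<^sub>E {..<N}" by auto
  moreover have "?v \<circ> sig m = ?v"
    unfolding Sym_fixes_word[OF sS] using blk_sig[of _ m] s Sym_less[OF sS] by auto
  ultimately have "?v \<in> {v. v \<in> {..<n} \<rightarrow>\<^sub>E {..<N} \<and> v \<circ> sig m = v \<and> content n v = part m}"
    using cont by simp
  then show ?thesis using fin unfolding pc_def by (metis (no_types, lifting) card_gt_0_iff empty_iff of_nat_0_less_iff)
qed

text \<open>A permutation fixing a word whose content has $k$ positive entries has at least $k$ cycles, and exactly $k$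
  only if its cycle type is that content. So the class in the support with the most cycles isolates itself.\<close>

lemma class_function_zero:
  assumes "n \<le> N" and cls: "\<And>g h. g \<in> Sym n \<Longrightarrow> h \<in> Sym n \<Longrightarrow> f (h \<circ> g \<circ> inv h) = f g"
    and orth: "\<And>a. a \<in> exps {..<N} n \<Longrightarrow> ip n f (pc N n a) = 0" and "g \<in> Sym n"
  shows "f g = 0"
proof (rule ccontr)
  assume nz: "f g \<noteq> 0"
  have type: "\<exists>m\<in>partitions n. f h = f (sig m) \<and> (\<forall>a. pc N n a h = pc N n a (sig m))" if h: "h \<in> Sym n" for h
  proof -
    obtain m k where m: "m \<in> partitions n" "k \<in> Sym n" "h = k \<circ> sig m \<circ> inv k" using conj_sig[OF h] by blast
    then have sS: "sig m \<in> Sym n" using sig_Sym[of m] by (simp add: partitions_def is_partition_def)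
    show ?thesis
      unfolding m(3) using cls[OF sS m(2)] pc_conj[OF sS m(2)] m(1) by auto
  qed
  define M where "M = {m \<in> partitions n. f (sig m) \<noteq> 0}"
  have "M \<noteq> {}" using type[OF assms(4)] nz by (auto simp: M_def)
  moreover have "finite M" by (simp add: M_def)
  ultimately have ne: "finite (length ` M)" "length ` M \<noteq> {}" by auto
  then obtain m where m0: "m \<in> M" "length m = Max (length ` M)" using Max_in by (metis (no_types, lifting) imageE)
  then have m: "m \<in> M" "\<And>r. r \<in> M \<Longrightarrow> length r \<le> length m" using Max_ge[OF ne(1)] by auto
  have mp: "m \<in> partitions n" using m by (simp add: M_def)
  have sS: "sig m \<in> Sym n" using sig_Sym[of m] mp by (simp add: partitions_def is_partition_def)
  let ?a = "part m"
  let ?d = "\<lambda>h. if f h = 0 then 0 else pc N n ?a h"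
  have eq: "f h * pc N n ?a h = f (sig m) * ?d h" if h: "h \<in> Sym n" for h
  proof (cases "f h = 0 \<or> pc N n ?a h = 0")
    case False
    obtain r where r: "r \<in> partitions n" "f h = f (sig r)" "pc N n ?a h = pc N n ?a (sig r)" using type[OF h] by blast
    then have "pc N n ?a (sig r) \<noteq> 0" using False by simp
    then obtain v where v: "v \<circ> sig r = v" "content n v = part m"
      unfolding pc_def by (metis (mono_tags, lifting) card.empty empty_Collect_eq of_nat_0)
    have "length r \<le> length m" using m(2)[of r] r False by (simp add: M_def)
    then have "r = m" using fixed_word_type[OF mp r(1) v] by simp
    then show ?thesis using r False by simp
  qed auto
  have "0 = (\<Sum>h\<in>Sym n. f h * pc N n ?a h)" using orth[OF part_exps[OF mp assms(1)]] by (simp add: ip_def)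
  also have "\<dots> = (\<Sum>h\<in>Sym n. f (sig m) * ?d h)" using eq by (intro sum.cong) auto
  also have "\<dots> = f (sig m) * (\<Sum>h\<in>Sym n. ?d h)" by (simp only: sum_distrib_left)
  finally have "(\<Sum>h\<in>Sym n. ?d h) = 0" using m(1) by (simp add: M_def)
  then have "\<forall>h\<in>Sym n. ?d h = 0" by (subst (asm) sum_nonneg_eq_0_iff) (auto simp: pc_def)
  then have "pc N n ?a (sig m) = 0" using sS m(1) by (auto simp: M_def)
  then show False using pc_sig_pos[OF mp assms(1)] by simp
qed


lemma conv_class:
  assumes f: "\<And>g h. g \<in> Sym n \<Longrightarrow> h \<in> Sym n \<Longrightarrow> f (h \<circ> g \<circ> inv h) = f g"
    and f': "\<And>g h. g \<in> Sym n \<Longrightarrow> h \<in> Sym n \<Longrightarrow> f' (h \<circ> g \<circ> inv h) = f' g"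
    and g: "g \<in> Sym n" and h: "h \<in> Sym n"
  shows "conv n f f' (h \<circ> g \<circ> inv h) = conv n f f' g"
proof -
  have "bij_betw (\<lambda>k. h \<circ> k \<circ> inv h) (Sym n) (Sym n)"
    by (rule bij_betw_byWitness[where f'="\<lambda>k. inv h \<circ> k \<circ> h"])
       (use h in \<open>auto simp: Sym_cancel comp_assoc Sym_inv_o intro!: Sym_comp Sym_inv\<close>)
  then have "conv n f f' (h \<circ> g \<circ> inv h) = (\<Sum>k\<in>Sym n. f (h \<circ> k \<circ> inv h) * f' (inv (h \<circ> k \<circ> inv h) \<circ> (h \<circ> g \<circ> inv h)))"
    unfolding conv_def by (rule sum.reindex_bij_betw[symmetric])
  also have "\<dots> = conv n f f' g"
    unfolding conv_def
  proof (rule sum.cong[OF refl])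
    fix k assume k: "k \<in> Sym n"
    have "inv (h \<circ> k \<circ> inv h) = h \<circ> (inv k \<circ> inv h)"
      by (simp only: Sym_inv_comp[OF Sym_comp[OF h k] Sym_inv[OF h]] Sym_inv_inv[OF h] Sym_inv_comp[OF h k])
    then have "inv (h \<circ> k \<circ> inv h) \<circ> (h \<circ> g \<circ> inv h) = h \<circ> (inv k \<circ> (inv h \<circ> (h \<circ> (g \<circ> inv h))))"
      by (simp only: comp_assoc)
    also have "\<dots> = h \<circ> (inv k \<circ> g) \<circ> inv h" by (simp only: Sym_cancel(2)[OF h] comp_assoc)
    finally show "f (h \<circ> k \<circ> inv h) * f' (inv (h \<circ> k \<circ> inv h) \<circ> (h \<circ> g \<circ> inv h)) = f k * f' (inv k \<circ> g)"
      using f[OF k h] f'[OF Sym_comp[OF Sym_inv[OF k] g] h] by simp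
  qed
  finally show ?thesis .
qed

lemma pc_ones:
  assumes "n \<le> N" "g \<in> Sym n" "g \<noteq> id"
  shows "pc N n (\<lambda>i. if i < n then 1 else 0) g = 0"
proof -
  have False if v: "v \<circ> g = v" "content n v = (\<lambda>i. if i < n then 1 else 0)" for v
  proof -
    obtain p where p: "g p \<noteq> p" using assms(3) by (metis eq_id_iff)
    then have pn: "p < n" using Sym_ge[OF assms(2)] by (meson not_le)
    have "{p, g p} \<subseteq> {i. i < n \<and> v i = v p}" using pn Sym_less[OF assms(2) pn] v(1) by (auto, metis comp_apply)
    then have "card {p, g p} \<le> content n v (v p)" unfolding content_def by (intro card_mono) auto
    also have "\<dots> \<le> 1" unfolding v(2) by simp
    finally show False using p by simp
  qed
  then show ?thesis by (simp add: pc_def) (metis (mono_tags, lifting) card.empty empty_Collect_eq)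
qed

text \<open>Only the identity fixes a word with distinct letters. Pairing with the content
  \<open>?a\<close> therefore isolates the value at the identity, and the result is a Kostka
  number.\<close>

lemma chi_id_nonneg: assumes "n \<le> N" "v \<in> Par n" shows "0 \<le> chi N n v id"
proof -
  let ?a = "\<lambda>i. if i < n then 1 else (0::nat)"
  have a: "?a \<in> exps {..<N} n"
  proof -
    have "(\<Sum>i<N. ?a i) = (\<Sum>i<n. 1)" using assms(1) by (intro sum.mono_neutral_cong_right) auto
    then show ?thesis using assms(1) by (simp add: exps_def)
  qed
  obtain w where w: "w \<in> {..<n} \<rightarrow>\<^sub>E {..<N}" "content n w = ?a" using word_exists[OF _ a] by auto
  have fin: "finite {v. v \<in> {..<n} \<rightarrow>\<^sub>E {..<N} \<and> v \<circ> id = v \<and> content n v = ?a}"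
    by (rule finite_subset[of _ "{..<n} \<rightarrow>\<^sub>E {..<N}"]) auto
  have "w \<in> {v. v \<in> {..<n} \<rightarrow>\<^sub>E {..<N} \<and> v \<circ> id = v \<and> content n v = ?a}" using w by simp
  then have pos: "0 < pc N n ?a id" using fin unfolding pc_def by (metis (no_types, lifting) card_gt_0_iff empty_iff of_nat_0_less_iff)
  have "(\<Sum>g\<in>Sym n. chi N n v g * pc N n ?a g) = (\<Sum>g\<in>Sym n. if g = id then chi N n v id * pc N n ?a id else 0)"
    using pc_ones[OF assms(1)] by (intro sum.cong) auto
  also have "\<dots> = chi N n v id * pc N n ?a id" by (simp only: sum.delta[OF Sym_finite] Sym_id if_True)
  finally have "chi N n v id * pc N n ?a id = fact n * real (K N v ?a)"
    using ip_chi_pc[OF assms a] by (simp add: ip_def field_simps)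
  then have "0 \<le> chi N n v id * pc N n ?a id" by simp
  then show ?thesis using pos by (simp add: zero_le_mult_iff)
qed

text \<open>By \<open>conv_chi_zero\<close> the convolution square is orthogonal to every other
  \<open>chi\<close>. Removing its component along \<open>?X\<close> leaves a class function
  orthogonal to all permutation characters, which vanishes by \<open>class_function_zero\<close>.
  The sign of \<open>c\<close> is read off at the identity, where the square takes the value
  \<open>fact n\<close>.\<close>

theorem chi_idempotent:
  assumes nN: "n \<le> N" and v: "v \<in> Par n"
  obtains c where "0 < c" "\<And>g. g \<in> Sym n \<Longrightarrow> conv n (chi N n v) (chi N n v) g = c * chi N n v g"
proof -
  let ?X = "chi N n v"
  define c where "c = ip n (conv n ?X ?X) ?X"
  define f where "f g = conv n ?X ?X g - c * ?X g" for g
  have cross: "ip n (conv n ?X ?X) (chi N n l) = 0" if l: "l \<in> Par n" "l \<noteq> v" for l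
  proof -
    have "(\<Sum>s\<in>Sym n. conv n ?X ?X s * chi N n l s) = (\<Sum>g\<in>Sym n. ?X g * (\<Sum>s\<in>Sym n. ?X (inv g \<circ> s) * chi N n l s))"
      unfolding conv_def sum_distrib_right sum_distrib_left by (subst sum.swap) (simp add: mult_ac)
    also have "\<dots> = (\<Sum>g\<in>Sym n. ?X g * conv n (chi N n l) ?X g)"
    proof (rule sum.cong[OF refl])
      fix g assume g: "g \<in> Sym n"
      have "?X (inv g \<circ> s) = ?X (inv s \<circ> g)" if s: "s \<in> Sym n" for s
        using chi_inv[OF Sym_comp[OF Sym_inv[OF g] s], of N v] 
        by (simp only: Sym_inv_comp[OF Sym_inv[OF g] s] Sym_inv_inv[OF g])
      then have "(\<Sum>s\<in>Sym n. ?X (inv g \<circ> s) * chi N n l s) = (\<Sum>s\<in>Sym n. chi N n l s * ?X (inv s \<circ> g))"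
        by (intro sum.cong) auto
      then show "?X g * (\<Sum>s\<in>Sym n. ?X (inv g \<circ> s) * chi N n l s) = ?X g * conv n (chi N n l) ?X g"
        unfolding conv_def by simp
    qed
    also have "\<dots> = 0" using conv_chi_zero[OF l(1) v nN _ l(2)] by simp
    finally show ?thesis by (simp add: ip_def)
  qed
  have ipf: "ip n f h = ip n (conv n ?X ?X) h - c * ip n ?X h" for h
    unfolding f_def by (simp only: ip_diff ip_scale)
  have fl: "ip n (chi N n l) f = 0" if l: "l \<in> Par n" for l
    unfolding ip_commute[of n _ f] ipf using cross[OF l] ip_chi[OF nN v l] by (cases "l = v") (auto simp: c_def)
  have "f g = 0" if g: "g \<in> Sym n" for g
  proof (rule class_function_zero[OF nN _ _ g])
    show "f (h \<circ> g \<circ> inv h) = f g" if "g \<in> Sym n" "h \<in> Sym n" for g h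
      unfolding f_def using conv_class[of n ?X ?X g h] chi_conj that by simp
    fix a assume a: "a \<in> exps {..<N} n"
    have "ip n f (pc N n a) = ip n (\<lambda>g. \<Sum>l\<in>Par n. real (K N l a) * chi N n l g) f"
      unfolding ip_commute[of n f] using pc_eq_chi[OF nN a] by (simp add: ip_def)
    also have "\<dots> = 0" unfolding ip_sum using fl by simp
    finally show "ip n f (pc N n a) = 0" .
  qed
  then have eq: "conv n ?X ?X g = c * ?X g" if "g \<in> Sym n" for g using that by (simp add: f_def)
  have "conv n ?X ?X id = (\<Sum>g\<in>Sym n. ?X g * ?X g)" unfolding conv_def using chi_inv by (intro sum.cong) auto
  also have "\<dots> = fact n" using ip_chi[OF nN v v] by (simp add: ip_def)
  finally have "0 < c * ?X id" using eq[of id] by simp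
  then have "0 < c" using chi_id_nonneg[OF nN v] by (simp add: zero_less_mult_iff)
  then show ?thesis using that eq by blast
qed

text \<open>Reparametrizing the convolution square turns it into a Gram matrix over the index
  \<open>k\<close>: the kernel in \<open>a\<close> and \<open>b\<close> is positive
  semidefinite.\<close>

lemma chi_convolution:
  assumes "n \<le> N" "v \<in> Par n"
  obtains c where "0 < c" "\<And>a b. a \<in> Sym n \<Longrightarrow> b \<in> Sym n \<Longrightarrow>
     c * chi N n v (inv a \<circ> b) = (\<Sum>k\<in>Sym n. chi N n v (inv k \<circ> a) * chi N n v (inv k \<circ> b))"
proof -
  let ?X = "chi N n v"
  obtain c where c: "0 < c" "\<And>g. g \<in> Sym n \<Longrightarrow> conv n ?X ?X g = c * ?X g" using chi_idempotent[OF assms] by blast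
  have "c * ?X (inv a \<circ> b) = (\<Sum>k\<in>Sym n. ?X (inv k \<circ> a) * ?X (inv k \<circ> b))" if a: "a \<in> Sym n" and b: "b \<in> Sym n" for a b
  proof -
    have "c * ?X (inv a \<circ> b) = (\<Sum>k\<in>Sym n. ?X k * ?X (inv k \<circ> (inv a \<circ> b)))"
      using c(2)[OF Sym_comp[OF Sym_inv[OF a] b]] by (simp add: conv_def)
    also have "\<dots> = (\<Sum>k\<in>Sym n. ?X (inv a \<circ> k) * ?X (inv (inv a \<circ> k) \<circ> (inv a \<circ> b)))"
      by (rule sum_Sym_left[OF Sym_inv[OF a], symmetric])
    also have "\<dots> = (\<Sum>k\<in>Sym n. ?X (inv k \<circ> a) * ?X (inv k \<circ> b))"
    proof (rule sum.cong[OF refl])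
      fix k assume k: "k \<in> Sym n"
      have i: "inv (inv a \<circ> k) = inv k \<circ> a" by (simp only: Sym_inv_comp[OF Sym_inv[OF a] k] Sym_inv_inv[OF a])
      then have "?X (inv a \<circ> k) = ?X (inv k \<circ> a)" using chi_inv[OF Sym_comp[OF Sym_inv[OF a] k], of N v] by simp
      moreover have "inv (inv a \<circ> k) \<circ> (inv a \<circ> b) = inv k \<circ> b" unfolding i by (simp only: comp_assoc Sym_cancel(1)[OF a])
      ultimately show "?X (inv a \<circ> k) * ?X (inv (inv a \<circ> k) \<circ> (inv a \<circ> b)) = ?X (inv k \<circ> a) * ?X (inv k \<circ> b)" by simp
    qed
    finally show ?thesis .
  qed
  then show ?thesis using that c(1) by blast
qed

text \<open>Real coefficients admit averages over groups and rational certificates. The number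
  \<open>N\<close> of variables is separate from the degree \<open>n\<close>, since factors of
  smaller degree must live in the same variables.\<close>

definition SP :: "nat \<Rightarrow> nat \<Rightarrow> ((nat \<Rightarrow> real) \<Rightarrow> real) \<Rightarrow> bool" where
  "SP N n F \<longleftrightarrow> (\<exists>c. (\<forall>l. 0 \<le> c l) \<and> (\<forall>x. F x = (\<Sum>l\<in>Par n. c l * S N l x)))"

lemma SPI: "(\<And>l. l \<in> Par n \<Longrightarrow> 0 \<le> c l) \<Longrightarrow> (\<And>x. F x = (\<Sum>l\<in>Par n. c l * S N l x)) \<Longrightarrow> SP N n F"
  unfolding SP_def by (rule exI[of _ "\<lambda>l. if l \<in> Par n then c l else 0"]) auto

lemma SP_add: assumes "SP N n F" "SP N n G" shows "SP N n (\<lambda>x. F x + G x)"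
proof -
  from assms obtain c d where c: "\<forall>l. 0 \<le> c l" "\<forall>x. F x = (\<Sum>l\<in>Par n. c l * S N l x)"
    and d: "\<forall>l. 0 \<le> d l" "\<forall>x. G x = (\<Sum>l\<in>Par n. d l * S N l x)" unfolding SP_def by blast
  show ?thesis by (rule SPI[of n "\<lambda>l. c l + d l"]) (use c d in \<open>auto simp: distrib_right sum.distrib\<close>)
qed

lemma SP_scale: assumes "SP N n F" "0 \<le> a" shows "SP N n (\<lambda>x. a * F x)"
proof -
  from assms obtain c where c: "\<forall>l. 0 \<le> c l" "\<forall>x. F x = (\<Sum>l\<in>Par n. c l * S N l x)" unfolding SP_def by blast
  show ?thesis by (rule SPI[of n "\<lambda>l. a * c l"]) (use c assms(2) in \<open>auto simp: sum_distrib_left mult_ac\<close>)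
qed

lemma SP_zero: "SP N n (\<lambda>x. 0)"
  by (rule SPI[of n "\<lambda>_. 0"]) auto

lemma SP_sum: "(\<And>i. i \<in> I \<Longrightarrow> SP N n (F i)) \<Longrightarrow> SP N n (\<lambda>x. \<Sum>i\<in>I. F i x)"
  by (induction I rule: infinite_finite_induct) (auto intro: SP_zero SP_add)

lemma SP_schur: "l \<in> Par n \<Longrightarrow> SP N n (S N l)"
  by (rule SPI[of n "\<lambda>m. if m = l then 1 else 0"]) (auto simp: if_distrib[of "\<lambda>t. t * _"] cong: if_cong)

text \<open>The coefficient of each Schur polynomial is a quadratic form in \<open>y\<close> whose
  kernel is positive semidefinite by \<open>chi_convolution\<close>. The positivity of class
  actions, of dihedral characters and of products all comes from here.\<close>

theorem SP_gram:
  assumes nN: "n \<le> N" and I: "finite I" "\<And>i. i \<in> I \<Longrightarrow> t i \<in> Sym n"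
  shows "SP N n (\<lambda>x. \<Sum>i\<in>I. \<Sum>j\<in>I. y i * y j * P N n (inv (t i) \<circ> t j) x)"
proof (rule SPI)
  fix x
  have "(\<Sum>i\<in>I. \<Sum>j\<in>I. y i * y j * P N n (inv (t i) \<circ> t j) x) = 
     (\<Sum>i\<in>I. \<Sum>j\<in>I. \<Sum>l\<in>Par n. y i * y j * chi N n l (inv (t i) \<circ> t j) * S N l x)"
    using I nN by (intro sum.cong refl) (simp add: P_eq_chi Sym_comp Sym_inv sum_distrib_left mult_ac)
  also have "\<dots> = (\<Sum>i\<in>I. \<Sum>l\<in>Par n. \<Sum>j\<in>I. y i * y j * chi N n l (inv (t i) \<circ> t j) * S N l x)"
    by (intro sum.cong refl) (rule sum.swap)
  also have "\<dots> = (\<Sum>l\<in>Par n. \<Sum>i\<in>I. \<Sum>j\<in>I. y i * y j * chi N n l (inv (t i) \<circ> t j) * S N l x)"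
    by (rule sum.swap)
  also have "\<dots> = (\<Sum>l\<in>Par n. (\<Sum>i\<in>I. \<Sum>j\<in>I. y i * y j * chi N n l (inv (t i) \<circ> t j)) * S N l x)"
    by (simp add: sum_distrib_right)
  finally show "(\<Sum>i\<in>I. \<Sum>j\<in>I. y i * y j * P N n (inv (t i) \<circ> t j) x) = \<dots>" .
next
  fix l assume l: "l \<in> Par n"
  obtain c where c: "0 < c" "\<And>a b. a \<in> Sym n \<Longrightarrow> b \<in> Sym n \<Longrightarrow>
     c * chi N n l (inv a \<circ> b) = (\<Sum>k\<in>Sym n. chi N n l (inv k \<circ> a) * chi N n l (inv k \<circ> b))"
    using chi_convolution[OF nN l] by blast
  have "c * (\<Sum>i\<in>I. \<Sum>j\<in>I. y i * y j * chi N n l (inv (t i) \<circ> t j)) = 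
     (\<Sum>i\<in>I. \<Sum>j\<in>I. y i * y j * (c * chi N n l (inv (t i) \<circ> t j)))"
    by (simp add: sum_distrib_left mult_ac)
  also have "\<dots> = (\<Sum>i\<in>I. \<Sum>j\<in>I. \<Sum>k\<in>Sym n. (y i * chi N n l (inv k \<circ> t i)) * (y j * chi N n l (inv k \<circ> t j)))"
    using I by (intro sum.cong refl) (simp add: c(2) sum_distrib_left mult_ac)
  also have "\<dots> = (\<Sum>i\<in>I. \<Sum>k\<in>Sym n. \<Sum>j\<in>I. (y i * chi N n l (inv k \<circ> t i)) * (y j * chi N n l (inv k \<circ> t j)))"
    by (intro sum.cong refl) (rule sum.swap)
  also have "\<dots> = (\<Sum>k\<in>Sym n. \<Sum>i\<in>I. \<Sum>j\<in>I. (y i * chi N n l (inv k \<circ> t i)) * (y j * chi N n l (inv k \<circ> t j)))"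
    by (rule sum.swap)
  also have "\<dots> = (\<Sum>k\<in>Sym n. (\<Sum>i\<in>I. y i * chi N n l (inv k \<circ> t i))\<^sup>2)"
    by (simp only: sum_product power2_eq_square)
  also have "\<dots> \<ge> 0" by (intro sum_nonneg) auto
  finally show "0 \<le> (\<Sum>i\<in>I. \<Sum>j\<in>I. y i * y j * chi N n l (inv (t i) \<circ> t j))"
    using c(1) by (simp add: zero_le_mult_iff)
qed

text \<open>By \<open>chi_idempotent\<close> a Schur polynomial is itself a Gram form up to a
  positive factor, with its own \<open>chi\<close> as weights. This is the input for
  products.\<close>

lemma schur_gram:
  assumes "n \<le> N" "v \<in> Par n"
  obtains c where "0 < c" "\<And>x. c * S N v x = (\<Sum>g\<in>Sym n. \<Sum>h\<in>Sym n. chi N n v g * chi N n v h * P N n (inv g \<circ> h) x)"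
proof -
  let ?X = "chi N n v"
  obtain c where c: "0 < c" "\<And>g. g \<in> Sym n \<Longrightarrow> conv n ?X ?X g = c * ?X g" using chi_idempotent[OF assms] by blast
  have "c * fact n * S N v x = (\<Sum>g\<in>Sym n. \<Sum>h\<in>Sym n. ?X g * ?X h * P N n (inv g \<circ> h) x)" for x
  proof -
    have "c * fact n * S N v x = (\<Sum>g\<in>Sym n. c * ?X g * P N n g x)"
      using schur_eq_chi[OF assms, of x] by (simp add: sum_distrib_left mult_ac)
    also have "\<dots> = (\<Sum>g\<in>Sym n. \<Sum>k\<in>Sym n. ?X k * ?X (inv k \<circ> g) * P N n g x)"
      by (intro sum.cong refl) (simp add: c(2)[symmetric] conv_def sum_distrib_right)
    also have "\<dots> = (\<Sum>k\<in>Sym n. \<Sum>g\<in>Sym n. ?X k * ?X (inv k \<circ> g) * P N n g x)" by (rule sum.swap)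
    also have "\<dots> = (\<Sum>k\<in>Sym n. \<Sum>g\<in>Sym n. ?X k * ?X g * P N n (k \<circ> g) x)"
    proof (rule sum.cong[OF refl])
      fix k assume k: "k \<in> Sym n"
      show "(\<Sum>g\<in>Sym n. ?X k * ?X (inv k \<circ> g) * P N n g x) = (\<Sum>g\<in>Sym n. ?X k * ?X g * P N n (k \<circ> g) x)"
        by (subst sum_Sym_left[OF k, symmetric]) (simp add: Sym_cancel(2)[OF k])
    qed
    also have "\<dots> = (\<Sum>k\<in>Sym n. \<Sum>g\<in>Sym n. ?X k * ?X g * P N n (inv k \<circ> g) x)"
      by (subst sum_Sym_inv[symmetric]) (simp add: chi_inv)
    finally show ?thesis .
  qed
  then show ?thesis using that[of "c * fact n"] c(1) by simp
qed

text \<open>The product of two Gram forms is a Gram form over the product of the index sets,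
  realized through \<open>glue\<close> in the larger symmetric group. So Littlewood-Richardson
  coefficients are nonnegative without any rule for them.\<close>

theorem SP_schur_mult:
  assumes l: "l \<in> Par k" and v: "v \<in> Par m" and N: "k + m \<le> N"
  shows "SP N (k + m) (\<lambda>x. S N l x * S N v x)"
proof -
  have kN: "k \<le> N" "m \<le> N" using N by auto
  let ?X = "chi N k l" and ?Y = "chi N m v"
  obtain c where c: "0 < c" "\<And>x. c * S N l x = (\<Sum>g\<in>Sym k. \<Sum>h\<in>Sym k. ?X g * ?X h * P N k (inv g \<circ> h) x)"
    using schur_gram[OF kN(1) l] by blast
  obtain d where d: "0 < d" "\<And>x. d * S N v x = (\<Sum>g\<in>Sym m. \<Sum>h\<in>Sym m. ?Y g * ?Y h * P N m (inv g \<circ> h) x)"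
    using schur_gram[OF kN(2) v] by blast
  let ?I = "Sym k \<times> Sym m"
  have "SP N (k + m) (\<lambda>x. \<Sum>i\<in>?I. \<Sum>j\<in>?I. (?X (fst i) * ?Y (snd i)) * (?X (fst j) * ?Y (snd j)) * 
      P N (k + m) (inv (glue k (fst i) (snd i)) \<circ> glue k (fst j) (snd j)) x)"
    by (rule SP_gram) (use N in \<open>auto intro: glue_Sym\<close>)
  moreover have "(\<Sum>i\<in>?I. \<Sum>j\<in>?I. (?X (fst i) * ?Y (snd i)) * (?X (fst j) * ?Y (snd j)) * 
      P N (k + m) (inv (glue k (fst i) (snd i)) \<circ> glue k (fst j) (snd j)) x) = (c * d) * (S N l x * S N v x)" for x
  proof -
    have "(\<Sum>i\<in>?I. \<Sum>j\<in>?I. (?X (fst i) * ?Y (snd i)) * (?X (fst j) * ?Y (snd j)) * 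
      P N (k + m) (inv (glue k (fst i) (snd i)) \<circ> glue k (fst j) (snd j)) x) =
      (\<Sum>i\<in>?I. \<Sum>j\<in>?I. (?X (fst i) * ?X (fst j) * P N k (inv (fst i) \<circ> fst j) x) * (?Y (snd i) * ?Y (snd j) * P N m (inv (snd i) \<circ> snd j) x))"
    proof (intro sum.cong refl)
      fix i j assume "i \<in> ?I" "j \<in> ?I"
      then have m: "fst i \<in> Sym k" "snd i \<in> Sym m" "fst j \<in> Sym k" "snd j \<in> Sym m" by auto
      have "inv (glue k (fst i) (snd i)) \<circ> glue k (fst j) (snd j) = glue k (inv (fst i) \<circ> fst j) (inv (snd i) \<circ> snd j)"
        using m by (simp add: glue_inv glue_comp)
      then show "(?X (fst i) * ?Y (snd i)) * (?X (fst j) * ?Y (snd j)) * 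
        P N (k + m) (inv (glue k (fst i) (snd i)) \<circ> glue k (fst j) (snd j)) x = 
        (?X (fst i) * ?X (fst j) * P N k (inv (fst i) \<circ> fst j) x) * (?Y (snd i) * ?Y (snd j) * P N m (inv (snd i) \<circ> snd j) x)"
        using m by (simp add: wts_glue Sym_comp Sym_inv)
    qed
    also have "\<dots> = (\<Sum>g\<in>Sym k. \<Sum>g'\<in>Sym m. \<Sum>h\<in>Sym k. \<Sum>h'\<in>Sym m. 
       (?X g * ?X h * P N k (inv g \<circ> h) x) * (?Y g' * ?Y h' * P N m (inv g' \<circ> h') x))"
      by (simp only: sum.cartesian_product' fst_conv snd_conv)
    also have "\<dots> = (\<Sum>g\<in>Sym k. \<Sum>h\<in>Sym k. ?X g * ?X h * P N k (inv g \<circ> h) x) * 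
      (\<Sum>g\<in>Sym m. \<Sum>h\<in>Sym m. ?Y g * ?Y h * P N m (inv g \<circ> h) x)"
      by (simp only: sum_product)
    finally show ?thesis by (simp only: c(2)[symmetric] d(2)[symmetric]) (simp add: mult_ac)
  qed
  ultimately have "SP N (k + m) (\<lambda>x. (c * d) * (S N l x * S N v x))" by simp
  from SP_scale[OF this, of "1 / (c * d)"] show ?thesis using c(1) d(1) by simp
qed

theorem SP_mult:
  assumes "SP N k F" "SP N m G" "k + m \<le> N"
  shows "SP N (k + m) (\<lambda>x. F x * G x)"
proof -
  from assms obtain c d where c: "\<forall>l. 0 \<le> c l" "\<forall>x. F x = (\<Sum>l\<in>Par k. c l * S N l x)"
    and d: "\<forall>l. 0 \<le> d l" "\<forall>x. G x = (\<Sum>l\<in>Par m. d l * S N l x)" unfolding SP_def by blast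
  have "SP N (k + m) (\<lambda>x. \<Sum>l\<in>Par k. \<Sum>v\<in>Par m. (c l * d v) * (S N l x * S N v x))"
    using c d assms(3) by (intro SP_sum SP_scale SP_schur_mult) auto
  moreover have "F x * G x = (\<Sum>l\<in>Par k. \<Sum>v\<in>Par m. (c l * d v) * (S N l x * S N v x))" for x
    using c d by (simp add: sum_product mult_ac)
  ultimately show ?thesis by simp
qed

section \<open>Centralizers\<close>

definition cent :: "nat \<Rightarrow> (nat \<Rightarrow> nat) \<Rightarrow> (nat \<Rightarrow> nat) set" where
  "cent n g = {h \<in> Sym n. g \<circ> h = h \<circ> g}"

text \<open>The Frobenius characteristic of the permutation action on the conjugacy class of cycle type $m$.\<close>

definition cyc :: "nat \<Rightarrow> nat list \<Rightarrow> (nat \<Rightarrow> real) \<Rightarrow> real" where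
  "cyc N m x = (\<Sum>h\<in>cent (sum_list m) (sig m). P N (sum_list m) h x) / real (card (cent (sum_list m) (sig m)))"

lemma finite_cent [simp]: "finite (cent n g)" by (simp add: cent_def)
lemma cent_Sym: "h \<in> cent n g \<Longrightarrow> h \<in> Sym n" by (simp add: cent_def)
lemma cent_id [simp]: "id \<in> cent n g" by (simp add: cent_def)
lemma cent_card_pos: "0 < card (cent n g)" using cent_id[of n g] by (metis card_gt_0_iff empty_iff finite_cent)

lemma cent_comp: assumes "h \<in> cent n g" "k \<in> cent n g" shows "h \<circ> k \<in> cent n g"
proof -
  have "g \<circ> (h \<circ> k) = (g \<circ> h) \<circ> k" by (simp only: comp_assoc)
  also have "\<dots> = h \<circ> (g \<circ> k)" using assms(1) by (simp only: cent_def mem_Collect_eq comp_assoc)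
  also have "\<dots> = (h \<circ> k) \<circ> g" using assms(2) by (simp only: cent_def mem_Collect_eq comp_assoc)
  finally show ?thesis using assms by (simp add: cent_def Sym_comp)
qed

lemma cent_inv: assumes "h \<in> cent n g" shows "inv h \<in> cent n g"
proof -
  have h: "h \<in> Sym n" "g \<circ> h = h \<circ> g" using assms by (auto simp: cent_def)
  have "g \<circ> inv h = inv h \<circ> (h \<circ> g) \<circ> inv h" by (simp only: comp_assoc[symmetric] Sym_inv_o[OF h(1)] id_comp)
  also have "\<dots> = inv h \<circ> (g \<circ> h) \<circ> inv h" by (simp only: h(2))
  also have "\<dots> = inv h \<circ> g" by (simp only: comp_assoc Sym_inv_o[OF h(1)] comp_id)
  finally show ?thesis using h(1) by (simp add: cent_def Sym_inv)
qed

text \<open>Up to the factor \<open>card ?Z\<close>, a sum over a subgroup is the Gram form with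
  constant weights.\<close>

lemma SP_cyc: assumes "m \<in> partitions n" "n \<le> N" shows "SP N n (cyc N m)"
proof -
  have s: "sum_list m = n" using assms(1) by (simp add: partitions_def is_partition_def)
  let ?Z = "cent n (sig m)"
  have "SP N n (\<lambda>x. \<Sum>i\<in>?Z. \<Sum>j\<in>?Z. 1 * 1 * P N n (inv i \<circ> j) x)"
    by (rule SP_gram[OF assms(2)]) (auto intro: cent_Sym)
  moreover have "(\<Sum>j\<in>?Z. P N n (inv i \<circ> j) x) = (\<Sum>j\<in>?Z. P N n j x)" if i: "i \<in> ?Z" for i x
  proof (rule sum.reindex_bij_betw)
    have "i \<in> Sym n" using i cent_Sym by blast
    then show "bij_betw (\<lambda>j. inv i \<circ> j) ?Z ?Z"
      by (intro bij_betw_byWitness[where f'="\<lambda>j. i \<circ> j"]) (auto simp: Sym_cancel i cent_comp cent_inv)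
  qed
  ultimately have "SP N n (\<lambda>x. card ?Z * (\<Sum>j\<in>?Z. P N n j x))" by simp
  from SP_scale[OF this, of "1 / (real (card ?Z))\<^sup>2"] 
  have "SP N n (\<lambda>x. 1 / (real (card ?Z))\<^sup>2 * (card ?Z * (\<Sum>j\<in>?Z. P N n j x)))" by simp
  moreover have "1 / (real (card ?Z))\<^sup>2 * (card ?Z * (\<Sum>j\<in>?Z. P N n j x)) = cyc N m x" for x
    using cent_card_pos[of n "sig m"] by (simp add: cyc_def s power2_eq_square)
  ultimately show ?thesis by simp
qed

lemma P_conj: "g \<in> Sym n \<Longrightarrow> h \<in> Sym n \<Longrightarrow> P N n (h \<circ> g \<circ> inv h) x = P N n g x"
  by (simp add: P_eq_pc pc_conj)

lemma bij_conj: assumes "h \<in> Sym n" shows "bij_betw (\<lambda>k. h \<circ> k \<circ> inv h) (cent n g) (cent n (h \<circ> g \<circ> inv h))"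
proof (rule bij_betw_byWitness[where f'="\<lambda>k. inv h \<circ> k \<circ> h"])
  have c1: "inv h \<circ> (h \<circ> k \<circ> inv h) \<circ> h = k" for k
    by (simp only: comp_assoc Sym_cancel(2)[OF assms] Sym_inv_o[OF assms] comp_id)
  have c2: "h \<circ> (inv h \<circ> k \<circ> h) \<circ> inv h = k" for k
    by (simp only: comp_assoc Sym_cancel(1)[OF assms] Sym_inv_o[OF assms] comp_id)
  have m: "(h \<circ> a \<circ> inv h) \<circ> (h \<circ> b \<circ> inv h) = h \<circ> (a \<circ> b) \<circ> inv h" for a b
    by (simp only: comp_assoc Sym_cancel(2)[OF assms])
  show "\<forall>a\<in>cent n g. inv h \<circ> (h \<circ> a \<circ> inv h) \<circ> h = a" "\<forall>a\<in>cent n (h \<circ> g \<circ> inv h). h \<circ> (inv h \<circ> a \<circ> h) \<circ> inv h = a"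
    using c1 c2 by auto
  show "(\<lambda>k. h \<circ> k \<circ> inv h) ` cent n g \<subseteq> cent n (h \<circ> g \<circ> inv h)"
    using assms by (auto simp only: image_subset_iff cent_def mem_Collect_eq m intro!: Sym_comp Sym_inv)
  have m': "(inv h \<circ> a \<circ> h) \<circ> (inv h \<circ> b \<circ> h) = inv h \<circ> (a \<circ> b) \<circ> h" for a b
    by (simp only: comp_assoc Sym_cancel(1)[OF assms])
  show "(\<lambda>k. inv h \<circ> k \<circ> h) ` cent n (h \<circ> g \<circ> inv h) \<subseteq> cent n g"
  proof (rule image_subsetI)
    fix k assume "k \<in> cent n (h \<circ> g \<circ> inv h)"
    then have k: "k \<in> Sym n" "(h \<circ> g \<circ> inv h) \<circ> k = k \<circ> (h \<circ> g \<circ> inv h)" by (auto simp: cent_def)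
    have "g \<circ> (inv h \<circ> k \<circ> h) = (inv h \<circ> (h \<circ> g \<circ> inv h) \<circ> h) \<circ> (inv h \<circ> k \<circ> h)" by (simp only: c1)
    also have "\<dots> = inv h \<circ> (k \<circ> (h \<circ> g \<circ> inv h)) \<circ> h" by (simp only: m' k(2))
    also have "\<dots> = (inv h \<circ> k \<circ> h) \<circ> g" by (simp only: comp_assoc Sym_inv_o[OF assms] comp_id)
    finally show "inv h \<circ> k \<circ> h \<in> cent n g" using k(1) assms by (simp add: cent_def Sym_comp Sym_inv)
  qed
qed

definition ctype :: "nat \<Rightarrow> (nat \<Rightarrow> nat) \<Rightarrow> nat list" where
  "ctype n g = (SOME m. m \<in> partitions n \<and> (\<exists>h\<in>Sym n. g = h \<circ> sig m \<circ> inv h))"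

lemma ctype: assumes "g \<in> Sym n" shows "ctype n g \<in> partitions n" "\<exists>h\<in>Sym n. g = h \<circ> sig (ctype n g) \<circ> inv h"
  using someI_ex[of "\<lambda>m. m \<in> partitions n \<and> (\<exists>h\<in>Sym n. g = h \<circ> sig m \<circ> inv h)"] conj_sig[OF assms]
  unfolding ctype_def by blast+

lemma partition_sig_Sym: "m \<in> partitions n \<Longrightarrow> sig m \<in> Sym n"
  using sig_Sym[of m] by (simp add: partitions_def is_partition_def)

lemma ctype_conj: assumes m: "m \<in> partitions n" and k: "k \<in> Sym n" shows "ctype n (k \<circ> sig m \<circ> inv k) = m"
proof -
  let ?g = "k \<circ> sig m \<circ> inv k"
  have g: "?g \<in> Sym n" using k partition_sig_Sym[OF m] by (intro Sym_comp Sym_inv)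
  obtain h where h: "h \<in> Sym n" "?g = h \<circ> sig (ctype n ?g) \<circ> inv h" using ctype(2)[OF g] by blast
  have "sig (ctype n ?g) = inv h \<circ> (h \<circ> sig (ctype n ?g) \<circ> inv h) \<circ> h"
    by (simp only: comp_assoc Sym_cancel(2)[OF h(1)] Sym_inv_o[OF h(1)] comp_id)
  also have "\<dots> = (inv h \<circ> k) \<circ> sig m \<circ> inv (inv h \<circ> k)"
    unfolding h(2)[symmetric]
    by (simp only: Sym_inv_comp[OF Sym_inv[OF h(1)] k] Sym_inv_inv[OF h(1)] comp_assoc)
  finally have "m = ctype n ?g"
    by (intro sig_conj_unique[OF m ctype(1)[OF g], of "inv h \<circ> k"] Sym_comp Sym_inv h(1) k)
  then show ?thesis by simp
qed

text \<open>Orbit and stabilizer for conjugation: each element of the class is reached from one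
  coset of the centralizer.\<close>

lemma class_sum:
  assumes m: "m \<in> partitions n"
  shows "(\<Sum>k\<in>Sym n. f (k \<circ> sig m \<circ> inv k)) = real (card (cent n (sig m))) * (\<Sum>g | g \<in> Sym n \<and> ctype n g = m. f g)"
proof -
  let ?C = "{g. g \<in> Sym n \<and> ctype n g = m}"
  let ?c = "\<lambda>k. k \<circ> sig m \<circ> inv k"
  have sS: "sig m \<in> Sym n" using partition_sig_Sym[OF m] .
  have "(\<Sum>k\<in>Sym n. f (?c k)) = (\<Sum>g\<in>?C. \<Sum>k | k \<in> Sym n \<and> ?c k = g. f (?c k))"
    by (rule sum.group[symmetric]) (use ctype_conj[OF m] sS in \<open>auto intro!: Sym_comp Sym_inv\<close>)
  also have "\<dots> = (\<Sum>g\<in>?C. real (card (cent n (sig m))) * f g)"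
  proof (rule sum.cong[OF refl])
    fix g assume g: "g \<in> ?C"
    then obtain h where h: "h \<in> Sym n" "g = ?c h" using ctype(2)[of g n] by blast
    have "bij_betw (\<lambda>k. h \<circ> k) (cent n (sig m)) {k. k \<in> Sym n \<and> ?c k = g}"
    proof (rule bij_betw_byWitness[where f'="\<lambda>k. inv h \<circ> k"])
      show "(\<lambda>k. h \<circ> k) ` cent n (sig m) \<subseteq> {k. k \<in> Sym n \<and> ?c k = g}"
      proof (rule image_subsetI)
        fix k assume "k \<in> cent n (sig m)"
        then have k: "k \<in> Sym n" "sig m \<circ> k = k \<circ> sig m" by (auto simp: cent_def)
        have "?c (h \<circ> k) = h \<circ> ((k \<circ> sig m) \<circ> inv k) \<circ> inv h"
          by (simp only: Sym_inv_comp[OF h(1) k(1)] comp_assoc)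
        also have "\<dots> = g" by (simp only: k(2)[symmetric] Sym_cancel(3)[OF k(1)] h(2))
        finally show "h \<circ> k \<in> {k. k \<in> Sym n \<and> ?c k = g}" using h(1) k(1) by (simp add: Sym_comp)
      qed
      show "(\<lambda>k. inv h \<circ> k) ` {k. k \<in> Sym n \<and> ?c k = g} \<subseteq> cent n (sig m)"
      proof (rule image_subsetI)
        fix k assume "k \<in> {k. k \<in> Sym n \<and> ?c k = g}"
        then have k: "k \<in> Sym n" "?c k = g" by auto
        have "k \<circ> sig m = ?c k \<circ> k" by (simp only: Sym_cancel(4)[OF k(1)])
        also have "\<dots> = h \<circ> sig m \<circ> inv h \<circ> k" by (simp only: k(2) h(2))
        finally have "inv h \<circ> (k \<circ> sig m) = inv h \<circ> (h \<circ> sig m \<circ> inv h \<circ> k)" by simp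
        then have "(inv h \<circ> k) \<circ> sig m = sig m \<circ> (inv h \<circ> k)" by (simp only: comp_assoc Sym_cancel(2)[OF h(1)])
        then show "inv h \<circ> k \<in> cent n (sig m)" using k(1) h(1) by (simp add: cent_def Sym_comp Sym_inv)
      qed
    qed (use h(1) in \<open>auto simp: Sym_cancel\<close>)
    from bij_betw_same_card[OF this]
    show "(\<Sum>k | k \<in> Sym n \<and> ?c k = g. f (?c k)) = real (card (cent n (sig m))) * f g" by simp
  qed
  finally show ?thesis by (simp add: sum_distrib_left)
qed

text \<open>Both sides count commuting pairs $(g,h)$, weighted by the words fixed by $h$.\<close>

theorem sum_cyc: assumes "n \<le> N" shows "(\<Sum>m\<in>partitions n. cyc N m x) = (\<Sum>m\<in>partitions n. pm N m x)"
proof -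
  have split: "(\<Sum>g\<in>Sym n. f g) = (\<Sum>m\<in>partitions n. \<Sum>g | g \<in> Sym n \<and> ctype n g = m. f g)" for f :: "_ \<Rightarrow> real"
    by (rule sum.group[symmetric]) (auto intro: ctype)
  have cls: "(\<Sum>g | g \<in> Sym n \<and> ctype n g = m. f g) = fact n / real (card (cent n (sig m))) * f (sig m)"
    if "m \<in> partitions n" "\<And>k. k \<in> Sym n \<Longrightarrow> f (k \<circ> sig m \<circ> inv k) = f (sig m)" for m and f :: "_ \<Rightarrow> real"
  proof -
    have "(\<Sum>k\<in>Sym n. f (k \<circ> sig m \<circ> inv k)) = fact n * f (sig m)" using that(2) by (simp add: card_Sym)
    then have "real (card (cent n (sig m))) * (\<Sum>g | g \<in> Sym n \<and> ctype n g = m. f g) = fact n * f (sig m)"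
      by (simp only: class_sum[OF that(1)])
    moreover have "real (card (cent n (sig m))) \<noteq> 0" using cent_card_pos[of n "sig m"] by linarith
    moreover have "S = F / c * y" if "c * S = F * y" "c \<noteq> 0" for S F y c :: real
      using that by (simp add: field_simps)
    ultimately show ?thesis by blast
  qed
  let ?T = "\<Sum>g\<in>Sym n. \<Sum>h\<in>cent n g. P N n h x"
  have "?T = (\<Sum>m\<in>partitions n. fact n * cyc N m x)"
    unfolding split[of "\<lambda>g. \<Sum>h\<in>cent n g. P N n h x"]
  proof (rule sum.cong[OF refl])
    fix m assume m: "m \<in> partitions n"
    have "(\<Sum>h\<in>cent n (k \<circ> sig m \<circ> inv k). P N n h x) = (\<Sum>h\<in>cent n (sig m). P N n h x)" if k: "k \<in> Sym n" for k
      unfolding sum.reindex_bij_betw[OF bij_conj[OF k], symmetric] using k cent_Sym by (intro sum.cong refl P_conj) auto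
    then have "(\<Sum>g | g \<in> Sym n \<and> ctype n g = m. \<Sum>h\<in>cent n g. P N n h x) = fact n / real (card (cent n (sig m))) * (\<Sum>h\<in>cent n (sig m). P N n h x)"
      by (rule cls[OF m])
    then show "(\<Sum>g | g \<in> Sym n \<and> ctype n g = m. \<Sum>h\<in>cent n g. P N n h x) = fact n * cyc N m x"
      using m by (simp add: cyc_def partitions_def is_partition_def)
  qed
  moreover have "?T = (\<Sum>m\<in>partitions n. fact n * pm N m x)"
  proof -
    have "?T = (\<Sum>g\<in>Sym n. \<Sum>h | h \<in> Sym n \<and> g \<circ> h = h \<circ> g. P N n h x)" by (simp add: cent_def)
    also have "\<dots> = (\<Sum>h\<in>Sym n. \<Sum>g | g \<in> Sym n \<and> g \<circ> h = h \<circ> g. P N n h x)" by (rule sum.swap_restrict) auto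
    also have "\<dots> = (\<Sum>h\<in>Sym n. real (card (cent n h)) * P N n h x)"
      by (intro sum.cong refl) (simp add: cent_def eq_commute)
    also have "\<dots> = (\<Sum>m\<in>partitions n. fact n * pm N m x)"
      unfolding split[of "\<lambda>h. real (card (cent n h)) * P N n h x"]
    proof (rule sum.cong[OF refl])
      fix m assume m: "m \<in> partitions n"
      have "(\<Sum>g | g \<in> Sym n \<and> ctype n g = m. real (card (cent n g)) * P N n g x)
         = fact n / real (card (cent n (sig m))) * (real (card (cent n (sig m))) * P N n (sig m) x)"
      proof (rule cls[OF m])
        fix k assume k: "k \<in> Sym n"
        show "real (card (cent n (k \<circ> sig m \<circ> inv k))) * P N n (k \<circ> sig m \<circ> inv k) x = real (card (cent n (sig m))) * P N n (sig m) x"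
          using bij_betw_same_card[OF bij_conj[OF k, of "sig m"]] P_conj[OF partition_sig_Sym[OF m] k] by simp
      qed
      moreover have "P N n (sig m) x = pm N m x"
        using m P_sig[of m N x] by (auto simp: partitions_def is_partition_def)
      moreover have "real (card (cent n (sig m))) \<noteq> 0" using cent_card_pos[of n "sig m"] by linarith
      ultimately show "(\<Sum>g | g \<in> Sym n \<and> ctype n g = m. real (card (cent n g)) * P N n g x) = fact n * pm N m x"
        by simp
    qed
    finally show ?thesis .
  qed
  ultimately have "fact n * (\<Sum>m\<in>partitions n. cyc N m x) = fact n * (\<Sum>m\<in>partitions n. pm N m x)"
    by (simp add: sum_distrib_left)
  then show ?thesis by simp
qed

lemma glue_id_right: "g \<in> Sym i \<Longrightarrow> glue i g id = g"
  using Sym_ge by (fastforce simp: glue_def fun_eq_iff)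

lemma sig_single: "sig [i] = rot i" by (simp add: glue_id_right[OF rot_Sym])

lemma per_sig_mem: assumes "j < sum_list m" shows "per (sig m) j \<in> set m"
proof -
  have "j \<in> {k. k < sum_list m \<and> per (sig m) k = per (sig m) j}" using assms by simp
  then have "card {k. k < sum_list m \<and> per (sig m) k = per (sig m) j} \<noteq> 0" by (subst card_0_eq) auto
  then show ?thesis unfolding card_per_sig by (metis count_mset_0_iff mult_0_right)
qed

lemma per_commute: assumes "h \<in> cent n g" shows "per g (h j) = per g j"
proof -
  have h: "h \<in> Sym n" "g \<circ> h = h \<circ> g" using assms by (auto simp: cent_def)
  have "h \<circ> g \<circ> inv h = g" by (simp only: h(2)[symmetric] Sym_cancel(3)[OF h(1)])
  then show ?thesis using per_conj[OF h(1), of g j] by simp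
qed

text \<open>Commuting permutations preserve periods, and under the hypothesis the period
  \<open>i\<close> occurs only on the first block. So the centralizer preserves both blocks and
  splits. With a second part equal to \<open>i\<close> two cycles could be exchanged.\<close>

lemma cent_glue:
  assumes "\<forall>q\<in>set m. q < i"
  shows "bij_betw (\<lambda>(h, k). glue i h k) (cent i (rot i) \<times> cent (sum_list m) (sig m)) (cent (sum_list (i # m)) (sig (i # m)))"
  unfolding bij_betw_def
proof
  let ?l = "sum_list m" and ?g = "sig (i # m)"
  show "inj_on (\<lambda>(h, k). glue i h k) (cent i (rot i) \<times> cent ?l (sig m))"
    by (auto simp: inj_on_def glue_inject cent_Sym)
  show "(\<lambda>(h, k). glue i h k) ` (cent i (rot i) \<times> cent ?l (sig m)) = cent (sum_list (i # m)) ?g"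
  proof (intro subset_antisym subsetI)
    fix z assume "z \<in> (\<lambda>(h, k). glue i h k) ` (cent i (rot i) \<times> cent ?l (sig m))"
    then obtain h k where z: "z = glue i h k" "h \<in> cent i (rot i)" "k \<in> cent ?l (sig m)" by auto
    then show "z \<in> cent (sum_list (i # m)) ?g"
      by (simp add: cent_def glue_Sym glue_comp rot_Sym)
  next
    fix z assume z: "z \<in> cent (sum_list (i # m)) ?g"
    have zS: "z \<in> Sym (i + ?l)" using cent_Sym[OF z] by simp
    have pl: "per ?g j = i" if "j < i" for j using that by (simp add: per_glue rot_Sym per_rot)
    have pg: "per ?g j \<noteq> i" if "i \<le> j" "j < i + ?l" for j
    proof -
      have "per ?g j = per (sig m) (j - i)" using that by (simp add: per_glue rot_Sym)
      then show ?thesis using per_sig_mem[of "j - i" m] that assms by fastforce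
    qed
    have pres: "w j < i \<longleftrightarrow> j < i" if w: "w \<in> cent (sum_list (i # m)) ?g" and j: "j < i + ?l" for w j
    proof -
      have "per ?g (w j) = per ?g j" using per_commute[OF w] .
      moreover have "w j < i + ?l" using Sym_less[OF cent_Sym[OF w]] j by simp
      ultimately show ?thesis using pl[of j] pl[of "w j"] pg[of j] pg[of "w j"] j by (metis not_le)
    qed
    define h where "h w = (\<lambda>j. if j < i then w j else j)" for w :: "nat \<Rightarrow> nat"
    define k where "k w = (\<lambda>j. w (i + j) - i)" for w :: "nat \<Rightarrow> nat"
    have dec: "w = glue i (h w) (k w)" if w: "w \<in> cent (sum_list (i # m)) ?g" for w
    proof
      fix j
      show "w j = glue i (h w) (k w) j"
        using pres[OF w, of j] Sym_ge[OF cent_Sym[OF w], of j] by (cases "j < i + ?l") (auto simp: glue_def h_def k_def)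
    qed
    have iz: "inv z \<in> cent (sum_list (i # m)) ?g" using z by (rule cent_inv)
    have inv: "inv z (z j) = j" "z (inv z j) = j" for j using zS by (simp_all add: Sym_def permutes_inverses)
    have hS: "h z \<in> Sym i"
      by (rule SymI[where h="h (inv z)"]) (use pres[OF z] pres[OF iz] inv in \<open>auto simp: h_def\<close>)
    have kS: "k z \<in> Sym ?l"
    proof (rule SymI[where h="k (inv z)"])
      have l: "k w j < ?l" "i \<le> w (i + j)" if "w \<in> cent (sum_list (i # m)) ?g" "j < ?l" for w j
        using pres[OF that(1), of "i + j"] Sym_less[OF cent_Sym[OF that(1)], of "i + j"] that(2) by (auto simp: k_def)
      show "\<And>j. j < ?l \<Longrightarrow> k z j < ?l" "\<And>j. j < ?l \<Longrightarrow> k (inv z) j < ?l" using l z iz by auto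
      show "k (inv z) (k z j) = j" "k z (k (inv z) j) = j" if "j < ?l" for j
        using l(2)[OF z that] l(2)[OF iz that] inv by (simp_all add: k_def)
      show "k z j = j" if "?l \<le> j" for j using Sym_ge[OF zS, of "i + j"] that by (simp add: k_def)
    qed
    have "glue i (rot i \<circ> h z) (sig m \<circ> k z) = ?g \<circ> glue i (h z) (k z)"
      using glue_comp[OF hS, of "rot i" "sig m" "k z"] by simp
    also have "\<dots> = glue i (h z) (k z) \<circ> ?g" using z dec[OF z] by (simp add: cent_def)
    also have "\<dots> = glue i (h z \<circ> rot i) (k z \<circ> sig m)" using glue_comp[OF rot_Sym, of i "h z" "k z" "sig m"] by simp
    finally have "rot i \<circ> h z = h z \<circ> rot i \<and> sig m \<circ> k z = k z \<circ> sig m"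
      by (simp add: glue_inject Sym_comp hS rot_Sym)
    then have "(h z, k z) \<in> cent i (rot i) \<times> cent ?l (sig m)" using hS kS by (simp add: cent_def)
    then show "z \<in> (\<lambda>(h, k). glue i h k) ` (cent i (rot i) \<times> cent ?l (sig m))" using dec[OF z] by force
  qed
qed

theorem cyc_Cons:
  assumes "\<forall>q\<in>set m. q < i"
  shows "cyc N (i # m) x = cyc N [i] x * cyc N m x"
proof -
  let ?A = "cent i (rot i)" and ?B = "cent (sum_list m) (sig m)" and ?C = "cent (sum_list (i # m)) (sig (i # m))"
  note bij = cent_glue[OF assms]
  have c: "card ?C = card ?A * card ?B" using bij_betw_same_card[OF bij] by (simp add: card_cartesian_product)
  have "(\<Sum>z\<in>?C. P N (sum_list (i # m)) z x) = (\<Sum>(h, k)\<in>?A \<times> ?B. P N (i + sum_list m) (glue i h k) x)"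
    unfolding sum.reindex_bij_betw[OF bij, symmetric] by (simp add: case_prod_unfold)
  also have "\<dots> = (\<Sum>(h, k)\<in>?A \<times> ?B. P N i h x * P N (sum_list m) k x)"
    by (intro sum.cong) (auto simp: wts_glue cent_Sym)
  also have "\<dots> = (\<Sum>h\<in>?A. P N i h x) * (\<Sum>k\<in>?B. P N (sum_list m) k x)"
    by (simp add: sum_product sum.cartesian_product)
  finally have s: "(\<Sum>z\<in>?C. P N (sum_list (i # m)) z x) = \<dots>" .
  show ?thesis unfolding cyc_def s c sig_single by simp
qed

section \<open>Cyclic and dihedral groups\<close>

text \<open>Integer parameters let the dihedral relations hold as identities in the parameter; by
  \<open>dihedral_mod\<close> it matters only modulo \<open>i\<close>.\<close>

definition rt :: "nat \<Rightarrow> int \<Rightarrow> nat \<Rightarrow> nat" where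
  "rt i t j = (if j < i then nat ((int j + t) mod int i) else j)"

definition rf :: "nat \<Rightarrow> int \<Rightarrow> nat \<Rightarrow> nat" where
  "rf i t j = (if j < i then nat ((t - int j) mod int i) else j)"

lemma nat_mod_less: "0 < i \<Longrightarrow> nat (a mod int i) < i"
  by (metis nat_less_iff of_nat_0_less_iff pos_mod_bound pos_mod_sign)

lemma dihedral_comp: assumes "0 < i"
  shows "rt i t \<circ> rt i u = rt i (t + u)" "rf i t \<circ> rf i u = rt i (t - u)"
    "rt i t \<circ> rf i u = rf i (t + u)" "rf i t \<circ> rt i u = rf i (t - u)"
proof -
  have n: "int (nat (a mod int i)) = a mod int i" for a using assms by simp
  show "rt i t \<circ> rt i u = rt i (t + u)" "rf i t \<circ> rf i u = rt i (t - u)"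
    "rt i t \<circ> rf i u = rf i (t + u)" "rf i t \<circ> rt i u = rf i (t - u)"
    using assms by (auto simp: fun_eq_iff rt_def rf_def nat_mod_less n mod_simps algebra_simps)
qed

lemma rt_0: "rt i 0 = id" by (auto simp: rt_def fun_eq_iff)

lemma dihedral_Sym: "rt i t \<in> Sym i" "rf i t \<in> Sym i"
proof -
  show "rt i t \<in> Sym i"
  proof (rule SymI[where h="rt i (- t)"])
    show "rt i t j < i" "rt i (- t) j < i" if "j < i" for j using that by (simp_all add: rt_def nat_mod_less)
    show "rt i (- t) (rt i t j) = j" "rt i t (rt i (- t) j) = j" if "j < i" for j
      using fun_cong[OF dihedral_comp(1)[of i "- t" t], of j] fun_cong[OF dihedral_comp(1)[of i t "- t"], of j] that by (simp_all add: rt_0)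
  qed (simp add: rt_def)
  show "rf i t \<in> Sym i"
  proof (rule SymI[where h="rf i t"])
    show "rf i t j < i" "rf i t j < i" if "j < i" for j using that by (simp_all add: rf_def nat_mod_less)
    show "rf i t (rf i t j) = j" "rf i t (rf i t j) = j" if "j < i" for j
      using fun_cong[OF dihedral_comp(2)[of i t t], of j] that by (simp_all add: rt_0)
  qed (simp add: rf_def)
qed

lemma dihedral_inv: assumes "0 < i" shows "inv (rt i t) = rt i (- t)" "inv (rf i t) = rf i t"
  by (rule inv_unique_comp; simp add: dihedral_comp[OF assms] rt_0)+

lemma dihedral_mod: assumes "0 < i" shows "rt i (t mod int i) = rt i t" "rf i (t mod int i) = rf i t"
  by (auto simp: fun_eq_iff rt_def rf_def mod_simps)

lemma periodic_sum:
  fixes F :: "int \<Rightarrow> real"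
  assumes i: "0 < i" and per: "\<And>t. F (t mod int i) = F t" 
  shows "(\<Sum>u\<in>{0..<int i}. F (u + c)) = (\<Sum>u\<in>{0..<int i}. F u)" "(\<Sum>u\<in>{0..<int i}. F (c - u)) = (\<Sum>u\<in>{0..<int i}. F u)"
proof -
  have "bij_betw (\<lambda>u. (u + c) mod int i) {0..<int i} {0..<int i}"
    by (rule bij_betw_byWitness[where f'="\<lambda>u. (u - c) mod int i"]) (use i in \<open>auto simp: mod_simps\<close>)
  from sum.reindex_bij_betw[OF this, of F] show "(\<Sum>u\<in>{0..<int i}. F (u + c)) = (\<Sum>u\<in>{0..<int i}. F u)" by (simp add: per)
  have "bij_betw (\<lambda>u. (c - u) mod int i) {0..<int i} {0..<int i}"
    by (rule bij_betw_byWitness[where f'="\<lambda>u. (c - u) mod int i"]) (use i in \<open>auto simp: mod_simps\<close>)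
  from sum.reindex_bij_betw[OF this, of F] show "(\<Sum>u\<in>{0..<int i}. F (c - u)) = (\<Sum>u\<in>{0..<int i}. F u)" by (simp add: per)
qed

definition refl :: "nat \<Rightarrow> nat \<Rightarrow> (nat \<Rightarrow> real) \<Rightarrow> real" where
  "refl N i x = (\<Sum>t\<in>{0..<int i}. P N i (rf i t) x) / real i"

lemma rot_power: "rot i ^^ k = rt i (int k)"
proof
  fix j show "(rot i ^^ k) j = rt i (int k) j"
  proof (cases "j < i")
    case True
    then show ?thesis using rot_funpow[OF True, of k] by (simp add: rt_def nat_mod_as_int)
  next
    case False
    then have "(rot i ^^ k) j = j" by (induction k) (auto simp: rot_def)
    then show ?thesis using False by (simp add: rt_def)
  qed
qed

text \<open>A permutation commuting with all powers of the cycle is determined by the image of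
  0.\<close>

lemma cent_rot: assumes "0 < i" shows "cent i (rot i) = rt i ` {0..<int i}"
proof (intro subset_antisym subsetI)
  fix h assume "h \<in> cent i (rot i)"
  then have h: "h \<in> Sym i" "rot i \<circ> h = h \<circ> rot i" by (auto simp: cent_def)
  have pow: "(rot i ^^ k) \<circ> h = h \<circ> (rot i ^^ k)" for k
  proof (induction k)
    case (Suc k)
    have "(rot i ^^ Suc k) \<circ> h = rot i \<circ> (h \<circ> (rot i ^^ k))" by (simp only: funpow.simps(2) comp_assoc Suc)
    also have "\<dots> = (rot i \<circ> h) \<circ> (rot i ^^ k)" by (simp only: comp_assoc)
    also have "\<dots> = h \<circ> (rot i ^^ Suc k)" by (simp only: h(2) funpow.simps(2) comp_assoc)
    finally show ?case .
  qed simp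
  have "h j = rt i (int (h 0)) j" for j
  proof (cases "j < i")
    case True
    have h0: "h 0 < i" using Sym_less[OF h(1)] assms by simp
    have "h j = h ((rot i ^^ j) 0)" using True rot_funpow[OF assms, of j] by simp
    also have "\<dots> = (rot i ^^ j) (h 0)" using fun_cong[OF pow[of j], of 0] by simp
    also have "\<dots> = (h 0 + j) mod i" by (rule rot_funpow[OF h0])
    finally show ?thesis using True by (simp add: rt_def nat_mod_as_int add.commute)
  next
    case False
    then show ?thesis using Sym_ge[OF h(1)] by (simp add: rt_def)
  qed
  moreover have "int (h 0) \<in> {0..<int i}" using Sym_less[OF h(1)] assms by simp
  ultimately show "h \<in> rt i ` {0..<int i}" by blast
next
  fix h assume "h \<in> rt i ` {0..<int i}"
  then obtain t where "h = rt i t" by blast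
  moreover have "rot i = rt i 1"   proof
    fix j
    have "(rot i ^^ 1) j = rt i (int 1) j" by (simp only: rot_power)
    moreover have "(rot i ^^ 1) j = rot i j" by (simp add: eval_nat_numeral)
    ultimately show "rot i j = rt i 1 j" by (simp only: of_nat_1)
  qed
  ultimately show "h \<in> cent i (rot i)" using assms by (simp add: cent_def dihedral_Sym dihedral_comp add.commute)
qed

lemma cyc_single: assumes "0 < i" shows "cyc N [i] x = (\<Sum>t\<in>{0..<int i}. P N i (rt i t) x) / real i"
proof -
  have inj: "inj_on (rt i) {0..<int i}"
  proof (rule inj_onI)
    fix t u assume *: "t \<in> {0..<int i}" "u \<in> {0..<int i}" "rt i t = rt i u"
    show "t = u" using fun_cong[OF *(3), of 0] *(1,2) assms by (auto simp: rt_def)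
  qed
  then have "card (cent i (rot i)) = i" by (simp add: cent_rot[OF assms] card_image)
  then show ?thesis using inj by (simp add: cyc_def sig_single[simplified] glue_id_right[OF rot_Sym] cent_rot[OF assms] sum.reindex)
qed

text \<open>The Gram form of the dihedral group with weight 1 on rotations and \<open>s\<close> on
  reflections, for both characters trivial on rotations. The index set consists of a flag and a
  parameter instead of permutations, so the count is the same for \<open>i \<le> 2\<close>, where
  rotations and reflections coincide.\<close>

theorem SP_cyc_refl:
  assumes i: "0 < i" "i \<le> N" and s: "s = 1 \<or> s = -1"
  shows "SP N i (\<lambda>x. cyc N [i] x + s * refl N i x)"
proof -
  let ?J = "{0..<int i}"
  let ?t = "\<lambda>(b, t). if b then rf i t else rt i t" and ?y = "\<lambda>(b, t). if b then s else (1::real)"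
  have "SP N i (\<lambda>x. \<Sum>p\<in>UNIV \<times> ?J. \<Sum>q\<in>UNIV \<times> ?J. ?y p * ?y q * P N i (inv (?t p) \<circ> ?t q) x)"
    by (rule SP_gram[OF i(2)]) (auto simp: dihedral_Sym)
  moreover have "(\<Sum>p\<in>UNIV \<times> ?J. \<Sum>q\<in>UNIV \<times> ?J. ?y p * ?y q * P N i (inv (?t p) \<circ> ?t q) x) = 
     2 * (real i)\<^sup>2 * (cyc N [i] x + s * refl N i x)" for x
  proof -
    have u: "(\<Sum>q\<in>UNIV \<times> ?J. f q) = (\<Sum>t\<in>?J. f (False, t)) + (\<Sum>t\<in>?J. f (True, t))" for f :: "bool \<times> int \<Rightarrow> real"
      by (simp only: sum.cartesian_product' UNIV_bool) simp
    let ?R = "\<Sum>t\<in>?J. P N i (rt i t) x" and ?S = "\<Sum>t\<in>?J. P N i (rf i t) x"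
    have R: "(\<Sum>u\<in>?J. P N i (rt i (u + c)) x) = ?R" "(\<Sum>u\<in>?J. P N i (rt i (c - u)) x) = ?R" for c
      using periodic_sum[OF i(1), of "\<lambda>t. P N i (rt i t) x" c] by (simp_all add: dihedral_mod[OF i(1)])
    have S: "(\<Sum>u\<in>?J. P N i (rf i (u + c)) x) = ?S" "(\<Sum>u\<in>?J. P N i (rf i (c - u)) x) = ?S" for c
      using periodic_sum[OF i(1), of "\<lambda>t. P N i (rf i t) x" c] by (simp_all add: dihedral_mod[OF i(1)])
    have c1: "inv (rt i a) \<circ> rt i b = rt i (b + (- a))" "inv (rt i a) \<circ> rf i b = rf i (b + (- a))" 
      "inv (rf i a) \<circ> rt i b = rf i (a - b)" "inv (rf i a) \<circ> rf i b = rt i (a - b)" for a b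
      by (simp_all add: dihedral_inv[OF i(1)] dihedral_comp[OF i(1)] algebra_simps)
    have "(\<Sum>p\<in>UNIV \<times> ?J. \<Sum>q\<in>UNIV \<times> ?J. ?y p * ?y q * P N i (inv (?t p) \<circ> ?t q) x) = 
      real i * (?R + s * ?S) + real i * (s * ?S + s * s * ?R)"
      unfolding u by (simp only: case_prod_conv if_True if_False c1 mult_1_left mult_1_right sum_distrib_left[symmetric] R S)
        (simp add: distrib_left)
    also have "\<dots> = 2 * (real i)\<^sup>2 * (?R / real i + s * (?S / real i))"
      using i(1) s by (auto simp: power2_eq_square field_simps)
    finally show ?thesis by (simp only: cyc_single[OF i(1)] refl_def)
  qed
  ultimately have "SP N i (\<lambda>x. 2 * (real i)\<^sup>2 * (cyc N [i] x + s * refl N i x))" by simp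
  from SP_scale[OF this, of "1 / (2 * (real i)\<^sup>2)"] show ?thesis using i(1) by simp
qed

section \<open>Cycle types of the reflections\<close>

lemma pm_two: "set m \<subseteq> {1, 2} \<Longrightarrow> pm N m x = pw N 1 x ^ count (mset m) 1 * pw N 2 x ^ count (mset m) 2
    \<and> sum_list m = count (mset m) 1 + 2 * count (mset m) 2"
  by (induction m) (auto simp: pm_def)

text \<open>All cycles have length 1 or 2, so the number of fixed points determines the cycle
  type.\<close>

lemma P_involution:
  assumes g: "g \<in> Sym n" and gg: "g \<circ> g = id" and k: "card {j. j < n \<and> g j = j} = k"
  shows "P N n g x = pw N 1 x ^ k * pw N 2 x ^ ((n - k) div 2)"
proof -
  obtain m h where m: "m \<in> partitions n" "h \<in> Sym n" "g = h \<circ> sig m \<circ> inv h" using conj_sig[OF g] by blast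
  have s: "sum_list m = n" "\<forall>q\<in>set m. 0 < q" using m(1) by (auto simp: partitions_def is_partition_def)
  have per_le: "per g j = 1 \<or> per g j = 2" for j
  proof -
    have "(g ^^ 2) j = j" using fun_cong[OF gg, of j] by (simp add: numeral_2_eq_2)
    then have "per g j dvd 2" by (rule least_power_minimal)
    then show ?thesis using two_is_prime_nat prime_nat_iff by blast
  qed
  have fix1: "g j = j \<longleftrightarrow> per g j = 1" for j
    using least_power_dvd[OF Sym_permutation[OF g], of j 1] by simp
  have perc: "per g (h j) = per (sig m) j" for j unfolding m(3) by (rule per_conj[OF m(2)])
  have "set m \<subseteq> {1, 2}"
  proof
    fix q assume q: "q \<in> set m"
    then have "card {j. j < sum_list m \<and> per (sig m) j = q} \<noteq> 0" unfolding card_per_sig using s(2) by (auto simp: count_mset_0_iff)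
    then obtain j where "per (sig m) j = q" by (metis (mono_tags, lifting) card.empty empty_Collect_eq)
    then show "q \<in> {1, 2}" using per_le[of "h j"] perc[of j] by auto
  qed
  note two = pm_two[OF this, of N x]
  have "bij_betw h {j. j < n \<and> per (sig m) j = 1} {j. j < n \<and> g j = j}"
  proof (rule bij_betw_byWitness[where f'="inv h"])
    have hi: "h (inv h j) = j" "inv h (h j) = j" for j using m(2) by (auto simp: Sym_def permutes_inverses)
    show "\<forall>a\<in>{j. j < n \<and> per (sig m) j = 1}. inv h (h a) = a" "\<forall>a\<in>{j. j < n \<and> g j = j}. h (inv h a) = a" using hi by auto
    show "h ` {j. j < n \<and> per (sig m) j = 1} \<subseteq> {j. j < n \<and> g j = j}"
      using fix1 perc Sym_less[OF m(2)] by auto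
    show "inv h ` {j. j < n \<and> g j = j} \<subseteq> {j. j < n \<and> per (sig m) j = 1}"
      using fix1 perc[of "inv h _"] hi Sym_less[OF Sym_inv[OF m(2)]] by auto
  qed
  then have "count (mset m) 1 = k" using bij_betw_same_card card_per_sig[of m 1] s k by fastforce
  moreover have "P N n g x = pm N m x" using P_sig[of m N x] s P_conj[OF partition_sig_Sym[OF m(1)] m(2)] m(3) by simp
  ultimately show ?thesis using two s by auto
qed

lemma rf_fixed: "0 < i \<Longrightarrow> {j. j < i \<and> rf i t j = j} = {j. j < i \<and> int i dvd t - 2 * int j}"
proof -
  assume i: "0 < i"
  have "nat ((t - int j) mod int i) = j \<longleftrightarrow> int i dvd t - 2 * int j" if "j < i" for j
  proof -
    have "nat ((t - int j) mod int i) = j \<longleftrightarrow> (t - int j) mod int i = int j mod int i" 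
      using i that by (simp add: nat_eq_iff)
    also have "\<dots> \<longleftrightarrow> int i dvd (t - int j) - int j" by (rule mod_eq_dvd_iff)
    finally show ?thesis by (simp add: algebra_simps)
  qed
  then show ?thesis by (auto simp: rf_def)
qed

lemma refl_odd: "refl N (2 * m + 1) x = pw N 1 x * pw N 2 x ^ m"
proof -
  let ?i = "2 * m + 1"
  have "P N ?i (rf ?i t) x = pw N 1 x ^ 1 * pw N 2 x ^ ((?i - 1) div 2)" for t
  proof (rule P_involution[OF dihedral_Sym(2)])
    show "rf ?i t \<circ> rf ?i t = id" by (simp add: dihedral_comp(2) rt_0)
    \<comment> \<open>The fixed point solves 2 j = t modulo \<open>?i\<close>, and
      \<open>m + 1\<close> is the inverse of 2 modulo \<open>2 * m + 1\<close>.\<close>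
    define a where "a = nat ((t * (int m + 1)) mod int ?i)"
    have "int ?i dvd t - 2 * int j \<longleftrightarrow> j = a" if "j < ?i" for j
    proof -
      have "int ?i dvd t - 2 * int j \<longleftrightarrow> int ?i dvd (t - 2 * int j) * (int m + 1)"
      proof -
        have "coprime (int ?i) (int m + 1)"
        proof -
          have "gcd (int ?i) (int m + 1) dvd 2 * (int m + 1) - int ?i" by (metis dvd_diff dvd_mult gcd_dvd1 gcd_dvd2)
          then show ?thesis by (simp add: coprime_iff_gcd_eq_1)
        qed
        then show ?thesis by (simp add: coprime_dvd_mult_left_iff)
      qed
      also have "(t - 2 * int j) * (int m + 1) = (t * (int m + 1) - int j) - int ?i * int j" by (simp add: algebra_simps)
      also have "int ?i dvd \<dots> \<longleftrightarrow> int ?i dvd t * (int m + 1) - int j" by (metis dvd_diff_commute dvd_diff_right_iff dvd_triv_left dvd_diff_left_iff)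
      also have "\<dots> \<longleftrightarrow> (t * (int m + 1)) mod int ?i = int j mod int ?i" by (rule mod_eq_dvd_iff[symmetric])
      also have "\<dots> \<longleftrightarrow> j = a" using that by (auto simp: a_def)
      finally show ?thesis .
    qed
    moreover have "a < ?i" unfolding a_def by (rule nat_mod_less) simp
    ultimately have "{j. j < ?i \<and> int ?i dvd t - 2 * int j} = {a}" by auto
    then show "card {j. j < ?i \<and> rf ?i t j = j} = 1" by (simp only: rf_fixed[of ?i t]) simp
  qed
  then show ?thesis by (simp add: refl_def)
qed

text \<open>Modulo an even number, 2 j = t has no solution for odd \<open>t\<close> and two
  solutions for even \<open>t\<close>. The average over both kinds produces the first factor, which
  equals \<open>H N 2 x\<close>.\<close>

lemma refl_even: "refl N (2 * m + 2) x = (pw N 1 x ^ 2 + pw N 2 x) / 2 * pw N 2 x ^ m"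
proof -
  let ?i = "2 * m + 2"
  have inv: "rf ?i t \<circ> rf ?i t = id" for t by (simp add: dihedral_comp(2) rt_0)
  have odd: "P N ?i (rf ?i t) x = pw N 1 x ^ 0 * pw N 2 x ^ ((?i - 0) div 2)" if t: "odd t" for t
  proof (rule P_involution[OF dihedral_Sym(2) inv])
    have "\<not> int ?i dvd t - 2 * int j" for j
    proof
      assume "int ?i dvd t - 2 * int j"
      moreover have "2 dvd int ?i" by simp
      ultimately have "2 dvd t - 2 * int j" using dvd_trans by blast
      then show False using t by simp
    qed
    then show "card {j. j < ?i \<and> rf ?i t j = j} = 0" by (simp only: rf_fixed[of ?i t]) simp
  qed
  have even: "P N ?i (rf ?i t) x = pw N 1 x ^ 2 * pw N 2 x ^ ((?i - 2) div 2)" if t: "even t" for t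
  proof (rule P_involution[OF dihedral_Sym(2) inv])
    obtain s where s: "t = 2 * s" using t by blast
    define a where "a = nat (s mod int (m + 1))"
    have am: "a < m + 1" unfolding a_def by (rule nat_mod_less) simp
    have "int ?i dvd t - 2 * int j \<longleftrightarrow> j mod (m + 1) = a" for j
    proof -
      have "int ?i dvd t - 2 * int j \<longleftrightarrow> 2 * int (m + 1) dvd 2 * (s - int j)" by (simp add: s algebra_simps)
      also have "\<dots> \<longleftrightarrow> int (m + 1) dvd s - int j" by (simp only: dvd_mult_cancel_left) simp
      also have "\<dots> \<longleftrightarrow> s mod int (m + 1) = int j mod int (m + 1)" by (rule mod_eq_dvd_iff[symmetric])
      also have "\<dots> \<longleftrightarrow> int a = int (j mod (m + 1))"
        using pos_mod_sign[of "int (m + 1)" s] by (simp only: a_def int_nat_eq zmod_int) simp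
      also have "\<dots> \<longleftrightarrow> j mod (m + 1) = a" by auto
      finally show ?thesis .
    qed
    moreover have "j < ?i \<and> j mod (m + 1) = a \<longleftrightarrow> j = a \<or> j = a + (m + 1)" for j
    proof
      assume j: "j < ?i \<and> j mod (m + 1) = a"
      show "j = a \<or> j = a + (m + 1)"
      proof (cases "j < m + 1")
        case False
        then have "j mod (m + 1) = (j - (m + 1)) mod (m + 1)" by (simp add: le_mod_geq)
        also have "\<dots> = j - (m + 1)" using j False by (intro mod_less) linarith
        finally show ?thesis using j False by auto
      qed (use j in auto)
    next
      assume "j = a \<or> j = a + (m + 1)"
      moreover have "(a + (m + 1)) mod (m + 1) = a" "a mod (m + 1) = a" using am by (simp_all only: mod_add_self2 mod_less)
      ultimately show "j < ?i \<and> j mod (m + 1) = a" using am by auto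
    qed
    ultimately have "{j. j < ?i \<and> int ?i dvd t - 2 * int j} = {a, a + (m + 1)}" by auto
    then show "card {j. j < ?i \<and> rf ?i t j = j} = 2" by (simp only: rf_fixed[of ?i t]) simp
  qed
  have "(\<Sum>t\<in>{0..<int ?i}. P N ?i (rf ?i t) x) = (\<Sum>s<?i. P N ?i (rf ?i (int s)) x)"
    by (rule sum.reindex_bij_witness[of _ int nat]) auto
  also have "\<dots> = (\<Sum>s<2 * (m + 1). if even s then pw N 1 x ^ 2 * pw N 2 x ^ m else pw N 2 x ^ (m + 1))"
    using odd even by (intro sum.cong) auto
  also have "\<dots> = real (m + 1) * (pw N 1 x ^ 2 * pw N 2 x ^ m + pw N 2 x ^ (m + 1))"
  proof -
    have "(\<Sum>s<2 * k. if even s then a else b) = real k * (a + b)" for k :: nat and a b :: real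
      by (induction k) (simp_all add: algebra_simps)
    then show ?thesis .
  qed
  finally show ?thesis by (simp add: refl_def field_simps)
qed

section \<open>Hooks\<close>

text \<open>The hook (i - r, 1^r), a partition of \<open>i\<close> for \<open>r < i\<close>;
  \<open>r\<close> is its leg length.\<close>

definition hk :: "nat \<Rightarrow> nat \<Rightarrow> nat \<Rightarrow> nat" where
  "hk i r = (\<lambda>j. if j = 0 then i - r else if j \<le> r then 1 else 0)"

lemma hk_Par: assumes "r < i" shows "hk i r \<in> Par i"
proof -
  have z: "hk i r j = 0" if "Suc r \<le> j" for j using that by (simp add: hk_def)
  have "shape (hk i r)" by (rule shapeI[OF _ z]) (use assms in \<open>auto simp: hk_def\<close>)
  moreover have "sz (hk i r) = i"
  proof -
    have "sz (hk i r) = hk i r 0 + (\<Sum>j<r. hk i r (Suc j))"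
      using sz_eq_sum[OF z] by (simp add: sum.lessThan_Suc_shift del: sum.lessThan_Suc)
    also have "(\<Sum>j<r. hk i r (Suc j)) = r" by (simp add: hk_def)
    finally show ?thesis using assms by (simp add: hk_def)
  qed
  ultimately show ?thesis by (simp add: Par_def)
qed

lemma hk_inject: "r < i \<Longrightarrow> r' < i \<Longrightarrow> hk i r = hk i r' \<longleftrightarrow> r = r'"
  by (auto simp: hk_def dest!: fun_cong[of _ _ 0])

lemma hk_row: "hk i 0 = row i" by (auto simp: hk_def row_def fun_eq_iff)

text \<open>A horizontal strip takes at most one cell from the leg of a hook and the others from its
  arm. So only two shapes of the smaller size are possible, and both are hooks.\<close>

lemma hs_hk_below:
  assumes "0 < i" "0 < k" "r < i + k"
  shows "{v. hs v (hk (i + k) r) \<and> sz v = i} = 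
     (if r < i then {hk i r} else {}) \<union> (if 0 < r \<and> r \<le> i then {hk i (r - 1)} else {})" (is "?L = ?R")
proof (intro subset_antisym subsetI)
  fix v assume "v \<in> ?L"
  then have v: "\<And>j. v j \<le> hk (i + k) r j" "\<And>j. hk (i + k) r (Suc j) \<le> v j" "sz v = i" by (auto simp: hs_def)
  have z: "v j = 0" if "Suc r \<le> j" for j using v(1)[of j] that by (simp add: hk_def)
  have szv: "i = v 0 + (\<Sum>j<r. v (Suc j))"
    using sz_eq_sum[of "Suc r" v] z v(3) by (simp add: sum.lessThan_Suc_shift del: sum.lessThan_Suc)
  have mid: "v j = 1" if "0 < j" "j < r" for j using v(1)[of j] v(2)[of j] that by (simp add: hk_def)
  show "v \<in> ?R"
  proof (cases "r = 0")
    case True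
    then have "v = hk i 0" using szv z by (auto simp: hk_def fun_eq_iff Suc_le_eq)
    then show ?thesis using True assms by simp
  next
    case False
    then obtain s where s: "r = Suc s" using not0_implies_Suc by blast
    have "(\<Sum>j<r. v (Suc j)) = s + v r" using mid by (simp add: s)
    then have i: "i = v 0 + s + v r" using szv by simp
    have "v r \<le> 1" using v(1)[of r] False by (simp add: hk_def)
    moreover have "1 \<le> v 0" using v(2)[of 0] False by (simp add: hk_def)
    ultimately consider "v r = 1" "r < i" "v 0 = i - r" | "v r = 0" "r \<le> i" "v 0 = i - s" using i s by linarith
    then show ?thesis
    proof cases
      case 1
      have "v j = hk i r j" for j
        using 1 mid[of j] z[of j] by (cases "j = 0"; cases "j < r"; cases "j = r") (auto simp: hk_def)
      then show ?thesis using 1 by auto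
    next
      case 2
      have "v j = hk i s j" for j
        using 2 mid[of j] z[of j] s by (cases "j = 0"; cases "j < r"; cases "j = r") (auto simp: hk_def)
      then have "v = hk i (r - 1)" using s by auto
      then show ?thesis using 2 False by auto
    qed
  qed
next
  fix v assume v: "v \<in> ?R"
  then have "(v = hk i r \<and> r < i) \<or> (v = hk i (r - 1) \<and> 0 < r \<and> r \<le> i)" by (auto split: if_splits)
  then show "v \<in> ?L"
  proof
    assume "v = hk i r \<and> r < i"
    then show ?thesis using hk_Par[of r i] by (auto simp: Par_def hs_def hk_def)
  next
    assume a: "v = hk i (r - 1) \<and> 0 < r \<and> r \<le> i"
    then have "sz v = i" using hk_Par[of "r - 1" i] assms(1) by (auto simp: Par_def)
    moreover have "hs v (hk (i + k) r)" using a assms by (auto simp: hs_def hk_def)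
    ultimately show ?thesis by simp
  qed
qed

lemma sum_hs_hk:
  fixes f :: "(nat \<Rightarrow> nat) \<Rightarrow> real"
  assumes "0 < i" "0 < k" "r < i + k"
  shows "(\<Sum>v | hs v (hk (i + k) r) \<and> sz v = i. f v) = 
    (if r < i then f (hk i r) else 0) + (if 0 < r \<and> r \<le> i then f (hk i (r - 1)) else 0)"
proof -
  have "hk i r \<noteq> hk i (r - 1)" if "r < i" "0 < r" using that hk_inject[of r i "r - 1"] by auto
  then show ?thesis unfolding hs_hk_below[OF assms] by auto
qed

text \<open>The Murnaghan-Nakayama rule for one cycle, by adding one variable at a time.
  \<open>T j r\<close> collects the shapes of size \<open>j\<close> left when the last variable is
  stripped from the hook with leg \<open>r\<close>. For \<open>0 < j < i\<close> each hook of size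
  \<open>j\<close> lies below two hooks with consecutive legs, hence opposite signs. Only
  \<open>j = 0\<close> and \<open>j = i\<close> survive: the new power and the old power
  sum.\<close>

theorem pw_hooks:
  assumes i: "0 < i" shows "pw a i x = (\<Sum>r<i. (-1) ^ r * S a (hk i r) x)"
proof (induction a)
  case 0
  have "hk i r \<noteq> (\<lambda>_. 0)" if "r < i" for r using that by (auto simp: hk_def dest!: fun_cong[of _ _ 0])
  then show ?case by (simp add: pw_def)
next
  case (Suc a)
  define T where "T j r = (\<Sum>v | hs v (hk i r) \<and> sz v = j. S a v x)" for j r
  have S: "S (Suc a) (hk i r) x = (\<Sum>j\<le>i. x a ^ (i - j) * T j r)" if r: "r < i" for r
  proof -
    have sh: "shape (hk i r)" "sz (hk i r) = i" using hk_Par[OF r] by (auto simp: Par_def)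
    have "S (Suc a) (hk i r) x = (\<Sum>j\<le>i. \<Sum>v | v \<in> {v. hs v (hk i r)} \<and> sz v = j. x a ^ (sz (hk i r) - sz v) * S a v x)"
      unfolding S.simps by (rule sum.group[symmetric]) (use finite_hs_below[OF sh(1)] hs_sz_le[of _ "hk i r"] sh in auto)
    also have "\<dots> = (\<Sum>j\<le>i. x a ^ (i - j) * T j r)"
      unfolding T_def sum_distrib_left by (intro sum.cong) (auto simp: sh)
    finally show ?thesis .
  qed
  have Ti: "T i r = S a (hk i r) x" if r: "r < i" for r
  proof -
    have sh: "shape (hk i r)" "sz (hk i r) = i" using hk_Par[OF r] by (auto simp: Par_def)
    have "v = hk i r" if v: "hs v (hk i r)" "sz v = i" for v
    proof
      fix j
      have z: "hk i r j = 0" if "Suc r \<le> j" for j using that by (simp add: hk_def)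
      have le: "v j \<le> hk i r j" for j using v(1) by (simp add: hs_def)
      have zv: "v j = 0" if "Suc r \<le> j" for j using z[OF that] le[of j] by simp
      have "(\<Sum>j<Suc r. v j) = (\<Sum>j<Suc r. hk i r j)" using sz_eq_sum[OF z] sz_eq_sum[OF zv] v(2) sh(2) by simp
      then have "v j = hk i r j" if "j < Suc r" using sum_mono_inv[of v "{..<Suc r}" "hk i r" j] le that by simp
      then show "v j = hk i r j" using z[of j] zv[of j] by (cases "j < Suc r") auto
    qed
    moreover have "hs (hk i r) (hk i r)" using shape_Suc[OF sh(1)] by (auto simp: hs_def)
    ultimately have "{v. hs v (hk i r) \<and> sz v = i} = {hk i r}" using sh by auto
    then show ?thesis by (simp add: T_def)
  qed
  have T0: "T 0 r = (if r = 0 then 1 else 0)" if r: "r < i" for r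
  proof -
    have sh: "shape (hk i r)" using hk_Par[OF r] by (auto simp: Par_def)
    have "hs (\<lambda>_. 0) (hk i r) \<longleftrightarrow> r = 0"
    proof
      assume "hs (\<lambda>_. 0) (hk i r)"
      then have "hk i r (Suc 0) \<le> 0" unfolding hs_def by blast
      then show "r = 0" by (simp add: hk_def split: if_splits)
    qed (simp add: hs_def hk_def)
    moreover have "sz v = 0 \<longleftrightarrow> v = (\<lambda>_. 0)" if "hs v (hk i r)" for v
      using sz_zero_iff[of v] hs_shape[OF that] sh by simp
    ultimately have "{v. hs v (hk i r) \<and> sz v = 0} = (if r = 0 then {\<lambda>_. 0} else {})" by auto
    then show ?thesis by (simp add: T_def)
  qed
  have Tj: "(\<Sum>r<i. (-1) ^ r * T j r) = 0" if j: "0 < j" "j < i" for j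
  proof -
    have t: "T j r = (if r < j then S a (hk j r) x else 0) + (if 0 < r \<and> r \<le> j then S a (hk j (r - 1)) x else 0)" if "r < i" for r
      using sum_hs_hk[of j "i - j" r "\<lambda>v. S a v x"] j that by (simp add: T_def)
    have "(\<Sum>r<i. (-1) ^ r * T j r) = (\<Sum>r<i. (-1) ^ r * (if r < j then S a (hk j r) x else 0)) + 
       (\<Sum>r<i. (-1) ^ r * (if 0 < r \<and> r \<le> j then S a (hk j (r - 1)) x else 0))"
      unfolding sum.distrib[symmetric] by (intro sum.cong) (auto simp: t distrib_left)
    also have "(\<Sum>r<i. (-1) ^ r * (if r < j then S a (hk j r) x else 0)) = (\<Sum>r<j. (-1) ^ r * S a (hk j r) x)"
      using j by (intro sum.mono_neutral_cong_right) auto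
    also have "(\<Sum>r<i. (-1) ^ r * (if 0 < r \<and> r \<le> j then S a (hk j (r - 1)) x else 0)) = (\<Sum>r\<in>Suc ` {..<j}. (-1) ^ r * S a (hk j (r - 1)) x)"
    proof (intro sum.mono_neutral_cong_right)
      show "\<forall>r\<in>{..<i} - Suc ` {..<j}. (-1) ^ r * (if 0 < r \<and> r \<le> j then S a (hk j (r - 1)) x else 0) = 0"
      proof
        fix r assume r: "r \<in> {..<i} - Suc ` {..<j}"
        have "\<not> (0 < r \<and> r \<le> j)"
        proof
          assume "0 < r \<and> r \<le> j"
          then have "r = Suc (r - 1)" "r - 1 \<in> {..<j}" by auto
          then show False using r by blast
        qed
        then show "(-1) ^ r * (if 0 < r \<and> r \<le> j then S a (hk j (r - 1)) x else 0) = 0" by auto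
      qed
    qed (use j in auto)
    also have "\<dots> = - (\<Sum>r<j. (-1) ^ r * S a (hk j r) x)" by (simp add: sum.reindex sum_negf)
    finally show ?thesis by simp
  qed
  have "(\<Sum>r<i. (-1) ^ r * S (Suc a) (hk i r) x) = (\<Sum>r<i. \<Sum>j\<le>i. x a ^ (i - j) * ((-1) ^ r * T j r))"
    by (intro sum.cong) (auto simp: S sum_distrib_left mult_ac simp del: S.simps)
  also have "\<dots> = (\<Sum>j\<le>i. x a ^ (i - j) * (\<Sum>r<i. (-1) ^ r * T j r))"
    by (subst sum.swap) (simp add: sum_distrib_left)
  also have "\<dots> = (\<Sum>j\<in>{0, i}. x a ^ (i - j) * (\<Sum>r<i. (-1) ^ r * T j r))"
    using Tj by (intro sum.mono_neutral_right) auto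
  also have "\<dots> = x a ^ i * (\<Sum>r<i. (-1) ^ r * T 0 r) + (\<Sum>r<i. (-1) ^ r * T i r)" using i by simp
  also have "(\<Sum>r<i. (-1) ^ r * T 0 r) = (\<Sum>r<i. if r = 0 then 1 else 0)" by (intro sum.cong) (auto simp: T0)
  also have "\<dots> = 1" using i by simp
  also have "(\<Sum>r<i. (-1) ^ r * T i r) = pw a i x" unfolding Suc by (intro sum.cong) (auto simp: Ti)
  finally show ?case by (simp add: pw_def)
qed

section \<open>Newton's identities\<close>

lemma H_recursion: "H (Suc a) (Suc k) x = H a (Suc k) x + x a * H (Suc a) k x"
proof -
  have "(\<Sum>g\<le>k. x a ^ (Suc k - g) * H a g x) = x a * (\<Sum>g\<le>k. x a ^ (k - g) * H a g x)"
    unfolding sum_distrib_left by (intro sum.cong) (auto simp: Suc_diff_le)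
  then show ?thesis unfolding H_Suc[of a "Suc k"] H_Suc[of a k] by simp
qed

text \<open>Induction on the variables and, inside it, on \<open>k\<close>.
  \<open>H_recursion\<close> splits the left side into the identity in fewer variables,
  \<open>x a\<close> times the identity for \<open>k\<close>, and one further
  \<open>x a * H (Suc a) k x\<close>, which supplies the powers of \<open>x a\<close> that enter the
  power sums.\<close>

theorem newton: "real k * H a k x = (\<Sum>j<k. pw a (Suc j) x * H a (k - Suc j) x)"
proof (induction a arbitrary: k)
  case 0
  have "H 0 k x = 0" if "0 < k" using that by (simp add: row_def fun_eq_iff)
  then show ?case by (cases "k = 0") (simp_all add: pw_def)
next
  case (Suc a)
  show ?case
  proof (induction k)
    case (Suc k)
    let ?H' = "\<lambda>k. H (Suc a) k x" and ?H = "\<lambda>k. H a k x"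
    have d: "x a * ?H' (k - Suc j) = ?H' (k - j) - ?H (k - j)" if "j < k" for j
      using H_recursion[of a "k - Suc j" x] that by (simp add: Suc_diff_Suc)
    have "x a * (real k * ?H' k) = (\<Sum>j<k. pw (Suc a) (Suc j) x * (?H' (k - j) - ?H (k - j)))"
      unfolding Suc.IH sum_distrib_left by (intro sum.cong refl) (simp only: d[symmetric] lessThan_iff mult.left_commute)
    also have "\<dots> = (\<Sum>j<Suc k. pw (Suc a) (Suc j) x * (?H' (k - j) - ?H (k - j)))" by (simp add: row_0 del: S.simps)
    finally have 1: "x a * (real k * ?H' k) = \<dots>" .
    have 2: "x a * ?H' k = (\<Sum>j<Suc k. x a ^ Suc j * ?H (k - j))"
    proof -
      have "(\<Sum>j<Suc k. x a ^ Suc j * ?H (k - j)) = (\<Sum>g\<le>k. x a ^ Suc (k - g) * ?H g)"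
        by (rule sum.reindex_bij_witness[of _ "\<lambda>g. k - g" "\<lambda>g. k - g"]) auto
      then show ?thesis unfolding H_Suc by (simp add: sum_distrib_left mult_ac)
    qed
    have 3: "real (Suc k) * ?H (Suc k) = (\<Sum>j<Suc k. pw a (Suc j) x * ?H (k - j))"
      using \<open>\<And>k. real k * H a k x = _ k\<close>[of "Suc k"] by simp
    have "real (Suc k) * ?H' (Suc k) = real (Suc k) * ?H (Suc k) + x a * (real k * ?H' k) + x a * ?H' k"
      unfolding H_recursion by (simp add: algebra_simps del: S.simps)
    also have "\<dots> = (\<Sum>j<Suc k. pw a (Suc j) x * ?H (k - j) + pw (Suc a) (Suc j) x * (?H' (k - j) - ?H (k - j)) + x a ^ Suc j * ?H (k - j))"
      unfolding 1 2 3 by (simp only: sum.distrib)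
    also have "\<dots> = (\<Sum>j<Suc k. pw (Suc a) (Suc j) x * ?H' (k - j))"
      by (intro sum.cong refl) (simp add: pw_def algebra_simps del: S.simps)
    finally show ?case by simp
  qed simp
qed

lemma pw_1: "pw N 1 x = H N 1 x" using newton[of 1 N x] by (simp add: row_0)

lemma pw_2: "pw N 2 x = 2 * H N 2 x - H N 1 x * H N 1 x"
  using newton[of 2 N x] pw_1[of N x] by (simp add: row_0 numeral_2_eq_2)

text \<open>Only the coefficients of hooks are recorded. By \<open>hs_hk_below\<close> they
  determine the hook coefficients after multiplication by a complete function, so the other
  coefficients never have to be computed. The last clause extends \<open>q\<close> by zero beyond
  the possible legs, which \<open>HC_pieri\<close> uses at the boundary.\<close>

definition HC :: "nat \<Rightarrow> nat \<Rightarrow> ((nat \<Rightarrow> real) \<Rightarrow> real) \<Rightarrow> (nat \<Rightarrow> real) \<Rightarrow> bool" where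
  "HC N n F q \<longleftrightarrow> (\<exists>b. (\<forall>x. F x = (\<Sum>l\<in>Par n. b l * S N l x)) \<and> (\<forall>r<n. b (hk n r) = q r)) \<and> (\<forall>r\<ge>n. q r = 0)"

lemma HC_combine: assumes "HC N n F q" "HC N n G q'" shows "HC N n (\<lambda>x. c * F x - d * G x) (\<lambda>r. c * q r - d * q' r)"
proof -
  obtain b b' where "\<forall>x. F x = (\<Sum>l\<in>Par n. b l * S N l x)" "\<forall>r<n. b (hk n r) = q r" "\<forall>r\<ge>n. q r = 0"
    "\<forall>x. G x = (\<Sum>l\<in>Par n. b' l * S N l x)" "\<forall>r<n. b' (hk n r) = q' r" "\<forall>r\<ge>n. q' r = 0"
    using assms unfolding HC_def by blast
  then show ?thesis unfolding HC_def
    by (intro conjI exI[of _ "\<lambda>l. c * b l - d * b' l"]) 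
       (auto simp: sum_subtractf left_diff_distrib sum_distrib_left mult.assoc)
qed

lemma HC_row: "0 < k \<Longrightarrow> HC N k (H N k) (\<lambda>r. if r = 0 then 1 else 0)"
proof -
  assume k: "0 < k"
  have "row k \<in> Par k" by (simp add: Par_def)
  then have "H N k x = (\<Sum>l\<in>Par k. (if l = row k then 1 else 0) * S N l x)" for x
    by (simp add: if_distrib[of "\<lambda>t. t * _"] cong: if_cong)
  moreover have "(if hk k r = row k then 1 else 0) = (if r = 0 then 1 else (0::real))" if "r < k" for r
    using hk_inject[of r k 0] that k by (simp add: hk_row)
  ultimately show ?thesis unfolding HC_def using k by (intro conjI exI[of _ "\<lambda>l. if l = row k then 1 else 0"]) auto
qed

lemma HC_pieri:
  assumes "HC N n F q" "0 < n" "0 < k"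
  shows "HC N (n + k) (\<lambda>x. H N k x * F x) (\<lambda>r. q r + (if r = 0 then 0 else q (r - 1)))"
proof -
  obtain b where b: "\<And>x. F x = (\<Sum>l\<in>Par n. b l * S N l x)" "\<forall>r<n. b (hk n r) = q r" and q: "\<forall>r\<ge>n. q r = 0"
    using assms(1) unfolding HC_def by blast
  define b' where "b' v = (\<Sum>l | l \<in> Par n \<and> hs l v. b l)" for v
  have "H N k x * F x = (\<Sum>v\<in>Par (n + k). b' v * S N v x)" for x
  proof -
    have "H N k x * F x = (\<Sum>l\<in>Par n. b l * (H N k x * S N l x))" by (simp add: b(1) sum_distrib_left mult_ac)
    also have "\<dots> = (\<Sum>l\<in>Par n. \<Sum>v | v \<in> Par (n + k) \<and> hs l v. b l * S N v x)"
    proof (rule sum.cong[OF refl])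
      fix l assume l: "l \<in> Par n"
      then have "{v. hs l v \<and> sz v = sz l + k} = {v. v \<in> Par (n + k) \<and> hs l v}" using hs_shape by (auto simp: Par_def)
      then show "b l * (H N k x * S N l x) = (\<Sum>v | v \<in> Par (n + k) \<and> hs l v. b l * S N v x)"
        using pieri[where l=l and a=N and n=k and x=x] l by (simp add: Par_shape sum_distrib_left[symmetric])
    qed
    also have "\<dots> = (\<Sum>v\<in>Par (n + k). \<Sum>l | l \<in> Par n \<and> hs l v. b l * S N v x)" by (rule sum.swap_restrict) auto
    finally show ?thesis by (simp add: b'_def sum_distrib_right)
  qed
  moreover have "b' (hk (n + k) r) = q r + (if r = 0 then 0 else q (r - 1))" if r: "r < n + k" for r
  proof -
    have "shape (hk (n + k) r)" using hk_Par[OF r] by (simp add: Par_def)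
    then have "{l. l \<in> Par n \<and> hs l (hk (n + k) r)} = {v. hs v (hk (n + k) r) \<and> sz v = n}" using hs_shape by (auto simp: Par_def)
    then show ?thesis using sum_hs_hk[OF assms(2,3) r, of b] b(2) q by (auto simp: b'_def)
  qed
  ultimately show ?thesis unfolding HC_def using q assms(3) by (intro conjI exI[of _ b']) auto
qed

text \<open>Let \<open>q\<close> be the coefficients of a polynomial in t. A complete function
  multiplies it by 1 + t, so p_2 = 2 h_2 - h_1^2 multiplies it by 2 (1 + t) - (1 + t)^2 = 1 -
  t^2.\<close>

lemma HC_p2: assumes "HC N n F q" "0 < n"
  shows "HC N (n + 2) (\<lambda>x. pw N 2 x * F x) (\<lambda>r. q r - (if r < 2 then 0 else q (r - 2)))"
proof -
  have "HC N (n + 2) (\<lambda>x. H N 1 x * (H N 1 x * F x)) (\<lambda>r. (q r + (if r = 0 then 0 else q (r - 1))) + 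
      (if r = 0 then 0 else q (r - 1) + (if r - 1 = 0 then 0 else q (r - 1 - 1))))"
    using HC_pieri[OF HC_pieri[OF assms(1,2), of 1], of 1] assms(2) by (simp add: numeral_2_eq_2)
  from HC_combine[OF HC_pieri[OF assms, of 2] this, of 2 1]
  have "HC N (n + 2) (\<lambda>x. 2 * (H N 2 x * F x) - 1 * (H N 1 x * (H N 1 x * F x))) (\<lambda>r. 2 * (q r + (if r = 0 then 0 else q (r - 1))) -
      1 * ((q r + (if r = 0 then 0 else q (r - 1))) + (if r = 0 then 0 else q (r - 1) + (if r - 1 = 0 then 0 else q (r - 1 - 1)))))" by simp
  moreover have "(\<lambda>x. 2 * (H N 2 x * F x) - 1 * (H N 1 x * (H N 1 x * F x))) = (\<lambda>x. pw N 2 x * F x)"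
    by (simp add: pw_2 fun_eq_iff algebra_simps)
  moreover have "(\<lambda>r. 2 * (q r + (if r = 0 then 0 else q (r - 1))) -
      1 * ((q r + (if r = 0 then 0 else q (r - 1))) + (if r = 0 then 0 else q (r - 1) + (if r - 1 = 0 then 0 else q (r - 1 - 1)))))
     = (\<lambda>r. q r - (if r < 2 then 0 else q (r - 2)))"
    by (auto simp: fun_eq_iff numeral_2_eq_2)
  ultimately show ?thesis by simp
qed

text \<open>The coefficient of t^r in (1 - t^2)^m.\<close>

definition bin :: "nat \<Rightarrow> nat \<Rightarrow> real" where
  "bin m r = (if even r then (-1) ^ (r div 2) * real (m choose (r div 2)) else 0)"

lemma HC_p2_power: 
  assumes "HC N n F (\<lambda>r. if r = 0 then 1 else 0)" "0 < n"
  shows "HC N (n + 2 * m) (\<lambda>x. F x * pw N 2 x ^ m) (bin m)"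
proof (induction m)
  case 0
  have "bin 0 = (\<lambda>r. if r = 0 then 1 else 0)" by (auto simp: bin_def fun_eq_iff binomial_eq_0_iff)
  then show ?case using assms(1) by simp
next
  case (Suc m)
  have "(\<lambda>r. bin m r - (if r < 2 then 0 else bin m (r - 2))) = bin (Suc m)"
  proof
    fix r show "bin m r - (if r < 2 then 0 else bin m (r - 2)) = bin (Suc m) r"
    proof (cases "even r")
      case True
      then obtain s where s: "r = 2 * s" by blast
      show ?thesis
      proof (cases s)
        case (Suc t)
        then have r: "r = 2 * t + 2" using s by simp
        have "bin m (r - 2) = (-1) ^ t * real (m choose t)" "bin m r = (-1) ^ Suc t * real (m choose Suc t)"
          "bin (Suc m) r = (-1) ^ Suc t * real (Suc m choose Suc t)" by (simp_all add: r bin_def)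
        then show ?thesis using r by (simp add: algebra_simps)
      qed (simp add: s bin_def)
    next
      case False
      then show ?thesis by (simp add: bin_def)
    qed
  qed
  moreover have "(\<lambda>x. pw N 2 x * (F x * pw N 2 x ^ m)) = (\<lambda>x. F x * pw N 2 x ^ Suc m)" by (simp add: fun_eq_iff mult_ac)
  ultimately show ?case using HC_p2[OF Suc] assms(2) by (simp add: add.assoc)
qed

text \<open>In either parity the average over reflections is \<open>H N 1\<close> or
  \<open>H N 2\<close> times a power of \<open>pw N 2\<close>. So the coefficients at hooks of even
  leg are binomial coefficients up to sign, and none of them vanishes for
  \<open>r < i\<close>.\<close>

lemma HC_refl: 
  assumes "0 < i" shows "\<exists>b. (\<forall>x. refl N i x = (\<Sum>l\<in>Par i. b l * S N l x)) \<and> (\<forall>r<i. even r \<longrightarrow> 1 \<le> \<bar>b (hk i r)\<bar>)"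
proof -
  have "\<exists>m. HC N i (refl N i) (bin m) \<and> i \<le> 2 * m + 2"
  proof (cases "odd i")
    case True
    then obtain m where m: "i = 2 * m + 1" using oddE by blast
    have "HC N (1 + 2 * m) (\<lambda>x. H N 1 x * pw N 2 x ^ m) (bin m)" by (rule HC_p2_power[OF HC_row]) auto
    moreover have "refl N (1 + 2 * m) = (\<lambda>x. H N 1 x * pw N 2 x ^ m)"
      using refl_odd[of N m] unfolding pw_1 by (simp add: fun_eq_iff del: S.simps)
    ultimately show ?thesis using m by (intro exI[of _ m]) (simp del: S.simps)
  next
    case False
    then obtain k where "i = 2 * k" by auto
    then obtain m where m: "i = 2 * m + 2" using assms by (cases k) auto
    have "HC N (2 + 2 * m) (\<lambda>x. H N 2 x * pw N 2 x ^ m) (bin m)" by (rule HC_p2_power[OF HC_row]) auto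
    moreover have "refl N i = (\<lambda>x. H N 2 x * pw N 2 x ^ m)"
    proof
      fix x
      have "(pw N 1 x ^ 2 + pw N 2 x) / 2 = H N 2 x" unfolding pw_1 pw_2 by (simp add: power2_eq_square del: S.simps)
      then show "refl N i x = H N 2 x * pw N 2 x ^ m" unfolding m refl_even by simp
    qed
    ultimately show ?thesis using m by (intro exI[of _ m]) (simp add: add.commute)
  qed
  then obtain m b where b: "\<forall>x. refl N i x = (\<Sum>l\<in>Par i. b l * S N l x)" "\<forall>r<i. b (hk i r) = bin m r" "i \<le> 2 * m + 2"
    unfolding HC_def by blast
  have "1 \<le> \<bar>bin m r\<bar>" if "r < i" "even r" for r
  proof -
    obtain s where s: "r = 2 * s" using \<open>even r\<close> by blast
    then have "1 \<le> m choose s" using that(1) b(3) by (simp add: Suc_le_eq zero_less_binomial_iff)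
    then have "1 \<le> real (m choose s)" by linarith
    then show ?thesis by (simp add: bin_def s abs_mult power_abs)
  qed
  then show ?thesis using b by auto
qed

definition Eh :: "nat \<Rightarrow> nat \<Rightarrow> (nat \<Rightarrow> real) \<Rightarrow> real" where
  "Eh N i x = (\<Sum>r | r < i \<and> even r. S N (hk i r) x)"

definition Oh :: "nat \<Rightarrow> nat \<Rightarrow> (nat \<Rightarrow> real) \<Rightarrow> real" where
  "Oh N i x = (\<Sum>r | r < i \<and> odd r. S N (hk i r) x)"

lemma pw_Eh_Oh: assumes "0 < i" shows "pw N i x = Eh N i x - Oh N i x"
proof -
  have "pw N i x = (\<Sum>r\<in>{r. r < i \<and> even r} \<union> {r. r < i \<and> odd r}. (-1) ^ r * S N (hk i r) x)"
    unfolding pw_hooks[OF assms] by (intro sum.cong) auto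
  also have "\<dots> = (\<Sum>r | r < i \<and> even r. (-1) ^ r * S N (hk i r) x) + (\<Sum>r | r < i \<and> odd r. (-1) ^ r * S N (hk i r) x)"
    by (rule sum.union_disjoint) auto
  also have "\<dots> = Eh N i x + - Oh N i x"
    unfolding Eh_def Oh_def sum_negf[symmetric] by (intro arg_cong2[where f="(+)"] sum.cong) auto
  finally show ?thesis by simp
qed

lemma SP_Eh: "SP N i (Eh N i)" and SP_Oh: "SP N i (Oh N i)"
  unfolding Eh_def[abs_def] Oh_def[abs_def] by (intro SP_sum SP_schur; simp add: hk_Par)+

text \<open>Up to a factor 2, the sum and the difference of the two terms are the characteristics of the two characters of the
  dihedral group that are trivial on rotations. So the multiplicities in the cyclic term dominate the absolute values
  of those in the reflection term.\<close>

theorem SP_cyc_Eh: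
  assumes i: "0 < i" "i \<le> N" shows "SP N i (\<lambda>x. cyc N [i] x - Eh N i x)"
proof -
  obtain c where c: "\<forall>l. 0 \<le> c l" "\<forall>x. cyc N [i] x + 1 * refl N i x = (\<Sum>l\<in>Par i. c l * S N l x)"
    using SP_cyc_refl[OF i, of 1] unfolding SP_def by blast
  obtain d where d: "\<forall>l. 0 \<le> d l" "\<forall>x. cyc N [i] x + (-1) * refl N i x = (\<Sum>l\<in>Par i. d l * S N l x)"
    using SP_cyc_refl[OF i, of "-1"] unfolding SP_def by blast
  obtain b where b: "\<forall>x. refl N i x = (\<Sum>l\<in>Par i. b l * S N l x)" "\<forall>r<i. even r \<longrightarrow> 1 \<le> \<bar>b (hk i r)\<bar>"
    using HC_refl[OF i(1)] by blast
  \<comment> \<open>Two expansions of \<open>refl\<close> are compared. With \<open>c\<close> and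
    \<open>d\<close> nonnegative the relation gives
    \<open>\<bar>b l\<bar> \<le> (c l + d l) / 2\<close>, the multiplicity in the cyclic
    term.\<close>
  have bcd: "b l - (c l - d l) / 2 = 0" if l: "l \<in> Par i" for l
  proof (rule schur_independent[OF i(2) _ l])
    fix x
    have "(\<Sum>l\<in>Par i. (b l - (c l - d l) / 2) * S N l x) = 
      (\<Sum>l\<in>Par i. b l * S N l x) - ((\<Sum>l\<in>Par i. c l * S N l x) - (\<Sum>l\<in>Par i. d l * S N l x)) / 2"
      by (simp add: sum_subtractf left_diff_distrib diff_divide_distrib sum_divide_distrib)
    also have "\<dots> = 0" unfolding b(1)[rule_format, symmetric] c(2)[rule_format, symmetric] d(2)[rule_format, symmetric] by simp
    finally show "(\<Sum>l\<in>Par i. (b l - (c l - d l) / 2) * S N l x) = 0" .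
  qed
  let ?E = "\<lambda>l. if \<exists>r<i. even r \<and> l = hk i r then 1 else (0::real)"
  show ?thesis
  proof (rule SPI[of i "\<lambda>l. (c l + d l) / 2 - ?E l"])
    fix l assume l: "l \<in> Par i"
    show "0 \<le> (c l + d l) / 2 - ?E l"
    proof (cases "\<exists>r<i. even r \<and> l = hk i r")
      case True
      then have "1 \<le> \<bar>b l\<bar>" using b(2) by auto
      moreover have "b l = (c l - d l) / 2" using bcd[OF l] by simp
      moreover have "0 \<le> c l" "0 \<le> d l" using c(1) d(1) by auto
      ultimately show ?thesis using True by (auto simp: abs_if split: if_splits)
    next
      case False
      then show ?thesis using c(1) d(1) by (simp only: if_False) simp
    qed
  next
    fix x
    have "(\<Sum>l\<in>Par i. ?E l * S N l x) = (\<Sum>l\<in>hk i ` {r. r < i \<and> even r}. S N l x)"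
      by (rule sum.mono_neutral_cong_right) (auto simp: hk_Par)
    also have "\<dots> = Eh N i x" unfolding Eh_def by (subst sum.reindex) (auto simp: inj_on_def hk_inject)
    finally have E: "(\<Sum>l\<in>Par i. ?E l * S N l x) = Eh N i x" .
    have "(\<Sum>l\<in>Par i. ((c l + d l) / 2 - ?E l) * S N l x) = 
      ((\<Sum>l\<in>Par i. c l * S N l x) + (\<Sum>l\<in>Par i. d l * S N l x)) / 2 - (\<Sum>l\<in>Par i. ?E l * S N l x)"
      by (simp only: sum_subtractf left_diff_distrib distrib_right add_divide_distrib sum.distrib sum_divide_distrib times_divide_eq_left)
    also have "\<dots> = cyc N [i] x - Eh N i x"
      unfolding E c(2)[rule_format, symmetric] d(2)[rule_format, symmetric] by simp
    finally show "cyc N [i] x - Eh N i x = (\<Sum>l\<in>Par i. ((c l + d l) / 2 - ?E l) * S N l x)" by simp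
  qed
qed

lemma hs_hk_hk: "0 < r \<Longrightarrow> r < Suc i \<Longrightarrow> hs (hk i (r - 1)) (hk (Suc i) r)"
  by (auto simp: hs_def hk_def)

text \<open>Adding a cell to the leg of a hook of even leg length gives every hook of size
  \<open>Suc i\<close> with odd leg length exactly once. The other terms of the Pieri expansions
  remain as a positive surplus.\<close>

theorem SP_p1_Eh_Oh:
  assumes "0 < i" shows "SP N (Suc i) (\<lambda>x. pw N 1 x * Eh N i x - Oh N (Suc i) x)"
proof -
  let ?R = "{r. r < i \<and> even r}"
  have one: "SP N (Suc i) (\<lambda>x. pw N 1 x * S N (hk i r) x - S N (hk (Suc i) (Suc r)) x)" if r: "r < i" for r
  proof -
    let ?A = "{v. hs (hk i r) v \<and> sz v = sz (hk i r) + 1}"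
    have p: "hk i r \<in> Par i" using hk_Par[OF r] .
    have m: "hk (Suc i) (Suc r) \<in> ?A" using hs_hk_hk[of "Suc r" i] hk_Par[of "Suc r" "Suc i"] p r by (simp add: Par_def)
    have A: "?A \<subseteq> Par (Suc i)" using p hs_shape by (auto simp: Par_def)
    then have fin: "finite ?A" using finite_subset finite_Par by blast
    have "pw N 1 x * S N (hk i r) x = (\<Sum>v\<in>?A. S N v x)" for x
      unfolding pw_1 by (rule pieri[symmetric]) (use p in \<open>simp add: Par_def\<close>)
    also have "\<dots> x = S N (hk (Suc i) (Suc r)) x + (\<Sum>v\<in>?A - {hk (Suc i) (Suc r)}. S N v x)" for x
      by (rule sum.remove[OF fin m])
    finally have "pw N 1 x * S N (hk i r) x - S N (hk (Suc i) (Suc r)) x = (\<Sum>v\<in>?A - {hk (Suc i) (Suc r)}. S N v x)" for x by simp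
    moreover have "SP N (Suc i) (\<lambda>x. \<Sum>v\<in>?A - {hk (Suc i) (Suc r)}. S N v x)" using A by (intro SP_sum SP_schur) auto
    ultimately show ?thesis by simp
  qed
  have "SP N (Suc i) (\<lambda>x. \<Sum>r\<in>?R. (pw N 1 x * S N (hk i r) x - S N (hk (Suc i) (Suc r)) x))"
    by (intro SP_sum one) auto
  moreover have "(\<Sum>r\<in>?R. (pw N 1 x * S N (hk i r) x - S N (hk (Suc i) (Suc r)) x)) = pw N 1 x * Eh N i x - Oh N (Suc i) x" for x
  proof -
    have "(\<Sum>r\<in>?R. S N (hk (Suc i) (Suc r)) x) = Oh N (Suc i) x"
      unfolding Oh_def by (rule sum.reindex_bij_witness[of _ "\<lambda>r. r - 1" Suc]) (auto elim: oddE)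
    then show ?thesis by (simp add: sum_subtractf Eh_def sum_distrib_left)
  qed
  ultimately show ?thesis by simp
qed

section \<open>Removing the long cycles\<close>

definition Q :: "nat \<Rightarrow> nat \<Rightarrow> (nat \<Rightarrow> real) \<Rightarrow> real" where
  "Q N n x = (\<Sum>m\<in>partitions n. pm N m x)"

lemma SP_Q: "n \<le> N \<Longrightarrow> SP N n (Q N n)"
  unfolding Q_def[abs_def] using sum_cyc[of n N] SP_sum[of "partitions n" N n "cyc N"] SP_cyc[of _ n N] by simp

lemma partitions_part_le: "m \<in> partitions k \<Longrightarrow> q \<in> set m \<Longrightarrow> q \<le> k"
  using member_le_sum_list by (fastforce simp: partitions_def is_partition_def)

lemma partitions_ConsI: "m \<in> partitions k \<Longrightarrow> (\<And>q. q \<in> set m \<Longrightarrow> q \<le> i) \<Longrightarrow> 0 < i \<Longrightarrow> i # m \<in> partitions (i + k)"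
  by (auto simp: partitions_def is_partition_def)

text \<open>For \<open>j < b\<close> the first bound gives \<open>j < n - j\<close>, so the first
  part \<open>n - j\<close> exceeds all others and \<open>cyc_Cons\<close> applies. By
  \<open>sum_cyc\<close> the tails sum to \<open>Q N j x\<close>; what is left is a sum over the
  remaining partitions.\<close>

lemma blocks:
  assumes "2 * b \<le> n + 1" "n \<le> N" "0 < n"
  shows "SP N n (\<lambda>x. Q N n x - (\<Sum>j<b. cyc N [n - j] x * Q N j x))"
proof -
  let ?B = "\<Union>j\<in>{..<b}. (\<lambda>m. (n - j) # m) ` partitions j"
  have sub: "?B \<subseteq> partitions n"
  proof clarsimp
    fix j m assume j: "j < b" "m \<in> partitions j"
    have "(n - j) # m \<in> partitions ((n - j) + j)"
      using j assms partitions_part_le[OF j(2)] by (intro partitions_ConsI) fastforce+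
    then show "(n - j) # m \<in> partitions n" using j assms by simp
  qed
  have "SP N n (\<lambda>x. \<Sum>m\<in>partitions n - ?B. cyc N m x)" using assms(2) by (intro SP_sum SP_cyc) auto
  moreover have "(\<Sum>m\<in>partitions n - ?B. cyc N m x) = Q N n x - (\<Sum>j<b. cyc N [n - j] x * Q N j x)" for x
  proof -
    have "(\<Sum>m\<in>?B. cyc N m x) = (\<Sum>j<b. \<Sum>m\<in>(\<lambda>m. (n - j) # m) ` partitions j. cyc N m x)"
      by (rule sum.UNION_disjoint) (use assms(1,3) in auto)
    also have "\<dots> = (\<Sum>j<b. \<Sum>m\<in>partitions j. cyc N [n - j] x * cyc N m x)"
    proof (rule sum.cong[OF refl])
      fix j assume j: "j \<in> {..<b}"
      have "cyc N ((n - j) # m) x = cyc N [n - j] x * cyc N m x" if m: "m \<in> partitions j" for m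
      proof (rule cyc_Cons)
        show "\<forall>q\<in>set m. q < n - j" using partitions_part_le[OF m] j assms(1,3) by fastforce
      qed
      then show "(\<Sum>m\<in>(\<lambda>m. (n - j) # m) ` partitions j. cyc N m x) = (\<Sum>m\<in>partitions j. cyc N [n - j] x * cyc N m x)"
        by (simp add: sum.reindex)
    qed
    also have "\<dots> = (\<Sum>j<b. cyc N [n - j] x * Q N j x)"
    proof (rule sum.cong[OF refl])
      fix j assume "j \<in> {..<b}"
      then have "j \<le> N" using assms by auto
      then show "(\<Sum>m\<in>partitions j. cyc N [n - j] x * cyc N m x) = cyc N [n - j] x * Q N j x"
        using sum_cyc[of j N x] by (simp add: sum_distrib_left[symmetric] Q_def)
    qed
    finally have B: "(\<Sum>m\<in>?B. cyc N m x) = (\<Sum>j<b. cyc N [n - j] x * Q N j x)" .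
    have "(\<Sum>m\<in>partitions n - ?B. cyc N m x) = (\<Sum>m\<in>partitions n. cyc N m x) - (\<Sum>m\<in>?B. cyc N m x)"
      by (rule sum_diff[OF finite_partitions sub])
    then show ?thesis using sum_cyc[OF assms(2), of x] B by (simp add: Q_def)
  qed
  ultimately show ?thesis by simp
qed

lemma SP_cyc_pw: assumes "0 < i" "i \<le> N" shows "SP N i (\<lambda>x. cyc N [i] x - pw N i x)"
proof -
  have "cyc N [i] x - Eh N i x + Oh N i x = cyc N [i] x - pw N i x" for x using pw_Eh_Oh[OF assms(1)] by simp
  then show ?thesis using SP_add[OF SP_cyc_Eh[OF assms] SP_Oh[of N i]] by presburger
qed

lemma SP_blocks_pw:
  assumes "2 * b \<le> n + 1" "n \<le> N" "0 < n"
  shows "SP N n (\<lambda>x. \<Sum>j<b. (cyc N [n - j] x - pw N (n - j) x) * Q N j x)"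
proof (rule SP_sum)
  fix j assume j: "j \<in> {..<b}"
  then have "SP N ((n - j) + j) (\<lambda>x. (cyc N [n - j] x - pw N (n - j) x) * Q N j x)"
    using assms by (intro SP_mult SP_cyc_pw SP_Q) auto
  then show "SP N n (\<lambda>x. (cyc N [n - j] x - pw N (n - j) x) * Q N j x)" using j assms by simp
qed

theorem SP_full_blocks:
  assumes "2 * b \<le> n + 1" "n \<le> N" "0 < n"
  shows "SP N n (\<lambda>x. Q N n x - (\<Sum>j<b. pw N (n - j) x * Q N j x))"
  using SP_add[OF blocks[OF assms] SP_blocks_pw[OF assms]]
  by (simp add: left_diff_distrib sum_subtractf)

text \<open>Modulo terms that are visibly positive, the deficit is the product of the odd hooks of size $n-k$ with
  Um; each odd hook arises from an even hook of size $n-k-1$ by adding a box, so the cycles of length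
  $n-k-1$ pay for it.\<close>

theorem SP_partial_block:
  assumes n: "2 * k + 2 < n" "n \<le> N"
    and Up: "SP N k Up" and Um: "SP N k Um" and V: "\<And>x. V x = Up x - Um x"
    and QU: "SP N k (\<lambda>x. Q N k x - Up x)" and QU': "SP N (Suc k) (\<lambda>x. Q N (Suc k) x - pw N 1 x * Um x)"
  shows "SP N n (\<lambda>x. Q N n x - (\<Sum>j<k. pw N (n - j) x * Q N j x) - pw N (n - k) x * V x)"
proof -
  define i where "i = n - k - 1"
  have i: "0 < i" "Suc i + k = n" "i + Suc k = n" "n - k = Suc i" "n - Suc k = i" "Suc i \<le> N" "i \<le> N" using n by (auto simp: i_def)
  \<comment> \<open>Block \<open>k\<close> is the one that is cut, and block \<open>Suc k\<close>,
    with cycles of length \<open>i\<close>, pays for the odd hooks. The bound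
    \<open>2 * k + 2 < n\<close> is what \<open>blocks\<close> demands for
    \<open>Suc (Suc k)\<close> blocks.\<close>
  have 1: "SP N n (\<lambda>x. Q N n x - (\<Sum>j<Suc (Suc k). cyc N [n - j] x * Q N j x))" by (rule blocks) (use n in auto)
  have 2: "SP N n (\<lambda>x. \<Sum>j<k. (cyc N [n - j] x - pw N (n - j) x) * Q N j x)" by (rule SP_blocks_pw) (use n in auto)
  have 3: "SP N n (\<lambda>x. (cyc N [Suc i] x - Eh N (Suc i) x) * Q N k x)"
    using SP_mult[OF SP_cyc_Eh[of "Suc i" N] SP_Q[of k N]] i n by simp
  have 4: "SP N n (\<lambda>x. Eh N (Suc i) x * (Q N k x - Up x))" using SP_mult[OF SP_Eh[where i="Suc i"] QU] i n by simp
  have 5: "SP N n (\<lambda>x. Eh N (Suc i) x * Um x)" using SP_mult[OF SP_Eh[where i="Suc i"] Um] i n by simp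
  have 6: "SP N n (\<lambda>x. Oh N (Suc i) x * Up x)" using SP_mult[OF SP_Oh[where i="Suc i"] Up] i n by simp
  have 7: "SP N n (\<lambda>x. (cyc N [i] x - Eh N i x) * Q N (Suc k) x)"
    using SP_mult[OF SP_cyc_Eh[of i N] SP_Q[of "Suc k" N]] i n by simp
  have 8: "SP N n (\<lambda>x. Eh N i x * (Q N (Suc k) x - pw N 1 x * Um x))" using SP_mult[OF SP_Eh[where i=i] QU'] i n by simp
  have 9: "SP N n (\<lambda>x. (pw N 1 x * Eh N i x - Oh N (Suc i) x) * Um x)" using SP_mult[OF SP_p1_Eh_Oh[OF i(1)] Um] i n by simp
  note sum = SP_add[OF 1 SP_add[OF 2 SP_add[OF 3 SP_add[OF 4 SP_add[OF 5 SP_add[OF 6 SP_add[OF 7 SP_add[OF 8 9]]]]]]]]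
  \<comment> \<open>In the removed product of \<open>Eh - Oh\<close> with \<open>Up - Um\<close> the
    terms \<open>Eh * Up\<close> and \<open>Oh * Um\<close> enter negatively. The former is covered
    by block \<open>k\<close> through 3 and 4, the latter by block \<open>Suc k\<close> through 7, 8
    and 9.\<close>
  have "Q N n x - (\<Sum>j<k. pw N (n - j) x * Q N j x) - pw N (n - k) x * V x = 
    Q N n x - (\<Sum>j<Suc (Suc k). cyc N [n - j] x * Q N j x) + ((\<Sum>j<k. (cyc N [n - j] x - pw N (n - j) x) * Q N j x) +
    ((cyc N [Suc i] x - Eh N (Suc i) x) * Q N k x + (Eh N (Suc i) x * (Q N k x - Up x) + (Eh N (Suc i) x * Um x +
    (Oh N (Suc i) x * Up x + ((cyc N [i] x - Eh N i x) * Q N (Suc k) x + (Eh N i x * (Q N (Suc k) x - pw N 1 x * Um x) +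
    (pw N 1 x * Eh N i x - Oh N (Suc i) x) * Um x)))))))" for x
  proof -
    have "(\<Sum>j<k. (cyc N [n - j] x - pw N (n - j) x) * Q N j x) = (\<Sum>j<k. cyc N [n - j] x * Q N j x) - (\<Sum>j<k. pw N (n - j) x * Q N j x)"
      by (simp add: left_diff_distrib sum_subtractf)
    then show ?thesis unfolding i(4) V pw_Eh_Oh[OF zero_less_Suc] by (simp add: i(4,5) algebra_simps)
  qed
  then show ?thesis using sum by presburger
qed

section \<open>Enumerating partitions and horizontal strips\<close>

text \<open>An executable enumeration in which \<open>m\<close> bounds the parts; in the small cases
  it is evaluated by \<open>code_simp\<close>.\<close>

fun plist :: "nat \<Rightarrow> nat \<Rightarrow> nat list list" where
  "plist 0 m = [[]]"
| "plist (Suc n) m = concat (map (\<lambda>i. map ((#) (Suc i)) (plist (n - i) (Suc i))) [0..<min m (Suc n)])"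

lemma partitions_Cons: "i # l \<in> partitions n \<longleftrightarrow> 0 < i \<and> i \<le> n \<and> (\<forall>q\<in>set l. q \<le> i) \<and> l \<in> partitions (n - i)"
  by (auto simp: partitions_def is_partition_def)

lemma partitions_Nil: "[] \<in> partitions n \<longleftrightarrow> n = 0"
  by (auto simp: partitions_def is_partition_def)

lemma partitions_0: "partitions 0 = {[]}"
proof -
  have "l \<in> partitions 0 \<longleftrightarrow> l = []" for l by (cases l) (auto simp: partitions_Cons partitions_Nil)
  then show ?thesis by auto
qed

lemma set_plist: "set (plist n m) = {l \<in> partitions n. \<forall>q\<in>set l. q \<le> m}"
proof (induction n m rule: plist.induct)
  case (2 n m)
  have "l \<in> set (plist (Suc n) m) \<longleftrightarrow> l \<in> partitions (Suc n) \<and> (\<forall>q\<in>set l. q \<le> m)" for l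
  proof (cases l)
    case (Cons i l')
    have "l \<in> set (plist (Suc n) m) \<longleftrightarrow> (\<exists>a<min m (Suc n). i = Suc a \<and> l' \<in> set (plist (n - a) (Suc a)))"
      by (auto simp: Cons)
    also have "\<dots> \<longleftrightarrow> (\<exists>a<min m (Suc n). i = Suc a \<and> l' \<in> partitions (n - a) \<and> (\<forall>q\<in>set l'. q \<le> i))"
      using 2 by (intro ex_cong1 conj_cong refl) auto
    also have "\<dots> \<longleftrightarrow> l \<in> partitions (Suc n) \<and> (\<forall>q\<in>set l. q \<le> m)"
      by (cases i) (auto simp: Cons partitions_Cons)
    finally show ?thesis .
  qed (auto simp: partitions_Nil)
  then show ?case by blast
qed (auto simp: partitions_0)

lemma distinct_concat_map:
  assumes "distinct xs" "\<And>a. a \<in> set xs \<Longrightarrow> distinct (f a)"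
    "\<And>a b. a \<in> set xs \<Longrightarrow> b \<in> set xs \<Longrightarrow> a \<noteq> b \<Longrightarrow> set (f a) \<inter> set (f b) = {}"
  shows "distinct (concat (map f xs))"
  using assms
proof (induction xs)
  case (Cons y ys)
  have "set (f y) \<inter> set (concat (map f ys)) = {}" using Cons.prems(1,3) by fastforce
  moreover have "distinct (concat (map f ys))" using Cons by (intro Cons.IH) auto
  ultimately show ?case using Cons.prems(2) by simp
qed simp

lemma distinct_plist: "distinct (plist n m)"
proof (induction n m rule: plist.induct)
  case (2 n m)
  show ?case unfolding plist.simps
    by (rule distinct_concat_map) (use 2 in \<open>auto simp: distinct_map\<close>)
qed simp

lemma Q_plist: "Q N n x = (\<Sum>l\<leftarrow>plist n n. pm N l x)"
proof -
  have "set (plist n n) = partitions n" using partitions_part_le by (auto simp: set_plist)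
  then show ?thesis using sum_list_distinct_conv_sum_set[OF distinct_plist] by (metis Q_def)
qed

text \<open>The structural and executable form of \<open>revlex_le\<close>. The two agree on lists
  of positive entries, where padding by zeros cannot create ties.\<close>

fun lexle :: "nat list \<Rightarrow> nat list \<Rightarrow> bool" where
  "lexle [] _ \<longleftrightarrow> True"
| "lexle (a # l) [] \<longleftrightarrow> False"
| "lexle (a # l) (b # m) \<longleftrightarrow> a < b \<or> a = b \<and> lexle l m"

lemma part_Cons: "Defs.part (a # l) = (\<lambda>i. case i of 0 \<Rightarrow> a | Suc i \<Rightarrow> Defs.part l i)"
  by (auto simp: Defs.part_def fun_eq_iff split: nat.split)

lemma part_Nil: "Defs.part [] = (\<lambda>_. 0)" by (simp add: Defs.part_def fun_eq_iff)

lemma revlex_le_Cons: "revlex_le (a # l) (b # m) \<longleftrightarrow> a < b \<or> a = b \<and> revlex_le l m"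
proof -
  have "(\<exists>j. (\<forall>i<j. Defs.part (a # l) i = Defs.part (b # m) i) \<and> Defs.part (a # l) j < Defs.part (b # m) j) \<longleftrightarrow>
    a < b \<or> a = b \<and> (\<exists>j. (\<forall>i<j. Defs.part l i = Defs.part m i) \<and> Defs.part l j < Defs.part m j)" (is "(\<exists>j. ?P j) \<longleftrightarrow> ?R")
  proof
    assume "\<exists>j. ?P j"
    then obtain j where j: "?P j" by blast
    show ?R
    proof (cases j)
      case 0 then show ?thesis using j by (simp add: part_Cons)
    next
      case (Suc k)
      have "a = b" using j Suc by (auto simp: part_Cons dest!: spec[of _ 0])
      moreover have "Defs.part l i = Defs.part m i" if "i < k" for i using j Suc that by (auto simp: part_Cons dest!: spec[of _ "Suc i"])
      moreover have "Defs.part l k < Defs.part m k" using j Suc by (simp add: part_Cons)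
      ultimately show ?thesis by blast
    qed
  next
    assume ?R
    then show "\<exists>j. ?P j"
    proof
      assume "a < b" then have "?P 0" by (simp add: part_Cons)
      then show ?thesis by blast
    next
      assume "a = b \<and> (\<exists>j. (\<forall>i<j. Defs.part l i = Defs.part m i) \<and> Defs.part l j < Defs.part m j)"
      then obtain j where "a = b" "(\<forall>i<j. Defs.part l i = Defs.part m i) \<and> Defs.part l j < Defs.part m j" by blast
      then have "?P (Suc j)" by (auto simp: part_Cons split: nat.split)
      then show ?thesis by blast
    qed
  qed
  then show ?thesis by (auto simp: revlex_le_def)
qed

lemma revlex_le_lexle: "(\<forall>q\<in>set l. 0 < q) \<Longrightarrow> (\<forall>q\<in>set m. 0 < q) \<Longrightarrow> revlex_le l m \<longleftrightarrow> lexle l m"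
proof (induction l m rule: lexle.induct)
  case (1 m)
  then show ?case by (cases m) (auto simp: revlex_le_def part_Cons part_Nil intro!: exI[of _ 0])
next
  case (2 a l)
  then show ?case by (auto simp: revlex_le_def part_Nil)
next
  case 3
  then show ?case by (auto simp: revlex_le_Cons)
qed

text \<open>The symmetric function of the theorem as a polynomial in \<open>N\<close> variables.
  \<open>schur_positiveI\<close> translates back to coefficients, with \<open>ones_least\<close>
  supplying the lower end of the interval.\<close>

definition T :: "nat \<Rightarrow> nat list \<Rightarrow> (nat \<Rightarrow> real) \<Rightarrow> real" where
  "T N mu x = (\<Sum>l | l \<in> partitions (sum_list mu) \<and> lexle l mu. pm N l x)"

lemma T_plist: assumes "sum_list mu = n" shows "T N mu x = (\<Sum>l\<leftarrow>filter (\<lambda>l. lexle l mu) (plist n n). pm N l x)"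
proof -
  have "set (filter (\<lambda>l. lexle l mu) (plist n n)) = {l. l \<in> partitions n \<and> lexle l mu}" using partitions_part_le by (auto simp: set_plist)
  then show ?thesis unfolding T_def assms
    by (metis (no_types, lifting) distinct_filter distinct_plist sum_list_distinct_conv_sum_set)
qed

text \<open>All ways to add a horizontal strip of \<open>k\<close> cells to a list. \<open>u\<close>
  bounds the current row; for the next row the bound becomes the old row \<open>t\<close>, which is
  the strip condition.\<close>

fun strips :: "nat \<Rightarrow> nat \<Rightarrow> nat list \<Rightarrow> nat list list" where
  "strips u k [] = (if k = 0 then [[]] else if k \<le> u then [[k]] else [])"
| "strips u k (t # ts) = concat (map (\<lambda>a. map ((#) (t + a)) (strips t (k - a) ts)) (filter (\<lambda>a. t + a \<le> u) [0..<Suc k]))"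

lemma sz_part: "sz (Defs.part l) = sum_list l"
proof -
  have "sz (Defs.part l) = (\<Sum>i<length l. Defs.part l i)" by (rule sz_eq_sum) (simp add: Defs.part_def)
  then show ?thesis by (simp add: Defs.part_def sum_list_sum_nth atLeast0LessThan)
qed

lemma sum_list_part_mono:
  assumes "\<And>i. Defs.part l i \<le> Defs.part m i"
  shows "sum_list l \<le> sum_list m"
proof -
  let ?L = "max (length l) (length m)"
  have "sz (Defs.part l) = (\<Sum>i<?L. Defs.part l i)" "sz (Defs.part m) = (\<Sum>i<?L. Defs.part m i)"
    by (rule sz_eq_sum; simp add: Defs.part_def)+
  then show ?thesis using assms by (simp add: sz_part sum_mono)
qed

lemma shape_part: "l \<in> partitions n \<Longrightarrow> shape (Defs.part l)"
proof (rule shapeI[of _ "length l"])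
  fix i assume "l \<in> partitions n"
  then have "sorted_wrt (\<ge>) l" by (simp add: partitions_def is_partition_def)
  then show "Defs.part l (Suc i) \<le> Defs.part l i" by (auto simp: Defs.part_def sorted_wrt_iff_nth_less)
qed (simp add: Defs.part_def)

lemma part_Par: "l \<in> partitions n \<Longrightarrow> Defs.part l \<in> Par n"
  using shape_part[of l n] by (simp add: Par_def sz_part partitions_def is_partition_def)

lemma part_inject: "(\<forall>q\<in>set l. 0 < q) \<Longrightarrow> (\<forall>q\<in>set m. 0 < q) \<Longrightarrow> Defs.part l = Defs.part m \<Longrightarrow> l = m"
proof (induction l m rule: lexle.induct)
  case (1 m)
  then show ?case by (cases m) (auto simp: part_Nil part_Cons dest!: fun_cong[of _ _ 0])
next
  case (2 a l)
  then show ?case by (auto simp: part_Nil part_Cons dest!: fun_cong[of _ _ 0])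
next
  case (3 a l b m)
  have "a = b" using fun_cong[OF 3(4), of 0] by (simp add: part_Cons)
  moreover have "Defs.part l = Defs.part m"
  proof
    fix i show "Defs.part l i = Defs.part m i" using fun_cong[OF 3(4), of "Suc i"] by (simp add: part_Cons)
  qed
  ultimately show ?case using 3 by auto
qed

lemma part_surj: assumes "shape v" obtains l where "Defs.part l = v" "\<forall>q\<in>set l. 0 < q" "l \<in> partitions (sz v)"
proof -
  define L where "L = (LEAST i. v i = 0)"
  have "v L = 0" unfolding L_def using shape_vanish[OF assms, of "sz v"] by (intro LeastI[of "\<lambda>i. v i = 0" "sz v"]) simp
  then have z: "v i = 0" if "L \<le> i" for i using shape_mono[OF assms that] by simp
  have nz: "0 < v i" if "i < L" for i using not_less_Least[of i "\<lambda>i. v i = 0"] that by (simp add: L_def)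
  define l where "l = map v [0..<L]"
  have p: "Defs.part l = v" using z by (auto simp: l_def Defs.part_def fun_eq_iff)
  moreover have pos: "\<forall>q\<in>set l. 0 < q" using nz by (auto simp: l_def)
  moreover have "sorted_wrt (\<ge>) l" using shape_mono[OF assms] by (auto simp: l_def sorted_wrt_iff_nth_less)
  ultimately show ?thesis using that sz_part[of l] by (auto simp: partitions_def is_partition_def)
qed

lemma bij_part: "bij_betw Defs.part (partitions n) (Par n)"
proof (rule bij_betw_imageI)
  show "inj_on Defs.part (partitions n)"
    by (rule inj_onI, rule part_inject) (auto simp: partitions_def is_partition_def)
  show "Defs.part ` partitions n = Par n"
  proof (intro subset_antisym subsetI)
    fix v assume "v \<in> Par n"
    then have "shape v" "sz v = n" by (auto simp: Par_def)
    then show "v \<in> Defs.part ` partitions n" by (metis part_surj imageI)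
  qed (auto simp: part_Par)
qed

lemma hs_part_Cons: "hs (Defs.part (t # ts)) (Defs.part (b # l)) \<longleftrightarrow> t \<le> b \<and> Defs.part l 0 \<le> t \<and> hs (Defs.part ts) (Defs.part l)"
proof -
  have all: "(\<forall>i. P i) \<longleftrightarrow> P 0 \<and> (\<forall>i. P (Suc i))" for P by (metis not0_implies_Suc)
  show ?thesis unfolding hs_def by (subst all) (auto simp: part_Cons)
qed

lemma set_strips:
  assumes "\<forall>q\<in>set ts. 0 < q"
  shows "set (strips u k ts) = {l. (\<forall>q\<in>set l. 0 < q) \<and> hs (Defs.part ts) (Defs.part l) \<and> Defs.part l 0 \<le> u \<and> sum_list l = sum_list ts + k}"
  using assms
proof (induction ts arbitrary: u k)
  case Nil
  have "l \<in> set (strips u k []) \<longleftrightarrow> (\<forall>q\<in>set l. 0 < q) \<and> hs (Defs.part []) (Defs.part l) \<and> Defs.part l 0 \<le> u \<and> sum_list l = sum_list [] + k" for l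
  proof (cases l)
    case (Cons b l')
    have "hs (Defs.part []) (Defs.part l) \<longleftrightarrow> (\<forall>i. Defs.part l' i = 0)" by (simp add: hs_def part_Nil Cons part_Cons)
    moreover have "(\<forall>i. Defs.part l' i = 0) \<longleftrightarrow> l' = []" if "\<forall>q\<in>set l'. 0 < q"
      using that by (cases l') (auto simp: part_Nil part_Cons intro!: exI[of _ 0])
    ultimately show ?thesis by (auto simp: Cons part_Cons)
  qed (auto simp: hs_def part_Nil)
  then show ?case by (intro set_eqI) (simp only: mem_Collect_eq)
next
  case (Cons t ts)
  note IH = Cons.IH and prems = Cons.prems
  have arith: "(\<exists>a\<le>k. t + a \<le> u \<and> b = t + a \<and> A \<and> s' = s + (k - a)) \<longleftrightarrow> t \<le> b \<and> b \<le> u \<and> A \<and> b + s' = t + s + k"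
    if "A \<Longrightarrow> s \<le> s'" for A s s' b
  proof
    assume "t \<le> b \<and> b \<le> u \<and> A \<and> b + s' = t + s + k"
    then show "\<exists>a\<le>k. t + a \<le> u \<and> b = t + a \<and> A \<and> s' = s + (k - a)" using that by (intro exI[of _ "b - t"]) auto
  qed auto
  have "l \<in> set (strips u k (t # ts)) \<longleftrightarrow> (\<forall>q\<in>set l. 0 < q) \<and> hs (Defs.part (t # ts)) (Defs.part l) \<and> Defs.part l 0 \<le> u \<and> sum_list l = sum_list (t # ts) + k" for l
  proof (cases l)
    case Nil
    have "\<not> hs (Defs.part (t # ts)) (Defs.part [])" using prems by (auto simp: hs_def part_Nil part_Cons intro!: exI[of _ 0])
    then show ?thesis using Nil by auto
  next
    case (Cons b l')
    let ?A = "(\<forall>q\<in>set l'. 0 < q) \<and> hs (Defs.part ts) (Defs.part l') \<and> Defs.part l' 0 \<le> t"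
    have "l \<in> set (strips u k (t # ts)) \<longleftrightarrow> (\<exists>a\<le>k. t + a \<le> u \<and> b = t + a \<and> l' \<in> set (strips t (k - a) ts))"
      by (auto simp: Cons less_Suc_eq_le simp del: upt_Suc)
    also have "\<dots> \<longleftrightarrow> (\<exists>a\<le>k. t + a \<le> u \<and> b = t + a \<and> ?A \<and> sum_list l' = sum_list ts + (k - a))"
      using IH prems by simp
    also have "\<dots> \<longleftrightarrow> t \<le> b \<and> b \<le> u \<and> ?A \<and> b + sum_list l' = t + sum_list ts + k"
      by (rule arith, rule sum_list_part_mono) (simp add: hs_def)
    finally show ?thesis using prems unfolding Cons hs_part_Cons by (auto simp: part_Cons)
  qed
  then show ?case by (intro set_eqI) (simp only: mem_Collect_eq)
qed

lemma distinct_strips: "distinct (strips u k ts)"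
proof (induction u k ts rule: strips.induct)
  case (2 u k t ts)
  show ?case unfolding strips.simps
    by (rule distinct_concat_map) (use 2 in \<open>auto simp: distinct_map\<close>)
qed simp

theorem pieri_strips:
  assumes "ts \<in> partitions n"
  shows "H N k x * S N (Defs.part ts) x = (\<Sum>l\<leftarrow>strips (n + k) k ts. S N (Defs.part l) x)"
proof -
  have ts: "\<forall>q\<in>set ts. 0 < q" "sum_list ts = n" using assms by (auto simp: partitions_def is_partition_def)
  have "{v. hs (Defs.part ts) v \<and> sz v = n + k} = Defs.part ` set (strips (n + k) k ts)"
  proof (intro subset_antisym subsetI)
    fix v assume v: "v \<in> {v. hs (Defs.part ts) v \<and> sz v = n + k}"
    then have "shape v" using hs_shape shape_part[OF assms] by blast
    then obtain l where l: "Defs.part l = v" "\<forall>q\<in>set l. 0 < q" "l \<in> partitions (sz v)" using part_surj by blast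
    have "Defs.part l 0 \<le> n + k" using l(3) v partitions_part_le[OF l(3)] by (cases l) (auto simp: part_Nil part_Cons)
    then have "l \<in> set (strips (n + k) k ts)" using l v ts by (simp add: set_strips partitions_def is_partition_def)
    then show "v \<in> Defs.part ` set (strips (n + k) k ts)" using l(1) by blast
  qed (auto simp: set_strips ts sz_part)
  moreover have "inj_on Defs.part (set (strips (n + k) k ts))"
    by (rule inj_onI, rule part_inject) (auto simp: set_strips ts)
  ultimately have "(\<Sum>v | hs (Defs.part ts) v \<and> sz v = n + k. S N v x) = (\<Sum>l\<in>set (strips (n + k) k ts). S N (Defs.part l) x)"
    by (simp add: sum.reindex)
  then show ?thesis
    using pieri[where l="Defs.part ts" and n=k and a=N and x=x] shape_part[OF assms]
    by (simp add: sz_part ts sum_list_distinct_conv_sum_set[OF distinct_strips])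
qed

lemma H_part: "0 < k \<Longrightarrow> S N (Defs.part [k]) x = H N k x"
proof -
  assume "0 < k"
  then have "Defs.part [k] = row k" by (auto simp: row_def part_Cons part_Nil fun_eq_iff split: nat.split)
  then show ?thesis by simp
qed


abbreviation sch :: "nat \<Rightarrow> nat list \<Rightarrow> (nat \<Rightarrow> real) \<Rightarrow> real" where
  "sch N l \<equiv> S N (Defs.part l)"

lemma newton_list: "0 < k \<Longrightarrow> real k * sch N [k] x = (\<Sum>j\<leftarrow>[1..<k]. pw N j x * sch N [k - j] x) + pw N k x"
proof -
  assume k: "0 < k"
  then obtain m where m: "k = Suc m" using gr0_implies_Suc by blast
  have "real k * sch N [k] x = (\<Sum>j<m. pw N (Suc j) x * H N (k - Suc j) x) + pw N k x"
    using newton[of k N x] by (simp add: H_part m row_0 del: S.simps)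
  also have "(\<Sum>j<m. pw N (Suc j) x * H N (k - Suc j) x) = (\<Sum>j<m. pw N (Suc j) x * sch N [k - Suc j] x)"
    by (intro sum.cong) (simp_all add: H_part m del: S.simps)
  also have "\<dots> = (\<Sum>j\<leftarrow>map Suc [0..<m]. pw N j x * sch N [k - j] x)"
    by (simp add: interv_sum_list_conv_sum_set_nat lessThan_atLeast0 comp_def del: S.simps)
  finally show ?thesis by (simp only: map_Suc_upt m One_nat_def)
qed

lemma pieri_list: "is_partition n ts \<Longrightarrow> 0 < k \<Longrightarrow> sch N [k] x * sch N ts x = (\<Sum>l\<leftarrow>strips (n + k) k ts. sch N l x)"
  using pieri_strips[of ts n N k x] by (simp add: H_part partitions_def)

text \<open>A formal combination of products of Schur polynomials: a coefficient with a list of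
  shapes for each term. Together with \<open>cert\<close> it reduces positivity to an identity
  between polynomials in power sums.\<close>

definition sprod :: "nat \<Rightarrow> (real \<times> nat list list) list \<Rightarrow> (nat \<Rightarrow> real) \<Rightarrow> real" where
  "sprod N C x = (\<Sum>(c, ts)\<leftarrow>C. c * (\<Prod>t\<leftarrow>ts. sch N t x))"

definition cert :: "nat \<Rightarrow> (real \<times> nat list list) list \<Rightarrow> bool" where
  "cert n C \<longleftrightarrow> (\<forall>(c, ts)\<in>set C. 0 \<le> c \<and> (\<forall>t\<in>set ts. is_partition (sum_list t) t) \<and> sum_list (map sum_list ts) = n)"

lemma SP_one: "SP N 0 (\<lambda>_. 1)"
  by (rule SPI[of 0 "\<lambda>_. 1"]) (simp_all add: Par_0)

lemma SP_prod_list: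
  assumes "\<forall>t\<in>set ts. is_partition (sum_list t) t" "sum_list (map sum_list ts) \<le> N"
  shows "SP N (sum_list (map sum_list ts)) (\<lambda>x. \<Prod>t\<leftarrow>ts. sch N t x)"
  using assms
proof (induction ts)
  case Nil
  then show ?case using SP_one by simp
next
  case (Cons t ts)
  have "Defs.part t \<in> Par (sum_list t)" using Cons.prems by (intro part_Par) (simp add: partitions_def)
  then have "SP N (sum_list t + sum_list (map sum_list ts)) (\<lambda>x. sch N t x * (\<Prod>t\<leftarrow>ts. sch N t x))"
    using Cons by (intro SP_mult SP_schur) auto
  then show ?case by simp
qed

lemma SP_sprod: assumes "cert n C" "n \<le> N" shows "SP N n (sprod N C)"
  using assms(1) unfolding cert_def sprod_def[abs_def]
proof (induction C)
  case (Cons a C)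
  obtain c ts where a: "a = (c, ts)" by fastforce
  have "SP N n (\<lambda>x. c * (\<Prod>t\<leftarrow>ts. sch N t x))"
    using Cons.prems SP_prod_list[of ts N] assms(2) by (auto simp: a intro!: SP_scale)
  then show ?case using SP_add[OF _ Cons.IH] Cons.prems by (simp add: a)
qed (simp add: SP_zero)

section \<open>Schur functions of small degree\<close>

lemma s1: "sch N [1] x = pw N 1 x" by (simp add: H_part pw_1 del: S.simps One_nat_def)

lemma s2: "sch N [2] x = 1/2*pw N 1 x^2 + 1/2*pw N 2 x"
proof -
  have "sch N [2] x = 1/2 * (pw N 1 x * sch N [1] x + pw N 2 x)" using newton_list[of 2 N x] by (simp add: upt_rec field_simps One_nat_def[symmetric] del: S.simps One_nat_def)
  also have "\<dots> = 1/2*pw N 1 x^2 + 1/2*pw N 2 x" unfolding s1 by algebra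
  finally show ?thesis .
qed

text \<open>The pattern for all shapes with several rows: the shape without its last row is
  multiplied by the complete function of that row. The wanted shape occurs once in the Pieri
  expansion; the others strictly dominate it and are already known.\<close>

lemma s11: "sch N [1, 1] x = 1/2*pw N 1 x^2 - 1/2*pw N 2 x"
proof -
  have "strips 2 1 [1] = [[1, 1], [2]]" by code_simp
  then have "sch N [1, 1] x = sch N [1] x * sch N [1] x - (sch N [2] x)"
    using pieri_list[of 1 "[1]" 1 N x] by (simp add: is_partition_def del: S.simps strips.simps One_nat_def)
  also have "\<dots> = 1/2*pw N 1 x^2 - 1/2*pw N 2 x" unfolding s1 s2 by algebra
  finally show ?thesis .
qed

lemma s3: "sch N [3] x = 1/6*pw N 1 x^3 + 1/2*pw N 1 x*pw N 2 x + 1/3*pw N 3 x"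
proof -
  have "sch N [3] x = 1/3 * (pw N 1 x * sch N [2] x + pw N 2 x * sch N [1] x + pw N 3 x)" using newton_list[of 3 N x] by (simp add: upt_rec field_simps One_nat_def[symmetric] del: S.simps One_nat_def)
  also have "\<dots> = 1/6*pw N 1 x^3 + 1/2*pw N 1 x*pw N 2 x + 1/3*pw N 3 x" unfolding s1 s2 by algebra
  finally show ?thesis .
qed

lemma s21: "sch N [2, 1] x = 1/3*pw N 1 x^3 - 1/3*pw N 3 x"
proof -
  have "strips 3 1 [2] = [[2, 1], [3]]" by code_simp
  then have "sch N [2, 1] x = sch N [1] x * sch N [2] x - (sch N [3] x)"
    using pieri_list[of 2 "[2]" 1 N x] by (simp add: is_partition_def del: S.simps strips.simps One_nat_def)
  also have "\<dots> = 1/3*pw N 1 x^3 - 1/3*pw N 3 x" unfolding s1 s2 s3 by algebra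
  finally show ?thesis .
qed

lemma s111: "sch N [1, 1, 1] x = 1/6*pw N 1 x^3 - 1/2*pw N 1 x*pw N 2 x + 1/3*pw N 3 x"
proof -
  have "strips 3 1 [1, 1] = [[1, 1, 1], [2, 1]]" by code_simp
  then have "sch N [1, 1, 1] x = sch N [1] x * sch N [1, 1] x - (sch N [2, 1] x)"
    using pieri_list[of 2 "[1, 1]" 1 N x] by (simp add: is_partition_def del: S.simps strips.simps One_nat_def)
  also have "\<dots> = 1/6*pw N 1 x^3 - 1/2*pw N 1 x*pw N 2 x + 1/3*pw N 3 x" unfolding s1 s11 s21 by algebra
  finally show ?thesis .
qed

lemma s4: "sch N [4] x = 1/24*pw N 1 x^4 + 1/4*pw N 1 x^2*pw N 2 x + 1/8*pw N 2 x^2 + 1/3*pw N 1 x*pw N 3 x + 1/4*pw N 4 x"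
proof -
  have "sch N [4] x = 1/4 * (pw N 1 x * sch N [3] x + pw N 2 x * sch N [2] x + pw N 3 x * sch N [1] x + pw N 4 x)" using newton_list[of 4 N x] by (simp add: upt_rec field_simps One_nat_def[symmetric] del: S.simps One_nat_def)
  also have "\<dots> = 1/24*pw N 1 x^4 + 1/4*pw N 1 x^2*pw N 2 x + 1/8*pw N 2 x^2 + 1/3*pw N 1 x*pw N 3 x + 1/4*pw N 4 x" unfolding s1 s2 s3 by algebra
  finally show ?thesis .
qed

lemma s31: "sch N [3, 1] x = 1/8*pw N 1 x^4 + 1/4*pw N 1 x^2*pw N 2 x - 1/8*pw N 2 x^2 - 1/4*pw N 4 x"
proof -
  have "strips 4 1 [3] = [[3, 1], [4]]" by code_simp
  then have "sch N [3, 1] x = sch N [1] x * sch N [3] x - (sch N [4] x)"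
    using pieri_list[of 3 "[3]" 1 N x] by (simp add: is_partition_def del: S.simps strips.simps One_nat_def)
  also have "\<dots> = 1/8*pw N 1 x^4 + 1/4*pw N 1 x^2*pw N 2 x - 1/8*pw N 2 x^2 - 1/4*pw N 4 x" unfolding s1 s3 s4 by algebra
  finally show ?thesis .
qed

lemma s22: "sch N [2, 2] x = 1/12*pw N 1 x^4 + 1/4*pw N 2 x^2 - 1/3*pw N 1 x*pw N 3 x"
proof -
  have "strips 4 2 [2] = [[2, 2], [3, 1], [4]]" by code_simp
  then have "sch N [2, 2] x = sch N [2] x * sch N [2] x - (sch N [3, 1] x + sch N [4] x)"
    using pieri_list[of 2 "[2]" 2 N x] by (simp add: is_partition_def del: S.simps strips.simps One_nat_def)
  also have "\<dots> = 1/12*pw N 1 x^4 + 1/4*pw N 2 x^2 - 1/3*pw N 1 x*pw N 3 x" unfolding s2 s31 s4 by algebra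
  finally show ?thesis .
qed

lemma s211: "sch N [2, 1, 1] x = 1/8*pw N 1 x^4 - 1/4*pw N 1 x^2*pw N 2 x - 1/8*pw N 2 x^2 + 1/4*pw N 4 x"
proof -
  have "strips 4 1 [2, 1] = [[2, 1, 1], [2, 2], [3, 1]]" by code_simp
  then have "sch N [2, 1, 1] x = sch N [1] x * sch N [2, 1] x - (sch N [2, 2] x + sch N [3, 1] x)"
    using pieri_list[of 3 "[2, 1]" 1 N x] by (simp add: is_partition_def del: S.simps strips.simps One_nat_def)
  also have "\<dots> = 1/8*pw N 1 x^4 - 1/4*pw N 1 x^2*pw N 2 x - 1/8*pw N 2 x^2 + 1/4*pw N 4 x" unfolding s1 s21 s22 s31 by algebra
  finally show ?thesis .
qed

lemma s1111: "sch N [1, 1, 1, 1] x = 1/24*pw N 1 x^4 - 1/4*pw N 1 x^2*pw N 2 x + 1/8*pw N 2 x^2 + 1/3*pw N 1 x*pw N 3 x - 1/4*pw N 4 x"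
proof -
  have "strips 4 1 [1, 1, 1] = [[1, 1, 1, 1], [2, 1, 1]]" by code_simp
  then have "sch N [1, 1, 1, 1] x = sch N [1] x * sch N [1, 1, 1] x - (sch N [2, 1, 1] x)"
    using pieri_list[of 3 "[1, 1, 1]" 1 N x] by (simp add: is_partition_def del: S.simps strips.simps One_nat_def)
  also have "\<dots> = 1/24*pw N 1 x^4 - 1/4*pw N 1 x^2*pw N 2 x + 1/8*pw N 2 x^2 + 1/3*pw N 1 x*pw N 3 x - 1/4*pw N 4 x" unfolding s1 s111 s211 by algebra
  finally show ?thesis .
qed

lemma s5: "sch N [5] x = 1/120*pw N 1 x^5 + 1/12*pw N 1 x^3*pw N 2 x + 1/8*pw N 1 x*pw N 2 x^2 + 1/6*pw N 1 x^2*pw N 3 x + 1/6*pw N 2 x*pw N 3 x + 1/4*pw N 1 x*pw N 4 x + 1/5*pw N 5 x"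
proof -
  have "sch N [5] x = 1/5 * (pw N 1 x * sch N [4] x + pw N 2 x * sch N [3] x + pw N 3 x * sch N [2] x + pw N 4 x * sch N [1] x + pw N 5 x)" using newton_list[of 5 N x] by (simp add: upt_rec field_simps One_nat_def[symmetric] del: S.simps One_nat_def)
  also have "\<dots> = 1/120*pw N 1 x^5 + 1/12*pw N 1 x^3*pw N 2 x + 1/8*pw N 1 x*pw N 2 x^2 + 1/6*pw N 1 x^2*pw N 3 x + 1/6*pw N 2 x*pw N 3 x + 1/4*pw N 1 x*pw N 4 x + 1/5*pw N 5 x" unfolding s1 s2 s3 s4 by algebra
  finally show ?thesis .
qed

lemma s41: "sch N [4, 1] x = 1/30*pw N 1 x^5 + 1/6*pw N 1 x^3*pw N 2 x + 1/6*pw N 1 x^2*pw N 3 x - 1/6*pw N 2 x*pw N 3 x - 1/5*pw N 5 x"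
proof -
  have "strips 5 1 [4] = [[4, 1], [5]]" by code_simp
  then have "sch N [4, 1] x = sch N [1] x * sch N [4] x - (sch N [5] x)"
    using pieri_list[of 4 "[4]" 1 N x] by (simp add: is_partition_def del: S.simps strips.simps One_nat_def)
  also have "\<dots> = 1/30*pw N 1 x^5 + 1/6*pw N 1 x^3*pw N 2 x + 1/6*pw N 1 x^2*pw N 3 x - 1/6*pw N 2 x*pw N 3 x - 1/5*pw N 5 x" unfolding s1 s4 s5 by algebra
  finally show ?thesis .
qed

lemma s32: "sch N [3, 2] x = 1/24*pw N 1 x^5 + 1/12*pw N 1 x^3*pw N 2 x + 1/8*pw N 1 x*pw N 2 x^2 - 1/6*pw N 1 x^2*pw N 3 x + 1/6*pw N 2 x*pw N 3 x - 1/4*pw N 1 x*pw N 4 x"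
proof -
  have "strips 5 2 [3] = [[3, 2], [4, 1], [5]]" by code_simp
  then have "sch N [3, 2] x = sch N [2] x * sch N [3] x - (sch N [4, 1] x + sch N [5] x)"
    using pieri_list[of 3 "[3]" 2 N x] by (simp add: is_partition_def del: S.simps strips.simps One_nat_def)
  also have "\<dots> = 1/24*pw N 1 x^5 + 1/12*pw N 1 x^3*pw N 2 x + 1/8*pw N 1 x*pw N 2 x^2 - 1/6*pw N 1 x^2*pw N 3 x + 1/6*pw N 2 x*pw N 3 x - 1/4*pw N 1 x*pw N 4 x" unfolding s2 s3 s41 s5 by algebra
  finally show ?thesis .
qed

lemma s311: "sch N [3, 1, 1] x = 1/20*pw N 1 x^5 - 1/4*pw N 1 x*pw N 2 x^2 + 1/5*pw N 5 x"
proof -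
  have "strips 5 1 [3, 1] = [[3, 1, 1], [3, 2], [4, 1]]" by code_simp
  then have "sch N [3, 1, 1] x = sch N [1] x * sch N [3, 1] x - (sch N [3, 2] x + sch N [4, 1] x)"
    using pieri_list[of 4 "[3, 1]" 1 N x] by (simp add: is_partition_def del: S.simps strips.simps One_nat_def)
  also have "\<dots> = 1/20*pw N 1 x^5 - 1/4*pw N 1 x*pw N 2 x^2 + 1/5*pw N 5 x" unfolding s1 s31 s32 s41 by algebra
  finally show ?thesis .
qed

lemma s221: "sch N [2, 2, 1] x = 1/24*pw N 1 x^5 - 1/12*pw N 1 x^3*pw N 2 x + 1/8*pw N 1 x*pw N 2 x^2 - 1/6*pw N 1 x^2*pw N 3 x - 1/6*pw N 2 x*pw N 3 x + 1/4*pw N 1 x*pw N 4 x"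
proof -
  have "strips 5 1 [2, 2] = [[2, 2, 1], [3, 2]]" by code_simp
  then have "sch N [2, 2, 1] x = sch N [1] x * sch N [2, 2] x - (sch N [3, 2] x)"
    using pieri_list[of 4 "[2, 2]" 1 N x] by (simp add: is_partition_def del: S.simps strips.simps One_nat_def)
  also have "\<dots> = 1/24*pw N 1 x^5 - 1/12*pw N 1 x^3*pw N 2 x + 1/8*pw N 1 x*pw N 2 x^2 - 1/6*pw N 1 x^2*pw N 3 x - 1/6*pw N 2 x*pw N 3 x + 1/4*pw N 1 x*pw N 4 x" unfolding s1 s22 s32 by algebra
  finally show ?thesis .
qed

lemma s2111: "sch N [2, 1, 1, 1] x = 1/30*pw N 1 x^5 - 1/6*pw N 1 x^3*pw N 2 x + 1/6*pw N 1 x^2*pw N 3 x + 1/6*pw N 2 x*pw N 3 x - 1/5*pw N 5 x"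
proof -
  have "strips 5 1 [2, 1, 1] = [[2, 1, 1, 1], [2, 2, 1], [3, 1, 1]]" by code_simp
  then have "sch N [2, 1, 1, 1] x = sch N [1] x * sch N [2, 1, 1] x - (sch N [2, 2, 1] x + sch N [3, 1, 1] x)"
    using pieri_list[of 4 "[2, 1, 1]" 1 N x] by (simp add: is_partition_def del: S.simps strips.simps One_nat_def)
  also have "\<dots> = 1/30*pw N 1 x^5 - 1/6*pw N 1 x^3*pw N 2 x + 1/6*pw N 1 x^2*pw N 3 x + 1/6*pw N 2 x*pw N 3 x - 1/5*pw N 5 x" unfolding s1 s211 s221 s311 by algebra
  finally show ?thesis .
qed

lemma s11111: "sch N [1, 1, 1, 1, 1] x = 1/120*pw N 1 x^5 - 1/12*pw N 1 x^3*pw N 2 x + 1/8*pw N 1 x*pw N 2 x^2 + 1/6*pw N 1 x^2*pw N 3 x - 1/6*pw N 2 x*pw N 3 x - 1/4*pw N 1 x*pw N 4 x + 1/5*pw N 5 x"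
proof -
  have "strips 5 1 [1, 1, 1, 1] = [[1, 1, 1, 1, 1], [2, 1, 1, 1]]" by code_simp
  then have "sch N [1, 1, 1, 1, 1] x = sch N [1] x * sch N [1, 1, 1, 1] x - (sch N [2, 1, 1, 1] x)"
    using pieri_list[of 4 "[1, 1, 1, 1]" 1 N x] by (simp add: is_partition_def del: S.simps strips.simps One_nat_def)
  also have "\<dots> = 1/120*pw N 1 x^5 - 1/12*pw N 1 x^3*pw N 2 x + 1/8*pw N 1 x*pw N 2 x^2 + 1/6*pw N 1 x^2*pw N 3 x - 1/6*pw N 2 x*pw N 3 x - 1/4*pw N 1 x*pw N 4 x + 1/5*pw N 5 x" unfolding s1 s1111 s2111 by algebra
  finally show ?thesis .
qed

text \<open>The one-row shape is the only shape of degree 6 that occurs in the certificates.\<close>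

lemma s6: "sch N [6] x = 1/720*pw N 1 x^6 + 1/48*pw N 1 x^4*pw N 2 x + 1/16*pw N 1 x^2*pw N 2 x^2 + 1/48*pw N 2 x^3 + 1/18*pw N 1 x^3*pw N 3 x + 1/6*pw N 1 x*pw N 2 x*pw N 3 x + 1/18*pw N 3 x^2 + 1/8*pw N 1 x^2*pw N 4 x + 1/8*pw N 2 x*pw N 4 x + 1/5*pw N 1 x*pw N 5 x + 1/6*pw N 6 x"
proof -
  have "sch N [6] x = 1/6 * (pw N 1 x * sch N [5] x + pw N 2 x * sch N [4] x + pw N 3 x * sch N [3] x + pw N 4 x * sch N [2] x + pw N 5 x * sch N [1] x + pw N 6 x)" using newton_list[of 6 N x] by (simp add: upt_rec field_simps One_nat_def[symmetric] del: S.simps One_nat_def)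
  also have "\<dots> = 1/720*pw N 1 x^6 + 1/48*pw N 1 x^4*pw N 2 x + 1/16*pw N 1 x^2*pw N 2 x^2 + 1/48*pw N 2 x^3 + 1/18*pw N 1 x^3*pw N 3 x + 1/6*pw N 1 x*pw N 2 x*pw N 3 x + 1/18*pw N 3 x^2 + 1/8*pw N 1 x^2*pw N 4 x + 1/8*pw N 2 x*pw N 4 x + 1/5*pw N 1 x*pw N 5 x + 1/6*pw N 6 x" unfolding s1 s2 s3 s4 s5 by algebra
  finally show ?thesis .
qed

lemmas sch_pw = s1 s2 s11 s3 s21 s111 s4 s31 s22 s211 s1111 s5 s41 s32 s311 s221 s2111 s11111 s6

section \<open>Small cases\<close>

lemmas pm_simps = pm_def sprod_def list.map sum_list.Cons sum_list.Nil prod_list.Cons prod_list.Nil case_prod_conv sch_pw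

lemmas cert_simps = cert_def is_partition_def

lemma SP_T:
  assumes "sum_list mu = n" "n \<le> N" "filter (\<lambda>l. lexle l mu) (plist n n) = ls" "cert n C"
    "\<And>x. (\<Sum>l\<leftarrow>ls. pm N l x) = sprod N C x"
  shows "SP N n (T N mu)"
  using SP_sprod[OF assms(4,2)] unfolding T_plist[OF assms(1), abs_def] assms(3,5) .

text \<open>\<open>A\<close> and \<open>B\<close> play the roles of \<open>Up\<close> and
  \<open>Um\<close> for the removed piece \<open>W\<close> of block \<open>k\<close>.
  \<open>C\<close> certifies that \<open>A\<close> fits into \<open>Q N k\<close>, and
  \<open>D\<close> that p_1 times \<open>B\<close> fits into \<open>Q N (Suc k)\<close>.\<close>

lemma SP_partial:
  assumes "2 * k + 2 < n" "n \<le> N" "cert k A" "cert k B" "cert k C" "cert (Suc k) D"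
    "plist k k = ls" "plist (Suc k) (Suc k) = ls'"
    "\<And>x. (\<Sum>l\<leftarrow>W. pm N l x) = sprod N A x - sprod N B x"
    "\<And>x. (\<Sum>l\<leftarrow>ls. pm N l x) = sprod N A x + sprod N C x"
    "\<And>x. (\<Sum>l\<leftarrow>ls'. pm N l x) = pw N 1 x * sprod N B x + sprod N D x"
  shows "SP N n (\<lambda>x. Q N n x - (\<Sum>j<k. pw N (n - j) x * Q N j x) - pw N (n - k) x * (\<Sum>l\<leftarrow>W. pm N l x))"
proof (rule SP_partial_block[OF assms(1,2) _ _ assms(9)])
  show "SP N k (sprod N A)" "SP N k (sprod N B)" using assms(1,2) by (auto intro: SP_sprod assms(3,4))
  show "SP N k (\<lambda>x. Q N k x - sprod N A x)"
    using SP_sprod[OF assms(5), of N] assms(1,2) unfolding Q_plist assms(7,10) by simp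
  show "SP N (Suc k) (\<lambda>x. Q N (Suc k) x - pw N 1 x * sprod N B x)"
    using SP_sprod[OF assms(6), of N] assms(1,2) unfolding Q_plist assms(8,11) by simp
qed

text \<open>The suffix of the name is the tail of \<open>mu\<close>: \<open>W\<close> lists the
  partitions of 2 above \<open>[1, 1]\<close>, and \<open>6 < n\<close> is the condition
  \<open>2 * k + 2 < n\<close> for \<open>k = 2\<close>. The next lemmas follow the same pattern for
  the tails of size 3 and 4 that are not largest.\<close>

lemma partial_11:
  assumes "6 < n" "n \<le> N"
  shows "SP N n (\<lambda>x. Q N n x - (\<Sum>j<2. pw N (n - j) x * Q N j x) - pw N (n - 2) x * (\<Sum>l\<leftarrow>[[2]]. pm N l x))"
proof (rule SP_partial[OF _ assms(2)])
  let ?A = "[(1, [[2]])]" and ?B = "[(1, [[1, 1]])]"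
  let ?C = "[(1, [[2]])]"
  let ?D = "[(3, [[3]])]"
  let ?W = "[[2]]"
  let ?P = "[[1, 1], [2]]"
  let ?Q = "[[1, 1, 1], [2, 1], [3]]"
  show "2 * 2 + 2 < n" using assms(1) by simp
  show "cert 2 ?A" "cert 2 ?B" "cert 2 ?C" "cert (Suc 2) ?D" by (simp_all add: cert_simps)
  show "plist 2 2 = ?P" "plist (Suc 2) (Suc 2) = ?Q" by code_simp+
  fix x
  show "(\<Sum>l\<leftarrow>?W. pm N l x) = sprod N ?A x - sprod N ?B x" unfolding pm_simps by algebra
  show "(\<Sum>l\<leftarrow>?P. pm N l x) = sprod N ?A x + sprod N ?C x" unfolding pm_simps by algebra
  show "(\<Sum>l\<leftarrow>?Q. pm N l x) = pw N 1 x * sprod N ?B x + sprod N ?D x" unfolding pm_simps by algebra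
qed

lemma partial_21:
  assumes "8 < n" "n \<le> N"
  shows "SP N n (\<lambda>x. Q N n x - (\<Sum>j<3. pw N (n - j) x * Q N j x) - pw N (n - 3) x * (\<Sum>l\<leftarrow>[[3]]. pm N l x))"
proof (rule SP_partial[OF _ assms(2)])
  let ?A = "[(1, [[3]]), (1, [[1, 1, 1]])]" and ?B = "[(1, [[2, 1]])]"
  let ?C = "[(2, [[3]]), (1, [[2, 1]])]"
  let ?D = "[(5, [[4]]), (1, [[3, 1]]), (2, [[2, 2]]), (1, [[2, 1, 1]]), (1, [[1, 1, 1, 1]])]"
  let ?W = "[[3]]"
  let ?P = "[[1, 1, 1], [2, 1], [3]]"
  let ?Q = "[[1, 1, 1, 1], [2, 1, 1], [2, 2], [3, 1], [4]]"
  show "2 * 3 + 2 < n" using assms(1) by simp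
  show "cert 3 ?A" "cert 3 ?B" "cert 3 ?C" "cert (Suc 3) ?D" by (simp_all add: cert_simps)
  show "plist 3 3 = ?P" "plist (Suc 3) (Suc 3) = ?Q" by code_simp+
  fix x
  show "(\<Sum>l\<leftarrow>?W. pm N l x) = sprod N ?A x - sprod N ?B x" unfolding pm_simps by algebra
  show "(\<Sum>l\<leftarrow>?P. pm N l x) = sprod N ?A x + sprod N ?C x" unfolding pm_simps by algebra
  show "(\<Sum>l\<leftarrow>?Q. pm N l x) = pw N 1 x * sprod N ?B x + sprod N ?D x" unfolding pm_simps by algebra
qed

lemma partial_111:
  assumes "8 < n" "n \<le> N"
  shows "SP N n (\<lambda>x. Q N n x - (\<Sum>j<3. pw N (n - j) x * Q N j x) - pw N (n - 3) x * (\<Sum>l\<leftarrow>[[2, 1], [3]]. pm N l x))"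
proof (rule SP_partial[OF _ assms(2)])
  let ?A = "[(2, [[3]])]" and ?B = "[(1, [[2, 1]])]"
  let ?C = "[(1, [[3]]), (1, [[2, 1]]), (1, [[1, 1, 1]])]"
  let ?D = "[(5, [[4]]), (1, [[3, 1]]), (2, [[2, 2]]), (1, [[2, 1, 1]]), (1, [[1, 1, 1, 1]])]"
  let ?W = "[[2, 1], [3]]"
  let ?P = "[[1, 1, 1], [2, 1], [3]]"
  let ?Q = "[[1, 1, 1, 1], [2, 1, 1], [2, 2], [3, 1], [4]]"
  show "2 * 3 + 2 < n" using assms(1) by simp
  show "cert 3 ?A" "cert 3 ?B" "cert 3 ?C" "cert (Suc 3) ?D" by (simp_all add: cert_simps)
  show "plist 3 3 = ?P" "plist (Suc 3) (Suc 3) = ?Q" by code_simp+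
  fix x
  show "(\<Sum>l\<leftarrow>?W. pm N l x) = sprod N ?A x - sprod N ?B x" unfolding pm_simps by algebra
  show "(\<Sum>l\<leftarrow>?P. pm N l x) = sprod N ?A x + sprod N ?C x" unfolding pm_simps by algebra
  show "(\<Sum>l\<leftarrow>?Q. pm N l x) = pw N 1 x * sprod N ?B x + sprod N ?D x" unfolding pm_simps by algebra
qed

lemma partial_31:
  assumes "10 < n" "n \<le> N"
  shows "SP N n (\<lambda>x. Q N n x - (\<Sum>j<4. pw N (n - j) x * Q N j x) - pw N (n - 4) x * (\<Sum>l\<leftarrow>[[4]]. pm N l x))"
proof (rule SP_partial[OF _ assms(2)])
  let ?A = "[(1, [[4]]), (1, [[2, 1, 1]])]" and ?B = "[(1, [[3, 1]]), (1, [[1, 1, 1, 1]])]"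
  let ?C = "[(4, [[4]]), (2, [[3, 1]]), (3, [[2, 2]]), (1, [[2, 1, 1]]), (1, [[1, 1, 1, 1]])]"
  let ?D = "[(7, [[5]]), (4, [[4, 1]]), (5, [[3, 2]]), (4, [[3, 1, 1]]), (4, [[2, 2, 1]]), (2, [[2, 1, 1, 1]])]"
  let ?W = "[[4]]"
  let ?P = "[[1, 1, 1, 1], [2, 1, 1], [2, 2], [3, 1], [4]]"
  let ?Q = "[[1, 1, 1, 1, 1], [2, 1, 1, 1], [2, 2, 1], [3, 1, 1], [3, 2], [4, 1], [5]]"
  show "2 * 4 + 2 < n" using assms(1) by simp
  show "cert 4 ?A" "cert 4 ?B" "cert 4 ?C" "cert (Suc 4) ?D" by (simp_all add: cert_simps)
  show "plist 4 4 = ?P" "plist (Suc 4) (Suc 4) = ?Q" by code_simp+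
  fix x
  show "(\<Sum>l\<leftarrow>?W. pm N l x) = sprod N ?A x - sprod N ?B x" unfolding pm_simps by algebra
  show "(\<Sum>l\<leftarrow>?P. pm N l x) = sprod N ?A x + sprod N ?C x" unfolding pm_simps by algebra
  show "(\<Sum>l\<leftarrow>?Q. pm N l x) = pw N 1 x * sprod N ?B x + sprod N ?D x" unfolding pm_simps by algebra
qed

lemma partial_22:
  assumes "10 < n" "n \<le> N"
  shows "SP N n (\<lambda>x. Q N n x - (\<Sum>j<4. pw N (n - j) x * Q N j x) - pw N (n - 4) x * (\<Sum>l\<leftarrow>[[3, 1], [4]]. pm N l x))"
proof (rule SP_partial[OF _ assms(2)])
  let ?A = "[(2, [[4]]), (1, [[2, 1, 1]])]" and ?B = "[(1, [[3, 1]]), (1, [[2, 2]])]"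
  let ?C = "[(3, [[4]]), (2, [[3, 1]]), (3, [[2, 2]]), (1, [[2, 1, 1]]), (1, [[1, 1, 1, 1]])]"
  let ?D = "[(7, [[5]]), (4, [[4, 1]]), (4, [[3, 2]]), (4, [[3, 1, 1]]), (3, [[2, 2, 1]]), (3, [[2, 1, 1, 1]]), (1, [[1, 1, 1, 1, 1]])]"
  let ?W = "[[3, 1], [4]]"
  let ?P = "[[1, 1, 1, 1], [2, 1, 1], [2, 2], [3, 1], [4]]"
  let ?Q = "[[1, 1, 1, 1, 1], [2, 1, 1, 1], [2, 2, 1], [3, 1, 1], [3, 2], [4, 1], [5]]"
  show "2 * 4 + 2 < n" using assms(1) by simp
  show "cert 4 ?A" "cert 4 ?B" "cert 4 ?C" "cert (Suc 4) ?D" by (simp_all add: cert_simps)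
  show "plist 4 4 = ?P" "plist (Suc 4) (Suc 4) = ?Q" by code_simp+
  fix x
  show "(\<Sum>l\<leftarrow>?W. pm N l x) = sprod N ?A x - sprod N ?B x" unfolding pm_simps by algebra
  show "(\<Sum>l\<leftarrow>?P. pm N l x) = sprod N ?A x + sprod N ?C x" unfolding pm_simps by algebra
  show "(\<Sum>l\<leftarrow>?Q. pm N l x) = pw N 1 x * sprod N ?B x + sprod N ?D x" unfolding pm_simps by algebra
qed

lemma partial_211:
  assumes "10 < n" "n \<le> N"
  shows "SP N n (\<lambda>x. Q N n x - (\<Sum>j<4. pw N (n - j) x * Q N j x) - pw N (n - 4) x * (\<Sum>l\<leftarrow>[[2, 2], [3, 1], [4]]. pm N l x))"
proof (rule SP_partial[OF _ assms(2)])
  let ?A = "[(3, [[4]]), (1, [[2, 2]]), (1, [[1, 1, 1, 1]])]" and ?B = "[(2, [[3, 1]])]"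
  let ?C = "[(2, [[4]]), (2, [[3, 1]]), (2, [[2, 2]]), (2, [[2, 1, 1]])]"
  let ?D = "[(7, [[5]]), (3, [[4, 1]]), (4, [[3, 2]]), (3, [[3, 1, 1]]), (4, [[2, 2, 1]]), (3, [[2, 1, 1, 1]]), (1, [[1, 1, 1, 1, 1]])]"
  let ?W = "[[2, 2], [3, 1], [4]]"
  let ?P = "[[1, 1, 1, 1], [2, 1, 1], [2, 2], [3, 1], [4]]"
  let ?Q = "[[1, 1, 1, 1, 1], [2, 1, 1, 1], [2, 2, 1], [3, 1, 1], [3, 2], [4, 1], [5]]"
  show "2 * 4 + 2 < n" using assms(1) by simp
  show "cert 4 ?A" "cert 4 ?B" "cert 4 ?C" "cert (Suc 4) ?D" by (simp_all add: cert_simps)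
  show "plist 4 4 = ?P" "plist (Suc 4) (Suc 4) = ?Q" by code_simp+
  fix x
  show "(\<Sum>l\<leftarrow>?W. pm N l x) = sprod N ?A x - sprod N ?B x" unfolding pm_simps by algebra
  show "(\<Sum>l\<leftarrow>?P. pm N l x) = sprod N ?A x + sprod N ?C x" unfolding pm_simps by algebra
  show "(\<Sum>l\<leftarrow>?Q. pm N l x) = pw N 1 x * sprod N ?B x + sprod N ?D x" unfolding pm_simps by algebra
qed

lemma partial_1111:
  assumes "10 < n" "n \<le> N"
  shows "SP N n (\<lambda>x. Q N n x - (\<Sum>j<4. pw N (n - j) x * Q N j x) - pw N (n - 4) x * (\<Sum>l\<leftarrow>[[2, 1, 1], [2, 2], [3, 1], [4]]. pm N l x))"
proof (rule SP_partial[OF _ assms(2)])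
  let ?A = "[(4, [[4]]), (1, [[2, 2]])]" and ?B = "[(1, [[3, 1]]), (1, [[2, 1, 1]])]"
  let ?C = "[(1, [[4]]), (2, [[3, 1]]), (2, [[2, 2]]), (2, [[2, 1, 1]]), (1, [[1, 1, 1, 1]])]"
  let ?D = "[(7, [[5]]), (4, [[4, 1]]), (5, [[3, 2]]), (3, [[3, 1, 1]]), (3, [[2, 2, 1]]), (2, [[2, 1, 1, 1]]), (1, [[1, 1, 1, 1, 1]])]"
  let ?W = "[[2, 1, 1], [2, 2], [3, 1], [4]]"
  let ?P = "[[1, 1, 1, 1], [2, 1, 1], [2, 2], [3, 1], [4]]"
  let ?Q = "[[1, 1, 1, 1, 1], [2, 1, 1, 1], [2, 2, 1], [3, 1, 1], [3, 2], [4, 1], [5]]"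
  show "2 * 4 + 2 < n" using assms(1) by simp
  show "cert 4 ?A" "cert 4 ?B" "cert 4 ?C" "cert (Suc 4) ?D" by (simp_all add: cert_simps)
  show "plist 4 4 = ?P" "plist (Suc 4) (Suc 4) = ?Q" by code_simp+
  fix x
  show "(\<Sum>l\<leftarrow>?W. pm N l x) = sprod N ?A x - sprod N ?B x" unfolding pm_simps by algebra
  show "(\<Sum>l\<leftarrow>?P. pm N l x) = sprod N ?A x + sprod N ?C x" unfolding pm_simps by algebra
  show "(\<Sum>l\<leftarrow>?Q. pm N l x) = pw N 1 x * sprod N ?B x + sprod N ?D x" unfolding pm_simps by algebra
qed

text \<open>The coefficients of the following certificates come from a linear program.\<close>

lemma T_411: "6 \<le> N \<Longrightarrow> SP N 6 (T N [4, 1, 1])"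
proof (rule SP_T)
  let ?C = "[(1, [[2], [1, 1], [1, 1]]), (1, [[2, 1], [1, 1], [1]]), (2, [[2, 1, 1], [1, 1]]), (2, [[4], [2]]), (5, [[3], [1, 1, 1]]), (4, [[3], [3]]), (2, [[4], [1], [1]]), (5, [[2, 2], [2]])]"
  let ?P = "[[1, 1, 1, 1, 1, 1], [2, 1, 1, 1, 1], [2, 2, 1, 1], [2, 2, 2], [3, 1, 1, 1], [3, 2, 1], [3, 3], [4, 1, 1]]"
  show "filter (\<lambda>l. lexle l [4, 1, 1]) (plist 6 6) = ?P" by code_simp
  show "cert 6 ?C" by (simp add: cert_simps)
  show "(\<Sum>l\<leftarrow>?P. pm N l x) = sprod N ?C x" for x unfolding pm_simps by algebra
qed simp_all

lemma T_321: "6 \<le> N \<Longrightarrow> SP N 6 (T N [3, 2, 1])"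
proof (rule SP_T)
  let ?C = "[(2, [[1, 1, 1, 1], [2]]), (2/3, [[3], [3]]), (10/3, [[2], [1, 1], [1, 1]]), (2, [[4], [2]]), (2/3, [[3, 1], [1], [1]]), (8/3, [[2], [2], [2]]), (2/3, [[4], [1], [1]]), (2/3, [[2, 1], [1, 1, 1]])]"
  let ?P = "[[1, 1, 1, 1, 1, 1], [2, 1, 1, 1, 1], [2, 2, 1, 1], [2, 2, 2], [3, 1, 1, 1], [3, 2, 1]]"
  show "filter (\<lambda>l. lexle l [3, 2, 1]) (plist 6 6) = ?P" by code_simp
  show "cert 6 ?C" by (simp add: cert_simps)
  show "(\<Sum>l\<leftarrow>?P. pm N l x) = sprod N ?C x" for x unfolding pm_simps by algebra
qed simp_all

lemma T_421: "7 \<le> N \<Longrightarrow> SP N 7 (T N [4, 2, 1])"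
proof (rule SP_T)
  let ?C = "[(1, [[1, 1, 1, 1], [1, 1, 1]]), (2, [[3], [3], [1]]), (1, [[1, 1, 1], [1, 1, 1], [1]]), (1, [[4], [1, 1, 1]]), (3/2, [[2, 2], [1, 1, 1]]), (11/2, [[3], [1, 1], [1, 1]]), (7/2, [[2, 1], [2, 1], [1]]), (5, [[4], [2], [1]]), (3, [[2, 1, 1], [2, 1]]), (3, [[4], [3]]), (1, [[2, 2], [3]])]"
  let ?P = "[[1, 1, 1, 1, 1, 1, 1], [2, 1, 1, 1, 1, 1], [2, 2, 1, 1, 1], [2, 2, 2, 1], [3, 1, 1, 1, 1], [3, 2, 1, 1], [3, 2, 2], [3, 3, 1], [4, 1, 1, 1], [4, 2, 1]]"
  show "filter (\<lambda>l. lexle l [4, 2, 1]) (plist 7 7) = ?P" by code_simp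
  show "cert 7 ?C" by (simp add: cert_simps)
  show "(\<Sum>l\<leftarrow>?P. pm N l x) = sprod N ?C x" for x unfolding pm_simps by algebra
qed simp_all

lemma T_4111: "7 \<le> N \<Longrightarrow> SP N 7 (T N [4, 1, 1, 1])"
proof (rule SP_T)
  let ?C = "[(1, [[1, 1, 1], [2], [2]]), (1, [[2, 1, 1], [1, 1], [1]]), (3, [[2, 1, 1], [2, 1]]), (1, [[1, 1, 1], [1, 1, 1], [1]]), (1, [[1, 1, 1, 1], [3]]), (3, [[3], [1, 1], [1, 1]]), (4, [[3], [2], [2]]), (3, [[2, 1], [2, 1], [1]]), (4, [[4], [2], [1]]), (1, [[4], [3]]), (3, [[4], [1, 1, 1]])]"
  let ?P = "[[1, 1, 1, 1, 1, 1, 1], [2, 1, 1, 1, 1, 1], [2, 2, 1, 1, 1], [2, 2, 2, 1], [3, 1, 1, 1, 1], [3, 2, 1, 1], [3, 2, 2], [3, 3, 1], [4, 1, 1, 1]]"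
  show "filter (\<lambda>l. lexle l [4, 1, 1, 1]) (plist 7 7) = ?P" by code_simp
  show "cert 7 ?C" by (simp add: cert_simps)
  show "(\<Sum>l\<leftarrow>?P. pm N l x) = sprod N ?C x" for x unfolding pm_simps by algebra
qed simp_all

lemma T_322: "7 \<le> N \<Longrightarrow> SP N 7 (T N [3, 2, 2])"
proof (rule SP_T)
  let ?C = "[(15/4, [[2, 2], [1, 1, 1]]), (5/2, [[1, 1, 1], [2], [1, 1]]), (3/2, [[4], [3]]), (9/4, [[2, 1], [2, 1], [1]]), (3/2, [[4], [1, 1], [1]]), (1, [[1, 1, 1], [1, 1], [1, 1]]), (1, [[3, 1], [2], [1]]), (1/2, [[1, 1, 1, 1], [2], [1]]), (11/2, [[3], [2], [2]]), (3/2, [[3, 1], [1, 1, 1]]), (17/4, [[3], [1, 1], [1, 1]])]"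
  let ?P = "[[1, 1, 1, 1, 1, 1, 1], [2, 1, 1, 1, 1, 1], [2, 2, 1, 1, 1], [2, 2, 2, 1], [3, 1, 1, 1, 1], [3, 2, 1, 1], [3, 2, 2]]"
  show "filter (\<lambda>l. lexle l [3, 2, 2]) (plist 7 7) = ?P" by code_simp
  show "cert 7 ?C" by (simp add: cert_simps)
  show "(\<Sum>l\<leftarrow>?P. pm N l x) = sprod N ?C x" for x unfolding pm_simps by algebra
qed simp_all

lemma T_3211: "7 \<le> N \<Longrightarrow> SP N 7 (T N [3, 2, 1, 1])"
proof (rule SP_T)
  let ?C = "[(14/3, [[1, 1, 1], [2], [1, 1]]), (4/3, [[1, 1, 1, 1], [2, 1]]), (8/3, [[2, 1], [2, 1], [1]]), (4/3, [[4], [2, 1]]), (10/3, [[3], [2], [2]]), (8/3, [[3, 1], [2], [1]]), (4/3, [[3], [1, 1], [1, 1]]), (4/3, [[1, 1, 1], [2], [2]]), (8/3, [[4], [2], [1]])]"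
  let ?P = "[[1, 1, 1, 1, 1, 1, 1], [2, 1, 1, 1, 1, 1], [2, 2, 1, 1, 1], [2, 2, 2, 1], [3, 1, 1, 1, 1], [3, 2, 1, 1]]"
  show "filter (\<lambda>l. lexle l [3, 2, 1, 1]) (plist 7 7) = ?P" by code_simp
  show "cert 7 ?C" by (simp add: cert_simps)
  show "(\<Sum>l\<leftarrow>?P. pm N l x) = sprod N ?C x" for x unfolding pm_simps by algebra
qed simp_all

lemma T_521: "8 \<le> N \<Longrightarrow> SP N 8 (T N [5, 2, 1])"
proof (rule SP_T)
  let ?C = "[(4/17, [[3, 2], [2], [1]]), (12/17, [[2, 1, 1], [1, 1], [1, 1]]), (26/17, [[3], [2, 1], [2]]), (7/17, [[2, 2], [1, 1], [1, 1]]), (79/17, [[2, 1, 1, 1], [3]]), (41/17, [[2, 1, 1, 1], [1, 1], [1]]), (169/17, [[4], [2, 2]]), (41/17, [[3, 1, 1], [1, 1], [1]]), (93/17, [[2, 1, 1], [2, 1, 1]]), (1, [[1, 1, 1, 1], [1, 1, 1], [1]]), (54/17, [[2, 2, 1], [2], [1]]), (249/17, [[3, 1, 1], [2], [1]]), (111/17, [[4, 1], [2, 1]]), (116/17, [[2, 2], [2, 2]]), (32/17, [[1, 1, 1, 1, 1], [2, 1]]), (110/17, [[3], [3], [2]]), (5/17, [[4], [1, 1], [1, 1]]), (179/17, [[4], [4]])]"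
  let ?P = "[[1, 1, 1, 1, 1, 1, 1, 1], [2, 1, 1, 1, 1, 1, 1], [2, 2, 1, 1, 1, 1], [2, 2, 2, 1, 1], [2, 2, 2, 2], [3, 1, 1, 1, 1, 1], [3, 2, 1, 1, 1], [3, 2, 2, 1], [3, 3, 1, 1], [3, 3, 2], [4, 1, 1, 1, 1], [4, 2, 1, 1], [4, 2, 2], [4, 3, 1], [4, 4], [5, 1, 1, 1], [5, 2, 1]]"
  show "filter (\<lambda>l. lexle l [5, 2, 1]) (plist 8 8) = ?P" by code_simp
  show "cert 8 ?C" by (simp add: cert_simps)
  show "(\<Sum>l\<leftarrow>?P. pm N l x) = sprod N ?C x" for x unfolding pm_simps by algebra
qed simp_all

lemma T_5111: "8 \<le> N \<Longrightarrow> SP N 8 (T N [5, 1, 1, 1])"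
proof (rule SP_T)
  let ?C = "[(9/7, [[2, 1, 1, 1], [1, 1, 1]]), (11, [[3, 2], [1, 1, 1]]), (19/7, [[2, 1, 1], [3], [1]]), (13/7, [[5], [1, 1], [1]]), (1, [[1, 1, 1, 1, 1], [2, 1]]), (2, [[1, 1, 1, 1, 1], [1, 1], [1]]), (11/7, [[3], [2, 1], [2]]), (17/7, [[3, 1, 1], [1, 1], [1]]), (19/7, [[5], [2], [1]]), (40/7, [[2, 1], [2, 1], [2]]), (19/7, [[2, 2], [1, 1], [1, 1]]), (26/7, [[2, 2], [2], [2]]), (39/7, [[2, 1, 1], [2, 1, 1]]), (73/7, [[4], [4]]), (5/7, [[1, 1, 1, 1], [2, 1], [1]]), (20/7, [[3], [3], [2]]), (78/7, [[4], [1, 1], [1, 1]]), (16/7, [[1, 1, 1, 1, 1], [3]])]"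
  let ?P = "[[1, 1, 1, 1, 1, 1, 1, 1], [2, 1, 1, 1, 1, 1, 1], [2, 2, 1, 1, 1, 1], [2, 2, 2, 1, 1], [2, 2, 2, 2], [3, 1, 1, 1, 1, 1], [3, 2, 1, 1, 1], [3, 2, 2, 1], [3, 3, 1, 1], [3, 3, 2], [4, 1, 1, 1, 1], [4, 2, 1, 1], [4, 2, 2], [4, 3, 1], [4, 4], [5, 1, 1, 1]]"
  show "filter (\<lambda>l. lexle l [5, 1, 1, 1]) (plist 8 8) = ?P" by code_simp
  show "cert 8 ?C" by (simp add: cert_simps)
  show "(\<Sum>l\<leftarrow>?P. pm N l x) = sprod N ?C x" for x unfolding pm_simps by algebra
qed simp_all

lemma T_431: "8 \<le> N \<Longrightarrow> SP N 8 (T N [4, 3, 1])"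
proof (rule SP_T)
  let ?C = "[(3/4, [[2, 1, 1], [1, 1], [1, 1]]), (1, [[3, 1], [3], [1]]), (3/2, [[2, 1, 1], [2], [1, 1]]), (19/2, [[3], [2, 1], [1, 1]]), (15/4, [[2, 1], [2, 1], [2]]), (5, [[4], [1, 1, 1, 1]]), (1/2, [[3, 1], [1, 1, 1], [1]]), (19/4, [[1, 1, 1], [1, 1, 1], [2]]), (9, [[4], [2], [2]]), (5, [[4], [4]]), (3, [[2, 1, 1], [3], [1]]), (11/4, [[4], [1, 1], [1, 1]]), (1/2, [[1, 1, 1, 1], [2, 1], [1]]), (29/4, [[2, 2], [1, 1], [1, 1]])]"
  let ?P = "[[1, 1, 1, 1, 1, 1, 1, 1], [2, 1, 1, 1, 1, 1, 1], [2, 2, 1, 1, 1, 1], [2, 2, 2, 1, 1], [2, 2, 2, 2], [3, 1, 1, 1, 1, 1], [3, 2, 1, 1, 1], [3, 2, 2, 1], [3, 3, 1, 1], [3, 3, 2], [4, 1, 1, 1, 1], [4, 2, 1, 1], [4, 2, 2], [4, 3, 1]]"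
  show "filter (\<lambda>l. lexle l [4, 3, 1]) (plist 8 8) = ?P" by code_simp
  show "cert 8 ?C" by (simp add: cert_simps)
  show "(\<Sum>l\<leftarrow>?P. pm N l x) = sprod N ?C x" for x unfolding pm_simps by algebra
qed simp_all

lemma T_422: "8 \<le> N \<Longrightarrow> SP N 8 (T N [4, 2, 2])"
proof (rule SP_T)
  let ?C = "[(1, [[1, 1, 1, 1], [1, 1], [1, 1]]), (1/3, [[2, 1, 1], [1, 1], [1, 1]]), (3, [[3], [3], [2]]), (5, [[2, 2], [1, 1], [1, 1]]), (5/3, [[4], [2, 2]]), (14/3, [[3], [1, 1, 1], [2]]), (7, [[2, 1], [2, 1], [2]]), (2, [[3, 1], [2, 1, 1]]), (8/3, [[3, 1], [1, 1, 1], [1]]), (7/3, [[2, 1, 1], [2], [1, 1]]), (8, [[4], [2], [2]]), (2, [[4], [4]]), (1/3, [[1, 1, 1, 1], [2, 1], [1]]), (10/3, [[1, 1, 1], [1, 1, 1], [2]]), (22/3, [[4], [1, 1], [1, 1]])]"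
  let ?P = "[[1, 1, 1, 1, 1, 1, 1, 1], [2, 1, 1, 1, 1, 1, 1], [2, 2, 1, 1, 1, 1], [2, 2, 2, 1, 1], [2, 2, 2, 2], [3, 1, 1, 1, 1, 1], [3, 2, 1, 1, 1], [3, 2, 2, 1], [3, 3, 1, 1], [3, 3, 2], [4, 1, 1, 1, 1], [4, 2, 1, 1], [4, 2, 2]]"
  show "filter (\<lambda>l. lexle l [4, 2, 2]) (plist 8 8) = ?P" by code_simp
  show "cert 8 ?C" by (simp add: cert_simps)
  show "(\<Sum>l\<leftarrow>?P. pm N l x) = sprod N ?C x" for x unfolding pm_simps by algebra
qed simp_all

lemma T_4211: "8 \<le> N \<Longrightarrow> SP N 8 (T N [4, 2, 1, 1])"
proof (rule SP_T)
  let ?C = "[(11/2, [[2, 1, 1], [2, 1, 1]]), (5/2, [[2, 1, 1], [3], [1]]), (7/2, [[4], [4]]), (9/2, [[4], [3, 1]]), (1/2, [[3, 1], [2, 1, 1]]), (13, [[3], [2, 1], [1, 1]]), (5/2, [[2, 1], [2, 1], [2]]), (11/2, [[4], [1, 1, 1, 1]]), (2, [[3, 1], [1, 1, 1], [1]]), (17/2, [[4], [2], [2]]), (5/2, [[2, 1], [1, 1, 1], [1, 1]]), (3/2, [[1, 1, 1, 1], [1, 1, 1, 1]]), (5, [[2, 2], [2, 2]]), (1/2, [[1, 1, 1, 1], [1, 1], [1, 1]]), (7/2, [[2, 2], [1, 1], [1, 1]])]"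
  let ?P = "[[1, 1, 1, 1, 1, 1, 1, 1], [2, 1, 1, 1, 1, 1, 1], [2, 2, 1, 1, 1, 1], [2, 2, 2, 1, 1], [2, 2, 2, 2], [3, 1, 1, 1, 1, 1], [3, 2, 1, 1, 1], [3, 2, 2, 1], [3, 3, 1, 1], [3, 3, 2], [4, 1, 1, 1, 1], [4, 2, 1, 1]]"
  show "filter (\<lambda>l. lexle l [4, 2, 1, 1]) (plist 8 8) = ?P" by code_simp
  show "cert 8 ?C" by (simp add: cert_simps)
  show "(\<Sum>l\<leftarrow>?P. pm N l x) = sprod N ?C x" for x unfolding pm_simps by algebra
qed simp_all

lemma T_41111: "8 \<le> N \<Longrightarrow> SP N 8 (T N [4, 1, 1, 1, 1])"
proof (rule SP_T)
  let ?C = "[(1, [[1, 1, 1, 1], [1, 1, 1, 1]]), (3, [[1, 1, 1, 1], [2], [2]]), (11/2, [[3], [1, 1, 1], [2]]), (2, [[2, 1, 1], [3], [1]]), (2, [[2, 2], [2, 2]]), (5, [[2, 1, 1], [2, 1, 1]]), (5/2, [[4], [2, 2]]), (19/2, [[2, 1], [2, 1], [2]]), (4, [[4], [1, 1, 1, 1]]), (3, [[1, 1, 1], [1, 1, 1], [2]]), (11, [[4], [2], [2]]), (9/2, [[2, 2], [1, 1, 1, 1]]), (2, [[4], [1, 1], [1, 1]]), (1/2, [[2, 2], [1, 1], [1, 1]]), (2, [[4], [3, 1]])]"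
  let ?P = "[[1, 1, 1, 1, 1, 1, 1, 1], [2, 1, 1, 1, 1, 1, 1], [2, 2, 1, 1, 1, 1], [2, 2, 2, 1, 1], [2, 2, 2, 2], [3, 1, 1, 1, 1, 1], [3, 2, 1, 1, 1], [3, 2, 2, 1], [3, 3, 1, 1], [3, 3, 2], [4, 1, 1, 1, 1]]"
  show "filter (\<lambda>l. lexle l [4, 1, 1, 1, 1]) (plist 8 8) = ?P" by code_simp
  show "cert 8 ?C" by (simp add: cert_simps)
  show "(\<Sum>l\<leftarrow>?P. pm N l x) = sprod N ?C x" for x unfolding pm_simps by algebra
qed simp_all

text \<open>Certificates in degrees 9 and 10 concern only the first part \<open>n - 4\<close>: for
  smaller \<open>k\<close> these degrees already satisfy \<open>2 * k + 2 < n\<close>.\<close>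

lemma T_531: "9 \<le> N \<Longrightarrow> SP N 9 (T N [5, 3, 1])"
proof (rule SP_T)
  let ?C = "[(19/9, [[2, 2, 1], [1, 1], [1, 1]]), (11/9, [[2, 1, 1, 1], [2, 1], [1]]), (32/9, [[1, 1, 1, 1, 1], [2, 2]]), (7/3, [[3, 2], [1, 1], [1, 1]]), (23/3, [[3], [3], [1, 1, 1]]), (107/9, [[3], [1, 1, 1], [1, 1, 1]]), (2, [[1, 1, 1, 1, 1], [1, 1, 1, 1]]), (34/9, [[3, 1], [1, 1, 1, 1], [1]]), (154/9, [[3, 1], [2, 1], [2]]), (28/3, [[2, 1, 1, 1], [2, 2]]), (20/9, [[3, 1, 1], [2], [1, 1]]), (31/3, [[2, 2, 1], [2], [2]]), (64/9, [[2, 1, 1], [2, 1, 1], [1]]), (4, [[4, 1], [2, 1, 1]]), (2, [[1, 1, 1, 1, 1], [1, 1], [1, 1]]), (67/9, [[3], [3], [3]]), (26/9, [[3, 2], [4]]), (6, [[5], [1, 1], [1, 1]]), (77/9, [[5], [2], [2]]), (16/9, [[2, 1, 1, 1], [2], [2]]), (6, [[5], [4]]), (65/9, [[3, 1, 1], [2], [2]])]"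
  let ?P = "[[1, 1, 1, 1, 1, 1, 1, 1, 1], [2, 1, 1, 1, 1, 1, 1, 1], [2, 2, 1, 1, 1, 1, 1], [2, 2, 2, 1, 1, 1], [2, 2, 2, 2, 1], [3, 1, 1, 1, 1, 1, 1], [3, 2, 1, 1, 1, 1], [3, 2, 2, 1, 1], [3, 2, 2, 2], [3, 3, 1, 1, 1], [3, 3, 2, 1], [3, 3, 3], [4, 1, 1, 1, 1, 1], [4, 2, 1, 1, 1], [4, 2, 2, 1], [4, 3, 1, 1], [4, 3, 2], [4, 4, 1], [5, 1, 1, 1, 1], [5, 2, 1, 1], [5, 2, 2], [5, 3, 1]]"
  show "filter (\<lambda>l. lexle l [5, 3, 1]) (plist 9 9) = ?P" by code_simp
  show "cert 9 ?C" by (simp add: cert_simps)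
  show "(\<Sum>l\<leftarrow>?P. pm N l x) = sprod N ?C x" for x unfolding pm_simps by algebra
qed simp_all

lemma T_522: "9 \<le> N \<Longrightarrow> SP N 9 (T N [5, 2, 2])"
proof (rule SP_T)
  let ?C = "[(5, [[2, 1, 1, 1], [2, 1], [1]]), (1/2, [[2, 2, 1], [1, 1, 1, 1]]), (15/2, [[2, 2], [3], [2]]), (4, [[5], [4]]), (11, [[2, 2, 1], [2], [1, 1]]), (11/2, [[3, 1, 1], [1, 1], [1, 1]]), (6, [[2, 2, 1], [4]]), (3, [[1, 1, 1], [1, 1, 1], [1, 1, 1]]), (16, [[3, 1], [2, 1], [2]]), (1, [[2, 2], [2, 1, 1], [1]]), (1/2, [[4], [2, 1], [1, 1]]), (5/2, [[4, 1], [1, 1, 1, 1]]), (5/2, [[3, 1, 1], [2], [1, 1]]), (5/2, [[2, 2], [1, 1, 1], [1, 1]]), (2, [[5], [1, 1], [1, 1]]), (37/2, [[3], [3], [1, 1, 1]]), (17/2, [[2, 2, 1], [2], [2]]), (6, [[1, 1, 1, 1, 1], [2], [2]]), (23/2, [[5], [2], [2]]), (11/2, [[3], [3], [3]]), (13/2, [[1, 1, 1, 1, 1], [3, 1]]), (13/2, [[2, 1, 1, 1], [3], [1]])]"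
  let ?P = "[[1, 1, 1, 1, 1, 1, 1, 1, 1], [2, 1, 1, 1, 1, 1, 1, 1], [2, 2, 1, 1, 1, 1, 1], [2, 2, 2, 1, 1, 1], [2, 2, 2, 2, 1], [3, 1, 1, 1, 1, 1, 1], [3, 2, 1, 1, 1, 1], [3, 2, 2, 1, 1], [3, 2, 2, 2], [3, 3, 1, 1, 1], [3, 3, 2, 1], [3, 3, 3], [4, 1, 1, 1, 1, 1], [4, 2, 1, 1, 1], [4, 2, 2, 1], [4, 3, 1, 1], [4, 3, 2], [4, 4, 1], [5, 1, 1, 1, 1], [5, 2, 1, 1], [5, 2, 2]]"
  show "filter (\<lambda>l. lexle l [5, 2, 2]) (plist 9 9) = ?P" by code_simp
  show "cert 9 ?C" by (simp add: cert_simps)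
  show "(\<Sum>l\<leftarrow>?P. pm N l x) = sprod N ?C x" for x unfolding pm_simps by algebra
qed simp_all

lemma T_5211: "9 \<le> N \<Longrightarrow> SP N 9 (T N [5, 2, 1, 1])"
proof (rule SP_T)
  let ?C = "[(94/13, [[5], [2], [2]]), (287/26, [[3, 1, 1], [2], [1, 1]]), (27/13, [[4, 1], [2, 1], [1]]), (3, [[5], [1, 1], [1, 1]]), (132/13, [[3, 2], [1, 1], [1, 1]]), (19/26, [[3, 1, 1], [2], [2]]), (53/26, [[1, 1, 1, 1, 1], [3, 1]]), (85/26, [[4], [2, 2], [1]]), (27/26, [[5], [2], [1, 1]]), (279/26, [[3], [3], [3]]), (245/26, [[3, 1], [2, 1], [2]]), (135/26, [[2, 2, 1], [1, 1, 1], [1]]), (111/26, [[4], [2, 1], [1, 1]]), (371/26, [[3], [1, 1, 1], [1, 1, 1]]), (35/13, [[2, 1, 1], [2, 1, 1], [1]]), (2, [[1, 1, 1], [1, 1, 1], [1, 1, 1]]), (3, [[2, 1, 1, 1], [1, 1, 1], [1]]), (120/13, [[2, 2, 1], [2, 1, 1]]), (16/13, [[2, 2, 1], [3], [1]]), (53/26, [[5], [4]]), (201/13, [[2, 1, 1], [3], [2]]), (83/26, [[2, 2], [2, 2], [1]]), (29/26, [[1, 1, 1, 1, 1], [2, 2]])]"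
  let ?P = "[[1, 1, 1, 1, 1, 1, 1, 1, 1], [2, 1, 1, 1, 1, 1, 1, 1], [2, 2, 1, 1, 1, 1, 1], [2, 2, 2, 1, 1, 1], [2, 2, 2, 2, 1], [3, 1, 1, 1, 1, 1, 1], [3, 2, 1, 1, 1, 1], [3, 2, 2, 1, 1], [3, 2, 2, 2], [3, 3, 1, 1, 1], [3, 3, 2, 1], [3, 3, 3], [4, 1, 1, 1, 1, 1], [4, 2, 1, 1, 1], [4, 2, 2, 1], [4, 3, 1, 1], [4, 3, 2], [4, 4, 1], [5, 1, 1, 1, 1], [5, 2, 1, 1]]"
  show "filter (\<lambda>l. lexle l [5, 2, 1, 1]) (plist 9 9) = ?P" by code_simp
  show "cert 9 ?C" by (simp add: cert_simps)
  show "(\<Sum>l\<leftarrow>?P. pm N l x) = sprod N ?C x" for x unfolding pm_simps by algebra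
qed simp_all

lemma T_51111: "9 \<le> N \<Longrightarrow> SP N 9 (T N [5, 1, 1, 1, 1])"
proof (rule SP_T)
  let ?C = "[(3, [[1, 1, 1, 1, 1], [1, 1, 1, 1]]), (3/10, [[4, 1], [3, 1]]), (137/10, [[2, 2], [2, 2], [1]]), (5/2, [[3, 1, 1], [1, 1], [1, 1]]), (27/10, [[2, 1, 1, 1], [2], [2]]), (2/5, [[1, 1, 1, 1, 1], [3, 1]]), (83/10, [[3, 2], [4]]), (1/5, [[3, 2], [1, 1, 1, 1]]), (207/10, [[4], [2, 1, 1], [1]]), (54/5, [[3, 1], [2, 1], [2]]), (57/5, [[3], [3], [3]]), (1/10, [[1, 1, 1, 1, 1], [3], [1]]), (49/10, [[3, 1, 1], [2], [1, 1]]), (17/10, [[3, 1], [1, 1, 1], [2]]), (31/10, [[4, 1], [1, 1, 1, 1]]), (81/10, [[2, 2, 1], [3], [1]]), (38/5, [[5], [2], [2]]), (23/10, [[2, 2], [2, 1, 1], [1]]), (5, [[1, 1, 1, 1, 1], [2], [1, 1]]), (13, [[2, 1], [2, 1], [1, 1, 1]]), (13/5, [[3], [3], [1, 1, 1]]), (13/5, [[5], [1, 1], [1, 1]])]"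
  let ?P = "[[1, 1, 1, 1, 1, 1, 1, 1, 1], [2, 1, 1, 1, 1, 1, 1, 1], [2, 2, 1, 1, 1, 1, 1], [2, 2, 2, 1, 1, 1], [2, 2, 2, 2, 1], [3, 1, 1, 1, 1, 1, 1], [3, 2, 1, 1, 1, 1], [3, 2, 2, 1, 1], [3, 2, 2, 2], [3, 3, 1, 1, 1], [3, 3, 2, 1], [3, 3, 3], [4, 1, 1, 1, 1, 1], [4, 2, 1, 1, 1], [4, 2, 2, 1], [4, 3, 1, 1], [4, 3, 2], [4, 4, 1], [5, 1, 1, 1, 1]]"
  show "filter (\<lambda>l. lexle l [5, 1, 1, 1, 1]) (plist 9 9) = ?P" by code_simp
  show "cert 9 ?C" by (simp add: cert_simps)
  show "(\<Sum>l\<leftarrow>?P. pm N l x) = sprod N ?C x" for x unfolding pm_simps by algebra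
qed simp_all

lemma T_631: "10 \<le> N \<Longrightarrow> SP N 10 (T N [6, 3, 1])"
proof (rule SP_T)
  let ?C = "[(7/4, [[4, 1], [4, 1]]), (31/4, [[2, 1, 1, 1], [3], [2]]), (38/5, [[4, 1], [2, 2], [1]]), (9, [[6], [4]]), (4/5, [[2, 2, 1], [1, 1, 1, 1, 1]]), (72/5, [[2, 2], [2, 1], [1, 1, 1]]), (51/5, [[2, 2], [1, 1, 1, 1], [1, 1]]), (10, [[1, 1, 1, 1], [1, 1, 1, 1], [2]]), (201/10, [[2, 1, 1, 1], [2, 1], [2]]), (129/20, [[3, 2], [3, 2]]), (7, [[3, 1, 1], [1, 1, 1], [1, 1]]), (267/10, [[2, 2], [2, 2], [2]]), (3, [[6], [1, 1], [1, 1]]), (6/5, [[3, 1], [3], [3]]), (14/5, [[5], [4, 1]]), (18/5, [[4], [2, 1], [2, 1]]), (261/20, [[3, 1, 1], [3, 1, 1]]), (9, [[6], [1, 1, 1, 1]]), (91/20, [[5], [3, 2]]), (168/5, [[3, 1], [3], [2, 1]]), (81/5, [[4, 1], [1, 1, 1], [1, 1]]), (3, [[2, 1, 1, 1], [2, 1, 1, 1]]), (9/5, [[2, 2, 1], [2, 2], [1]]), (16/5, [[3, 1], [2, 1, 1], [1, 1]]), (133/10, [[4], [3, 1], [1, 1]]), (249/10, [[3, 1, 1], [2, 2], [1]]), (11/2, [[2, 1, 1], [2, 1, 1], [2]]), (39/4, [[2, 2, 1], [4], [1]]), (10, [[5], [5]]), (87/20, [[2, 2, 1], [3, 1], [1]]),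 (15, [[6], [2], [2]]), (3, [[6], [2], [1, 1]]), (131/20, [[3, 1, 1], [4], [1]]), (36/5, [[5], [1, 1, 1], [1, 1]])]"
  let ?P = "[[1, 1, 1, 1, 1, 1, 1, 1, 1, 1], [2, 1, 1, 1, 1, 1, 1, 1, 1], [2, 2, 1, 1, 1, 1, 1, 1], [2, 2, 2, 1, 1, 1, 1], [2, 2, 2, 2, 1, 1], [2, 2, 2, 2, 2], [3, 1, 1, 1, 1, 1, 1, 1], [3, 2, 1, 1, 1, 1, 1], [3, 2, 2, 1, 1, 1], [3, 2, 2, 2, 1], [3, 3, 1, 1, 1, 1], [3, 3, 2, 1, 1], [3, 3, 2, 2], [3, 3, 3, 1], [4, 1, 1, 1, 1, 1, 1], [4, 2, 1, 1, 1, 1], [4, 2, 2, 1, 1], [4, 2, 2, 2], [4, 3, 1, 1, 1], [4, 3, 2, 1], [4, 3, 3], [4, 4, 1, 1], [4, 4, 2], [5, 1, 1, 1, 1, 1], [5, 2, 1, 1, 1], [5, 2, 2, 1], [5, 3, 1, 1], [5, 3, 2], [5, 4, 1], [5, 5], [6, 1, 1, 1, 1], [6, 2, 1, 1], [6, 2, 2], [6, 3, 1]]"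
  show "filter (\<lambda>l. lexle l [6, 3, 1]) (plist 10 10) = ?P" by code_simp
  show "cert 10 ?C" by (simp add: cert_simps)
  show "(\<Sum>l\<leftarrow>?P. pm N l x) = sprod N ?C x" for x unfolding pm_simps by algebra
qed simp_all

lemma T_622: "10 \<le> N \<Longrightarrow> SP N 10 (T N [6, 2, 2])"
proof (rule SP_T)
  let ?C = "[(745/38, [[3, 2], [2, 1, 1], [1]]), (55/38, [[4, 1], [4, 1]]), (869/76, [[3, 1, 1], [1, 1, 1, 1, 1]]), (97/38, [[2, 2], [3], [3]]), (9, [[1, 1, 1, 1], [2, 1], [1, 1, 1]]), (507/38, [[3, 1], [3, 1], [2]]), (1, [[1, 1, 1, 1, 1], [1, 1, 1, 1, 1]]), (313/76, [[5], [2, 1, 1, 1]]), (5, [[5], [3], [1, 1]]), (313/76, [[2, 1, 1, 1], [3], [2]]), (284/19, [[2, 1, 1], [2, 1, 1], [2]]), (27/19, [[2, 2], [2, 2], [1, 1]]), (43/76, [[3, 1, 1], [1, 1, 1], [1, 1]]), (329/19, [[4], [1, 1, 1], [1, 1, 1]]), (537/38, [[3, 1], [2, 1], [2, 1]]), (599/76, [[2, 1, 1, 1], [2, 1], [2]]), (4, [[2, 2, 1], [1, 1, 1, 1, 1]]), (63/19, [[4], [1, 1, 1, 1], [2]]), (49/19, [[2, 2], [2, 1, 1], [2]]), (116/19, [[4, 1], [3], [1, 1]]), (215/19, [[3, 2], [1, 1, 1, 1], [1]]), (400/19, [[2, 2], [2, 2], [2]]), (267/38, [[4], [3, 1], [1,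 1]]), (63/19, [[5], [2, 1, 1], [1]]), (49/38, [[1, 1, 1, 1], [3], [2, 1]]), (6, [[6], [1, 1], [1, 1]]), (15, [[5], [5]]), (428/19, [[4], [2, 1], [2, 1]]), (18, [[6], [2], [2]]), (10, [[4, 1], [1, 1, 1], [1, 1]]), (1457/76, [[2, 2, 1], [1, 1, 1], [2]]), (9/38, [[5], [3, 1, 1]])]"
  let ?P = "[[1, 1, 1, 1, 1, 1, 1, 1, 1, 1], [2, 1, 1, 1, 1, 1, 1, 1, 1], [2, 2, 1, 1, 1, 1, 1, 1], [2, 2, 2, 1, 1, 1, 1], [2, 2, 2, 2, 1, 1], [2, 2, 2, 2, 2], [3, 1, 1, 1, 1, 1, 1, 1], [3, 2, 1, 1, 1, 1, 1], [3, 2, 2, 1, 1, 1], [3, 2, 2, 2, 1], [3, 3, 1, 1, 1, 1], [3, 3, 2, 1, 1], [3, 3, 2, 2], [3, 3, 3, 1], [4, 1, 1, 1, 1, 1, 1], [4, 2, 1, 1, 1, 1], [4, 2, 2, 1, 1], [4, 2, 2, 2], [4, 3, 1, 1, 1], [4, 3, 2, 1], [4, 3, 3], [4, 4, 1, 1], [4, 4, 2], [5, 1, 1, 1, 1, 1], [5, 2, 1, 1, 1], [5, 2, 2, 1], [5, 3, 1, 1], [5, 3, 2], [5, 4, 1], [5, 5], [6, 1, 1, 1, 1], [6, 2, 1, 1], [6, 2, 2]]"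
  show "filter (\<lambda>l. lexle l [6, 2, 2]) (plist 10 10) = ?P" by code_simp
  show "cert 10 ?C" by (simp add: cert_simps)
  show "(\<Sum>l\<leftarrow>?P. pm N l x) = sprod N ?C x" for x unfolding pm_simps by algebra
qed simp_all

lemma T_6211: "10 \<le> N \<Longrightarrow> SP N 10 (T N [6, 2, 1, 1])"
proof (rule SP_T)
  let ?C = "[(1, [[4], [3], [3]]), (65/23, [[2, 1, 1, 1], [2, 1], [1, 1]]), (57/46, [[4, 1], [3], [1, 1]]), (813/46, [[4], [1, 1, 1], [1, 1, 1]]), (89/46, [[2, 1, 1, 1], [3], [1, 1]]), (600/23, [[3, 2], [1, 1, 1], [1, 1]]), (1197/46, [[3, 1], [3, 1], [2]]), (31/46, [[1, 1, 1, 1], [2, 1], [1, 1, 1]]), (531/23, [[4], [2, 2], [2]]), (19, [[5], [5]]), (65/46, [[4, 1], [4, 1]]), (275/46, [[1, 1, 1, 1], [1, 1, 1, 1], [2]]), (8/23, [[1, 1, 1, 1], [1, 1, 1], [1, 1, 1]]), (12, [[6], [2], [1, 1]]), (10, [[2, 1, 1, 1], [3], [2]]), (675/46, [[2, 1, 1], [3], [3]]), (291/46, [[3, 1], [2, 1], [2, 1]]), (256/23, [[2, 2], [1, 1, 1, 1], [2]]), (393/23, [[5], [1, 1, 1, 1], [1]]), (199/23, [[4], [2, 1], [2, 1]]), (38/23, [[1, 1, 1, 1, 1], [1, 1, 1, 1, 1]]), (212/23, [[2, 2, 1], [1, 1, 1, 1, 1]]), (545/23, [[2, 2, 1], [2,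 1], [1, 1]]), (919/46, [[4, 1], [1, 1, 1], [1, 1]]), (441/46, [[3, 1, 1], [1, 1, 1], [1, 1]]), (317/46, [[2, 2], [2, 2], [2]]), (279/46, [[3, 2], [1, 1, 1], [2]]), (287/46, [[3, 2], [1, 1, 1, 1, 1]]), (12, [[6], [2], [2]]), (27/46, [[5], [3, 2]]), (135/46, [[2, 1, 1, 1], [2, 1, 1, 1]]), (369/23, [[2, 2, 1], [3], [1, 1]])]"
  let ?P = "[[1, 1, 1, 1, 1, 1, 1, 1, 1, 1], [2, 1, 1, 1, 1, 1, 1, 1, 1], [2, 2, 1, 1, 1, 1, 1, 1], [2, 2, 2, 1, 1, 1, 1], [2, 2, 2, 2, 1, 1], [2, 2, 2, 2, 2], [3, 1, 1, 1, 1, 1, 1, 1], [3, 2, 1, 1, 1, 1, 1], [3, 2, 2, 1, 1, 1], [3, 2, 2, 2, 1], [3, 3, 1, 1, 1, 1], [3, 3, 2, 1, 1], [3, 3, 2, 2], [3, 3, 3, 1], [4, 1, 1, 1, 1, 1, 1], [4, 2, 1, 1, 1, 1], [4, 2, 2, 1, 1], [4, 2, 2, 2], [4, 3, 1, 1, 1], [4, 3, 2, 1], [4, 3, 3], [4, 4, 1, 1], [4, 4, 2], [5, 1, 1, 1, 1, 1], [5, 2, 1, 1, 1], [5, 2, 2, 1], [5, 3, 1, 1], [5, 3, 2], [5, 4, 1], [5, 5], [6, 1, 1, 1, 1], [6, 2, 1, 1]]"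
  show "filter (\<lambda>l. lexle l [6, 2, 1, 1]) (plist 10 10) = ?P" by code_simp
  show "cert 10 ?C" by (simp add: cert_simps)
  show "(\<Sum>l\<leftarrow>?P. pm N l x) = sprod N ?C x" for x unfolding pm_simps by algebra
qed simp_all

lemma T_61111: "10 \<le> N \<Longrightarrow> SP N 10 (T N [6, 1, 1, 1, 1])"
proof (rule SP_T)
  let ?C = "[(6, [[6], [1, 1, 1, 1]]), (190/9, [[3, 1], [2, 2], [1, 1]]), (43/9, [[2, 1, 1, 1], [2, 1], [1, 1]]), (37/3, [[2, 2], [1, 1, 1, 1], [2]]), (119/9, [[3, 2], [1, 1, 1], [1, 1]]), (71/36, [[4], [2, 2], [2]]), (155/18, [[1, 1, 1, 1, 1], [3, 1], [1]]), (1/18, [[4], [4], [1, 1]]), (1, [[1, 1, 1, 1, 1], [1, 1, 1], [1, 1]]), (152/9, [[2, 2], [2, 2], [2]]), (229/12, [[4], [2, 1], [2, 1]]), (163/18, [[2, 1, 1, 1], [4], [1]]), (32/9, [[2, 1, 1, 1], [2, 1], [2]]), (395/18, [[4], [1, 1, 1], [1, 1, 1]]), (47/9, [[2, 2], [1, 1, 1, 1], [1, 1]]), (65/18, [[3, 1, 1], [1, 1, 1], [1, 1]]), (125/18, [[5], [1, 1, 1, 1, 1]]), (12, [[6], [2, 1], [1]]), (35/18, [[5], [1, 1, 1, 1], [1]]), (124/9, [[3, 1], [2, 1], [2, 1]]), (6, [[1, 1, 1, 1], [2, 1], [1, 1, 1]]), (6, [[6], [2, 1, 1]]), (107/6, [[5],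 [3, 2]]), (52/3, [[2, 2, 1], [2, 1], [1, 1]]), (325/18, [[5], [5]]), (6, [[6], [3], [1]]), (19/2, [[4, 1], [1, 1, 1, 1], [1]]), (125/18, [[4], [4], [2]]), (163/9, [[3, 2], [2, 1, 1, 1]]), (113/18, [[4, 1], [2, 1, 1], [1]]), (575/36, [[4], [2, 1, 1], [2]]), (329/36, [[3, 1], [3, 1], [2]]), (289/36, [[2, 2], [3], [3]]), (11/4, [[2, 1, 1], [3], [3]])]"
  let ?P = "[[1, 1, 1, 1, 1, 1, 1, 1, 1, 1], [2, 1, 1, 1, 1, 1, 1, 1, 1], [2, 2, 1, 1, 1, 1, 1, 1], [2, 2, 2, 1, 1, 1, 1], [2, 2, 2, 2, 1, 1], [2, 2, 2, 2, 2], [3, 1, 1, 1, 1, 1, 1, 1], [3, 2, 1, 1, 1, 1, 1], [3, 2, 2, 1, 1, 1], [3, 2, 2, 2, 1], [3, 3, 1, 1, 1, 1], [3, 3, 2, 1, 1], [3, 3, 2, 2], [3, 3, 3, 1], [4, 1, 1, 1, 1, 1, 1], [4, 2, 1, 1, 1, 1], [4, 2, 2, 1, 1], [4, 2, 2, 2], [4, 3, 1, 1, 1], [4, 3, 2, 1], [4, 3, 3], [4, 4, 1, 1], [4, 4, 2], [5, 1, 1, 1, 1, 1], [5, 2, 1, 1, 1], [5, 2, 2, 1], [5, 3, 1, 1], [5, 3, 2], [5, 4, 1], [5, 5], [6, 1, 1, 1, 1]]"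
  show "filter (\<lambda>l. lexle l [6, 1, 1, 1, 1]) (plist 10 10) = ?P" by code_simp
  show "cert 10 ?C" by (simp add: cert_simps)
  show "(\<Sum>l\<leftarrow>?P. pm N l x) = sprod N ?C x" for x unfolding pm_simps by algebra
qed simp_all

section \<open>The top of the order\<close>

lemma sum_list_partitions: "l \<in> partitions n \<Longrightarrow> sum_list l = n"
  by (simp add: partitions_def is_partition_def)

lemma pm_Cons: "pm N (i # l) x = pw N i x * pm N l x" by (simp add: pm_def)

text \<open>The partitions above \<open>mu\<close> have a first part \<open>n - j\<close> with
  \<open>j < k\<close>, or the first part \<open>n - k\<close> with a tail above \<open>v\<close>.
  In the former case \<open>j \<le> n - j\<close>, so the tails are all partitions of
  \<open>j\<close>. In the latter the bound on the parts must be kept, since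
  \<open>2 * k = n + 1\<close> is allowed.\<close>

lemma T_block:
  assumes mu: "(n - k) # v \<in> partitions n" and k: "2 * k \<le> n + 1" "k \<le> n"
  shows "T N ((n - k) # v) x = Q N n x - (\<Sum>j<k. pw N (n - j) x * Q N j x) -
    pw N (n - k) x * (\<Sum>l | l \<in> partitions k \<and> (\<forall>q\<in>set l. q \<le> n - k) \<and> \<not> lexle l v. pm N l x)"
proof -
  let ?W = "{l \<in> partitions k. (\<forall>q\<in>set l. q \<le> n - k) \<and> \<not> lexle l v}"
  define B where "B j = (if j < k then partitions j else ?W)" for j
  have kn: "0 < n - k" using mu by (auto simp: partitions_Cons)
  have sub: "{l \<in> partitions n. \<not> lexle l ((n - k) # v)} = (\<Union>j\<in>{..<Suc k}. (#) (n - j) ` B j)"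
  proof (intro subset_antisym subsetI)
    fix l assume l: "l \<in> {l \<in> partitions n. \<not> lexle l ((n - k) # v)}"
    then obtain i l' where il: "l = i # l'" by (cases l) auto
    have i: "i \<le> n" "l' \<in> partitions (n - i)" "\<forall>q\<in>set l'. q \<le> i" using l by (auto simp: il partitions_Cons)
    have "n - k < i \<or> i = n - k \<and> \<not> lexle l' v" using l by (auto simp: il)
    then have "n - i < Suc k" "l' \<in> B (n - i)" using i k kn by (auto simp: B_def)
    moreover have "l = (n - (n - i)) # l'" using i il by simp
    ultimately show "l \<in> (\<Union>j\<in>{..<Suc k}. (#) (n - j) ` B j)" by blast
  next
    fix l assume "l \<in> (\<Union>j\<in>{..<Suc k}. (#) (n - j) ` B j)"
    then obtain j l' where j: "j < Suc k" "l' \<in> B j" "l = (n - j) # l'" by blast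
    then consider "j < k" "l' \<in> partitions j" | "j = k" "l' \<in> ?W" by (auto simp: B_def less_Suc_eq)
    then show "l \<in> {l \<in> partitions n. \<not> lexle l ((n - k) # v)}"
    proof cases
      case 1
      have "\<forall>q\<in>set l'. q \<le> n - j" using partitions_part_le[OF 1(2)] 1(1) k by fastforce
      moreover have "n - (n - j) = j" "\<not> n - j < n - k" "n - j \<noteq> n - k" "0 < n - j" using 1(1) k by auto
      ultimately show ?thesis using 1(2) by (simp add: j(3) partitions_Cons)
    next
      case 2
      then show ?thesis using k kn by (simp add: j(3) partitions_Cons)
    qed
  qed
  have finB: "finite (B j)" for j by (auto simp: B_def)
  have "(\<Sum>l | l \<in> partitions n \<and> \<not> lexle l ((n - k) # v). pm N l x) = (\<Sum>j<Suc k. \<Sum>l\<in>(#) (n - j) ` B j. pm N l x)"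
    unfolding sub using k finB by (intro sum.UNION_disjoint) auto
  also have "\<dots> = (\<Sum>j<Suc k. pw N (n - j) x * (\<Sum>l\<in>B j. pm N l x))"
    by (simp add: sum.reindex pm_Cons sum_distrib_left)
  also have "\<dots> = (\<Sum>j<k. pw N (n - j) x * Q N j x) + pw N (n - k) x * (\<Sum>l\<in>?W. pm N l x)"
    by (simp add: B_def Q_def)
  finally have D: "(\<Sum>l | l \<in> partitions n \<and> \<not> lexle l ((n - k) # v). pm N l x) = \<dots>" .
  have "Q N n x = T N ((n - k) # v) x + (\<Sum>l | l \<in> partitions n \<and> \<not> lexle l ((n - k) # v). pm N l x)"
    unfolding Q_def T_def sum_list_partitions[OF mu]
    by (subst sum.union_disjoint[symmetric]) (auto intro!: sum.cong)
  then show ?thesis using D by simp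
qed

text \<open>The hypothesis on \<open>v\<close> makes \<open>mu\<close> the largest partition with
  its first part, so only full blocks are removed.\<close>

lemma SP_T_full:
  assumes mu: "(n - k) # v \<in> partitions n" and k: "2 * k \<le> n + 1" "k \<le> n" "n \<le> N"
    and v: "\<And>l. l \<in> partitions k \<Longrightarrow> (\<forall>q\<in>set l. q \<le> n - k) \<Longrightarrow> lexle l v"
  shows "SP N n (T N ((n - k) # v))"
proof -
  have 0: "{l. l \<in> partitions k \<and> (\<forall>q\<in>set l. q \<le> n - k) \<and> \<not> lexle l v} = {}" using v by blast
  have "0 < n" using mu by (auto simp: partitions_Cons)
  then show ?thesis using SP_full_blocks[OF k(1,3)] unfolding T_block[OF mu k(1,2), abs_def] 0 by simp
qed

text \<open>The bound puts \<open>k\<close> below \<open>n - k\<close>, so every partition of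
  \<open>k\<close> is an admissible tail and \<open>W\<close> can be read off from
  \<open>plist\<close>.\<close>

lemma SP_T_partial:
  assumes mu: "(n - k) # v \<in> partitions n" and k: "2 * k + 2 < n" "n \<le> N"
    and W: "filter (\<lambda>l. \<not> lexle l v) (plist k k) = W"
    and SP: "SP N n (\<lambda>x. Q N n x - (\<Sum>j<k. pw N (n - j) x * Q N j x) - pw N (n - k) x * (\<Sum>l\<leftarrow>W. pm N l x))"
  shows "SP N n (T N ((n - k) # v))"
proof -
  have "{l. l \<in> partitions k \<and> (\<forall>q\<in>set l. q \<le> n - k) \<and> \<not> lexle l v} = set W"
    using k partitions_part_le by (fastforce simp: W[symmetric] set_plist)
  moreover have "distinct W" unfolding W[symmetric] by (simp add: distinct_plist)
  ultimately have S: "(\<Sum>l | l \<in> partitions k \<and> (\<forall>q\<in>set l. q \<le> n - k) \<and> \<not> lexle l v. pm N l x) = (\<Sum>l\<leftarrow>W. pm N l x)" for x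
    by (simp add: sum_list_distinct_conv_sum_set)
  have k': "2 * k \<le> n + 1" "k \<le> n" using k by auto
  show ?thesis using SP unfolding T_block[OF mu k', abs_def] by (simp add: S)
qed

section \<open>The bottom of the order\<close>

text \<open>The partition (2^i, 1^(n - 2 i)). On these partitions the order is a chain in
  \<open>i\<close>.\<close>

definition tw :: "nat \<Rightarrow> nat \<Rightarrow> nat list" where
  "tw n i = replicate i 2 @ replicate (n - 2 * i) 1"

lemma tw_partitions: "2 * i \<le> n \<Longrightarrow> tw n i \<in> partitions n"
proof -
  have "sorted_wrt (\<ge>) (replicate m a)" for m and a :: nat by (induction m) auto
  then show "2 * i \<le> n \<Longrightarrow> tw n i \<in> partitions n"
    by (auto simp: tw_def partitions_def is_partition_def sum_list_replicate sorted_wrt_append)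
qed

lemma tw_Suc: "tw n (Suc i) = 2 # tw (n - 2) i" by (simp add: tw_def)

lemma lexle_tw: "2 * i \<le> n \<Longrightarrow> 2 * k \<le> n \<Longrightarrow> lexle (tw n i) (tw n k) \<longleftrightarrow> i \<le> k"
proof (induction i arbitrary: n k)
  case 0
  have ones: "lexle (replicate m 1) (replicate m 1)" for m by (induction m) auto
  show ?case
  proof (cases k)
    case 0 then show ?thesis using ones by (simp add: tw_def)
  next
    case (Suc k')
    then show ?thesis using 0 by (cases n) (auto simp: tw_def)
  qed
next
  case (Suc i)
  show ?case
  proof (cases k)
    case 0
    then show ?thesis using Suc.prems by (cases n) (auto simp: tw_def)
  next
    case (Suc k')
    then show ?thesis using Suc.prems Suc.IH[of "n - 2" k'] by (simp add: tw_Suc)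
  qed
qed

lemma twos_ones: "l \<in> partitions n \<Longrightarrow> \<forall>q\<in>set l. q \<le> 2 \<Longrightarrow> \<exists>i. 2 * i \<le> n \<and> l = tw n i"
proof (induction l arbitrary: n)
  case Nil
  then show ?case by (auto simp: partitions_Nil tw_def)
next
  case (Cons a l)
  have a: "0 < a" "a \<le> n" "\<forall>q\<in>set l. q \<le> a" "l \<in> partitions (n - a)" using Cons.prems(1) by (auto simp: partitions_Cons)
  obtain i where i: "2 * i \<le> n - a" "l = tw (n - a) i" using Cons.IH[OF a(4)] Cons.prems(2) by auto
  have "a = 1 \<or> a = 2" using a(1) Cons.prems(2) by auto
  then show ?case
  proof
    assume "a = 2"
    then show ?thesis using i a(2) by (intro exI[of _ "Suc i"]) (auto simp: tw_Suc)
  next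
    assume 1: "a = 1"
    have "i = 0" using a(3) by (cases i) (auto simp: i(2) tw_def 1)
    moreover have "n = Suc (n - 1)" using a(1,2) by simp
    ultimately have "a # l = tw n 0" using i(2) 1 by (metis One_nat_def append_Nil diff_zero mult_0_right replicate_0 replicate_Suc tw_def)
    then show ?thesis by (intro exI[of _ 0]) simp
  qed
qed

lemma pm_tw: "pm N (tw n i) x = pw N 2 x ^ i * pw N 1 x ^ (n - 2 * i)"
  by (simp add: tw_def pm_def prod_list_replicate)

lemma le_tw:
  assumes "2 * k \<le> n"
  shows "{l \<in> partitions n. lexle l (tw n k)} = tw n ` {..k}"
proof (intro subset_antisym subsetI)
  fix l assume l: "l \<in> {l \<in> partitions n. lexle l (tw n k)}"
  have "\<forall>q\<in>set l. q \<le> 2"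
  proof (cases l)
    case (Cons a l')
    have "tw n k \<noteq> []" using l Cons by (cases "tw n k") auto
    then obtain b t where b: "tw n k = b # t" by (cases "tw n k") auto
    then have "b \<in> set (tw n k)" by simp
    then have "b \<le> 2" by (auto simp: tw_def)
    then show ?thesis using l by (auto simp: Cons b partitions_Cons)
  qed simp
  then obtain i where i: "2 * i \<le> n" "l = tw n i" using twos_ones l by blast
  then show "l \<in> tw n ` {..k}" using l lexle_tw[OF i(1) assms] by auto
next
  fix l assume "l \<in> tw n ` {..k}"
  then show "l \<in> {l \<in> partitions n. lexle l (tw n k)}" using assms tw_partitions lexle_tw by auto
qed

text \<open>The partitions up to \<open>tw n k\<close> are the \<open>tw n i\<close> with
  \<open>i \<le> k\<close>. After the common power of p_1 is taken out, the sum is geometric in p_2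
  and p_1^2.\<close>

lemma T_tw:
  assumes "2 * k \<le> n"
  shows "T N (tw n k) x = pw N 1 x ^ (n - 2 * k) * (\<Sum>i\<le>k. pw N 2 x ^ i * (pw N 1 x ^ 2) ^ (k - i))"
proof -
  have inj: "inj_on (tw n) {..k}"
  proof (rule inj_onI)
    fix i j assume "i \<in> {..k}" "j \<in> {..k}" "tw n i = tw n j"
    then show "i = j" using assms lexle_tw[of i n j] lexle_tw[of j n i] lexle_tw[of i n i] by auto
  qed
  have "T N (tw n k) x = (\<Sum>i\<le>k. pm N (tw n i) x)"
    unfolding T_def sum_list_partitions[OF tw_partitions[OF assms]]
    using le_tw[OF assms] inj by (simp add: sum.reindex)
  also have "\<dots> = (\<Sum>i\<le>k. pw N 1 x ^ (n - 2 * k) * (pw N 2 x ^ i * (pw N 1 x ^ 2) ^ (k - i)))"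
  proof (rule sum.cong[OF refl])
    fix i assume "i \<in> {..k}"
    then have E: "n - 2 * i = n - 2 * k + 2 * (k - i)" using assms by auto
    show "pm N (tw n i) x = pw N 1 x ^ (n - 2 * k) * (pw N 2 x ^ i * (pw N 1 x ^ 2) ^ (k - i))"
      unfolding pm_tw E power_add power_mult by (simp only: mult_ac)
  qed
  finally show ?thesis by (simp add: sum_distrib_left)
qed

text \<open>With $h = h_2$ and $e = e_2$ the pair below is
  $\bigl(\frac{(h+e)^k+(h-e)^k}2, \frac{(h+e)^k-(h-e)^k}{2e}\bigr)$, where $h+e=p_1^2$ and $h-e=p_2$.\<close>

primrec ab :: "nat \<Rightarrow> nat \<Rightarrow> (nat \<Rightarrow> real) \<Rightarrow> real \<times> real" where
  "ab N 0 x = (1, 0)"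
| "ab N (Suc k) x = (sch N [2] x * fst (ab N k x) + sch N [1, 1] x ^ 2 * snd (ab N k x), fst (ab N k x) + sch N [2] x * snd (ab N k x))"

lemma ab_powers:
  "fst (ab N k x) + sch N [1, 1] x * snd (ab N k x) = (pw N 1 x ^ 2) ^ k"
  "fst (ab N k x) - sch N [1, 1] x * snd (ab N k x) = pw N 2 x ^ k"
proof -
  have A: "pw N 1 x ^ 2 = sch N [2] x + sch N [1, 1] x" and B: "pw N 2 x = sch N [2] x - sch N [1, 1] x"
    unfolding s2 s11 by algebra+
  show "fst (ab N k x) + sch N [1, 1] x * snd (ab N k x) = (pw N 1 x ^ 2) ^ k"
  proof (induction k)
    case (Suc k)
    show ?case unfolding power_Suc Suc[symmetric] unfolding A ab.simps fst_conv snd_conv by algebra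
  qed simp
  show "fst (ab N k x) - sch N [1, 1] x * snd (ab N k x) = pw N 2 x ^ k"
  proof (induction k)
    case (Suc k)
    show ?case unfolding power_Suc Suc[symmetric] unfolding B ab.simps fst_conv snd_conv by algebra
  qed simp
qed

text \<open>The geometric sum is the quotient of (p_1^2)^(k+1) - p_2^(k+1) by p_1^2 - p_2 = 2 e_2,
  which by \<open>ab_powers\<close> is the second component. The induction avoids the
  division.\<close>

lemma ab_sum: "snd (ab N (Suc k) x) = (\<Sum>i\<le>k. pw N 2 x ^ i * (pw N 1 x ^ 2) ^ (k - i))"
proof (induction k)
  case (Suc k)
  have "(\<Sum>i\<le>Suc k. pw N 2 x ^ i * (pw N 1 x ^ 2) ^ (Suc k - i)) = pw N 1 x ^ 2 * snd (ab N (Suc k) x) + pw N 2 x ^ Suc k"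
    unfolding Suc sum_distrib_left by (simp add: Suc_diff_le mult_ac)
  also have "\<dots> = (sch N [2] x + sch N [1, 1] x) * snd (ab N (Suc k) x) + (fst (ab N (Suc k) x) - sch N [1, 1] x * snd (ab N (Suc k) x))"
  proof -
    have "pw N 1 x ^ 2 = sch N [2] x + sch N [1, 1] x" unfolding s2 s11 by algebra
    then show ?thesis by (simp only: ab_powers)
  qed
  also have "\<dots> = snd (ab N (Suc (Suc k)) x)" unfolding ab.simps(2)[of N "Suc k"] snd_conv by algebra
  finally show ?case by simp
qed simp

lemma SP_sch: "is_partition k l \<Longrightarrow> SP N k (sch N l)"
  by (rule SP_schur, rule part_Par) (simp add: partitions_def)

lemma SP_power: "SP N k F \<Longrightarrow> k * j \<le> N \<Longrightarrow> SP N (k * j) (\<lambda>x. F x ^ j)"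
proof (induction j)
  case (Suc j)
  then have "SP N (k + k * j) (\<lambda>x. F x * F x ^ j)" by (intro SP_mult) auto
  then show ?case by simp
qed (use SP_one in simp)

text \<open>The recursion of \<open>ab\<close> uses only sums and products of h_2 and e_2^2, so no
  minus sign is left. The second component has degree \<open>2 * (k - 1)\<close>; for
  \<open>k = 0\<close> it is zero, and the truncated subtraction does no harm.\<close>

lemma SP_ab: "2 * k \<le> N \<Longrightarrow> SP N (2 * k) (\<lambda>x. fst (ab N k x)) \<and> SP N (2 * k) (\<lambda>x. snd (ab N (Suc k) x)) \<and>
   SP N (2 * (k - 1)) (\<lambda>x. snd (ab N k x))"
proof (induction k)
  case 0
  then show ?case using SP_one by (simp add: SP_zero)
next
  case (Suc k)
  let ?h = "sch N [2]" and ?e = "sch N [1, 1]"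
  have h: "SP N 2 ?h" and e: "SP N 2 ?e" by (auto intro: SP_sch simp: is_partition_def)
  have IH: "SP N (2 * k) (\<lambda>x. fst (ab N k x))" "SP N (2 * k) (\<lambda>x. snd (ab N (Suc k) x))" "SP N (2 * (k - 1)) (\<lambda>x. snd (ab N k x))"
    using Suc by auto
  have ha: "SP N (2 * Suc k) (\<lambda>x. ?h x * fst (ab N k x))" using SP_mult[OF h IH(1)] Suc.prems by simp
  have eb: "SP N (2 * Suc k) (\<lambda>x. ?e x ^ 2 * snd (ab N k x))"
  proof (cases k)
    case 0
    then show ?thesis by (simp add: SP_zero)
  next
    case (Suc j)
    have "SP N (2 * 2 + 2 * (k - 1)) (\<lambda>x. ?e x ^ 2 * snd (ab N k x))"
      by (intro SP_mult SP_power e IH(3)) (use \<open>2 * Suc k \<le> N\<close> Suc in auto)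
    moreover have "2 * 2 + 2 * (k - 1) = 2 * Suc k" using Suc by simp
    ultimately show ?thesis by metis
  qed
  have a: "SP N (2 * Suc k) (\<lambda>x. fst (ab N (Suc k) x))" using SP_add[OF ha eb] by simp
  have "SP N (2 * Suc k) (\<lambda>x. fst (ab N (Suc k) x) + ?h x * snd (ab N (Suc k) x))"
    using SP_add[OF a] SP_mult[OF h IH(2)] Suc.prems by simp
  then have "SP N (2 * Suc k) (\<lambda>x. snd (ab N (Suc (Suc k)) x))" by simp
  then show ?case using a IH(2) by (simp del: ab.simps)
qed

lemma SP_p1_power: "j \<le> N \<Longrightarrow> SP N j (\<lambda>x. pw N 1 x ^ j)"
  using SP_power[OF SP_sch[of 1 "[1]" N], of j] unfolding s1 by (simp add: is_partition_def)

lemma le_ones: assumes "l \<in> partitions m" "lexle l (replicate m 1)" shows "l = replicate m 1"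
proof -
  have "l \<in> {l \<in> partitions m. lexle l (tw m 0)}" using assms by (simp add: tw_def)
  then have "l \<in> tw m ` {..0}" by (subst (asm) le_tw) auto
  then show ?thesis by (simp add: tw_def)
qed

lemma SP_T_tw:
  assumes "2 * k \<le> n" "n \<le> N"
  shows "SP N n (T N (tw n k))"
proof -
  have "SP N (n - 2 * k) (\<lambda>x. pw N 1 x ^ (n - 2 * k))" by (rule SP_p1_power) (use assms in simp)
  then have "SP N (n - 2 * k + 2 * k) (\<lambda>x. pw N 1 x ^ (n - 2 * k) * snd (ab N (Suc k) x))"
    using SP_ab[of k N] assms by (intro SP_mult) auto
  then show ?thesis unfolding T_tw[OF assms(1), abs_def] ab_sum[symmetric] using assms by simp
qed

text \<open>Besides the partitions with parts 1 and 2 there is one more term, p_3 p_1^(n-3). By p_3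
  = 2 s_3 + s_111 - p_1 h_2 its negative part is - h_2 p_1^(n-2). Written through \<open>ab\<close>,
  it is absorbed by the geometric sum, which leaves the coefficient h_2^2 + e_2^2 - h_2 e_2 = s_4 +
  2 s_22 + s_1111.\<close>

lemma SP_T_three:
  assumes n: "3 \<le> n" "n \<le> N"
  shows "SP N n (T N (3 # replicate (n - 3) 1))"
proof -
  \<comment> \<open>The maximal number of twos, so that \<open>tw n m\<close> is the largest
    partition with parts at most 2.\<close>
  define m where "m = n div 2"
  have m: "1 \<le> m" "2 * m \<le> n" "n < 2 * m + 2" using n by (auto simp: m_def)
  let ?mu = "3 # replicate (n - 3) 1" and ?h = "sch N [2]" and ?e = "sch N [1, 1]"
  have mu: "?mu \<in> partitions n" using tw_partitions[of 0 "n - 3"] n by (auto simp: partitions_Cons tw_def)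
  have "{l \<in> partitions n. lexle l ?mu} = insert ?mu {l \<in> partitions n. lexle l (tw n m)}"
  proof (intro set_eqI iffI)
    fix l assume l: "l \<in> {l \<in> partitions n. lexle l ?mu}"
    then obtain a l' where al: "l = a # l'" using n by (cases l) (auto simp: partitions_Nil)
    have "a < 3 \<or> a = 3 \<and> lexle l' (replicate (n - 3) 1)" using l by (simp add: al)
    then show "l \<in> insert ?mu {l \<in> partitions n. lexle l (tw n m)}"
    proof
      assume "a < 3"
      then have "\<forall>q\<in>set l. q \<le> 2" using l by (auto simp: al partitions_Cons)
      then obtain i where i: "2 * i \<le> n" "l = tw n i" using twos_ones[of l n] l by blast
      then show ?thesis using lexle_tw[OF i(1) m(2)] tw_partitions m by simp
    next
      assume a: "a = 3 \<and> lexle l' (replicate (n - 3) 1)"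
      then have "l' = replicate (n - 3) 1" using l by (intro le_ones) (auto simp: al partitions_Cons)
      then show ?thesis using a by (simp add: al)
    qed
  next
    fix l assume l: "l \<in> insert ?mu {l \<in> partitions n. lexle l (tw n m)}"
    have "lexle l ?mu" if "l \<in> partitions n" "lexle l (tw n m)"
    proof -
      have "l \<in> tw n ` {..m}" unfolding le_tw[OF m(2), symmetric] using that by simp
      then obtain i where "l = tw n i" by blast
      then show ?thesis using n by (cases i) (cases n, auto simp: tw_def)
    qed
    moreover have "lexle v v" for v by (induction v) auto
    ultimately show "l \<in> {l \<in> partitions n. lexle l ?mu}" using l mu by auto
  qed
  moreover have "\<not> lexle ?mu (tw n m)"
    using m by (cases m) (simp_all add: tw_def)
  ultimately have "T N ?mu x = pm N ?mu x + T N (tw n m) x" for x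
    unfolding T_def sum_list_partitions[OF mu] sum_list_partitions[OF tw_partitions[OF m(2)]] by simp
  also have "pm N ?mu x + T N (tw n m) x = pw N 3 x * pw N 1 x ^ (n - 3) + pw N 1 x ^ (n - 2 * m) * snd (ab N (Suc m) x)" for x
    unfolding T_tw[OF m(2)] ab_sum[symmetric] by (simp add: pm_def prod_list_replicate del: ab.simps)
  also have "\<dots> x = pw N 1 x ^ (n - 2 * m) * (?h x * fst (ab N (m - 1) x) + sprod N [(1, [[4]]), (2, [[2, 2]]), (1, [[1, 1, 1, 1]])] x * snd (ab N (m - 1) x))
    + (2 * sch N [3] x + sch N [1, 1, 1] x) * pw N 1 x ^ (n - 3)" for x
  proof -
    obtain j where j: "m = Suc j" using m(1) by (cases m) auto
    have p3: "pw N 3 x = 2 * sch N [3] x + sch N [1, 1, 1] x - pw N 1 x * ?h x" unfolding s3 s111 s2 by algebra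
    have p1: "pw N 1 x * pw N 1 x ^ (n - 3) = pw N 1 x ^ (n - 2 * m) * (fst (ab N j x) + ?e x * snd (ab N j x))"
    proof -
      have "Suc (n - 3) = n - 2 * m + 2 * j" using m n j by auto
      then show ?thesis unfolding ab_powers by (metis power_Suc power_add power_mult)
    qed
    have q: "sprod N [(1, [[4]]), (2, [[2, 2]]), (1, [[1, 1, 1, 1]])] x = ?h x ^ 2 + ?e x ^ 2 - ?h x * ?e x"
      unfolding pm_simps by algebra
    have s: "snd (ab N (Suc m) x) = ?h x * fst (ab N j x) + ?e x ^ 2 * snd (ab N j x) + ?h x * (fst (ab N j x) + ?h x * snd (ab N j x))"
      by (simp add: j)
    have "pw N 3 x * pw N 1 x ^ (n - 3) = (2 * sch N [3] x + sch N [1, 1, 1] x) * pw N 1 x ^ (n - 3) - ?h x * (pw N 1 x * pw N 1 x ^ (n - 3))"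
      unfolding p3 by (simp add: algebra_simps del: S.simps)
    then show ?thesis unfolding p1 q s using j by (simp add: algebra_simps power2_eq_square del: S.simps ab.simps)
  qed
  finally have T: "T N ?mu = (\<lambda>x. pw N 1 x ^ (n - 2 * m) * (?h x * fst (ab N (m - 1) x) + sprod N [(1, [[4]]), (2, [[2, 2]]), (1, [[1, 1, 1, 1]])] x * snd (ab N (m - 1) x))
    + (2 * sch N [3] x + sch N [1, 1, 1] x) * pw N 1 x ^ (n - 3))" by blast
  obtain j where j: "m = Suc j" using m(1) by (cases m) auto
  have ab: "SP N (2 * j) (\<lambda>x. fst (ab N j x))" "SP N (2 * (j - 1)) (\<lambda>x. snd (ab N j x))" using SP_ab[of j N] m n j by auto
  have "SP N (2 * m) (\<lambda>x. ?h x * fst (ab N j x))"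
    using SP_mult[OF SP_sch[of 2 "[2]"] ab(1)] m n j by (simp add: is_partition_def)
  moreover have "SP N (2 * m) (\<lambda>x. sprod N [(1, [[4]]), (2, [[2, 2]]), (1, [[1, 1, 1, 1]])] x * snd (ab N j x))"
  proof (cases j)
    case (Suc i)
    have "cert 4 [(1, [[4]]), (2, [[2, 2]]), (1, [[1, 1, 1, 1]])]" by (simp add: cert_simps)
    then have "SP N (4 + 2 * (j - 1)) (\<lambda>x. sprod N [(1, [[4]]), (2, [[2, 2]]), (1, [[1, 1, 1, 1]])] x * snd (ab N j x))"
      using m n j Suc by (intro SP_mult SP_sprod ab(2)) auto
    moreover have "4 + 2 * (j - 1) = 2 * m" using j Suc by simp
    ultimately show ?thesis by simp
  qed (simp add: SP_zero)
  ultimately have 1: "SP N (n - 2 * m + 2 * m) (\<lambda>x. pw N 1 x ^ (n - 2 * m) * (?h x * fst (ab N j x) + sprod N [(1, [[4]]), (2, [[2, 2]]), (1, [[1, 1, 1, 1]])] x * snd (ab N j x)))"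
    using m n by (intro SP_mult SP_p1_power SP_add) auto
  have "SP N 3 (\<lambda>x. 2 * sch N [3] x + sch N [1, 1, 1] x)"
    by (intro SP_add SP_scale SP_sch) (auto simp: is_partition_def)
  then have 2: "SP N (3 + (n - 3)) (\<lambda>x. (2 * sch N [3] x + sch N [1, 1, 1] x) * pw N 1 x ^ (n - 3))"
    using n by (intro SP_mult SP_p1_power) auto
  have e: "n - 2 * m + 2 * m = n" "3 + (n - 3) = n" "m - 1 = j" using m n j by auto
  show ?thesis unfolding T e(3) by (rule SP_add[OF 1[unfolded e(1)] 2[unfolded e(2)]])
qed

lemma SP_bottom:
  assumes mu: "mu \<in> partitions n" and n: "3 \<le> n" "n \<le> N" and le: "lexle mu (3 # replicate (n - 3) 1)"
  shows "SP N n (T N mu)"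
proof (cases "\<forall>q\<in>set mu. q \<le> 2")
  case True
  then show ?thesis using twos_ones[OF mu] SP_T_tw n by blast
next
  case False
  obtain a v where a: "mu = a # v" using mu n by (cases mu) (auto simp: partitions_Nil)
  have "\<not> a \<le> 2" using False mu by (auto simp: a partitions_Cons)
  then have a3: "a = 3" "lexle v (replicate (n - 3) 1)" using le by (auto simp: a)
  then have "v = replicate (n - 3) 1" using mu by (intro le_ones) (auto simp: a partitions_Cons)
  then show ?thesis using SP_T_three[OF n] a a3 by simp
qed

lemma partitions_plist: "partitions k = set (plist k k)"
  using partitions_part_le by (auto simp: set_plist)

text \<open>The lower bound forces a first part \<open>n - k\<close> with \<open>k \<le> 4\<close>,
  so only finitely many tails \<open>v\<close> occur. A largest tail is settled by
  \<open>full\<close>; the others by \<open>partial\<close> for large \<open>n\<close>, by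
  \<open>bottom\<close> if \<open>mu\<close> is at most (3, 1^(n-3)), and by a certificate in the
  degrees between.\<close>

lemma SP_top:
  assumes mu: "mu \<in> partitions n" and n: "5 \<le> n" "n \<le> N" and le: "lexle ((n - 4) # replicate 4 1) mu"
  shows "SP N n (T N mu)"
proof -
  obtain i v where iv: "mu = i # v" using mu n by (cases mu) (auto simp: partitions_Nil)
  have i: "n - 4 \<le> i" "i \<le> n" "v \<in> partitions (n - i)" "\<forall>q\<in>set v. q \<le> i" "0 < i"
    using le mu by (auto simp: iv partitions_Cons)
  define k where "k = n - i"
  have k: "k \<le> 4" "k \<le> n" "k < n" "v \<in> set (plist k k)" "\<forall>q\<in>set v. q \<le> n - k" and muk: "mu = (n - k) # v"
    using i n by (auto simp: k_def iv partitions_plist)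
  have bottom: ?thesis if "lexle ((n - k) # v) (3 # replicate (n - 3) 1)"
    using SP_bottom[OF mu _ n(2)] n(1) that by (simp add: muk)
  have full: ?thesis if "2 * k \<le> n + 1" "\<forall>l\<in>set (plist k k). (\<forall>q\<in>set l. q \<le> n - k) \<longrightarrow> lexle l v"
    unfolding muk using mu that k n by (intro SP_T_full) (auto simp: muk partitions_plist)
  have partial: ?thesis if "2 * k + 2 < n" "filter (\<lambda>l. \<not> lexle l v) (plist k k) = W"
    "SP N n (\<lambda>x. Q N n x - (\<Sum>j<k. pw N (n - j) x * Q N j x) - pw N (n - k) x * (\<Sum>l\<leftarrow>W. pm N l x))" for W
    unfolding muk using mu that n by (intro SP_T_partial) (auto simp: muk)
  have plists: "plist 0 0 = [[]]" "plist 1 1 = [[1]]" "plist 2 2 = [[1, 1], [2]]" "plist 3 3 = [[1, 1, 1], [2, 1], [3]]"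
    "plist 4 4 = [[1, 1, 1, 1], [2, 1, 1], [2, 2], [3, 1], [4]]" by code_simp+
  have "k = 0 \<or> k = 1 \<or> k = 2 \<or> k = 3 \<or> k = 4" using k(1) by auto
  then show ?thesis
  proof (elim disjE)
    assume k4: "k = 0"
    then show ?thesis using full k(4) by (simp add: plists)
  next
    assume k4: "k = 1"
    then show ?thesis using full k(4) n by (simp add: plists[unfolded One_nat_def])
  next
    assume k4: "k = 2"
    then consider "v = [1, 1]" | "v = [2]" using k(4) by (auto simp: plists)
    then show ?thesis
    proof cases
      case 1
      show ?thesis
      proof (cases "6 < n")
        case True
        show ?thesis by (rule partial[OF _ _ partial_11[OF True n(2), folded k4]]) (use True in \<open>simp_all add: k4 1 plists\<close>)
      next
        case False
        then have "n = 5 \<or> n = 6" using n(1) k(5) k4 1 by auto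
        then show ?thesis
        proof (elim disjE)
          assume n5: "n = 5"
          then show ?thesis by (intro bottom) (simp add: k4 1 numeral_eq_Suc)
        next
          assume n5: "n = 6"
          then show ?thesis using T_411[of N] n(2) by (simp add: muk k4 1)
        qed
      qed
    next
      case 2
      have "2 * k \<le> n + 1" using k(5) n(1) 2 k4 by auto
      then show ?thesis by (rule full) (simp add: k4 2 plists)
    qed
  next
    assume k4: "k = 3"
    then consider "v = [1, 1, 1]" | "v = [2, 1]" | "v = [3]" using k(4) by (auto simp: plists)
    then show ?thesis
    proof cases
      case 1
      show ?thesis
      proof (cases "8 < n")
        case True
        show ?thesis by (rule partial[OF _ _ partial_111[OF True n(2), folded k4]]) (use True in \<open>simp_all add: k4 1 plists\<close>)
      next
        case False
        then have "n = 5 \<or> n = 6 \<or> n = 7 \<or> n = 8" using n(1) k(5) k4 1 by auto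
        then show ?thesis
        proof (elim disjE)
          assume n5: "n = 5"
          then show ?thesis by (intro bottom) (simp add: k4 1 numeral_eq_Suc)
        next
          assume n5: "n = 6"
          then show ?thesis by (intro bottom) (simp add: k4 1 numeral_eq_Suc)
        next
          assume n5: "n = 7"
          then show ?thesis using T_4111[of N] n(2) by (simp add: muk k4 1)
        next
          assume n5: "n = 8"
          then show ?thesis using T_5111[of N] n(2) by (simp add: muk k4 1)
        qed
      qed
    next
      case 2
      show ?thesis
      proof (cases "8 < n")
        case True
        show ?thesis by (rule partial[OF _ _ partial_21[OF True n(2), folded k4]]) (use True in \<open>simp_all add: k4 2 plists\<close>)
      next
        case False
        then have "n = 5 \<or> n = 6 \<or> n = 7 \<or> n = 8" using n(1) k(5) k4 2 by auto
        then show ?thesis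
        proof (elim disjE)
          assume n5: "n = 5"
          then show ?thesis by (intro bottom) (simp add: k4 2 numeral_eq_Suc)
        next
          assume n5: "n = 6"
          then show ?thesis using T_321[of N] n(2) by (simp add: muk k4 2)
        next
          assume n5: "n = 7"
          then show ?thesis using T_421[of N] n(2) by (simp add: muk k4 2)
        next
          assume n5: "n = 8"
          then show ?thesis using T_521[of N] n(2) by (simp add: muk k4 2)
        qed
      qed
    next
      case 3
      have "2 * k \<le> n + 1" using k(5) n(1) 3 k4 by auto
      then show ?thesis by (rule full) (simp add: k4 3 plists)
    qed
  next
    assume k4: "k = 4"
    then consider "v = [1, 1, 1, 1]" | "v = [2, 1, 1]" | "v = [2, 2]" | "v = [3, 1]" | "v = [4]" using k(4) by (auto simp: plists)
    then show ?thesis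
    proof cases
      case 1
      show ?thesis
      proof (cases "10 < n")
        case True
        show ?thesis by (rule partial[OF _ _ partial_1111[OF True n(2), folded k4]]) (use True in \<open>simp_all add: k4 1 plists\<close>)
      next
        case False
        then have "n = 5 \<or> n = 6 \<or> n = 7 \<or> n = 8 \<or> n = 9 \<or> n = 10" using n(1) k(5) k4 1 by auto
        then show ?thesis
        proof (elim disjE)
          assume n5: "n = 5"
          then show ?thesis by (intro bottom) (simp add: k4 1 numeral_eq_Suc)
        next
          assume n5: "n = 6"
          then show ?thesis by (intro bottom) (simp add: k4 1 numeral_eq_Suc)
        next
          assume n5: "n = 7"
          then show ?thesis by (intro bottom) (simp add: k4 1 numeral_eq_Suc)
        next
          assume n5: "n = 8"
          then show ?thesis using T_41111[of N] n(2) by (simp add: muk k4 1)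
        next
          assume n5: "n = 9"
          then show ?thesis using T_51111[of N] n(2) by (simp add: muk k4 1)
        next
          assume n5: "n = 10"
          then show ?thesis using T_61111[of N] n(2) by (simp add: muk k4 1)
        qed
      qed
    next
      case 2
      show ?thesis
      proof (cases "10 < n")
        case True
        show ?thesis by (rule partial[OF _ _ partial_211[OF True n(2), folded k4]]) (use True in \<open>simp_all add: k4 2 plists\<close>)
      next
        case False
        then have "n = 6 \<or> n = 7 \<or> n = 8 \<or> n = 9 \<or> n = 10" using n(1) k(5) k4 2 by auto
        then show ?thesis
        proof (elim disjE)
          assume n5: "n = 6"
          then show ?thesis by (intro bottom) (simp add: k4 2 numeral_eq_Suc)
        next
          assume n5: "n = 7"
          then show ?thesis using T_3211[of N] n(2) by (simp add: muk k4 2)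
        next
          assume n5: "n = 8"
          then show ?thesis using T_4211[of N] n(2) by (simp add: muk k4 2)
        next
          assume n5: "n = 9"
          then show ?thesis using T_5211[of N] n(2) by (simp add: muk k4 2)
        next
          assume n5: "n = 10"
          then show ?thesis using T_6211[of N] n(2) by (simp add: muk k4 2)
        qed
      qed
    next
      case 3
      show ?thesis
      proof (cases "10 < n")
        case True
        show ?thesis by (rule partial[OF _ _ partial_22[OF True n(2), folded k4]]) (use True in \<open>simp_all add: k4 3 plists\<close>)
      next
        case False
        then have "n = 6 \<or> n = 7 \<or> n = 8 \<or> n = 9 \<or> n = 10" using n(1) k(5) k4 3 by auto
        then show ?thesis
        proof (elim disjE)
          assume n5: "n = 6"
          then show ?thesis by (intro bottom) (simp add: k4 3 numeral_eq_Suc)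
        next
          assume n5: "n = 7"
          then show ?thesis using T_322[of N] n(2) by (simp add: muk k4 3)
        next
          assume n5: "n = 8"
          then show ?thesis using T_422[of N] n(2) by (simp add: muk k4 3)
        next
          assume n5: "n = 9"
          then show ?thesis using T_522[of N] n(2) by (simp add: muk k4 3)
        next
          assume n5: "n = 10"
          then show ?thesis using T_622[of N] n(2) by (simp add: muk k4 3)
        qed
      qed
    next
      case 4
      show ?thesis
      proof (cases "10 < n")
        case True
        show ?thesis by (rule partial[OF _ _ partial_31[OF True n(2), folded k4]]) (use True in \<open>simp_all add: k4 4 plists\<close>)
      next
        case False
        then have "n = 7 \<or> n = 8 \<or> n = 9 \<or> n = 10" using n(1) k(5) k4 4 by auto
        then show ?thesis
        proof (elim disjE)
          assume n5: "n = 7"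
          \<comment> \<open>In degree 7 the first part is 3, which excludes the tail
            \<open>[4]\<close>. So \<open>[3, 1]\<close> is the largest tail and no block is
            cut.\<close>
          then show ?thesis by (intro full) (simp_all add: k4 4 plists)
        next
          assume n5: "n = 8"
          then show ?thesis using T_431[of N] n(2) by (simp add: muk k4 4)
        next
          assume n5: "n = 9"
          then show ?thesis using T_531[of N] n(2) by (simp add: muk k4 4)
        next
          assume n5: "n = 10"
          then show ?thesis using T_631[of N] n(2) by (simp add: muk k4 4)
        qed
      qed
    next
      case 5
      have "2 * k \<le> n + 1" using k(5) n(1) 5 k4 by auto
      then show ?thesis by (rule full) (simp add: k4 5 plists)
    qed
  qed
qed

section \<open>Tableaux and monomial coefficients\<close>

definition cl :: "(nat \<Rightarrow> nat) \<Rightarrow> (nat \<times> nat) set" where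
  "cl l = {(i, j). j < l i}"

text \<open>The content is prescribed only for letters below \<open>a\<close>, so that deleting the
  largest letter keeps the same \<open>m\<close>.\<close>

definition tab :: "nat \<Rightarrow> (nat \<Rightarrow> nat) \<Rightarrow> (nat \<Rightarrow> nat) \<Rightarrow> (nat \<times> nat \<Rightarrow> nat) set" where
  "tab a l m = {t \<in> cl l \<rightarrow>\<^sub>E {..<a}. (\<forall>i j. Suc j < l i \<longrightarrow> t (i, j) \<le> t (i, Suc j)) \<and>
     (\<forall>i j. j < l i \<and> j < l (Suc i) \<longrightarrow> t (i, j) < t (Suc i, j)) \<and> (\<forall>k<a. card {c \<in> cl l. t c = k} = m k)}"

lemma card_cl: assumes "shape l" shows "finite (cl l)" "card (cl l) = sz l"
proof -
  have cl: "cl l = Sigma {i. l i \<noteq> 0} (\<lambda>i. {..<l i})" by (auto simp: cl_def)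
  moreover have "finite {i. l i \<noteq> 0}" using assms by (simp add: shape_def)
  ultimately show "finite (cl l)" "card (cl l) = sz l" by (simp_all add: sz_def)
qed

text \<open>Fills the cells of \<open>l\<close> outside \<open>r\<close> with the new largest letter
  \<open>a\<close>. The value off the shape is the default of extensional functions.\<close>

definition ext :: "nat \<Rightarrow> (nat \<Rightarrow> nat) \<Rightarrow> (nat \<Rightarrow> nat) \<Rightarrow> (nat \<times> nat \<Rightarrow> nat) \<Rightarrow> nat \<times> nat \<Rightarrow> nat" where
  "ext a l r t = (\<lambda>(i, j). if j < l i then if j < r i then t (i, j) else a else undefined)"

lemma tab_less: "t \<in> tab a l m \<Longrightarrow> j < l i \<Longrightarrow> t (i, j) < a"
  by (auto simp: tab_def cl_def PiE_def Pi_def)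

lemma ext_less: "t \<in> tab a r m \<Longrightarrow> r i \<le> l i \<Longrightarrow> j < l i \<and> ext a l r t (i, j) < a \<longleftrightarrow> j < r i"
  using tab_less[of t a r m j i] by (auto simp: ext_def)

lemma ext_tab:
  assumes l: "shape l" and r: "hs r l" "sz r + m a = sz l" and t: "t \<in> tab a r m"
  shows "ext a l r t \<in> tab (Suc a) l m"
proof -
  let ?t = "ext a l r t"
  have rl: "r i \<le> l i" "l (Suc i) \<le> r i" for i using r(1) by (auto simp: hs_def)
  have sub: "cl r \<subseteq> cl l" using rl(1) by (auto simp: cl_def intro: less_le_trans)
  have "shape r" using hs_shape[OF r(1)] l by simp
  have "?t \<in> cl l \<rightarrow>\<^sub>E {..<Suc a}"
  proof (rule PiE_I)
    fix c assume "c \<in> cl l"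
    then obtain i j where c: "c = (i, j)" "j < l i" by (auto simp: cl_def)
    then show "?t c \<in> {..<Suc a}" using tab_less[OF t, of j i] by (auto simp: ext_def less_Suc_eq)
  next
    fix c assume "c \<notin> cl l"
    then show "?t c = undefined" by (auto simp: cl_def ext_def split: prod.split)
  qed
  moreover have "?t (i, j) \<le> ?t (i, Suc j)" if "Suc j < l i" for i j
  proof (cases "Suc j < r i")
    case True
    then show ?thesis using t that by (auto simp: ext_def tab_def)
  next
    case False
    then show ?thesis using that tab_less[OF t, of j i] by (auto simp: ext_def)
  qed
  moreover have "?t (i, j) < ?t (Suc i, j)" if j: "j < l i" "j < l (Suc i)" for i j
  proof -
    have "j < r i" using j(2) rl(2)[of i] by simp
    moreover have "t (i, j) < t (Suc i, j)" if "j < r (Suc i)" using t that \<open>j < r i\<close> by (auto simp: tab_def)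
    ultimately show ?thesis using j tab_less[OF t, of j i] by (auto simp: ext_def)
  qed
  moreover have "card {c \<in> cl l. ?t c = k} = m k" if "k < Suc a" for k
  proof (cases "k = a")
    case True
    have "(i, j) \<in> {c \<in> cl l. ?t c = k} \<longleftrightarrow> (i, j) \<in> cl l - cl r" for i j
      using tab_less[OF t, of j i] True by (auto simp: cl_def ext_def)
    then have "{c \<in> cl l. ?t c = k} = cl l - cl r" by (simp add: set_eq_iff split_paired_all)
    then show ?thesis using card_cl[OF \<open>shape r\<close>] card_cl[OF l] sub r(2) True by (simp add: card_Diff_subset)
  next
    case False
    have "(i, j) \<in> {c \<in> cl l. ?t c = k} \<longleftrightarrow> (i, j) \<in> {c \<in> cl r. t c = k}" for i j
      using False rl(1)[of i] by (auto simp: cl_def ext_def)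
    then have "{c \<in> cl l. ?t c = k} = {c \<in> cl r. t c = k}" by (simp add: set_eq_iff split_paired_all)
    then show ?thesis using t that False by (simp add: tab_def)
  qed
  ultimately show ?thesis by (simp add: tab_def)
qed

text \<open>The entries below \<open>a\<close> are an initial segment of each row because rows
  increase weakly. What is removed is a horizontal strip because a column contains \<open>a\<close>
  at most once.\<close>

lemma ext_surj:
  assumes l: "shape l" and t: "t \<in> tab (Suc a) l m"
  shows "\<exists>r. hs r l \<and> sz r + m a = sz l \<and> t \<in> ext a l r ` tab a r m"
proof -
  \<comment> \<open>The number of entries below \<open>a\<close> in row \<open>i\<close>; the
    minimum exists because \<open>l i\<close> satisfies the condition.\<close>
  define r where "r i = (LEAST j. \<not> (j < l i \<and> t (i, j) < a))" for i
  have row: "t (i, j) \<le> t (i, Suc j)" if "Suc j < l i" for i j using t that by (auto simp: tab_def)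
  have in_r: "j < l i \<and> t (i, j) < a" if "j < r i" for i j using not_less_Least[of j] that unfolding r_def by blast
  have rl: "r i \<le> l i" for i unfolding r_def by (rule Least_le) simp
  have out_r: "t (i, j) = a" if j: "r i \<le> j" "j < l i" for i j
  proof -
    have "\<not> (r i < l i \<and> t (i, r i) < a)" unfolding r_def by (rule LeastI[of _ "l i"]) simp
    then have "a \<le> t (i, r i)" using j by auto
    also have "t (i, r i) \<le> t (i, j)" using j
    proof (induction j rule: dec_induct)
      case (step n)
      then show ?case using row[of n i] by simp
    qed simp
    finally show ?thesis using tab_less[OF t j(2)] by simp
  qed
  have "l (Suc i) \<le> r i" for i
  proof (rule ccontr)
    assume "\<not> l (Suc i) \<le> r i"
    then have *: "r i < l (Suc i)" "r i < l i" using shape_Suc[OF l, of i] by auto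
    then have "t (i, r i) < t (Suc i, r i)" using t by (auto simp: tab_def)
    then show False using out_r[of i "r i"] tab_less[OF t *(1)] * by simp
  qed
  then have hs: "hs r l" using rl by (simp add: hs_def)
  have "shape r" using hs_shape[OF hs] l by simp
  have sub: "cl r \<subseteq> cl l" using rl by (auto simp: cl_def intro: less_le_trans)
  have "(i, j) \<in> {c \<in> cl l. t c = a} \<longleftrightarrow> (i, j) \<in> cl l - cl r" for i j
    using in_r[of j i] out_r[of i j] by (cases "j < r i") (auto simp: cl_def)
  then have "{c \<in> cl l. t c = a} = cl l - cl r" by (simp add: set_eq_iff split_paired_all)
  moreover have "card {c \<in> cl l. t c = a} = m a" using t by (simp add: tab_def)
  ultimately have "m a = sz l - sz r" using card_cl[OF \<open>shape r\<close>] card_cl[OF l] sub by (simp add: card_Diff_subset)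
  then have szr: "sz r + m a = sz l" using hs_sz_le[OF hs l] by simp
  let ?t = "restrict t (cl r)"
  have "?t \<in> tab a r m"
  proof -
    have "?t \<in> cl r \<rightarrow>\<^sub>E {..<a}" using in_r by (auto simp: cl_def)
    moreover have "?t (i, j) \<le> ?t (i, Suc j)" if "Suc j < r i" for i j
      using row[of j i] rl[of i] that by (simp add: cl_def)
    moreover have "?t (i, j) < ?t (Suc i, j)" if "j < r i \<and> j < r (Suc i)" for i j
    proof -
      have "j < l i \<and> j < l (Suc i)" using that rl[of i] rl[of "Suc i"] by simp
      then have "t (i, j) < t (Suc i, j)" using t by (auto simp: tab_def)
      then show ?thesis using that by (simp add: cl_def)
    qed
    moreover have "card {c \<in> cl r. ?t c = k} = m k" if "k < a" for k
    proof -
      have "{c \<in> cl r. ?t c = k} = {c \<in> cl l. t c = k}"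
        using sub that out_r by (auto simp: cl_def) (metis leI less_irrefl)
      then show ?thesis using t that by (simp add: tab_def)
    qed
    ultimately show ?thesis by (simp add: tab_def)
  qed
  moreover have "ext a l r ?t = t"
  proof
    fix c :: "nat \<times> nat"
    obtain i j where c: "c = (i, j)" using prod.exhaust by blast
    show "ext a l r ?t c = t c"
    proof (cases "j < l i")
      case True
      then show ?thesis using out_r[of i j] by (auto simp: c ext_def cl_def)
    next
      case False
      have "t \<in> cl l \<rightarrow>\<^sub>E {..<Suc a}" using t by (simp add: tab_def)
      then have "t c = undefined" using False by (intro PiE_arb) (auto simp: c cl_def)
      then show ?thesis using False by (simp add: c ext_def)
    qed
  qed
  ultimately show ?thesis using hs szr by (metis imageI)
qed

lemma ext_inj:
  assumes "hs r l" "hs r' l" "t \<in> tab a r m" "t' \<in> tab a r' m" "ext a l r t = ext a l r' t'"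
  shows "r = r' \<and> t = t'"
proof -
  have rl: "r i \<le> l i" "r' i \<le> l i" for i using assms(1,2) by (auto simp: hs_def)
  have "j < r i \<longleftrightarrow> j < r' i" for i j
    using ext_less[of t a r m i l j] ext_less[of t' a r' m i l j] assms(3-5) rl by simp
  then have r: "r = r'" by (metis ext linorder_neqE_nat less_irrefl)
  have "t (i, j) = t' (i, j)" if "j < r i" for i j
    using fun_cong[OF assms(5), of "(i, j)"] that rl(1)[of i] by (auto simp: ext_def r)
  moreover have "t \<in> cl r \<rightarrow>\<^sub>E {..<a}" "t' \<in> cl r \<rightarrow>\<^sub>E {..<a}" using assms(3,4) by (auto simp: tab_def r)
  ultimately have "t = t'" by (intro PiE_ext) (auto simp: cl_def)
  then show ?thesis using r by simp
qed

lemma finite_tab: "shape l \<Longrightarrow> finite (tab a l m)"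
  unfolding tab_def by (rule finite_subset[of _ "cl l \<rightarrow>\<^sub>E {..<a}"]) (auto intro: finite_PiE simp: card_cl)

text \<open>Deleting the largest letter follows the recursion of \<open>K\<close>:
  \<open>ext\<close> splits the tableaux according to the remaining shape, and
  \<open>ext_inj\<close> makes the pieces disjoint and the maps injective.\<close>

theorem card_tab: "shape l \<Longrightarrow> card (tab a l m) = K a l m"
proof (induction a arbitrary: l)
  case 0
  show ?case
  proof (cases "l = (\<lambda>_. 0)")
    case True
    then have "tab 0 l m = {\<lambda>_. undefined}" by (auto simp: tab_def cl_def)
    then show ?thesis using True by simp
  next
    case False
    then obtain i where "0 < l i" by (metis ext gr0I)
    then have "tab 0 l m = {}" using tab_less[of _ 0 l m 0 i] by auto
    then show ?thesis using False by simp
  qed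
next
  case (Suc a)
  let ?R = "{r. hs r l \<and> sz r + m a = sz l}"
  have finR: "finite ?R" using finite_hs_below[OF Suc.prems] by (rule finite_subset[rotated]) auto
  have sr: "shape r" if "r \<in> ?R" for r using that hs_shape[of r l] Suc.prems by simp
  have "tab (Suc a) l m = (\<Union>r\<in>?R. ext a l r ` tab a r m)"
    using ext_tab[OF Suc.prems] ext_surj[OF Suc.prems] by auto
  then have "card (tab (Suc a) l m) = card (\<Union>r\<in>?R. ext a l r ` tab a r m)" by simp
  also have "\<dots> = (\<Sum>r\<in>?R. card (ext a l r ` tab a r m))"
  proof (rule card_UN_disjoint[OF finR])
    show "\<forall>r\<in>?R. finite (ext a l r ` tab a r m)" using finite_tab[OF sr] by blast
    show "\<forall>r\<in>?R. \<forall>r'\<in>?R. r \<noteq> r' \<longrightarrow> ext a l r ` tab a r m \<inter> ext a l r' ` tab a r' m = {}"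
    proof (intro ballI impI)
      fix r r' assume "r \<in> ?R" "r' \<in> ?R" "r \<noteq> r'"
      then show "ext a l r ` tab a r m \<inter> ext a l r' ` tab a r' m = {}" using ext_inj[of r l r'] by blast
    qed
  qed
  also have "\<dots> = (\<Sum>r\<in>?R. K a r m)"
  proof (rule sum.cong[OF refl])
    fix r assume r: "r \<in> ?R"
    have "inj_on (ext a l r) (tab a r m)" using ext_inj[of r l r] r by (auto intro!: inj_onI)
    then show "card (ext a l r ` tab a r m) = K a r m" using Suc.IH[OF sr[OF r]] by (simp add: card_image)
  qed
  finally show ?case by simp
qed

text \<open>The statement prescribes the count of every letter, \<open>tab\<close> only of those
  below \<open>n\<close>. The two agree because larger letters neither occur in the tableau nor in
  \<open>al\<close>.\<close>

lemma s_coeff_K: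
  assumes "nu \<in> partitions k" "exponent n al"
  shows "s_coeff n nu al = int (K n (Defs.part nu) al)"
proof -
  have cells: "cells nu = cl (Defs.part nu)" by (auto simp: cells_def cl_def Defs.part_def split: if_splits)
  have mem: "(i, j) \<in> cl (Defs.part nu) \<longleftrightarrow> j < Defs.part nu i" for i j by (simp add: cl_def)
  have "{t \<in> ssyt n nu. \<forall>k. card {c \<in> cells nu. t c = k} = al k} = tab n (Defs.part nu) al"
  proof -
    have "(\<forall>k. card {c \<in> cl (Defs.part nu). t c = k} = al k) \<longleftrightarrow> (\<forall>k<n. card {c \<in> cl (Defs.part nu). t c = k} = al k)"
      if t: "t \<in> cl (Defs.part nu) \<rightarrow>\<^sub>E {..<n}" for t
    proof -
      have "card {c \<in> cl (Defs.part nu). t c = k} = al k" if k: "n \<le> k" for k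
      proof -
        have "{c \<in> cl (Defs.part nu). t c = k} = {}" using t k by (fastforce simp: PiE_def Pi_def)
        moreover have "al k = 0" using assms(2) k by (simp add: exponent_def)
        ultimately show ?thesis by (metis card.empty)
      qed
      then show ?thesis by (meson not_le)
    qed
    then show ?thesis unfolding ssyt_def tab_def cells mem by (auto dest: Suc_lessD)
  qed
  then show ?thesis using card_tab[OF shape_part[OF assms(1)]] by (simp add: s_coeff_def)
qed

text \<open>Expanding the product of power sums chooses a variable for each part. The choice is the
  map counted by \<open>p_coeff\<close>, and \<open>w f\<close> is the exponent vector it
  produces.\<close>

lemma p_coeff_pm:
  assumes lam: "lam \<in> partitions n"
  shows "pm n lam x = (\<Sum>m\<in>exps {..<n} n. real_of_int (p_coeff n lam m) * mon {..<n} m x)"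
    and "exponent n al \<Longrightarrow> al \<notin> exps {..<n} n \<Longrightarrow> p_coeff n lam al = 0"
proof -
  let ?L = "{..<length lam}"
  let ?F = "?L \<rightarrow>\<^sub>E {..<n}"
  define w where "w f j = (\<Sum>i | i < length lam \<and> f i = j. lam ! i)" for f :: "nat \<Rightarrow> nat" and j
  have pc: "p_coeff n lam m = int (card {f \<in> ?F. w f = m})" for m
    by (simp add: p_coeff_def w_def fun_eq_iff)
  have w: "w f \<in> exps {..<n} n" if f: "f \<in> ?F" for f
  proof -
    have "w f c = 0" if "c \<notin> {..<n}" for c
    proof -
      have "{i. i < length lam \<and> f i = c} = {}" using f that by auto
      then show ?thesis by (simp only: w_def sum.empty)
    qed
    moreover have "(\<Sum>c<n. w f c) = (\<Sum>i<length lam. lam ! i)"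
      using sum.group[of ?L "{..<n}" f "\<lambda>i. lam ! i"] f by (auto simp: w_def)
    moreover have "(\<Sum>i<length lam. lam ! i) = n"
      using sum_list_partitions[OF lam] by (simp add: sum_list_sum_nth atLeast0LessThan)
    ultimately show ?thesis by (simp add: exps_def)
  qed
  have finF: "finite ?F" by (intro finite_PiE) auto
  have "pm n lam x = (\<Prod>i<length lam. \<Sum>j<n. x j ^ (lam ! i))"
    by (simp add: pm_def pw_def prod.list_conv_set_nth atLeast0LessThan)
  also have "\<dots> = (\<Sum>f\<in>?F. \<Prod>i<length lam. x (f i) ^ (lam ! i))"
    by (rule prod_sum_PiE) auto
  also have "\<dots> = (\<Sum>f\<in>?F. mon {..<n} (w f) x)"
  proof (rule sum.cong[OF refl])
    fix f assume f: "f \<in> ?F"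
    have "(\<Prod>i<length lam. x (f i) ^ (lam ! i)) = (\<Prod>j<n. \<Prod>i | i \<in> ?L \<and> f i = j. x (f i) ^ (lam ! i))"
      by (rule prod.group[symmetric]) (use f in auto)
    also have "\<dots> = mon {..<n} (w f) x"
      unfolding mon_def w_def power_sum by (intro prod.cong) auto
    finally show "(\<Prod>i<length lam. x (f i) ^ (lam ! i)) = mon {..<n} (w f) x" .
  qed
  also have "\<dots> = (\<Sum>m\<in>exps {..<n} n. \<Sum>f | f \<in> ?F \<and> w f = m. mon {..<n} (w f) x)"
    by (rule sum.group[symmetric]) (use finF w in auto)
  also have "\<dots> = (\<Sum>m\<in>exps {..<n} n. real_of_int (p_coeff n lam m) * mon {..<n} m x)"
    by (intro sum.cong) (auto simp: pc)
  finally show "pm n lam x = (\<Sum>m\<in>exps {..<n} n. real_of_int (p_coeff n lam m) * mon {..<n} m x)" .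
  assume "al \<notin> exps {..<n} n"
  then have "{f \<in> ?F. w f = al} = {}" using w by blast
  then show "p_coeff n lam al = 0" unfolding pc by (metis card.empty of_nat_0)
qed

lemma ones_least: "lam \<in> partitions n \<Longrightarrow> revlex_le (replicate n 1) lam"
proof -
  assume l: "lam \<in> partitions n"
  have "lexle (replicate (sum_list lam) 1) lam" if "\<forall>q\<in>set lam. 0 < q" for lam
    using that
  proof (induction lam)
    case (Cons a l)
    then show ?case by (cases a; cases "a - 1") (auto simp: replicate_add)
  qed simp
  then show ?thesis using l by (subst revlex_le_lexle) (auto simp: partitions_def is_partition_def)
qed

text \<open>Comparing monomials turns the real Schur expansion into a linear system with Kostka
  numbers. Its integer inverse \<open>invK\<close> expresses the coefficients through the integers
  \<open>psi_coeff\<close>, so they are integers and the floor in the witness changes nothing. For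
  exponent vectors of another degree both sides vanish.\<close>

theorem schur_positiveI:
  assumes mu: "mu \<in> partitions n" and SP: "SP n n (T n mu)"
  shows "schur_positive n (psi_coeff n mu)"
proof -
  let ?E = "exps {..<n} n" and ?A = "{lam \<in> partitions n. lexle lam mu}"
  have "{lam \<in> partitions n. revlex_le (replicate n 1) lam \<and> revlex_le lam mu} = ?A"
  proof -
    have "revlex_le lam mu \<longleftrightarrow> lexle lam mu" if "lam \<in> partitions n" for lam
      using that mu by (intro revlex_le_lexle) (auto simp: partitions_def is_partition_def)
    then show ?thesis using ones_least by blast
  qed
  then have psi: "psi_coeff n mu al = (\<Sum>lam\<in>?A. p_coeff n lam al)" for al by (simp add: psi_coeff_def)
  obtain c where c: "\<And>l. 0 \<le> c l" "\<And>x. T n mu x = (\<Sum>l\<in>Par n. c l * S n l x)" using SP unfolding SP_def by blast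
  have psiT: "T n mu x = (\<Sum>m\<in>?E. real_of_int (psi_coeff n mu m) * mon {..<n} m x)" for x
  proof -
    have "T n mu x = (\<Sum>lam\<in>?A. \<Sum>m\<in>?E. real_of_int (p_coeff n lam m) * mon {..<n} m x)"
      unfolding T_def sum_list_partitions[OF mu] by (intro sum.cong) (auto simp: p_coeff_pm)
    then show ?thesis by (subst (asm) sum.swap) (simp add: psi sum_distrib_right)
  qed
  have cK: "T n mu x = (\<Sum>m\<in>?E. (\<Sum>l\<in>Par n. c l * real (K n l m)) * mon {..<n} m x)" for x
  proof -
    have "T n mu x = (\<Sum>l\<in>Par n. \<Sum>m\<in>?E. c l * real (K n l m) * mon {..<n} m x)"
      unfolding c(2) by (intro sum.cong) (auto simp: S_eq_K Par_def sum_distrib_left mult_ac)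
    then show ?thesis by (subst (asm) sum.swap) (simp add: sum_distrib_right)
  qed
  have eq: "real_of_int (psi_coeff n mu m) = (\<Sum>l\<in>Par n. c l * real (K n l m))" if m: "m \<in> ?E" for m
  proof -
    have "real_of_int (psi_coeff n mu m) - (\<Sum>l\<in>Par n. c l * real (K n l m)) = 0"
    proof (rule monomials_independent[of ?E n "\<lambda>m. real_of_int (psi_coeff n mu m) - (\<Sum>l\<in>Par n. c l * real (K n l m))"])
      show "(\<Sum>m\<in>?E. (real_of_int (psi_coeff n mu m) - (\<Sum>l\<in>Par n. c l * real (K n l m))) * mon {..<n} m x) = 0" for x
        using psiT[of x] cK[of x] by (simp add: left_diff_distrib sum_subtractf)
      show "m' k = 0" if "m' \<in> ?E" "k \<notin> {..<n}" for m' k using that by (simp add: exps_def)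
    qed (use m in simp_all)
    then show ?thesis by simp
  qed
  have int: "c v \<in> \<int>" if v: "v \<in> Par n" for v
  proof -
    have "(\<Sum>b\<in>Par n. real_of_int (invK n n v b) * real_of_int (psi_coeff n mu b)) =
      (\<Sum>b\<in>Par n. \<Sum>l\<in>Par n. c l * (real_of_int (invK n n v b) * real (K n l b)))"
      using Par_exps[of _ n n] by (intro sum.cong) (auto simp: eq sum_distrib_left mult_ac)
    also have "\<dots> = (\<Sum>l\<in>Par n. c l * (\<Sum>b\<in>Par n. real_of_int (invK n n v b) * real (K n l b)))"
      by (subst sum.swap) (simp add: sum_distrib_left)
    also have "\<dots> = (\<Sum>l\<in>Par n. if l = v then c l else 0)"
      using invK(3)[OF order_refl v] by (intro sum.cong) auto
    also have "\<dots> = c v" using v by simp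
    finally show ?thesis by (rule subst) (intro Ints_sum Ints_mult Ints_of_int)
  qed
  show ?thesis unfolding schur_positive_def
  proof (intro exI[of _ "\<lambda>nu. nat \<lfloor>c (Defs.part nu)\<rfloor>"] allI impI)
    fix al assume al: "exponent n al"
    have s: "(\<Sum>nu\<in>partitions n. int (nat \<lfloor>c (Defs.part nu)\<rfloor>) * s_coeff n nu al) =
       (\<Sum>l\<in>Par n. \<lfloor>c l\<rfloor> * int (K n l al))"
    proof -
      have "(\<Sum>l\<in>Par n. \<lfloor>c l\<rfloor> * int (K n l al)) = (\<Sum>nu\<in>partitions n. \<lfloor>c (Defs.part nu)\<rfloor> * int (K n (Defs.part nu) al))"
        by (rule sum.reindex_bij_betw[OF bij_part, symmetric])
      also have "\<dots> = (\<Sum>nu\<in>partitions n. int (nat \<lfloor>c (Defs.part nu)\<rfloor>) * s_coeff n nu al)"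
        using c(1) by (intro sum.cong) (auto simp: s_coeff_K[OF _ al])
      finally show ?thesis ..
    qed
    show "psi_coeff n mu al = (\<Sum>nu\<in>partitions n. int (nat \<lfloor>c (Defs.part nu)\<rfloor>) * s_coeff n nu al)"
    proof (cases "al \<in> ?E")
      case True
      have "real_of_int (\<Sum>l\<in>Par n. \<lfloor>c l\<rfloor> * int (K n l al)) = (\<Sum>l\<in>Par n. c l * real (K n l al))"
        unfolding of_int_sum using int by (intro sum.cong) (auto elim!: Ints_cases)
      then have "real_of_int (psi_coeff n mu al) = real_of_int (\<Sum>l\<in>Par n. \<lfloor>c l\<rfloor> * int (K n l al))" using eq[OF True] by simp
      then show ?thesis unfolding s of_int_eq_iff .
    next
      case False
      have "K n l al = 0" if l: "l \<in> Par n" for l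
      proof (rule ccontr)
        assume "K n l al \<noteq> 0"
        then have "sz l = (\<Sum>i<n. al i)" using K_nonzero[of n l al] l by (auto simp: Par_def)
        then show False using False l al by (auto simp: exps_def exponent_def Par_def)
      qed
      then have "(\<Sum>l\<in>Par n. \<lfloor>c l\<rfloor> * int (K n l al)) = 0" by simp
      moreover have "psi_coeff n mu al = 0" using p_coeff_pm(2)[OF _ al False] by (simp add: psi)
      ultimately show ?thesis using s by simp
    qed
  qed
qed

theorem theorem1p3:
  fixes n :: nat and mu :: "nat list"
  assumes "0 < n"
    and "is_partition n mu"
    and "(is_partition n (3 # replicate (n - 3) 1) \<and> revlex_le mu (3 # replicate (n - 3) 1)) \<or>
         (is_partition n ((n - 4) # replicate 4 1) \<and> revlex_le ((n - 4) # replicate 4 1) mu)"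
  shows "schur_positive n (psi_coeff n mu)"
proof (rule schur_positiveI)
  show mu: "mu \<in> partitions n" using assms(2) by (simp add: partitions_def)
  have pos: "\<forall>q\<in>set mu. 0 < q" using assms(2) by (simp add: is_partition_def)
  show "SP n n (T n mu)" using assms(3)
  proof (elim disjE conjE)
    assume "is_partition n (3 # replicate (n - 3) 1)" "revlex_le mu (3 # replicate (n - 3) 1)"
    then show ?thesis using pos mu by (intro SP_bottom) (auto simp: is_partition_def revlex_le_lexle sum_list_replicate)
  next
    assume "is_partition n ((n - 4) # replicate 4 1)" "revlex_le ((n - 4) # replicate 4 1) mu"
    then show ?thesis using pos mu by (intro SP_top) (auto simp: is_partition_def revlex_le_lexle)
  qed
qed

end
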